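(* Let $(M,F)$ be a Pontryagin type $C^0$-Finsler manifold. Then every minimizing curve $x(t)$ of $(M,F)$ parameterized by arclength is the projection on $M$ of a Pontryagin extremal $(x(t),\alpha(t))$ in $T^*M\backslash 0$. Consequently the Hamiltonian $H_{u(t)}(x(t),\alpha(t))$ is constant, where $u(t)$ is the control such that $X_{u(t)}(x(t))=x'(t)$ for almost every $t$.
   Context: An asymmetric norm on a finite dimensional real vector space $V$ is a function $F:V\to[0,\infty)$ with $F(y)=0$ iff $y=0$, $F(\lambda y)=\lambda F(y)$ for all $\lambda>0$, and $F(y_1+y_2)\le F(y_1)+F(y_2)$. A $C^0$-Finsler structure on a $C^\infty$ manifold $M$ is a continuous $F:TM\to[0,\infty)$ such that each $F(x,\cdot):T_xM\to[0,\infty)$ is an asymmetric norm; $S_F[x,0,1]=\{y\in T_xM: F(x,y)=1\}$. Pontryagin type: $(M,F)$ ($\dim M=n$) is of Pontryagin type at $p\in M$ if there are a neighborhood $U$ of $p$, a coordinate system $\phi=(x^1,\dots,x^n):U\to\mathbb R^n$ (with natural coordinates $(x^1,\dots,x^n,y^1,\dots,y^n)$ on $TU$) and a family of $C^1$ unit vector fields $X_u(x)=(f^1(x,u),\dots,f^n(x,u))$ on $U$ ($F(x,X_u(x))=1$), parameterized by $u\in C:=S^{n-1}$ (Euclidean unit sphere), such that (1) for every $x\in U$, $u\mapsto X_u(x)$ is a homeomorphism of $S^{n-1}$ onto $S_F[x,0,1]$; (2) $(x,u)\mapsto (f^1(x,u),\dots,f^n(x,u))$ is continuous; (3) $(x,u)\mapsto(\frac{\partial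 f^1}{\partial x^i}(x,u),\dots,\frac{\partial f^n}{\partial x^i}(x,u))$ is continuous for each $i$. $(M,F)$ is of Pontryagin type if it is so at every $p\in M$. Extended geodesic field: for $u\in C$ put $H_u(x,\alpha)=\alpha(X_u(x))$ on $T^*U$, and let $\vec H_u$ be its Hamiltonian vector field, in natural coordinates $(x^i,\alpha_i)$ of $T^*U$: $$\vec H_u=\sum_i f^i(x,u)\frac{\partial}{\partial x^i}-\sum_{i,j}\alpha_j\frac{\partial f^j}{\partial x^i}(x,u)\frac{\partial}{\partial\alpha_i}.$$ Let $\mathcal C(x,\alpha)=\{u\in C: H_u(x,\alpha)=\max_{v\in C}H_v(x,\alpha)\}$. The extended geodesic field $\mathcal E$ associates to each $(x,\alpha)\in T^*M\backslash 0$ the set $\mathcal E(x,\alpha)=\{\vec H_u(x,\alpha):u\in\mathcal C(x,\alpha)\}$ (it does not depend on the coordinates and the local family chosen). A Pontryagin extremal is an absolutely continuous curve $\gamma:[a,b]\to T^*M\backslash 0$ with $\gamma'(t)\in\mathcal E(\gamma(t))$ for almost every $t$. The length of an absolutely continuous curve $x:[a,b]\to M$ is $\int_a^bF(x(t),x'(t))\,dt$; a curve is minimizing if its length is the infimum of the lengths of curves from its initial to its final point; it is parameterized by arclength if $F(x(t),x'(t))=1$ almost everywhere. *)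

theory Defs
  imports "HOL-Analysis.Analysis"
begin

section \<open>Smoothness and absolute continuity in Euclidean spaces\<close>

text \<open>\<open>C_on k f S\<close>: \<open>f\<close> is of class \<open>C^k\<close> on the \<^emph>\<open>open\<close> set \<open>S\<close>.\<close>

fun C_on :: "nat \<Rightarrow> ('a::real_normed_vector \<Rightarrow> 'b::real_normed_vector) \<Rightarrow> 'a set \<Rightarrow> bool" where
  "C_on 0 f S \<longleftrightarrow> continuous_on S f"
| "C_on (Suc k) f S \<longleftrightarrow> (\<forall>x\<in>S. f differentiable (at x)) \<and>
     (\<forall>v. C_on k (\<lambda>x. frechet_derivative f (at x) v) S)"

definition smooth_on :: "('a::real_normed_vector \<Rightarrow> 'b::real_normed_vector) \<Rightarrow> 'a set \<Rightarrow> bool" where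
  "smooth_on f S \<longleftrightarrow> (\<forall>k. C_on k f S)"

definition abs_continuous_on :: "real set \<Rightarrow> (real \<Rightarrow> 'a::real_normed_vector) \<Rightarrow> bool" where
  "abs_continuous_on S f \<longleftrightarrow>
     (\<forall>\<epsilon>>0. \<exists>\<delta>>0. \<forall>\<D>. \<D> division_of \<Union>\<D> \<and> \<Union>\<D> \<subseteq> S \<and> (\<Sum>K\<in>\<D>. Sup K - Inf K) < \<delta> \<longrightarrow>
        (\<Sum>K\<in>\<D>. norm (f (Sup K) - f (Inf K))) < \<epsilon>)"


section \<open>Manifolds, tangent and cotangent bundles\<close>

text \<open>A chart is a pair \<open>(U, \<phi>)\<close>; the values of \<open>\<phi>\<close> outside \<open>U\<close> are irrelevant.\<close>

type_synonym ('p, 'e) chart = "'p set \<times> ('p \<Rightarrow> 'e)"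

definition transition :: "('p, 'e) chart \<Rightarrow> ('p, 'e) chart \<Rightarrow> 'e \<Rightarrow> 'e" where
  "transition c d = snd d \<circ> inv_into (fst c) (snd c)"

definition is_chart :: "('p::topological_space, 'e::euclidean_space) chart \<Rightarrow> bool" where
  "is_chart c \<longleftrightarrow> open (fst c) \<and> open (snd c ` fst c) \<and>
     homeomorphism (fst c) (snd c ` fst c) (snd c) (inv_into (fst c) (snd c))"

definition compatible_charts ::
    "('p, 'e::euclidean_space) chart \<Rightarrow> ('p, 'e) chart \<Rightarrow> bool" where
  "compatible_charts c d \<longleftrightarrow>
     smooth_on (transition c d) (snd c ` (fst c \<inter> fst d)) \<and>
     smooth_on (transition d c) (snd d ` (fst c \<inter> fst d))"

text \<open>A \<open>C^\<infinity>\<close> structure (maximal atlas) on the whole type \<open>'p\<close>; the members of \<open>A\<close> are the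
  coordinate systems of the manifold.\<close>

definition smooth_structure ::
    "('p::{t2_space, second_countable_topology}, 'e::euclidean_space) chart set \<Rightarrow> bool" where
  "smooth_structure A \<longleftrightarrow>
     (\<forall>c\<in>A. is_chart c) \<and> (\<Union>c\<in>A. fst c) = UNIV \<and>
     (\<forall>c\<in>A. \<forall>d\<in>A. compatible_charts c d) \<and>
     (\<forall>c. is_chart c \<and> (\<forall>d\<in>A. compatible_charts c d) \<longrightarrow> c \<in> A)"

text \<open>The topology that an atlas induces on the points it covers. It is used for the
  tangent bundle, whose points are pairs and not a type of their own.\<close>

definition atlas_topology :: "('p, 'e::euclidean_space) chart set \<Rightarrow> 'p topology" where
  "atlas_topology A = topology (\<lambda>W. W \<subseteq> (\<Union>c\<in>A. fst c) \<and>
     (\<forall>c\<in>A. openin (top_of_set (snd c ` fst c))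
        {z \<in> snd c ` fst c. inv_into (fst c) (snd c) z \<in> W}))"

lemma openin_atlas_topology:
  "openin (atlas_topology A) W \<longleftrightarrow> W \<subseteq> (\<Union>c\<in>A. fst c) \<and>
     (\<forall>c\<in>A. openin (top_of_set (snd c ` fst c))
        {z \<in> snd c ` fst c. inv_into (fst c) (snd c) z \<in> W})"
proof -
  let ?pre = "\<lambda>c W. {z \<in> snd c ` fst c. inv_into (fst c) (snd c) z \<in> W}"
  let ?P = "\<lambda>W. W \<subseteq> (\<Union>c\<in>A. fst c) \<and> (\<forall>c\<in>A. openin (top_of_set (snd c ` fst c)) (?pre c W))"
  have "istopology ?P"
    unfolding istopology_def
  proof (intro conjI allI impI)
    fix S T assume S: "?P S" and T: "?P T"
    show "\<forall>c\<in>A. openin (top_of_set (snd c ` fst c)) (?pre c (S \<inter> T))"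
    proof
      fix c assume "c \<in> A"
      then have "openin (top_of_set (snd c ` fst c)) (?pre c S \<inter> ?pre c T)"
        using S T by (intro openin_Int) blast+
      moreover have "?pre c (S \<inter> T) = ?pre c S \<inter> ?pre c T" by blast
      ultimately show "openin (top_of_set (snd c ` fst c)) (?pre c (S \<inter> T))"
        by (simp only:)
    qed
    show "S \<inter> T \<subseteq> (\<Union>c\<in>A. fst c)" using S by blast
  next
    fix \<W> assume W: "\<forall>K\<in>\<W>. ?P K"
    show "\<forall>c\<in>A. openin (top_of_set (snd c ` fst c)) (?pre c (\<Union>\<W>))"
    proof
      fix c assume "c \<in> A"
      then have "openin (top_of_set (snd c ` fst c)) (\<Union>(?pre c ` \<W>))"
        by (intro openin_Union) (use W in blast)
      moreover have "?pre c (\<Union>\<W>) = \<Union>(?pre c ` \<W>)" by blast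
      ultimately show "openin (top_of_set (snd c ` fst c)) (?pre c (\<Union>\<W>))"
        by (simp only:)
    qed
    show "\<Union>\<W> \<subseteq> (\<Union>c\<in>A. fst c)" using W by blast
  qed
  then show ?thesis
    unfolding atlas_topology_def by (simp add: topology_inverse')
qed

text \<open>A tangent vector at \<open>p\<close> is the family of its coordinate vectors in the charts around \<open>p\<close>,
  related by the derivatives of the coordinate changes (and \<open>0\<close> at the charts not containing
  \<open>p\<close>, so that equality of tangent vectors is equality of functions). The vector space structure
  is pointwise. Here \<open>A\<close> may be any atlas.\<close>

type_synonym ('p, 'e) tvec = "('p, 'e) chart \<Rightarrow> 'e"

definition tangent_space ::
    "('p, 'e::euclidean_space) chart set \<Rightarrow> 'p \<Rightarrow> ('p, 'e) tvec set" where
  "tangent_space A p = {v.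
     (\<forall>c. c \<notin> A \<or> p \<notin> fst c \<longrightarrow> v c = 0) \<and>
     (\<forall>c\<in>A. \<forall>d\<in>A. p \<in> fst c \<inter> fst d \<longrightarrow>
        v d = frechet_derivative (transition c d) (at (snd c p)) (v c))}"

text \<open>The tangent vector at \<open>p\<close> whose coordinate vector in the chart \<open>c\<close> is \<open>y\<close>.\<close>

definition tangent_of ::
    "('p, 'e::euclidean_space) chart set \<Rightarrow> ('p, 'e) chart \<Rightarrow> 'p \<Rightarrow> 'e \<Rightarrow> ('p, 'e) tvec" where
  "tangent_of A c p y = (\<lambda>d. if d \<in> A \<and> p \<in> fst d
     then frechet_derivative (transition c d) (at (snd c p)) y else 0)"

text \<open>Natural coordinates \<open>(x, y)\<close> on the tangent bundle.\<close>

definition tangent_chart ::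
    "('p, 'e::euclidean_space) chart set \<Rightarrow> ('p, 'e) chart \<Rightarrow> ('p \<times> ('p, 'e) tvec, 'e \<times> 'e) chart"
  where
  "tangent_chart A c =
     ({(p, v). p \<in> fst c \<and> v \<in> tangent_space A p}, \<lambda>(p, v). (snd c p, v c))"

definition tangent_atlas ::
    "('p, 'e::euclidean_space) chart set \<Rightarrow> ('p \<times> ('p, 'e) tvec, 'e \<times> 'e) chart set" where
  "tangent_atlas A = tangent_chart A ` A"

text \<open>Covectors at \<open>p\<close> are the linear functionals on the tangent space (extended by \<open>0\<close> outside it,
  so that they are determined by their values on the tangent space).\<close>

type_synonym ('p, 'e) cvec = "('p, 'e) tvec \<Rightarrow> real"

definition cotangent_space ::
    "('p, 'e::euclidean_space) chart set \<Rightarrow> 'p \<Rightarrow> ('p, 'e) cvec set" where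
  "cotangent_space A p = {\<alpha>.
     (\<forall>v\<in>tangent_space A p. \<forall>w\<in>tangent_space A p. \<alpha> (\<lambda>c. v c + w c) = \<alpha> v + \<alpha> w) \<and>
     (\<forall>r. \<forall>v\<in>tangent_space A p. \<alpha> (\<lambda>c. r *\<^sub>R v c) = r * \<alpha> v) \<and>
     (\<forall>v. v \<notin> tangent_space A p \<longrightarrow> \<alpha> v = 0)}"

text \<open>Natural coordinates \<open>(x\<^sup>i, \<alpha>\<^sub>i)\<close> on the cotangent bundle, with
  \<open>\<alpha>\<^sub>i = \<alpha>(\<partial>/\<partial>x\<^sup>i)\<close>.\<close>

definition cotangent_chart ::
    "('p, real^'n) chart set \<Rightarrow> ('p, real^'n) chart \<Rightarrow>
     ('p \<times> ('p, real^'n) cvec, (real^'n) \<times> (real^'n)) chart" where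
  "cotangent_chart A c =
     ({(p, \<alpha>). p \<in> fst c \<and> \<alpha> \<in> cotangent_space A p},
      \<lambda>(p, \<alpha>). (snd c p, \<chi> i. \<alpha> (tangent_of A c p (axis i 1))))"

definition cotangent_atlas ::
    "('p, real^'n) chart set \<Rightarrow> ('p \<times> ('p, real^'n) cvec, (real^'n) \<times> (real^'n)) chart set" where
  "cotangent_atlas A = cotangent_chart A ` A"


section \<open>Curves\<close>

text \<open>Absolutely continuous curves with respect to an atlas. Since every parameter has a
  neighbourhood that is mapped into one chart domain, continuity is included.\<close>

definition ac_curve ::
    "('p, 'e::euclidean_space) chart set \<Rightarrow> (real \<Rightarrow> 'p) \<Rightarrow> real \<Rightarrow> real \<Rightarrow> bool" where
  "ac_curve A \<gamma> a b \<longleftrightarrow> (\<forall>t\<in>{a..b}. \<exists>c\<in>A. \<exists>\<delta>>0.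
     \<gamma> ` ({a..b} \<inter> {t - \<delta>..t + \<delta>}) \<subseteq> fst c \<and>
     abs_continuous_on ({a..b} \<inter> {t - \<delta>..t + \<delta>}) (snd c \<circ> \<gamma>))"

definition has_velocity ::
    "('p, 'e::euclidean_space) chart set \<Rightarrow> (real \<Rightarrow> 'p) \<Rightarrow> real set \<Rightarrow> real \<Rightarrow> ('p, 'e) tvec \<Rightarrow> bool"
  where
  "has_velocity A \<gamma> I t v \<longleftrightarrow> v \<in> tangent_space A (\<gamma> t) \<and>
     (\<forall>c\<in>A. \<gamma> t \<in> fst c \<longrightarrow> ((snd c \<circ> \<gamma>) has_vector_derivative v c) (at t within I))"

definition velocity ::
    "('p, 'e::euclidean_space) chart set \<Rightarrow> (real \<Rightarrow> 'p) \<Rightarrow> real set \<Rightarrow> real \<Rightarrow> ('p, 'e) tvec" where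
  "velocity A \<gamma> I t = (THE v. has_velocity A \<gamma> I t v)"


section \<open>\<open>C^0\<close>-Finsler structures\<close>

text \<open>An asymmetric norm on a vector space \<open>V\<close> of functions with pointwise operations.\<close>

definition asymmetric_norm :: "('c \<Rightarrow> 'e::real_vector) set \<Rightarrow> (('c \<Rightarrow> 'e) \<Rightarrow> real) \<Rightarrow> bool" where
  "asymmetric_norm V N \<longleftrightarrow>
     (\<forall>v\<in>V. 0 \<le> N v) \<and>
     (\<forall>v\<in>V. N v = 0 \<longleftrightarrow> v = (\<lambda>_. 0)) \<and>
     (\<forall>v\<in>V. \<forall>r>0. N (\<lambda>c. r *\<^sub>R v c) = r * N v) \<and>
     (\<forall>v\<in>V. \<forall>w\<in>V. N (\<lambda>c. v c + w c) \<le> N v + N w)"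

definition C0_Finsler ::
    "('p, 'e::euclidean_space) chart set \<Rightarrow> ('p \<times> ('p, 'e) tvec \<Rightarrow> real) \<Rightarrow> bool" where
  "C0_Finsler A F \<longleftrightarrow>
     (\<forall>p. asymmetric_norm (tangent_space A p) (\<lambda>v. F (p, v))) \<and>
     continuous_map (atlas_topology (tangent_atlas A)) euclideanreal F"

text \<open>The integrand is nonnegative wherever the velocity exists, so for absolutely continuous
  curves this gauge integral is the Lebesgue integral.\<close>

definition curve_length ::
    "('p, 'e::euclidean_space) chart set \<Rightarrow> ('p \<times> ('p, 'e) tvec \<Rightarrow> real) \<Rightarrow>
     (real \<Rightarrow> 'p) \<Rightarrow> real \<Rightarrow> real \<Rightarrow> real" where
  "curve_length A F x a b = integral {a..b} (\<lambda>t. F (x t, velocity A x {a..b} t))"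

definition minimizing ::
    "('p, 'e::euclidean_space) chart set \<Rightarrow> ('p \<times> ('p, 'e) tvec \<Rightarrow> real) \<Rightarrow>
     (real \<Rightarrow> 'p) \<Rightarrow> real \<Rightarrow> real \<Rightarrow> bool" where
  "minimizing A F x a b \<longleftrightarrow> ac_curve A x a b \<and>
     curve_length A F x a b =
       Inf {curve_length A F y c d | y c d. c < d \<and> ac_curve A y c d \<and> y c = x a \<and> y d = x b}"

definition arclength_parameterized ::
    "('p, 'e::euclidean_space) chart set \<Rightarrow> ('p \<times> ('p, 'e) tvec \<Rightarrow> real) \<Rightarrow>
     (real \<Rightarrow> 'p) \<Rightarrow> real \<Rightarrow> real \<Rightarrow> bool" where
  "arclength_parameterized A F x a b \<longleftrightarrow>
     (AE t in lebesgue. t \<in> {a..b} \<longrightarrow> (\<exists>v. has_velocity A x {a..b} t v \<and> F (x t, v) = 1))"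


section \<open>Pontryagin type and the extended geodesic field\<close>

text \<open>\<open>S\<^sub>F[p, 0, 1]\<close>\<close>

definition unit_sphere ::
    "('p, 'e::euclidean_space) chart set \<Rightarrow> ('p \<times> ('p, 'e) tvec \<Rightarrow> real) \<Rightarrow> 'p \<Rightarrow> ('p, 'e) tvec set"
  where
  "unit_sphere A F p = {v \<in> tangent_space A p. F (p, v) = 1}"

text \<open>A family of vector fields on the domain of a chart \<open>c\<close> is given by \<open>f z u\<close>, the coordinate
  vector of \<open>X\<^sub>u\<close> at the point with coordinates \<open>z\<close>. The topology of a tangent space is the one of
  coordinate vectors in the chart \<open>c\<close>.\<close>

definition pontryagin_family ::
    "('p, real^'n) chart set \<Rightarrow> ('p \<times> ('p, real^'n) tvec \<Rightarrow> real) \<Rightarrow> ('p, real^'n) chart \<Rightarrow>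
     (real^'n \<Rightarrow> real^'n \<Rightarrow> real^'n) \<Rightarrow> bool" where
  "pontryagin_family A F c f \<longleftrightarrow> c \<in> A \<and>
     (\<forall>u\<in>sphere 0 1. C_on 1 (\<lambda>z. f z u) (snd c ` fst c)) \<and>
     (\<forall>p\<in>fst c. \<exists>g. homeomorphism (sphere 0 1) ((\<lambda>v. v c) ` unit_sphere A F p) (f (snd c p)) g) \<and>
     continuous_on ((snd c ` fst c) \<times> sphere 0 1) (\<lambda>(z, u). f z u) \<and>
     (\<forall>i. continuous_on ((snd c ` fst c) \<times> sphere 0 1)
        (\<lambda>(z, u). frechet_derivative (\<lambda>z'. f z' u) (at z) (axis i 1)))"

definition pontryagin_type ::
    "('p, real^'n) chart set \<Rightarrow> ('p \<times> ('p, real^'n) tvec \<Rightarrow> real) \<Rightarrow> bool" where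
  "pontryagin_type A F \<longleftrightarrow> (\<forall>p. \<exists>c f. p \<in> fst c \<and> pontryagin_family A F c f)"

definition control_field ::
    "('p, real^'n) chart set \<Rightarrow> ('p, real^'n) chart \<Rightarrow> (real^'n \<Rightarrow> real^'n \<Rightarrow> real^'n) \<Rightarrow>
     real^'n \<Rightarrow> 'p \<Rightarrow> ('p, real^'n) tvec" where
  "control_field A c f u p = tangent_of A c p (f (snd c p) u)"

definition hamiltonian ::
    "('p, real^'n) chart set \<Rightarrow> ('p, real^'n) chart \<Rightarrow> (real^'n \<Rightarrow> real^'n \<Rightarrow> real^'n) \<Rightarrow>
     real^'n \<Rightarrow> 'p \<times> ('p, real^'n) cvec \<Rightarrow> real" where
  "hamiltonian A c f u = (\<lambda>(p, \<alpha>). \<alpha> (control_field A c f u p))"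

definition maximizing_controls ::
    "('p, real^'n) chart set \<Rightarrow> ('p, real^'n) chart \<Rightarrow> (real^'n \<Rightarrow> real^'n \<Rightarrow> real^'n) \<Rightarrow>
     'p \<times> ('p, real^'n) cvec \<Rightarrow> (real^'n) set" where
  "maximizing_controls A c f q =
     {u \<in> sphere 0 1. \<forall>v\<in>sphere 0 1. hamiltonian A c f v q \<le> hamiltonian A c f u q}"

text \<open>The Hamiltonian vector field of \<open>H\<^sub>u\<close> in the natural coordinates \<open>(z, \<xi>)\<close> of the
  cotangent bundle.\<close>

definition hamiltonian_field ::
    "(real^'n \<Rightarrow> real^'n \<Rightarrow> real^'n) \<Rightarrow> real^'n \<Rightarrow> (real^'n) \<times> (real^'n) \<Rightarrow> (real^'n) \<times> (real^'n)" where
  "hamiltonian_field f u = (\<lambda>(z, \<xi>).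
     (f z u, \<chi> i. - (\<Sum>j\<in>UNIV. \<xi> $ j * frechet_derivative (\<lambda>z'. f z' u) (at z) (axis i 1) $ j)))"

text \<open>A field of sets of tangent vectors of the cotangent bundle. The set
  of Hamiltonian vectors of maximizing controls is the same for all choices of the local
  family \<open>(c, f)\<close> around the base point, so that the existential quantifier over \<open>c\<close>
  and \<open>f\<close> expresses an arbitrary choice.\<close>

definition extended_geodesic_field ::
    "('p, real^'n) chart set \<Rightarrow> ('p \<times> ('p, real^'n) tvec \<Rightarrow> real) \<Rightarrow>
     'p \<times> ('p, real^'n) cvec \<Rightarrow>
     ('p \<times> ('p, real^'n) cvec, (real^'n) \<times> (real^'n)) tvec set" where
  "extended_geodesic_field A F q = {V \<in> tangent_space (cotangent_atlas A) q.
     \<exists>c f. pontryagin_family A F c f \<and> fst q \<in> fst c \<and>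
       (\<exists>u\<in>maximizing_controls A c f q.
          V (cotangent_chart A c) = hamiltonian_field f u (snd (cotangent_chart A c) q))}"

definition pontryagin_extremal ::
    "('p, real^'n) chart set \<Rightarrow> ('p \<times> ('p, real^'n) tvec \<Rightarrow> real) \<Rightarrow>
     (real \<Rightarrow> 'p \<times> ('p, real^'n) cvec) \<Rightarrow> real \<Rightarrow> real \<Rightarrow> bool" where
  "pontryagin_extremal A F \<gamma> a b \<longleftrightarrow>
     (\<forall>t\<in>{a..b}. snd (\<gamma> t) \<in> cotangent_space A (fst (\<gamma> t)) \<and> snd (\<gamma> t) \<noteq> (\<lambda>_. 0)) \<and>
     ac_curve (cotangent_atlas A) \<gamma> a b \<and>
     (AE t in lebesgue. t \<in> {a..b} \<longrightarrow>
        (\<exists>V \<in> extended_geodesic_field A F (\<gamma> t). has_velocity (cotangent_atlas A) \<gamma> {a..b} t V))"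

text \<open>\<open>H\<^bsub>u(t)\<^esub>(\<gamma>(t))\<close> is constant almost everywhere, where \<open>u(t)\<close> is the control (unique
  for a given local family around \<open>x(t)\<close>) with \<open>X\<^bsub>u(t)\<^esub>(x(t)) = x'(t)\<close>. The constant does
  not depend on the local families used along the curve \<open>x = fst \<circ> \<gamma>\<close>.\<close>

definition hamiltonian_constant_along ::
    "('p, real^'n) chart set \<Rightarrow> ('p \<times> ('p, real^'n) tvec \<Rightarrow> real) \<Rightarrow>
     (real \<Rightarrow> 'p \<times> ('p, real^'n) cvec) \<Rightarrow> real \<Rightarrow> real \<Rightarrow> bool" where
  "hamiltonian_constant_along A F \<gamma> a b \<longleftrightarrow>
     (\<exists>h. AE t in lebesgue. t \<in> {a..b} \<longrightarrow>
        (\<forall>c f u. pontryagin_family A F c f \<and> fst (\<gamma> t) \<in> fst c \<and> u \<in> sphere 0 1 \<and>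
           has_velocity A (fst \<circ> \<gamma>) {a..b} t (control_field A c f u (fst (\<gamma> t))) \<longrightarrow>
           hamiltonian A c f u (\<gamma> t) = h))"

end

theory Submission
  imports Defs
begin

text \<open>In one chart, let \<open>x\<close> have coordinates \<open>z\<close> with \<open>z' = f z u\<close> on \<open>[s, t]\<close>. For a continuous \<open>\<eta>\<close> and a constant
  \<open>\<mu> \<ge> 0\<close>, let \<open>v\<close> solve the linear equation \<open>v' = A v + \<eta> - \<mu> z'\<close>, where \<open>A\<close> is the derivative of \<open>f\<close> in \<open>z\<close> along the
  curve. Then \<open>z + \<epsilon> v\<close>, even after a correction of size \<open>o(\<epsilon>)\<close> of its end points, has speed at most
  \<open>1 + \<epsilon> (N z \<eta> - \<mu>) + o(\<epsilon>)\<close> by the triangle inequality, so that no nonlinear equation has to be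
  solved. The pairs (first order change of length, displacement of the end point) of such variations form a convex
  cone, and the cones of consecutive pieces compose without further perturbations of the inner end
  points. If \<open>x\<close> is minimizing, the final cone has no element with negative first and zero second component.
  A separating functional \<open>(- q, \<psi>)\<close> is transported backwards by the adjoint
  equation \<open>p' = - A\<^sup>T p\<close>, and \<open>p(t) v(t) - p(s) v(s) = \<integral> p (\<eta> - \<mu> z')\<close> for all \<open>\<eta>\<close>, \<open>\<mu>\<close>
  gives \<open>p w \<le> q N z w\<close> and \<open>p z' = q\<close>, which is the maximum principle. Here \<open>\<psi> \<noteq> 0\<close>, since
  shortening \<open>x\<close> (\<open>\<eta> = 0\<close>, \<open>\<mu> > 0\<close>) gives an element of the cone with negative first component.

  For the constancy along an arbitrary extremal, the maximized Hamiltonian \<open>M\<close> is absolutely continuous, and at almost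
  every \<open>t\<close> it is touched from below by \<open>H\<^sub>u\<close> with \<open>u = u(t)\<close> frozen, whose derivative along the extremal
  vanishes at \<open>t\<close>. So \<open>M\<close> has one-sided derivative bounds of both signs almost everywhere.\<close>

text \<open>The obstacle is low regularity: \<open>N\<close> is only continuous in the point and
  \<open>f\<close> only continuous in the control, so the length cannot be differentiated along a
  variation. The way out is that \<open>N y (f y u) = 1\<close> at every point \<open>y\<close> of
  the chart. If the curve is displaced and the control kept, a velocity that follows
  \<open>f\<close> still has speed 1, and the term \<open>A v\<close> of the linear equation is the
  first order change of \<open>f\<close> under the displacement. What is left of the velocity enters
  through the triangle inequality alone. The constant \<mu> slows the curve down: lengths are
  compared, not travel times, so varied curves keep the parameter interval and need not have unit
  speed.

  Velocities and controls exist only almost everywhere. Solutions of linear equations are therefore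
  Lipschitz functions that satisfy the equation off a null set, and the analysis behind them is
  Lebesgue differentiation, obtained here from Vitali coverings.

  The constancy claim concerns every extremal over \<open>x\<close>, including those that the
  separation argument does not produce. It cannot be read off from \<open>p z' = q\<close> and needs
  its own argument by touching from below.\<close>

section \<open>Differentiation of monotone functions and of integrals\<close>

text \<open>Vitali's theorem covers \<open>E\<close> up to a null set by countably many disjoint
  intervals inside \<open>G\<close> with property \<open>P\<close>. Finite subfamilies have total
  weight at most \<open>B\<close>, and this bound passes to the countable union of the sets
  \<open>T\<close>. The weight need not be the length, so that a second covering argument can be run
  inside each interval.\<close>

lemma vitali_straddle_bound:
  fixes P :: "real \<Rightarrow> real \<Rightarrow> bool" and w :: "real \<Rightarrow> real \<Rightarrow> real"
  assumes "open G" "E \<subseteq> G"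
    and fine: "\<And>t d. t \<in> E \<Longrightarrow> 0 < d \<Longrightarrow> \<exists>u v. u < t \<and> t < v \<and> v - u < d \<and> P u v"
    and cover: "\<And>u v. u < v \<Longrightarrow> P u v \<Longrightarrow> {u..v} \<subseteq> G \<Longrightarrow>
        \<exists>T. E \<inter> {u..v} \<subseteq> T \<and> T \<in> lmeasurable \<and> measure lebesgue T \<le> w u v"
    and bound: "\<And>D. finite D \<Longrightarrow> (\<And>u v. (u, v) \<in> D \<Longrightarrow> u < v \<and> P u v \<and> {u..v} \<subseteq> G) \<Longrightarrow>
        pairwise (\<lambda>i j. disjnt {fst i..snd i} {fst j..snd j}) D \<Longrightarrow> (\<Sum>(u, v)\<in>D. w u v) \<le> B"
  shows "\<exists>T. E \<subseteq> T \<and> T \<in> lmeasurable \<and> measure lebesgue T \<le> B"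
proof -
  let ?\<mu> = "measure lebesgue"
  define K where "K = {(u, v). u < v \<and> P u v \<and> {u..v} \<subseteq> G}"
  define c r :: "real \<times> real \<Rightarrow> real" where "c = (\<lambda>i. (fst i + snd i) / 2)" and "r = (\<lambda>i. (snd i - fst i) / 2)"
  have cb: "cball (c i) (r i) = {fst i..snd i}" for i
    by (simp add: cball_eq_atLeastAtMost c_def r_def field_simps)
  obtain C where C: "countable C" "C \<subseteq> K"
    and pw: "pairwise (\<lambda>i j. disjnt (cball (c i) (r i)) (cball (c j) (r j))) C"
    and neg: "negligible (E - (\<Union>i\<in>C. cball (c i) (r i)))"
  proof (rule Vitali_covering_theorem_cballs[of K r E c])
    show "0 < r i" if "i \<in> K" for i using that by (auto simp: K_def r_def)
    fix t d :: real assume t: "t \<in> E" and d: "0 < d"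
    then obtain e where e: "e > 0" "cball t e \<subseteq> G"
      using \<open>open G\<close> \<open>E \<subseteq> G\<close> open_contains_cball by blast
    obtain u v where uv: "u < t" "t < v" "v - u < min d e" "P u v"
      using fine[of t "min d e"] t d e by auto
    have "{u..v} \<subseteq> cball t e" using uv by (auto simp: cball_eq_atLeastAtMost)
    then have "(u, v) \<in> K" using uv e by (auto simp: K_def)
    moreover have "t \<in> cball (c (u, v)) (r (u, v))" unfolding cb using uv by auto
    moreover have "r (u, v) < d" using uv d by (auto simp: r_def)
    ultimately show "\<exists>i. i \<in> K \<and> t \<in> cball (c i) (r i) \<and> r i < d" by blast
  qed auto
  have "\<exists>T. E \<inter> {fst i..snd i} \<subseteq> T \<and> T \<in> lmeasurable \<and> ?\<mu> T \<le> w (fst i) (snd i)" if "i \<in> C" for i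
  proof -
    have "fst i < snd i \<and> P (fst i) (snd i) \<and> {fst i..snd i} \<subseteq> G"
      using subsetD[OF C(2) that] by (simp add: K_def case_prod_unfold)
    then show ?thesis by (intro cover) (elim conjE; assumption)+
  qed
  then obtain T where T: "\<And>i. i \<in> C \<Longrightarrow> E \<inter> {fst i..snd i} \<subseteq> T i"
      "\<And>i. i \<in> C \<Longrightarrow> T i \<in> lmeasurable" "\<And>i. i \<in> C \<Longrightarrow> ?\<mu> (T i) \<le> w (fst i) (snd i)"
    by metis
  have fin: "?\<mu> (\<Union>i\<in>I. T i) \<le> B" if "I \<subseteq> C" "finite I" for I
  proof -
    have "?\<mu> (\<Union>i\<in>I. T i) \<le> (\<Sum>i\<in>I. ?\<mu> (T i))"
      using that T by (intro measure_UNION_le) auto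
    also have "\<dots> \<le> (\<Sum>i\<in>I. w (fst i) (snd i))"
      using that T by (intro sum_mono) auto
    also have "\<dots> \<le> B"
    proof -
      have pwI: "pairwise (\<lambda>i j. disjnt {fst i..snd i} {fst j..snd j}) I"
        using pairwise_subset[OF pw that(1)] unfolding cb .
      show ?thesis
      proof -
        have "u < v \<and> P u v \<and> {u..v} \<subseteq> G" if "(u, v) \<in> I" for u v
          using subsetD[OF C(2) subsetD[OF \<open>I \<subseteq> C\<close> that]] by (simp add: K_def)
        then show ?thesis
          using bound[OF \<open>finite I\<close> _ pwI] by (simp add: case_prod_unfold)
      qed
    qed
    finally show ?thesis .
  qed
  let ?N = "E - (\<Union>i\<in>C. {fst i..snd i})"
  have 1: "(\<Union>i\<in>C. T i) \<in> lmeasurable" "?\<mu> (\<Union>i\<in>C. T i) \<le> B"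
    using fmeasurable_UN_bound[OF C(1) T(2) fin] measure_UN_bound[OF C(1) T(2) fin] by auto
  have N: "negligible ?N" using neg unfolding cb .
  have "E \<subseteq> (\<Union>i\<in>C. T i) \<union> ?N" using T(1) by blast
  moreover have "(\<Union>i\<in>C. T i) \<union> ?N \<in> lmeasurable"
    using 1 N negligible_imp_measurable by blast
  moreover have "?\<mu> ((\<Union>i\<in>C. T i) \<union> ?N) \<le> B"
    using measure_Un_le[of "\<Union>i\<in>C. T i" lebesgue ?N] 1 N negligible_imp_measure0[OF N] negligible_imp_measurable[OF N]
    by (simp add: fmeasurableD)
  ultimately show ?thesis by blast
qed

lemma sum_lengths_le_measure:
  fixes D :: "(real \<times> real) set"
  assumes "finite D" "\<And>u v. (u, v) \<in> D \<Longrightarrow> u < v \<and> {u..v} \<subseteq> G"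
    "pairwise (\<lambda>i j. disjnt {fst i..snd i} {fst j..snd j}) D" "G \<in> lmeasurable"
  shows "(\<Sum>(u, v)\<in>D. v - u) \<le> measure lebesgue G"
proof -
  have "(\<Sum>(u, v)\<in>D. v - u) = (\<Sum>i\<in>D. measure lebesgue {fst i..snd i})"
    using assms(2) by (intro sum.cong) (force simp: case_prod_unfold)+
  also have "\<dots> = measure lebesgue (\<Union>i\<in>D. {fst i..snd i})"
    using assms by (intro measure_UNION'[symmetric]) auto
  also have "\<dots> \<le> measure lebesgue G"
  proof (rule measure_mono_fmeasurable)
    show "(\<Union>i\<in>D. {fst i..snd i}) \<subseteq> G" using assms(2) by fastforce
  qed (use assms in \<open>auto intro!: sets.finite_UN\<close>)
  finally show ?thesis .
qed

text \<open>The induction adds the interval with the largest right end point. Disjointness puts all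
  others to the left of its left end point \<open>u\<close>, so the induction hypothesis applies
  with \<open>u\<close> in place of \<open>b\<close>.\<close>

lemma mono_sum_increments_le:
  fixes f :: "real \<Rightarrow> real"
  assumes "mono f" "finite D" "\<And>u v. (u, v) \<in> D \<Longrightarrow> u < v \<and> a \<le> u \<and> v \<le> b"
    "pairwise (\<lambda>i j. disjnt {fst i..snd i} {fst j..snd j}) D" "a \<le> b"
  shows "(\<Sum>(u, v)\<in>D. f v - f u) \<le> f b - f a"
  using assms(2-)
proof (induction D arbitrary: b rule: finite_ranking_induct[where f = snd])
  case empty
  then show ?case using \<open>mono f\<close> by (simp add: mono_def)
next
  case (insert x S)
  show ?case
  proof (cases "x \<in> S")
    case True
    then show ?thesis using insert by (simp add: insert_absorb)
  next
    case False
    obtain u v where x: "x = (u, v)" by force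
    have uv: "u < v" "a \<le> u" "v \<le> b" using insert.prems(1)[of u v] x by auto
    have "v' \<le> u" if "(u', v') \<in> S" for u' v'
    proof -
      have "u' < v'" using insert.prems(1)[of u' v'] that by auto
      moreover have "disjnt {u'..v'} {u..v}"
        using insert.prems(2) that x False by (auto simp: pairwise_insert)
      moreover have "v' \<le> v" using insert.hyps(2)[OF that] x by simp
      ultimately show ?thesis using uv by (auto simp: disjnt_iff not_le dest: spec[of _ v'])
    qed
    moreover have "u' < v' \<and> a \<le> u'" if "(u', v') \<in> S" for u' v'
      using insert.prems(1)[of u' v'] that by auto
    ultimately have "(\<Sum>(u, v)\<in>S. f v - f u) \<le> f u - f a"
      using insert.prems(2) uv by (intro insert.IH) (auto simp: pairwise_insert)
    moreover have "f v \<le> f b" using \<open>mono f\<close> uv by (simp add: mono_def)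
    ultimately show ?thesis using insert.hyps(1) False x by simp
  qed
qed

text \<open>A derivate condition with intervals that contain \<open>t\<close> strictly inside,
  instead of quotients based at \<open>t\<close>. For each \<open>d\<close> the admissible
  \<open>t\<close> form a union of open intervals, so the set is Borel for an arbitrary
  \<open>f\<close>, and the intervals are directly usable in a Vitali covering.\<close>

definition steep_set :: "(real \<Rightarrow> real) \<Rightarrow> real \<Rightarrow> real set" where
  "steep_set f r = {t. \<forall>d>0. \<exists>u v. u < t \<and> t < v \<and> v - u < d \<and> r * (v - u) < f v - f u}"

lemma steep_set_borel: "steep_set f r \<in> sets borel"
proof -
  let ?A = "\<lambda>n::nat. \<Union>(u,v)\<in>{(u,v). v - u < inverse (Suc n) \<and> r * (v - u) < f v - f u}. {u<..<v}"
  have "steep_set f r = (\<Inter>n. ?A n)"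
  proof (intro equalityI subsetI)
    fix t assume "t \<in> steep_set f r"
    then show "t \<in> (\<Inter>n. ?A n)"
      unfolding steep_set_def
    proof (intro INT_I)
      fix n :: nat
      obtain u v where "u < t" "t < v" "v - u < inverse (Suc n)" "r * (v - u) < f v - f u"
        using \<open>t \<in> steep_set f r\<close>[unfolded steep_set_def mem_Collect_eq, rule_format, of "inverse (Suc n)"] by auto
      then show "t \<in> ?A n" by (intro UN_I[of "(u, v)"]) auto
    qed
  next
    fix t assume t: "t \<in> (\<Inter>n. ?A n)"
    have "\<exists>u v. u < t \<and> t < v \<and> v - u < d \<and> r * (v - u) < f v - f u" if d: "d > 0" for d
    proof -
      obtain n where n: "inverse (real (Suc n)) < d" using reals_Archimedean[OF d] by blast
      have "t \<in> ?A n" using t by blast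
      then show ?thesis using n by force
    qed
    then show "t \<in> steep_set f r" by (simp add: steep_set_def)
  qed
  also have "\<dots> \<in> sets borel"
  proof -
    have "?A n \<in> sets borel" for n by (intro borel_open open_UN) auto
    then show ?thesis by (intro sets.countable_INT) auto
  qed
  finally show ?thesis .
qed

lemma not_steepD:
  assumes "t \<notin> steep_set f r"
  obtains d where "d > 0" "\<And>u v. u < t \<Longrightarrow> t < v \<Longrightarrow> v - u < d \<Longrightarrow> f v - f u \<le> r * (v - u)"
  using assms unfolding steep_set_def by (force simp: not_less)

text \<open>By continuity the estimate for \<open>u < t < v\<close> survives the limit in which one
  of the end points tends to \<open>t\<close>, which gives the usual one-sided quotients.\<close>

lemma has_real_derivative_straddle:
  fixes f :: "real \<Rightarrow> real"
  assumes cont: "isCont f t"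
    and str: "\<And>e. e > 0 \<Longrightarrow> \<exists>d>0. \<forall>u v. u < t \<and> t < v \<and> v - u < d \<longrightarrow> \<bar>f v - f u - D * (v - u)\<bar> \<le> e * (v - u)"
  shows "(f has_real_derivative D) (at t)"
proof -
  have "\<exists>d>0. \<forall>y. norm (y - t) < d \<longrightarrow> norm (f y - f t - D * (y - t)) \<le> e * norm (y - t)" if "e > 0" for e
  proof -
    obtain d where d: "d > 0" "\<And>u v. u < t \<Longrightarrow> t < v \<Longrightarrow> v - u < d \<Longrightarrow> \<bar>f v - f u - D * (v - u)\<bar> \<le> e * (v - u)"
      using str[OF \<open>e > 0\<close>] by blast
    have lim: "(f \<longlongrightarrow> f t) (at t)" using cont by (simp add: isCont_def)
    have R: "\<bar>f y - f t - D * (y - t)\<bar> \<le> e * (y - t)" if y: "t < y" "y - t < d" for y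
    proof (rule tendsto_le[of "at_left t"])
      show "((\<lambda>u. \<bar>f y - f u - D * (y - u)\<bar>) \<longlongrightarrow> \<bar>f y - f t - D * (y - t)\<bar>) (at_left t)"
        by (intro tendsto_intros tendsto_mono[OF at_le lim]) auto
      show "((\<lambda>u. e * (y - u)) \<longlongrightarrow> e * (y - t)) (at_left t)" by (intro tendsto_intros)
      show "\<forall>\<^sub>F u in at_left t. \<bar>f y - f u - D * (y - u)\<bar> \<le> e * (y - u)"
        using y d(2) eventually_at_left[of "t-1"] by (auto simp: eventually_at_left[of "t-1"] intro!: exI[of _ "y - d"])
    qed simp
    have L: "\<bar>f y - f t - D * (y - t)\<bar> \<le> e * (t - y)" if y: "y < t" "t - y < d" for y
    proof (rule tendsto_le[of "at_right t"])
      show "((\<lambda>v. \<bar>f v - f y - D * (v - y)\<bar>) \<longlongrightarrow> \<bar>f y - f t - D * (y - t)\<bar>) (at_right t)"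
      proof -
        have "((\<lambda>v. \<bar>f v - f y - D * (v - y)\<bar>) \<longlongrightarrow> \<bar>f t - f y - D * (t - y)\<bar>) (at_right t)"
          by (intro tendsto_intros tendsto_mono[OF at_le lim]) auto
        moreover have "\<bar>f t - f y - D * (t - y)\<bar> = \<bar>f y - f t - D * (y - t)\<bar>"
          by (simp add: abs_if algebra_simps)
        ultimately show ?thesis by simp
      qed
      show "((\<lambda>v. e * (v - y)) \<longlongrightarrow> e * (t - y)) (at_right t)" by (intro tendsto_intros)
      show "\<forall>\<^sub>F v in at_right t. \<bar>f v - f y - D * (v - y)\<bar> \<le> e * (v - y)"
        using y d(2) by (auto simp: eventually_at_right[of t "t+1"] intro!: exI[of _ "y + d"])
    qed simp
    have "\<bar>f y - f t - D * (y - t)\<bar> \<le> e * \<bar>y - t\<bar>" if "\<bar>y - t\<bar> < d" for y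
      using R[of y] L[of y] that by (cases y t rule: linorder_cases) auto
    then show ?thesis using d(1) by auto
  qed
  then show ?thesis
    unfolding has_field_derivative_def has_derivative_at_alt
    by (auto simp: bounded_linear_mult_right)
qed

text \<open>Disjoint intervals of mean slope above \<open>r\<close> have total length at most the
  total increase divided by \<open>r\<close>. The outer set \<open>T\<close> allows sets
  \<open>E\<close> that are not measurable.\<close>

lemma steep_bound:
  fixes f :: "real \<Rightarrow> real"
  assumes "mono f" "E \<subseteq> steep_set f r" "E \<subseteq> {a<..<b}" "r > 0" "a < b"
  shows "\<exists>T. E \<subseteq> T \<and> T \<in> lmeasurable \<and> measure lebesgue T \<le> (f b - f a) / r"
proof (rule vitali_straddle_bound[where G = "{a<..<b}" and P = "\<lambda>u v. r * (v - u) < f v - f u" and w = "\<lambda>u v. v - u"])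
  show "\<exists>u v. u < t \<and> t < v \<and> v - u < d \<and> r * (v - u) < f v - f u" if "t \<in> E" "0 < d" for t d
    using assms(2) that by (auto simp: steep_set_def)
  show "\<exists>T. E \<inter> {u..v} \<subseteq> T \<and> T \<in> lmeasurable \<and> measure lebesgue T \<le> v - u" if "u < v" for u v
    using that by (intro exI[of _ "{u..v}"]) auto
  fix D :: "(real \<times> real) set"
  assume D: "finite D" "\<And>u v. (u, v) \<in> D \<Longrightarrow> u < v \<and> r * (v - u) < f v - f u \<and> {u..v} \<subseteq> {a<..<b}"
    "pairwise (\<lambda>i j. disjnt {fst i..snd i} {fst j..snd j}) D"
  have "r * (\<Sum>(u, v)\<in>D. v - u) \<le> (\<Sum>(u, v)\<in>D. f v - f u)"
    unfolding sum_distrib_left using D(2) by (intro sum_mono) (force simp: less_imp_le)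
  also have "\<dots> \<le> f b - f a"
  proof (rule mono_sum_increments_le[OF assms(1) D(1) _ D(3)])
    show "u < v \<and> a \<le> u \<and> v \<le> b" if "(u, v) \<in> D" for u v
      using D(2)[OF that] subsetD[of "{u..v}" "{a<..<b}" u] subsetD[of "{u..v}" "{a<..<b}" v] by auto
  qed (use assms in auto)
  finally show "(\<Sum>(u, v)\<in>D. v - u) \<le> (f b - f a) / r" using assms by (simp add: field_simps)
qed (use assms in auto)

text \<open>Lebesgue's two-step covering. Let \<open>m\<close> be the measure of the set and
  \<open>G\<close> an open superset of measure at most \<open>m + e\<close>. Intervals in
  \<open>G\<close> of mean slope below \<open>s\<close> have total increment at most
  \<open>s (m + e)\<close>; inside each of them the points of slope above \<open>r\<close> have
  measure at most increment over \<open>r\<close>. Hence \<open>m \<le> s (m + e) / r\<close> for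
  all \<open>e\<close>, which forces \<open>m = 0\<close>.\<close>

lemma steep_gap_negligible:
  fixes f :: "real \<Rightarrow> real"
  assumes "mono f" "0 \<le> s" "s < r" "a < b"
  shows "negligible (steep_set f r \<inter> steep_set (\<lambda>t. - f t) (- s) \<inter> {a<..<b})" (is "negligible ?E")
proof -
  have E: "?E \<in> lmeasurable"
  proof (rule bounded_set_imp_lmeasurable)
    show "bounded ?E" by (rule bounded_subset[of "{a<..<b}"]) auto
    have "steep_set f r \<in> sets lebesgue" "steep_set (\<lambda>t. - f t) (- s) \<in> sets lebesgue"
      using steep_set_borel by (auto intro!: sets_completionI_sets simp: sets_lborel)
    then show "?E \<in> sets lebesgue" by auto
  qed
  let ?m = "measure lebesgue ?E"
  have "?m \<le> s * (?m + e) / r" if epos: "e > 0" for e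
  proof -
    obtain H where H: "open H" "?E \<subseteq> H" "H - ?E \<in> lmeasurable" "emeasure lebesgue (H - ?E) < ennreal e"
      by (rule sets_lebesgue_outer_open[OF fmeasurableD[OF E] epos])
    define G where "G = H \<inter> {a<..<b}"
    have G: "open G" "?E \<subseteq> G" "G \<subseteq> {a<..<b}" using H by (auto simp: G_def)
    have Gm: "G \<in> lmeasurable"
      by (rule bounded_set_imp_lmeasurable) (use G in \<open>auto intro: bounded_subset[of "{a<..<b}"]\<close>)
    have "measure lebesgue G \<le> ?m + measure lebesgue (H - ?E)"
    proof -
      have "measure lebesgue G \<le> measure lebesgue (?E \<union> (H - ?E))"
        using fmeasurable.Un[OF E H(3)] Gm by (intro measure_mono_fmeasurable) (auto simp: G_def fmeasurableD)
      also have "\<dots> \<le> ?m + measure lebesgue (H - ?E)"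
        using E H by (intro measure_Un_le) auto
      finally show ?thesis .
    qed
    moreover have "measure lebesgue (H - ?E) < e"
      using H(3,4) that by (simp add: emeasure_eq_measure2 ennreal_less_iff)
    ultimately have Ge: "measure lebesgue G \<le> ?m + e" by simp
    have "\<exists>T. ?E \<subseteq> T \<and> T \<in> lmeasurable \<and> measure lebesgue T \<le> s * (?m + e) / r"
    proof (rule vitali_straddle_bound[where G = G and P = "\<lambda>u v. f v - f u < s * (v - u)" and w = "\<lambda>u v. (f v - f u) / r"])
      show "\<exists>u v. u < t \<and> t < v \<and> v - u < d \<and> f v - f u < s * (v - u)" if "t \<in> ?E" "0 < d" for t d
      proof -
        have "t \<in> steep_set (\<lambda>t. - f t) (- s)" using that by blast
        then obtain u v where "u < t" "t < v" "v - u < d" "- s * (v - u) < - f v - - f u"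
          using \<open>0 < d\<close> unfolding steep_set_def by blast
        then show ?thesis by (intro exI[of _ u] exI[of _ v]) auto
      qed
      show "\<exists>T. ?E \<inter> {u..v} \<subseteq> T \<and> T \<in> lmeasurable \<and> measure lebesgue T \<le> (f v - f u) / r" if "u < v" for u v
      proof -
        have "?E \<inter> {u<..<v} \<subseteq> steep_set f r" "?E \<inter> {u<..<v} \<subseteq> {u<..<v}" "0 < r"
          using assms by auto
        from steep_bound[OF assms(1) this that]
        obtain T where T: "?E \<inter> {u<..<v} \<subseteq> T" "T \<in> lmeasurable" "measure lebesgue T \<le> (f v - f u) / r"
          by (elim exE conjE)
        \<comment> \<open>\<open>steep_bound\<close> only sees the open interval; the two end points
          are put back as a null set.\<close>
        have n: "negligible {u, v}" by simp
        have "measure lebesgue (T \<union> {u, v}) \<le> measure lebesgue T + measure lebesgue {u, v}"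
          using T(2) n negligible_imp_measurable[OF n] by (intro measure_Un_le) auto
        then have "measure lebesgue (T \<union> {u, v}) \<le> (f v - f u) / r"
          using T(3) negligible_imp_measure0[OF n] by simp
        moreover have "T \<union> {u, v} \<in> lmeasurable" using T(2) negligible_imp_measurable[OF n] by blast
        moreover have "?E \<inter> {u..v} \<subseteq> T \<union> {u, v}" using T(1) by fastforce
        ultimately show ?thesis by blast
      qed
      fix D :: "(real \<times> real) set"
      assume D: "finite D" "\<And>u v. (u, v) \<in> D \<Longrightarrow> u < v \<and> f v - f u < s * (v - u) \<and> {u..v} \<subseteq> G"
        "pairwise (\<lambda>i j. disjnt {fst i..snd i} {fst j..snd j}) D"
      have "(\<Sum>(u, v)\<in>D. (f v - f u) / r) \<le> (\<Sum>(u, v)\<in>D. s / r * (v - u))"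
      proof (rule sum_mono)
        fix i assume "i \<in> D"
        then have "f (snd i) - f (fst i) < s * (snd i - fst i)"
          using D(2)[of "fst i" "snd i"] by simp
        then have "(f (snd i) - f (fst i)) / r \<le> s * (snd i - fst i) / r"
          using assms by (intro divide_right_mono) auto
        then show "(case i of (u, v) \<Rightarrow> (f v - f u) / r) \<le> (case i of (u, v) \<Rightarrow> s / r * (v - u))"
          by (simp add: case_prod_unfold)
      qed
      also have "\<dots> = s / r * (\<Sum>(u, v)\<in>D. v - u)"
        by (simp add: sum_distrib_left case_prod_unfold)
      also have "\<dots> \<le> s / r * (?m + e)"
        using sum_lengths_le_measure[OF D(1) _ D(3) Gm] D(2) Ge assms
        by (intro mult_left_mono) (force)+
      finally show "(\<Sum>(u, v)\<in>D. (f v - f u) / r) \<le> s * (?m + e) / r" by simp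
    qed (use G in auto)
    then obtain T where T: "?E \<subseteq> T" "T \<in> lmeasurable" "measure lebesgue T \<le> s * (?m + e) / r" by blast
    then show ?thesis
      using measure_mono_fmeasurable[of ?E T lebesgue] E by (auto simp: fmeasurableD)
  qed
  then have *: "?m \<le> s / r * ?m + s / r * e" if "e > 0" for e
    using \<open>\<And>e. e > 0 \<Longrightarrow> ?m \<le> s * (?m + e) / r\<close>[OF that] by (simp add: ring_distribs add_divide_distrib)
  have "?m \<le> s / r * ?m"
  proof (rule field_le_epsilon)
    fix e :: real assume "e > 0"
    have "s / r * e \<le> e" using assms \<open>e > 0\<close> by (simp add: field_simps)
    then show "?m \<le> s / r * ?m + e" using *[OF \<open>e > 0\<close>] by simp
  qed
  then have "(r - s) * ?m \<le> 0" using assms by (simp add: field_simps)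
  then have "?m \<le> 0" using assms by (simp add: mult_le_0_iff)
  then have "?m = 0" by (simp add: antisym)
  then show ?thesis using E by (simp add: negligible_iff_measure)
qed

text \<open>Three null sets are removed: \<open>N1\<close> (infinite upper derivate),
  \<open>N2\<close> (a gap between lower and upper derivates, witnessed by rationals
  \<open>s < r\<close>) and the discontinuities. At the remaining points the infimum
  \<open>D\<close> of the slopes \<open>r\<close> with \<open>t\<close> outside
  \<open>steep_set f r\<close> is the derivative.\<close>

lemma mono_differentiable_ae:
  fixes f :: "real \<Rightarrow> real"
  assumes "mono f"
  shows "negligible {t. \<not> f differentiable (at t)}"
proof -
  define N1 where "N1 n = (\<Inter>k::nat. steep_set f (Suc k)) \<inter> {- real (Suc n)<..<real (Suc n)}" for n :: nat
  define N2 where "N2 = (\<lambda>(s, r, n::nat). steep_set f (of_rat r) \<inter> steep_set (\<lambda>t. - f t) (- of_rat s) \<inter> {- real (Suc n)<..<real (Suc n)})"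
  define I where "I = {(s::rat, r::rat, n::nat). 0 \<le> s \<and> s < r}"
  have "negligible (N1 n)" for n
  proof -
    let ?C = "f (Suc n) - f (- real (Suc n))"
    have "\<exists>T. N1 n \<subseteq> T \<and> T \<in> lmeasurable \<and> measure lebesgue T \<le> e" if "e > 0" for e
    proof -
      obtain k :: nat where k: "?C / e < real k" using reals_Archimedean2 by blast
      obtain T where T: "N1 n \<subseteq> T" "T \<in> lmeasurable" "measure lebesgue T \<le> ?C / Suc k"
        using steep_bound[OF assms, of "N1 n" "Suc k" "- real (Suc n)" "real (Suc n)"] by (fastforce simp: N1_def)
      have "?C / Suc k \<le> e" using k \<open>e > 0\<close> by (simp add: field_simps)
      then show ?thesis using T by (intro exI[of _ T]) linarith
    qed
    then show ?thesis by (auto simp: negligible_outer_le)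
  qed
  moreover have "negligible (N2 i)" if "i \<in> I" for i
    using that steep_gap_negligible[OF assms] by (auto simp: N2_def I_def of_rat_less)
  ultimately have "negligible ((\<Union>n. N1 n) \<union> (\<Union>i\<in>I. N2 i))"
    by (intro negligible_Un negligible_countable_Union) auto
  moreover have "negligible {t. \<not> isCont f t}"
    using mono_ctble_discont[OF assms] by (simp add: countable_imp_null_set_lborel negligible_iff_null_sets null_sets_completionI)
  ultimately have "negligible ((\<Union>n. N1 n) \<union> (\<Union>i\<in>I. N2 i) \<union> {t. \<not> isCont f t})"
    by (rule negligible_Un)
  moreover have "{t. \<not> f differentiable (at t)} \<subseteq> (\<Union>n. N1 n) \<union> (\<Union>i\<in>I. N2 i) \<union> {t. \<not> isCont f t}"
  proof (rule subsetI, rule ccontr)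
    fix t assume nd: "t \<in> {t. \<not> f differentiable (at t)}"
      and t: "t \<notin> (\<Union>n. N1 n) \<union> (\<Union>i\<in>I. N2 i) \<union> {t. \<not> isCont f t}"
    obtain n :: nat where n: "\<bar>t\<bar> < real n" using reals_Archimedean2 by blast
    then have tn: "t \<in> {- real (Suc n)<..<real (Suc n)}" by auto
    have "t \<notin> N1 n" using t by blast
    then obtain k where k: "t \<notin> steep_set f (real (Suc k))" using tn by (auto simp: N1_def)
    define S where "S = {r. t \<notin> steep_set f r}"
    \<comment> \<open>Monotonicity makes all negative slopes steep, so \<open>S\<close> is bounded
      below by 0 and its infimum is meaningful.\<close>
    have neg: "t \<in> steep_set f r" if "r < 0" for r
      unfolding steep_set_def
    proof (intro CollectI allI impI)
      fix d :: real assume d: "0 < d"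
      have "r * (t + d / 4 - (t - d / 4)) < f (t + d / 4) - f (t - d / 4)"
      proof -
        have "f (t - d / 4) \<le> f (t + d / 4)" using assms d by (simp add: mono_def)
        moreover have "r * (t + d / 4 - (t - d / 4)) < 0" using that d by (simp add: mult_neg_pos)
        ultimately show ?thesis by linarith
      qed
      then show "\<exists>u v. u < t \<and> t < v \<and> v - u < d \<and> r * (v - u) < f v - f u"
        using d by (intro exI[of _ "t - d/4"] exI[of _ "t + d/4"]) auto
    qed
    have S0: "0 \<le> r" if "r \<in> S" for r using neg[of r] that by (force simp: S_def)
    have Sne: "S \<noteq> {}" using k by (auto simp: S_def)
    have Sbdd: "bdd_below S" using S0 by (rule bdd_belowI)
    define D where "D = Inf S"
    have D0: "0 \<le> D" unfolding D_def using Sne S0 by (rule cInf_greatest)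
    have "\<exists>d>0. \<forall>u v. u < t \<and> t < v \<and> v - u < d \<longrightarrow> \<bar>f v - f u - D * (v - u)\<bar> \<le> e * (v - u)" if e: "e > 0" for e
    proof -
      have "\<exists>r\<in>S. r < D + e" using cInf_lessD[OF Sne, of "D + e"] e by (auto simp: D_def)
      then obtain r where r: "t \<notin> steep_set f r" "r < D + e" by (auto simp: S_def)
      obtain d1 where d1: "d1 > 0" "\<And>u v. u < t \<Longrightarrow> t < v \<Longrightarrow> v - u < d1 \<Longrightarrow> f v - f u \<le> r * (v - u)"
        using not_steepD[OF r(1)] by blast
      have "\<exists>d2>0. \<forall>u v. u < t \<and> t < v \<and> v - u < d2 \<longrightarrow> (D - e) * (v - u) \<le> f v - f u"
      proof (cases "D - e < 0")
        \<comment> \<open>The gap sets only cover slopes \<open>s \<ge> 0\<close>; for a negative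
          bound the monotonicity of \<open>f\<close> suffices.\<close>
        case True
        have "(D - e) * (v - u) \<le> f v - f u" if "u < t" "t < v" for u v
        proof -
          have "(D - e) * (v - u) \<le> 0" using True that by (simp add: mult_nonpos_nonneg)
          moreover have "f u \<le> f v" using assms that by (simp add: mono_def)
          ultimately show ?thesis by simp
        qed
        then show ?thesis by (intro exI[of _ 1]) auto
      next
        case False
        \<comment> \<open>Two rationals are needed below \<open>D\<close>: \<open>t\<close> is steep
          for \<open>q\<close> because \<open>q < D\<close>, and being outside \<open>N2\<close>
          then bounds the slopes from below by the smaller \<open>s\<close>.\<close>
        obtain s where s: "D - e < of_rat s" "of_rat s < D" using of_rat_dense[of "D - e" D] e by auto
        obtain q where q: "of_rat s < (of_rat q :: real)" "of_rat q < D" using of_rat_dense[OF s(2)] by auto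
        have "of_rat q \<notin> S" using q(2) cInf_lower[OF _ Sbdd] by (force simp: D_def)
        then have "t \<in> steep_set f (of_rat q)" by (simp add: S_def)
        moreover have "(0::real) \<le> of_rat s" using False s by linarith
        then have "(s, q, n) \<in> I" using q by (auto simp: I_def of_rat_less)
        then have "t \<notin> N2 (s, q, n)" using t by blast
        ultimately have "t \<notin> steep_set (\<lambda>t. - f t) (- of_rat s)" using tn by (auto simp: N2_def)
        then obtain d2 where d2: "d2 > 0" "\<And>u v. u < t \<Longrightarrow> t < v \<Longrightarrow> v - u < d2 \<Longrightarrow> - f v - - f u \<le> - of_rat s * (v - u)"
          using not_steepD by metis
        have "(D - e) * (v - u) \<le> f v - f u" if "u < t" "t < v" "v - u < d2" for u v
        proof -
          have "(D - e) * (v - u) \<le> of_rat s * (v - u)" using s that by (intro mult_right_mono) auto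
          then show ?thesis using d2(2)[OF that] by simp
        qed
        then show ?thesis using d2(1) by blast
      qed
      then obtain d2 where d2: "d2 > 0" "\<And>u v. u < t \<Longrightarrow> t < v \<Longrightarrow> v - u < d2 \<Longrightarrow> (D - e) * (v - u) \<le> f v - f u"
        by blast
      have "\<bar>f v - f u - D * (v - u)\<bar> \<le> e * (v - u)" if "u < t" "t < v" "v - u < min d1 d2" for u v
      proof -
        have "r * (v - u) \<le> (D + e) * (v - u)" using r(2) that by (intro mult_right_mono) auto
        then have "f v - f u \<le> (D + e) * (v - u)" using d1(2)[of u v] that by linarith
        moreover have "(D - e) * (v - u) \<le> f v - f u" using d2(2)[of u v] that by auto
        ultimately show ?thesis by (simp add: abs_le_iff algebra_simps)
      qed
      then show ?thesis using d1(1) d2(1) by (intro exI[of _ "min d1 d2"]) auto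
    qed
    then have "(f has_real_derivative D) (at t)" using t by (intro has_real_derivative_straddle) auto
    then show False using nd by (auto simp: real_differentiable_def)
  qed
  ultimately show ?thesis by (rule negligible_subset)
qed

section \<open>Differentiation of indefinite integrals of bounded measurable functions\<close>

lemma bounded_measurable_imp_integrable_on:
  fixes g :: "real \<Rightarrow> 'a::euclidean_space"
  assumes "g \<in> borel_measurable (lebesgue_on {a..b})" "\<And>t. t \<in> {a..b} \<Longrightarrow> norm (g t) \<le> K"
  shows "g integrable_on {a..b}"
  by (rule measurable_bounded_by_integrable_imp_integrable[OF assms(1) integrable_const_ivl assms(2)])
    (assumption, rule fmeasurableD, rule lmeasurable_interval)

lemma steep_set_lebesgue: "steep_set f r \<in> sets lebesgue"
  by (rule sets_completionI_sets) (simp add: steep_set_borel)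

text \<open>On an interval from the covering the integral of \<open>g\<close> exceeds
  \<open>r\<close> times the length, although \<open>g < s\<close> on \<open>E\<close>. The excess
  must come from points outside \<open>E\<close>, where \<open>g\<close> is bounded, and an open set
  close to \<open>E\<close> leaves arbitrarily little room for them.\<close>

lemma integral_has_real_derivative_upper:
  fixes g :: "real \<Rightarrow> real"
  assumes g: "g \<in> borel_measurable (lebesgue_on {a..b})" "\<And>t. t \<in> {a..b} \<Longrightarrow> \<bar>g t\<bar> \<le> K" and "s < r"
  shows "negligible (steep_set (\<lambda>t. integral {a..t} g) r \<inter> {t \<in> {a<..<b}. g t < s})" (is "negligible ?E")
proof -
  let ?\<mu> = "measure lebesgue" and ?G = "\<lambda>t. integral {a..t} g"
  have int: "g integrable_on {a..b}"
    by (rule bounded_measurable_imp_integrable_on[OF g(1)]) (use g(2) in simp)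
  have "{t \<in> {a..b}. g t < s} \<in> sets (lebesgue_on {a..b})"
    using borel_measurable_less[OF g(1) borel_measurable_const[of s]] by simp
  then have "{t \<in> {a..b}. g t < s} \<in> sets lebesgue"
    by (simp add: sets_restrict_space_iff)
  moreover have "{a<..<b} \<in> sets lebesgue" by simp
  ultimately have "steep_set ?G r \<inter> {t \<in> {a..b}. g t < s} \<inter> {a<..<b} \<in> sets lebesgue"
    using steep_set_lebesgue[of ?G r] by (metis sets.Int)
  also have "steep_set ?G r \<inter> {t \<in> {a..b}. g t < s} \<inter> {a<..<b} = ?E" by auto
  finally have E': "?E \<in> sets lebesgue" .
  define E where "E = ?E"
  have E: "E \<in> sets lebesgue" and Esub: "\<And>t. t \<in> E \<longleftrightarrow> t \<in> steep_set ?G r \<and> a < t \<and> t < b \<and> g t < s"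
    using E' by (auto simp: E_def)
  have Em: "- E \<inter> {u..v} \<in> lmeasurable" for u v
    using fmeasurable_Diff[OF lmeasurable_interval(1)[of u v] E] by (simp add: Diff_eq Int_commute)
  \<comment> \<open>Bounds \<open>g - s\<close> outside \<open>E\<close>, so that
    \<open>g \<le> s + C\<close> there and \<open>g \<le> s\<close> on \<open>E\<close>.\<close>
  define C where "C = \<bar>K\<bar> + \<bar>s\<bar>"
  have "\<exists>T. E \<subseteq> T \<and> T \<in> lmeasurable \<and> ?\<mu> T \<le> e" if e: "e > 0" for e
  proof -
    \<comment> \<open>Chosen such that the estimate \<open>(r - s) * length \<le> C * e'\<close> at
      the end yields a total length of at most \<open>e\<close>.\<close>
    define e' where "e' = e * (r - s) / (C + 1)"
    have "C \<ge> 0" by (simp add: C_def)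
    then have e': "e' > 0" using e \<open>s < r\<close> by (simp add: e'_def)
    obtain H where H: "open H" "E \<subseteq> H" "H - E \<in> lmeasurable" "emeasure lebesgue (H - E) < ennreal e'"
      by (rule sets_lebesgue_outer_open[OF E e'])
    have He: "?\<mu> (H - E) < e'"
      using H(3,4) e' by (simp add: emeasure_eq_measure2 ennreal_less_iff)
    define G where "G = H \<inter> {a<..<b}"
    show ?thesis
    proof (rule vitali_straddle_bound[where G = G and P = "\<lambda>u v. r * (v - u) < ?G v - ?G u" and w = "\<lambda>u v. v - u"])
      show "\<exists>u v. u < t \<and> t < v \<and> v - u < d \<and> r * (v - u) < ?G v - ?G u" if "t \<in> E" "0 < d" for t d
        using that Esub[of t] unfolding steep_set_def by blast
      show "\<exists>T. E \<inter> {u..v} \<subseteq> T \<and> T \<in> lmeasurable \<and> ?\<mu> T \<le> v - u" if "u < v" for u v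
        using that by (intro exI[of _ "{u..v}"]) auto
      show "open G" unfolding G_def using H(1) by (rule open_Int) simp
      show "E \<subseteq> G" unfolding G_def using H(2) Esub by fastforce
      fix D :: "(real \<times> real) set"
      assume D: "finite D" "\<And>u v. (u, v) \<in> D \<Longrightarrow> u < v \<and> r * (v - u) < ?G v - ?G u \<and> {u..v} \<subseteq> G"
        "pairwise (\<lambda>i j. disjnt {fst i..snd i} {fst j..snd j}) D"
      have one: "?G v - ?G u \<le> s * (v - u) + C * ?\<mu> ({u..v} - E)" if uv: "(u, v) \<in> D" for u v
      proof -
        have uv': "u < v" "{u..v} \<subseteq> {a<..<b}" using D(2)[OF uv] by (auto simp: G_def)
        then have ab: "a < u" "v < b" using subsetD[OF uv'(2), of u] subsetD[OF uv'(2), of v] by auto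
        have "?G u + integral {u..v} g = ?G v"
          using uv' ab by (intro Henstock_Kurzweil_Integration.integral_combine integrable_on_subinterval[OF int]) auto
        then have "?G v - ?G u = integral {u..v} g" by simp
        also have "\<dots> \<le> integral {u..v} (\<lambda>t. s + C * indicator (- E) t)"
        proof (rule integral_le)
          show "g integrable_on {u..v}"
            using ab by (intro integrable_on_subinterval[OF int]) auto
          have "(\<lambda>t. indicator (- E) t :: real) integrable_on {u..v}"
            using Em[of u v] by (simp add: integrable_on_indicator Int_commute)
          then show "(\<lambda>t. s + C * indicator (- E) t) integrable_on {u..v}"
            by (intro integrable_add integrable_on_mult_right) auto
          fix t assume t: "t \<in> {u..v}"
          then have "\<bar>g t\<bar> \<le> K" using g(2) ab by auto
          then show "g t \<le> s + C * indicator (- E) t"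
            using Esub[of t] by (cases "t \<in> E") (auto simp: C_def abs_le_iff)
        qed
        also have "\<dots> = s * (v - u) + C * ?\<mu> ({u..v} - E)"
        proof -
          have i: "(\<lambda>t. indicator (- E) t :: real) integrable_on {u..v}"
            using Em[of u v] by (simp add: integrable_on_indicator Int_commute)
          have "integral {u..v} (\<lambda>t. s + C * indicator (- E) t) = integral {u..v} (\<lambda>t. s) + integral {u..v} (\<lambda>t. C * indicator (- E) t)"
            using i by (intro Henstock_Kurzweil_Integration.integral_add integrable_on_mult_right) auto
          also have "\<dots> = s * (v - u) + C * integral {u..v} (indicator (- E))"
            using uv' by simp
          also have "integral {u..v} (indicator (- E)) = ?\<mu> ({u..v} - E)"
            using Equivalence_Lebesgue_Henstock_Integration.integral_indicator[OF Em[of u v]] by (simp add: Int_commute Diff_eq)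
          finally show ?thesis .
        qed
        finally show ?thesis .
      qed
      have "r * (\<Sum>(u, v)\<in>D. v - u) \<le> (\<Sum>(u, v)\<in>D. s * (v - u) + C * ?\<mu> ({u..v} - E))"
        unfolding sum_distrib_left case_prod_unfold
      proof (rule sum_mono)
        fix i assume "i \<in> D"
        then show "r * (snd i - fst i) \<le> s * (snd i - fst i) + C * ?\<mu> ({fst i..snd i} - E)"
          using one[of "fst i" "snd i"] D(2)[of "fst i" "snd i"] by auto
      qed
      also have "\<dots> = s * (\<Sum>(u, v)\<in>D. v - u) + C * (\<Sum>(u, v)\<in>D. ?\<mu> ({u..v} - E))"
        by (simp add: sum.distrib sum_distrib_left case_prod_unfold)
      also have "(\<Sum>(u, v)\<in>D. ?\<mu> ({u..v} - E)) \<le> e'"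
      proof -
        have m: "{fst i..snd i} - E \<in> lmeasurable" for i :: "real \<times> real"
          by (rule fmeasurable_Diff[OF lmeasurable_interval(1) E])
        have "(\<Sum>(u, v)\<in>D. ?\<mu> ({u..v} - E)) = ?\<mu> (\<Union>i\<in>D. {fst i..snd i} - E)"
          unfolding case_prod_unfold using m
          by (intro measure_UNION'[symmetric] D(1) pairwise_mono[OF D(3)]) (auto simp: disjnt_def)
        also have "\<dots> \<le> ?\<mu> (H - E)"
        proof (rule measure_mono_fmeasurable)
          show "(\<Union>i\<in>D. {fst i..snd i} - E) \<subseteq> H - E"
            using D(2) by (fastforce simp: G_def)
          show "(\<Union>i\<in>D. {fst i..snd i} - E) \<in> sets lebesgue"
            using D(1) m by (intro sets.finite_UN) (auto simp: fmeasurableD)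
        qed (use H in auto)
        finally show ?thesis using He by simp
      qed
      finally have "r * (\<Sum>(u, v)\<in>D. v - u) \<le> s * (\<Sum>(u, v)\<in>D. v - u) + C * e'"
        using \<open>C \<ge> 0\<close> by (simp add: mult_left_mono)
      then have "(r - s) * (\<Sum>(u, v)\<in>D. v - u) \<le> C * e'" by (simp add: algebra_simps)
      also have "\<dots> \<le> (r - s) * e"
        using \<open>C \<ge> 0\<close> e \<open>s < r\<close> by (simp add: e'_def field_simps)
      finally show "(\<Sum>(u, v)\<in>D. v - u) \<le> e" using \<open>s < r\<close> by simp
    qed
  qed
  then have "negligible E" unfolding negligible_outer_le by blast
  then show ?thesis by (simp add: E_def)
qed

text \<open>The one-sided bound is applied to \<open>g\<close> and to \<open>- g\<close>, with
  rational pairs \<open>s < r\<close>; outside the countably many null sets all straddling quotients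
  close to \<open>t\<close> lie between \<open>g t - e\<close> and \<open>g t + e\<close>.\<close>

lemma integral_has_real_derivative_ae:
  fixes g :: "real \<Rightarrow> real"
  assumes g: "g \<in> borel_measurable (lebesgue_on {a..b})" "\<And>t. t \<in> {a..b} \<Longrightarrow> \<bar>g t\<bar> \<le> K"
  shows "negligible {t \<in> {a<..<b}. \<not> ((\<lambda>t. integral {a..t} g) has_real_derivative g t) (at t)}"
proof -
  let ?G = "\<lambda>t. integral {a..t} g" and ?G' = "\<lambda>t. integral {a..t} (\<lambda>t. - g t)"
  define I where "I = {(s::rat, r). s < r}"
  define A where "A = (\<lambda>(s::rat, r::rat). steep_set ?G (of_rat r) \<inter> {t \<in> {a<..<b}. g t < of_rat s})"
  define B where "B = (\<lambda>(s::rat, r::rat). steep_set ?G' (of_rat r) \<inter> {t \<in> {a<..<b}. - g t < of_rat s})"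
  have int: "g integrable_on {a..b}"
    by (rule bounded_measurable_imp_integrable_on[OF g(1)]) (use g(2) in simp)
  have "negligible (A i)" if "i \<in> I" for i
    using that integral_has_real_derivative_upper[OF g] by (auto simp: A_def I_def of_rat_less)
  moreover have "negligible (B i)" if "i \<in> I" for i
    using that integral_has_real_derivative_upper[of "\<lambda>t. - g t" a b K] g by (auto simp: B_def I_def of_rat_less)
  ultimately have "negligible ((\<Union>i\<in>I. A i) \<union> (\<Union>i\<in>I. B i))"
    by (intro negligible_Un negligible_countable_Union) auto
  moreover have "{t \<in> {a<..<b}. \<not> (?G has_real_derivative g t) (at t)} \<subseteq> (\<Union>i\<in>I. A i) \<union> (\<Union>i\<in>I. B i)"
  proof (rule subsetI, rule ccontr)
    fix t assume t: "t \<in> {t \<in> {a<..<b}. \<not> (?G has_real_derivative g t) (at t)}"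
      and n: "t \<notin> (\<Union>i\<in>I. A i) \<union> (\<Union>i\<in>I. B i)"
    have ab: "a < t" "t < b" using t by auto
    have "(?G has_real_derivative g t) (at t)"
    proof (rule has_real_derivative_straddle)
      have "continuous_on {a..b} ?G" by (rule indefinite_integral_continuous_1[OF int])
      then show "isCont ?G t" using ab by (intro continuous_on_interior[of "{a..b}"]) auto
      fix e :: real assume e: "e > 0"
      obtain s r where sr: "g t < of_rat s" "of_rat s < (of_rat r :: real)" "of_rat r < g t + e"
        using of_rat_dense[of "g t" "g t + e"] of_rat_dense e by (metis less_add_same_cancel1)
      then have "t \<notin> A (s, r)" using n by (auto simp: I_def of_rat_less)
      then have "t \<notin> steep_set ?G (of_rat r)" using sr ab by (auto simp: A_def)
      then obtain d1 where d1: "d1 > 0" "\<And>u v. u < t \<Longrightarrow> t < v \<Longrightarrow> v - u < d1 \<Longrightarrow> ?G v - ?G u \<le> of_rat r * (v - u)"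
        using not_steepD by metis
      obtain s' r' where sr': "- g t < of_rat s'" "of_rat s' < (of_rat r' :: real)" "of_rat r' < - g t + e"
        using of_rat_dense[of "- g t" "- g t + e"] of_rat_dense e by (metis less_add_same_cancel1)
      then have "t \<notin> B (s', r')" using n by (auto simp: I_def of_rat_less)
      then have "t \<notin> steep_set ?G' (of_rat r')" using sr' ab by (auto simp: B_def)
      then obtain d2 where d2: "d2 > 0" "\<And>u v. u < t \<Longrightarrow> t < v \<Longrightarrow> v - u < d2 \<Longrightarrow> ?G' v - ?G' u \<le> of_rat r' * (v - u)"
        using not_steepD by metis
      have "\<bar>?G v - ?G u - g t * (v - u)\<bar> \<le> e * (v - u)" if uv: "u < t" "t < v" "v - u < min d1 d2" for u v
      proof -
        have "of_rat r * (v - u) \<le> (g t + e) * (v - u)" using sr uv by (intro mult_right_mono) auto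
        moreover have "of_rat r' * (v - u) \<le> (- g t + e) * (v - u)" using sr' uv by (intro mult_right_mono) auto
        moreover have "?G v - ?G u \<le> of_rat r * (v - u)" using d1(2)[of u v] uv by linarith
        moreover have "?G' v - ?G' u \<le> of_rat r' * (v - u)" using d2(2)[of u v] uv by linarith
        ultimately show ?thesis by (simp add: abs_le_iff algebra_simps)
      qed
      then show "\<exists>d>0. \<forall>u v. u < t \<and> t < v \<and> v - u < d \<longrightarrow> \<bar>?G v - ?G u - g t * (v - u)\<bar> \<le> e * (v - u)"
        using d1(1) d2(1) by (intro exI[of _ "min d1 d2"]) auto
    qed
    then show False using t by simp
  qed
  ultimately show ?thesis by (rule negligible_subset)
qed

lemma integral_has_vector_derivative_ae:
  fixes g :: "real \<Rightarrow> 'a::euclidean_space"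
  assumes g: "g \<in> borel_measurable (lebesgue_on {a..b})" "\<And>t. t \<in> {a..b} \<Longrightarrow> norm (g t) \<le> K"
  shows "negligible {t \<in> {a<..<b}. \<not> ((\<lambda>t. integral {a..t} g) has_vector_derivative g t) (at t)}"
proof -
  have int: "g integrable_on {a..b}"
    by (rule bounded_measurable_imp_integrable_on[OF g(1)]) (use g(2) in simp)
  define N where "N i = {t \<in> {a<..<b}. \<not> ((\<lambda>t. integral {a..t} (\<lambda>t. g t \<bullet> i)) has_real_derivative g t \<bullet> i) (at t)}" for i
  have "negligible (N i)" if "i \<in> Basis" for i
    unfolding N_def
  proof (rule integral_has_real_derivative_ae)
    show "(\<lambda>t. g t \<bullet> i) \<in> borel_measurable (lebesgue_on {a..b})" using g(1) by measurable
    show "\<bar>g t \<bullet> i\<bar> \<le> K" if "t \<in> {a..b}" for t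
      using Basis_le_norm[OF \<open>i \<in> Basis\<close>, of "g t"] g(2)[OF that] by simp
  qed
  then have "negligible (\<Union>i\<in>Basis. N i)"
    by (intro negligible_Union) auto
  moreover have "{t \<in> {a<..<b}. \<not> ((\<lambda>t. integral {a..t} g) has_vector_derivative g t) (at t)} \<subseteq> (\<Union>i\<in>Basis. N i)"
  proof (rule subsetI, rule ccontr)
    fix t assume t: "t \<in> {t \<in> {a<..<b}. \<not> ((\<lambda>t. integral {a..t} g) has_vector_derivative g t) (at t)}"
      and n: "t \<notin> (\<Union>i\<in>Basis. N i)"
    have "((\<lambda>t. integral {a..t} g) has_vector_derivative g t) (at t)"
      unfolding has_vector_derivative_def
      unfolding has_derivative_componentwise_within[of "\<lambda>t. integral {a..t} g"]
    proof
      fix i :: 'a assume i: "i \<in> Basis"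
      have "((\<lambda>t. integral {a..t} (\<lambda>t. g t \<bullet> i)) has_real_derivative g t \<bullet> i) (at t)"
        using n i t by (auto simp: N_def)
      then have "((\<lambda>t. integral {a..t} (\<lambda>t. g t \<bullet> i)) has_derivative (\<lambda>x. x *\<^sub>R g t \<bullet> i)) (at t)"
        by (simp add: has_field_derivative_def mult_commute_abs)
      then show "((\<lambda>t. integral {a..t} g \<bullet> i) has_derivative (\<lambda>x. x *\<^sub>R g t \<bullet> i)) (at t)"
      proof (rule has_derivative_transform_within_open[of _ _ _ _ "{a<..<b}"])
        fix \<tau> assume "\<tau> \<in> {a<..<b}"
        then have "g integrable_on {a..\<tau>}" by (intro integrable_on_subinterval[OF int]) auto
        then show "integral {a..\<tau>} (\<lambda>t. g t \<bullet> i) = integral {a..\<tau>} g \<bullet> i" by simp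
      qed (use t in auto)
    qed
    then show False using t by simp
  qed
  ultimately show ?thesis by (rule negligible_subset)
qed

section \<open>Absolutely continuous functions\<close>

text \<open>Total variation over divisions inside \<open>S\<close>, where \<open>S\<close> may be
  any set, such as an open neighbourhood of a null set. A real \<open>Sup\<close> says something
  only for bounded sums, hence the assumption \<open>bound\<close> of the context below.\<close>

definition variation :: "(real \<Rightarrow> 'a::real_normed_vector) \<Rightarrow> real set \<Rightarrow> real" where
  "variation f S = Sup {\<Sum>K\<in>\<D>. norm (f (Sup K) - f (Inf K)) | \<D>. \<D> division_of \<Union>\<D> \<and> \<Union>\<D> \<subseteq> S}"

lemma division_real_interval:
  fixes \<D> :: "real set set"
  assumes "\<D> division_of S" "K \<in> \<D>"
  obtains u v where "K = {u..v}" "u \<le> v" "Sup K = v" "Inf K = u"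
proof -
  obtain u v where "K = cbox u v" using division_ofD(4)[OF assms] by blast
  moreover have "K \<noteq> {}" using division_ofD(3)[OF assms] .
  ultimately show ?thesis using that[of u v] by auto
qed

lemma division_sum_lengths:
  fixes \<D> :: "real set set"
  assumes "\<D> division_of S"
  shows "(\<Sum>K\<in>\<D>. Sup K - Inf K) = measure lebesgue S"
proof -
  have "(\<Sum>K\<in>\<D>. Sup K - Inf K) = (\<Sum>K\<in>\<D>. measure lebesgue K)"
  proof (rule sum.cong)
    fix K assume "K \<in> \<D>"
    then obtain u v where "K = {u..v}" "u \<le> v" "Sup K = v" "Inf K = u"
      using division_real_interval[OF assms] by metis
    then show "Sup K - Inf K = measure lebesgue K" by simp
  qed simp
  also have "\<dots> = measure lebesgue S"
    using content_division[OF assms] .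
  finally show ?thesis .
qed

lemma division_of_insert_right:
  fixes \<D> :: "real set set"
  assumes "\<D> division_of \<Union>\<D>" "\<Union>\<D> \<subseteq> {..t}" "t < s"
  shows "insert {t..s} \<D> division_of \<Union>(insert {t..s} \<D>)" "{t..s} \<notin> \<D>"
proof -
  show n: "{t..s} \<notin> \<D>" using assms(2,3) by (auto simp: subset_iff dest!: bspec[of _ _ "{t..s}"] spec[of _ s])
  have "interior K \<inter> interior {t..s} = {}" if K: "K \<in> \<D>" for K
  proof -
    have "interior K \<subseteq> K" by (rule interior_subset)
    moreover have "K \<subseteq> {..t}" using assms(2) K by blast
    ultimately show ?thesis by fastforce
  qed
  then show "insert {t..s} \<D> division_of \<Union>(insert {t..s} \<D>)"
    using assms(1,3) unfolding division_of_def
    by (auto simp: Int_commute interval_cbox[symmetric] intro: exI[of _ t])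
qed

context
  fixes f :: "real \<Rightarrow> 'a::real_normed_vector" and S :: "real set" and B :: real
  assumes bound: "\<And>\<D>. \<D> division_of \<Union>\<D> \<Longrightarrow> \<Union>\<D> \<subseteq> S \<Longrightarrow> (\<Sum>K\<in>\<D>. norm (f (Sup K) - f (Inf K))) \<le> B"
begin

lemma variation_bdd: "T \<subseteq> S \<Longrightarrow>
  bdd_above {\<Sum>K\<in>\<D>. norm (f (Sup K) - f (Inf K)) | \<D>. \<D> division_of \<Union>\<D> \<and> \<Union>\<D> \<subseteq> T}"
  by (rule bdd_aboveI[of _ B]) (use bound in blast)

lemma variation_nonempty:
  "{\<Sum>K\<in>\<D>. norm (f (Sup K) - f (Inf K)) | \<D>. \<D> division_of \<Union>\<D> \<and> \<Union>\<D> \<subseteq> T} \<noteq> {}"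
proof -
  have "({} :: real set set) division_of \<Union>{}" by (simp add: division_of_def)
  then show ?thesis by blast
qed

lemma variation_upper: "\<D> division_of \<Union>\<D> \<Longrightarrow> \<Union>\<D> \<subseteq> T \<Longrightarrow> T \<subseteq> S \<Longrightarrow>
   (\<Sum>K\<in>\<D>. norm (f (Sup K) - f (Inf K))) \<le> variation f T"
  unfolding variation_def by (rule cSup_upper[OF _ variation_bdd]) blast+

lemma variation_le: "T \<subseteq> S \<Longrightarrow> variation f T \<le> B"
  unfolding variation_def by (rule cSup_least[OF variation_nonempty]) (use bound in blast)

lemma variation_nonneg: "T \<subseteq> S \<Longrightarrow> 0 \<le> variation f T"
  using variation_upper[of "{}" T] by (simp add: division_of_def)

lemma variation_mono: "T \<subseteq> T' \<Longrightarrow> T' \<subseteq> S \<Longrightarrow> variation f T \<le> variation f T'"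
  unfolding variation_def by (rule cSup_subset_mono[OF variation_nonempty variation_bdd]) blast+

text \<open>Any division to the left of \<open>t\<close> can be enlarged by \<open>{t..s}\<close>.
  The consequence in use is that the variation up to a point grows at least as fast as
  \<open>f\<close> changes.\<close>

lemma variation_step:
  assumes "t < s" "{t..s} \<subseteq> S"
  shows "variation f (S \<inter> {..t}) + norm (f s - f t) \<le> variation f (S \<inter> {..s})"
proof -
  have "variation f (S \<inter> {..t}) \<le> variation f (S \<inter> {..s}) - norm (f s - f t)"
    unfolding variation_def[of f "S \<inter> {..t}"]
  proof (rule cSup_least[OF variation_nonempty], clarify)
    fix \<D> :: "real set set" assume D: "\<D> division_of \<Union>\<D>" "\<Union>\<D> \<subseteq> S \<inter> {..t}"
    have fin: "finite \<D>" using D(1) by auto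
    note i = division_of_insert_right[OF D(1) _ \<open>t < s\<close>]
    have "norm (f s - f t) + (\<Sum>K\<in>\<D>. norm (f (Sup K) - f (Inf K))) = (\<Sum>K\<in>insert {t..s} \<D>. norm (f (Sup K) - f (Inf K)))"
      using i(2) D(2) fin assms(1) by simp
    also have "\<dots> \<le> variation f (S \<inter> {..s})"
    proof (rule variation_upper)
      show "insert {t..s} \<D> division_of \<Union>(insert {t..s} \<D>)" using i(1) D(2) by blast
      show "\<Union>(insert {t..s} \<D>) \<subseteq> S \<inter> {..s}"
        using D(2) assms(2) \<open>t < s\<close> by (auto simp: subset_iff intro: order_trans less_imp_le)
    qed simp
    finally show "(\<Sum>K\<in>\<D>. norm (f (Sup K) - f (Inf K))) \<le> variation f (S \<inter> {..s}) - norm (f s - f t)" by simp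
  qed
  then show ?thesis by simp
qed

end

lemma abs_continuous_on_subset: "abs_continuous_on S f \<Longrightarrow> T \<subseteq> S \<Longrightarrow> abs_continuous_on T f"
  unfolding abs_continuous_on_def by (meson order_trans)

lemma abs_continuous_onE:
  assumes "abs_continuous_on S f" "e > 0"
  obtains d where "d > 0" "\<And>\<D>. \<D> division_of \<Union>\<D> \<Longrightarrow> \<Union>\<D> \<subseteq> S \<Longrightarrow> measure lebesgue (\<Union>\<D>) < d \<Longrightarrow>
    (\<Sum>K\<in>\<D>. norm (f (Sup K) - f (Inf K))) < e"
proof -
  obtain d where d: "d > 0" "\<forall>\<D>. \<D> division_of \<Union>\<D> \<and> \<Union>\<D> \<subseteq> S \<and> (\<Sum>K\<in>\<D>. Sup K - Inf K) < d \<longrightarrow>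
        (\<Sum>K\<in>\<D>. norm (f (Sup K) - f (Inf K))) < e"
    using assms unfolding abs_continuous_on_def by blast
  show ?thesis
    by (rule that[OF d(1)]) (use d(2) division_sum_lengths in metis)
qed

lemma abs_continuous_on_small_interval:
  assumes "abs_continuous_on S f" "e > 0"
  obtains d where "d > 0" "\<And>u v. u \<le> v \<Longrightarrow> {u..v} \<subseteq> S \<Longrightarrow> v - u < d \<Longrightarrow> norm (f v - f u) < e"
proof -
  obtain d where d: "d > 0" "\<And>\<D>. \<D> division_of \<Union>\<D> \<Longrightarrow> \<Union>\<D> \<subseteq> S \<Longrightarrow> measure lebesgue (\<Union>\<D>) < d \<Longrightarrow>
    (\<Sum>K\<in>\<D>. norm (f (Sup K) - f (Inf K))) < e"
    by (rule abs_continuous_onE[OF assms]) (rule that)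
  show ?thesis
  proof (rule that[OF d(1)])
    fix u v :: real assume "u \<le> v" "{u..v} \<subseteq> S" "v - u < d"
    moreover have "{{u..v}} division_of \<Union>{{u..v}}"
      using division_of_self[of u v] \<open>u \<le> v\<close> by simp
    ultimately show "norm (f v - f u) < e" using d(2)[of "{{u..v}}"] by simp
  qed
qed

lemma abs_continuous_on_imp_continuous_on:
  assumes "abs_continuous_on {a..b} f"
  shows "continuous_on {a..b} f"
  unfolding continuous_on_iff
proof (intro ballI allI impI)
  fix x e :: real assume x: "x \<in> {a..b}" and e: "e > 0"
  obtain d where d: "d > 0" "\<And>u v. u \<le> v \<Longrightarrow> {u..v} \<subseteq> {a..b} \<Longrightarrow> v - u < d \<Longrightarrow> norm (f v - f u) < e"
    by (rule abs_continuous_on_small_interval[OF assms e]) (rule that)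
  have "dist (f y) (f x) < e" if y: "y \<in> {a..b}" "dist y x < d" for y
    using d(2)[of x y] d(2)[of y x] x y
    by (cases "x \<le> y") (auto simp: dist_norm norm_minus_commute)
  then show "\<exists>d>0. \<forall>y\<in>{a..b}. dist y x < d \<longrightarrow> dist (f y) (f x) < e" using d(1) by blast
qed

text \<open>One domination criterion covers sums of absolutely continuous functions, Lipschitz functions
  and Lipschitz functions of absolutely continuous ones.\<close>

lemma abs_continuous_on_dominated:
  assumes f: "abs_continuous_on {a..b} f" and g: "abs_continuous_on {a..b} g"
    and dom: "\<And>s t. s \<in> {a..b} \<Longrightarrow> t \<in> {a..b} \<Longrightarrow> norm (h s - h t) \<le> C * norm (f s - f t) + C * norm (g s - g t)"
  shows "abs_continuous_on {a..b} h"
  unfolding abs_continuous_on_def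
proof (intro allI impI)
  fix e :: real assume e: "e > 0"
  define e' where "e' = e / (2 * (\<bar>C\<bar> + 1))"
  have e': "e' > 0" using e by (simp add: e'_def)
  obtain d1 where d1: "d1 > 0" "\<And>\<D>. \<D> division_of \<Union>\<D> \<Longrightarrow> \<Union>\<D> \<subseteq> {a..b} \<Longrightarrow> measure lebesgue (\<Union>\<D>) < d1 \<Longrightarrow>
    (\<Sum>K\<in>\<D>. norm (f (Sup K) - f (Inf K))) < e'" by (rule abs_continuous_onE[OF f e']) (rule that)
  obtain d2 where d2: "d2 > 0" "\<And>\<D>. \<D> division_of \<Union>\<D> \<Longrightarrow> \<Union>\<D> \<subseteq> {a..b} \<Longrightarrow> measure lebesgue (\<Union>\<D>) < d2 \<Longrightarrow>
    (\<Sum>K\<in>\<D>. norm (g (Sup K) - g (Inf K))) < e'" by (rule abs_continuous_onE[OF g e']) (rule that)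
  have "(\<Sum>K\<in>\<D>. norm (h (Sup K) - h (Inf K))) < e"
    if D: "\<D> division_of \<Union>\<D>" "\<Union>\<D> \<subseteq> {a..b}" "(\<Sum>K\<in>\<D>. Sup K - Inf K) < min d1 d2" for \<D>
  proof -
    let ?F = "\<Sum>K\<in>\<D>. norm (f (Sup K) - f (Inf K))" and ?G = "\<Sum>K\<in>\<D>. norm (g (Sup K) - g (Inf K))"
    have F: "?F < e'" "?G < e'" using d1(2)[OF D(1,2)] d2(2)[OF D(1,2)] D(3) division_sum_lengths[OF D(1)] by auto
    have "(\<Sum>K\<in>\<D>. norm (h (Sup K) - h (Inf K))) \<le> (\<Sum>K\<in>\<D>. \<bar>C\<bar> * norm (f (Sup K) - f (Inf K)) + \<bar>C\<bar> * norm (g (Sup K) - g (Inf K)))"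
    proof (rule sum_mono)
      fix K assume K: "K \<in> \<D>"
      then obtain u v where uv: "K = {u..v}" "u \<le> v" "Sup K = v" "Inf K = u"
        using division_real_interval[OF D(1)] by metis
      have "{u..v} \<subseteq> {a..b}" using D(2) K uv by blast
      then have "norm (h v - h u) \<le> C * norm (f v - f u) + C * norm (g v - g u)"
        using dom[of v u] uv(2) by auto
      also have "\<dots> \<le> \<bar>C\<bar> * norm (f v - f u) + \<bar>C\<bar> * norm (g v - g u)"
        by (intro add_mono mult_right_mono) auto
      finally show "norm (h (Sup K) - h (Inf K)) \<le> \<bar>C\<bar> * norm (f (Sup K) - f (Inf K)) + \<bar>C\<bar> * norm (g (Sup K) - g (Inf K))"
        using uv by simp
    qed
    also have "\<dots> = \<bar>C\<bar> * (?F + ?G)" by (simp add: sum.distrib sum_distrib_left ring_distribs)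
    also have "\<dots> \<le> \<bar>C\<bar> * (2 * e')" using F by (intro mult_left_mono) auto
    also have "\<dots> < e" using e by (simp add: e'_def field_simps)
    finally show ?thesis .
  qed
  then show "\<exists>d>0. \<forall>\<D>. \<D> division_of \<Union>\<D> \<and> \<Union>\<D> \<subseteq> {a..b} \<and> (\<Sum>K\<in>\<D>. Sup K - Inf K) < d \<longrightarrow>
        (\<Sum>K\<in>\<D>. norm (h (Sup K) - h (Inf K))) < e"
    using d1(1) d2(1) by (intro exI[of _ "min d1 d2"]) auto
qed

lemma abs_continuous_on_id: "abs_continuous_on {a..b} (\<lambda>t::real. t)"
  unfolding abs_continuous_on_def
proof (intro allI impI)
  fix e :: real assume e: "e > 0"
  have "(\<Sum>K\<in>\<D>. norm (Sup K - Inf K)) < e" if D: "\<D> division_of \<Union>\<D>" "(\<Sum>K\<in>\<D>. Sup K - Inf K) < e" for \<D> :: "real set set"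
  proof -
    have "(\<Sum>K\<in>\<D>. norm (Sup K - Inf K)) = (\<Sum>K\<in>\<D>. Sup K - Inf K)"
    proof (rule sum.cong)
      fix K assume "K \<in> \<D>"
      then show "norm (Sup K - Inf K) = Sup K - Inf K" by (rule division_real_interval[OF D(1)]) auto
    qed simp
    then show ?thesis using D by simp
  qed
  then show "\<exists>d>0. \<forall>\<D>. \<D> division_of \<Union>\<D> \<and> \<Union>\<D> \<subseteq> {a..b} \<and> (\<Sum>K\<in>\<D>. Sup K - Inf K) < d \<longrightarrow>
        (\<Sum>K\<in>\<D>. norm (Sup K - Inf K)) < e" using e by blast
qed

lemma abs_continuous_on_lipschitz_compose:
  assumes f: "abs_continuous_on {a..b} f" and "L-lipschitz_on T g" "f ` {a..b} \<subseteq> T"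
  shows "abs_continuous_on {a..b} (g \<circ> f)"
proof (rule abs_continuous_on_dominated[OF f f, of _ L])
  fix s t assume st: "s \<in> {a..b}" "t \<in> {a..b}"
  have "norm ((g \<circ> f) s - (g \<circ> f) t) \<le> L * norm (f s - f t)"
    using lipschitz_on_normD[OF assms(2), of "f s" "f t"] subsetD[OF assms(3) imageI] st by simp
  moreover have "0 \<le> L * norm (f s - f t)" using lipschitz_on_nonneg[OF assms(2)] by simp
  ultimately show "norm ((g \<circ> f) s - (g \<circ> f) t) \<le> L * norm (f s - f t) + L * norm (f s - f t)" by linarith
qed

lemma lipschitz_imp_abs_continuous_on:
  assumes "L-lipschitz_on {a..b} f"
  shows "abs_continuous_on {a..b} f"
  using abs_continuous_on_lipschitz_compose[OF abs_continuous_on_id assms] by (simp add: o_def)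

lemma abs_continuous_on_add:
  assumes "abs_continuous_on {a..b} f" "abs_continuous_on {a..b} g"
  shows "abs_continuous_on {a..b} (\<lambda>t. f t + g t)"
proof (rule abs_continuous_on_dominated[OF assms, of _ 1])
  fix s t
  have "norm (f s + g s - (f t + g t)) \<le> norm (f s - f t) + norm (g s - g t)"
    using norm_triangle_ineq[of "f s - f t" "g s - g t"] by (simp add: algebra_simps)
  then show "norm (f s + g s - (f t + g t)) \<le> 1 * norm (f s - f t) + 1 * norm (g s - g t)" by simp
qed

lemma abs_continuous_on_Pair:
  assumes "abs_continuous_on {a..b} f" "abs_continuous_on {a..b} g"
  shows "abs_continuous_on {a..b} (\<lambda>t. (f t, g t))"
proof (rule abs_continuous_on_dominated[OF assms, of _ 1])
  fix s t
  show "norm ((f s, g s) - (f t, g t)) \<le> 1 * norm (f s - f t) + 1 * norm (g s - g t)"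
    using norm_Pair_le[of "f s - f t" "g s - g t"] by simp
qed

lemma abs_continuous_on_reflect:
  assumes "abs_continuous_on {a..b} f"
  shows "abs_continuous_on {-b..-a} (\<lambda>t. f (- t))"
  unfolding abs_continuous_on_def
proof (intro allI impI)
  fix e :: real assume e: "e > 0"
  obtain d where d: "d > 0" "\<forall>\<D>. \<D> division_of \<Union>\<D> \<and> \<Union>\<D> \<subseteq> {a..b} \<and> (\<Sum>K\<in>\<D>. Sup K - Inf K) < d \<longrightarrow>
        (\<Sum>K\<in>\<D>. norm (f (Sup K) - f (Inf K))) < e"
    using assms e unfolding abs_continuous_on_def by blast
  have "(\<Sum>K\<in>\<D>. norm (f (- Sup K) - f (- Inf K))) < e"
    if D: "\<D> division_of \<Union>\<D>" "\<Union>\<D> \<subseteq> {-b..-a}" "(\<Sum>K\<in>\<D>. Sup K - Inf K) < d" for \<D>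
  proof -
    let ?m = "\<lambda>K. uminus ` K :: real set"
    have inj: "inj_on ?m \<D>" by (rule inj_onI) (simp add: inj_image_eq_iff)
    have "?m ` \<D> division_of \<Union>(?m ` \<D>)"
      unfolding division_of_def
    proof (intro conjI ballI impI)
      show "finite (?m ` \<D>)" using D(1) by auto
      fix K assume K: "K \<in> ?m ` \<D>"
      then obtain K' where K': "K = ?m K'" "K' \<in> \<D>" by blast
      show "K \<subseteq> \<Union>(?m ` \<D>)" using K by blast
      show "K \<noteq> {}" using K' D(1) by auto
      obtain u v where "K' = {u..v}" using division_real_interval[OF D(1) K'(2)] by metis
      then have "K = cbox (- v) (- u)" using K' by simp
      then show "\<exists>a b. K = cbox a b" by blast
      fix L assume L: "L \<in> ?m ` \<D>" "K \<noteq> L"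
      then obtain L' where L': "L = ?m L'" "L' \<in> \<D>" by blast
      have "interior K' \<inter> interior L' = {}" using division_ofD(5)[OF D(1)] K' L' L by blast
      then show "interior K \<inter> interior L = {}" using K' L' by (auto simp: interior_negations)
    qed auto
    moreover have "\<Union>(?m ` \<D>) \<subseteq> {a..b}" using D(2) by force
    moreover have SI: "Sup (?m K) = - Inf K \<and> Inf (?m K) = - Sup K" if "K \<in> \<D>" for K
      using division_real_interval[OF D(1) that] by (metis image_uminus_atLeastAtMost neg_le_iff_le cSup_atLeastAtMost cInf_atLeastAtMost)
    moreover have "(\<Sum>K\<in>?m ` \<D>. Sup K - Inf K) = (\<Sum>K\<in>\<D>. Sup K - Inf K)"
      using SI by (simp add: sum.reindex[OF inj])
    ultimately have "(\<Sum>K\<in>?m ` \<D>. norm (f (Sup K) - f (Inf K))) < e"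
      using d(2) D(3) by auto
    also have "(\<Sum>K\<in>?m ` \<D>. norm (f (Sup K) - f (Inf K))) = (\<Sum>K\<in>\<D>. norm (f (- Sup K) - f (- Inf K)))"
      using SI by (simp add: sum.reindex[OF inj] norm_minus_commute)
    finally show ?thesis .
  qed
  then show "\<exists>d>0. \<forall>\<D>. \<D> division_of \<Union>\<D> \<and> \<Union>\<D> \<subseteq> {-b..-a} \<and> (\<Sum>K\<in>\<D>. Sup K - Inf K) < d \<longrightarrow>
        (\<Sum>K\<in>\<D>. norm (f (- Sup K) - f (- Inf K))) < e" using d(1) by blast
qed

text \<open>A division of \<open>{a..c}\<close> is cut at \<open>b\<close>. The cut pieces form a
  division of a subset of \<open>{a..b}\<close> with smaller lengths and the same increments of the
  stopped function.\<close>

lemma abs_continuous_on_stop: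
  assumes "abs_continuous_on {a..b} f" "a \<le> b"
  shows "abs_continuous_on {a..c} (\<lambda>t. f (min t b))"
  unfolding abs_continuous_on_def
proof (intro allI impI)
  fix e :: real assume e: "e > 0"
  obtain d where d: "d > 0" "\<forall>\<D>. \<D> division_of \<Union>\<D> \<and> \<Union>\<D> \<subseteq> {a..b} \<and> (\<Sum>K\<in>\<D>. Sup K - Inf K) < d \<longrightarrow>
        (\<Sum>K\<in>\<D>. norm (f (Sup K) - f (Inf K))) < e"
    using assms e unfolding abs_continuous_on_def by blast
  have "(\<Sum>K\<in>\<D>. norm (f (min (Sup K) b) - f (min (Inf K) b))) < e"
    if D: "\<D> division_of \<Union>\<D>" "\<Union>\<D> \<subseteq> {a..c}" "(\<Sum>K\<in>\<D>. Sup K - Inf K) < d" for \<D>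
  proof -
    let ?m = "\<lambda>K. K \<inter> {..b} :: real set"
    \<comment> \<open>Degenerate intervals and those to the right of \<open>b\<close> contribute no
      increment. Without them every cut piece has nonempty interior, which makes cutting injective
      on the division.\<close>
    define \<D>' where "\<D>' = {K\<in>\<D>. Inf K < Sup K \<and> Inf K < b}"
    have sub: "\<D>' \<subseteq> \<D>" and fin: "finite \<D>" using D(1) by (auto simp: \<D>'_def)
    have m: "\<exists>u v. K = {u..v} \<and> u < v \<and> u < b \<and> Sup K = v \<and> Inf K = u \<and> ?m K = {u..min v b}" if K: "K \<in> \<D>'" for K
    proof -
      obtain u v where "K = {u..v}" "u \<le> v" "Sup K = v" "Inf K = u"
        by (rule division_real_interval[OF D(1) subsetD[OF sub K]])
      then show ?thesis using K by (auto simp: \<D>'_def intro!: exI[of _ u] exI[of _ v])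
    qed
    have dis: "interior (?m K) \<inter> interior (?m L) = {}" if "K \<in> \<D>'" "L \<in> \<D>'" "K \<noteq> L" for K L
      using division_ofD(5)[OF D(1), of K L] that sub by auto
    have ne: "interior (?m K) \<noteq> {}" if K: "K \<in> \<D>'" for K
    proof -
      obtain u v where "?m K = {u..min v b}" "u < v" "u < b" using m[OF K] by blast
      then show ?thesis by simp
    qed
    have inj: "inj_on ?m \<D>'"
      by (rule inj_onI) (metis dis ne Int_absorb)
    have "?m ` \<D>' division_of \<Union>(?m ` \<D>')"
      unfolding division_of_def
    proof (intro conjI ballI impI)
      show "finite (?m ` \<D>')" using fin sub by (auto intro: finite_subset)
      fix K assume K: "K \<in> ?m ` \<D>'"
      then obtain K' where K': "K = ?m K'" "K' \<in> \<D>'" by blast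
      show "K \<subseteq> \<Union>(?m ` \<D>')" using K by blast
      show "K \<noteq> {}" using ne[OF K'(2)] unfolding K'(1) by (metis interior_empty)
      obtain u v where "?m K' = {u..v}" using m[OF K'(2)] by blast
      then show "\<exists>a b. K = cbox a b" using K' by auto
      fix L assume L: "L \<in> ?m ` \<D>'" "K \<noteq> L"
      then obtain L' where L': "L = ?m L'" "L' \<in> \<D>'" by blast
      then show "interior K \<inter> interior L = {}" using dis[of K' L'] K' L by blast
    qed auto
    moreover have "\<Union>(?m ` \<D>') \<subseteq> {a..b}" using D(2) sub by force
    moreover have SI: "Sup (?m K) = min (Sup K) b \<and> Inf (?m K) = Inf K \<and> Inf K < b \<and> Inf K < Sup K" if "K \<in> \<D>'" for K
    proof -
      obtain u v where uv: "K = {u..v}" "u < v" "u < b" "Sup K = v" "Inf K = u" "?m K = {u..min v b}" using m[OF \<open>K \<in> \<D>'\<close>] by blast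
      have "u \<le> min v b" using uv by auto
      then show ?thesis unfolding uv(6) using uv by simp
    qed
    moreover have "(\<Sum>K\<in>?m ` \<D>'. Sup K - Inf K) < d"
    proof -
      have "(\<Sum>K\<in>?m ` \<D>'. Sup K - Inf K) = (\<Sum>K\<in>\<D>'. min (Sup K) b - Inf K)"
        using SI by (simp add: sum.reindex[OF inj])
      also have "\<dots> \<le> (\<Sum>K\<in>\<D>'. Sup K - Inf K)" by (intro sum_mono) auto
      also have "\<dots> \<le> (\<Sum>K\<in>\<D>. Sup K - Inf K)"
      proof (rule sum_mono2[OF fin sub])
        fix K assume "K \<in> \<D> - \<D>'"
        then have "K \<in> \<D>" by simp
        then show "0 \<le> Sup K - Inf K" by (rule division_real_interval[OF D(1)]) auto
      qed
      finally show ?thesis using D(3) by simp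
    qed
    ultimately have "(\<Sum>K\<in>?m ` \<D>'. norm (f (Sup K) - f (Inf K))) < e"
      using d(2) by auto
    also have "(\<Sum>K\<in>?m ` \<D>'. norm (f (Sup K) - f (Inf K))) = (\<Sum>K\<in>\<D>'. norm (f (min (Sup K) b) - f (min (Inf K) b)))"
    proof -
      have "min (Inf K) b = Inf K" if "K \<in> \<D>'" for K using SI[OF that] by simp
      then show ?thesis using SI by (simp add: sum.reindex[OF inj])
    qed
    also have "\<dots> = (\<Sum>K\<in>\<D>. norm (f (min (Sup K) b) - f (min (Inf K) b)))"
    proof (rule sum.mono_neutral_left[OF fin sub], rule ballI)
      fix K assume K: "K \<in> \<D> - \<D>'"
      then have "K \<in> \<D>" by simp
      then obtain u v where "K = {u..v}" "u \<le> v" "Sup K = v" "Inf K = u" using division_real_interval[OF D(1)] by metis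
      then show "norm (f (min (Sup K) b) - f (min (Inf K) b)) = 0"
        using K by (cases "u < b") (auto simp: \<D>'_def min_absorb2)
    qed
    finally show ?thesis .
  qed
  then show "\<exists>d>0. \<forall>\<D>. \<D> division_of \<Union>\<D> \<and> \<Union>\<D> \<subseteq> {a..c} \<and> (\<Sum>K\<in>\<D>. Sup K - Inf K) < d \<longrightarrow>
        (\<Sum>K\<in>\<D>. norm (f (min (Sup K) b) - f (min (Inf K) b))) < e" using d(1) by blast
qed

lemma abs_continuous_on_start:
  assumes "abs_continuous_on {b..c} f" "b \<le> c"
  shows "abs_continuous_on {a..c} (\<lambda>t. f (max t b))"
proof -
  have "abs_continuous_on {-c..-a} (\<lambda>t. f (- min t (- b)))"
    using abs_continuous_on_stop[OF abs_continuous_on_reflect[OF assms(1)], of "- a"] assms(2) by simp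
  from abs_continuous_on_reflect[OF this] have "abs_continuous_on {a..c} (\<lambda>t. f (- min (- t) (- b)))" by simp
  moreover have "- min (- t) (- b) = max t b" for t by (simp add: min_def max_def)
  ultimately show ?thesis by simp
qed

text \<open>Up to the constant \<open>f b\<close>, the function is the sum of its version stopped at
  \<open>b\<close> and its version started at \<open>b\<close>. This avoids splitting divisions
  whose intervals contain \<open>b\<close> in the interior.\<close>

lemma abs_continuous_on_concat:
  assumes "abs_continuous_on {a..b} f" "abs_continuous_on {b..c} f" "a \<le> b" "b \<le> c"
  shows "abs_continuous_on {a..c} f"
proof (rule abs_continuous_on_dominated[OF abs_continuous_on_stop[OF assms(1,3)] abs_continuous_on_start[OF assms(2,4)], of _ 1])
  fix s t
  have eq: "f s = f (min s b) + f (max s b) - f b" for s by (cases "s \<le> b") (auto simp: min_def max_def)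
  have "f s - f t = (f (min s b) - f (min t b)) + (f (max s b) - f (max t b))"
    by (subst (1 2) eq) (simp add: algebra_simps)
  then show "norm (f s - f t) \<le> 1 * norm (f (min s b) - f (min t b)) + 1 * norm (f (max s b) - f (max t b))"
    using norm_triangle_ineq by simp
qed

section \<open>Almost everywhere differentiability of absolutely continuous functions\<close>

lemma abs_continuous_on_differentiable_ae_short:
  fixes f :: "real \<Rightarrow> real"
  assumes bound: "\<And>\<D>. \<D> division_of \<Union>\<D> \<Longrightarrow> \<Union>\<D> \<subseteq> {a..b} \<Longrightarrow> (\<Sum>K\<in>\<D>. norm (f (Sup K) - f (Inf K))) \<le> B"
    and "a \<le> b"
  shows "negligible {t \<in> {a<..<b}. \<not> f differentiable (at t)}"
proof -
  \<comment> \<open>Jordan decomposition: \<open>V\<close> and \<open>V - f\<close> are both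
    increasing, and \<open>f\<close> is their difference. The clamp \<open>c\<close> extends them to
    monotone functions on the whole line.\<close>
  define V where "V t = variation f ({a..b} \<inter> {..t})" for t
  define c where "c t = max a (min t b)" for t
  have sub: "{a..b} \<inter> {..t} \<subseteq> {a..b}" for t by simp
  have step: "\<bar>f (c s) - f (c t)\<bar> \<le> V (c s) - V (c t)" if "t \<le> s" for s t
  proof (cases "c t = c s")
    case False
    then have "c t < c s" using that by (auto simp: c_def)
    moreover have "{c t..c s} \<subseteq> {a..b}" using \<open>a \<le> b\<close> by (auto simp: c_def)
    ultimately have "variation f ({a..b} \<inter> {..c t}) + norm (f (c s) - f (c t)) \<le> variation f ({a..b} \<inter> {..c s})"
      by (intro variation_step[OF bound])
    then show ?thesis by (simp add: V_def)
  qed simp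
  have "mono (\<lambda>t. V (c t))"
    by (rule monoI) (use step in \<open>smt (verit) abs_ge_zero\<close>)
  moreover have "mono (\<lambda>t. V (c t) - f (c t))"
    by (rule monoI) (use step in \<open>smt (verit) abs_ge_self\<close>)
  ultimately have "negligible ({t. \<not> (\<lambda>t. V (c t)) differentiable (at t)} \<union> {t. \<not> (\<lambda>t. V (c t) - f (c t)) differentiable (at t)})"
    by (intro negligible_Un mono_differentiable_ae)
  moreover have "{t \<in> {a<..<b}. \<not> f differentiable (at t)} \<subseteq>
    {t. \<not> (\<lambda>t. V (c t)) differentiable (at t)} \<union> {t. \<not> (\<lambda>t. V (c t) - f (c t)) differentiable (at t)}"
  proof (rule subsetI, rule ccontr)
    fix t assume t: "t \<in> {t \<in> {a<..<b}. \<not> f differentiable (at t)}"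
      and n: "t \<notin> {t. \<not> (\<lambda>t. V (c t)) differentiable (at t)} \<union> {t. \<not> (\<lambda>t. V (c t) - f (c t)) differentiable (at t)}"
    have "(\<lambda>t. V (c t) - (V (c t) - f (c t))) differentiable (at t)"
      by (rule differentiable_diff) (use n in blast)+
    then obtain D where "((\<lambda>t. f (c t)) has_derivative D) (at t)" by (auto simp: differentiable_def)
    then have "(f has_derivative D) (at t)"
      by (rule has_derivative_transform_within_open[of _ _ _ _ "{a<..<b}"]) (use t in \<open>auto simp: c_def\<close>)
    then show False using t by (auto simp: differentiable_def)
  qed
  ultimately show ?thesis by (rule negligible_subset)
qed

text \<open>Absolute continuity with bound 1 makes the variation finite on intervals shorter than
  the corresponding \<open>d\<close>. Being null is a local property, so short intervals around each
  point are enough.\<close>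

lemma abs_continuous_on_differentiable_ae_real:
  fixes f :: "real \<Rightarrow> real"
  assumes ac: "abs_continuous_on {a..b} f"
  shows "negligible {t \<in> {a<..<b}. \<not> f differentiable (at t)}"
proof -
  obtain d where d: "d > 0" "\<And>\<D>. \<D> division_of \<Union>\<D> \<Longrightarrow> \<Union>\<D> \<subseteq> {a..b} \<Longrightarrow> measure lebesgue (\<Union>\<D>) < d \<Longrightarrow>
    (\<Sum>K\<in>\<D>. norm (f (Sup K) - f (Inf K))) < 1"
    by (rule abs_continuous_onE[OF ac zero_less_one]) (rule that)
  let ?S = "{t \<in> {a<..<b}. \<not> f differentiable (at t)}"
  have "\<exists>U. openin (top_of_set ?S) U \<and> t \<in> U \<and> negligible U" if t: "t \<in> ?S" for t
  proof -
    define u v where "u = max a (t - d / 4)" and "v = min b (t + d / 4)"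
    have uv: "u < t" "t < v" "{u..v} \<subseteq> {a..b}" "v - u < d"
      using t d(1) by (auto simp: u_def v_def)
    have "negligible {t \<in> {u<..<v}. \<not> f differentiable (at t)}"
    proof (rule abs_continuous_on_differentiable_ae_short[of u v f 1])
      fix \<D> assume D: "\<D> division_of \<Union>\<D>" "\<Union>\<D> \<subseteq> {u..v}"
      have "\<Union>\<D> \<in> lmeasurable" using D(1) lmeasurable_division by blast
      then have "measure lebesgue (\<Union>\<D>) \<le> measure lebesgue {u..v}"
        using D(2) by (intro measure_mono_fmeasurable) (auto simp: fmeasurableD)
      then have "measure lebesgue (\<Union>\<D>) < d" using uv by simp
      then show "(\<Sum>K\<in>\<D>. norm (f (Sup K) - f (Inf K))) \<le> 1"
        using d(2)[OF D(1)] D(2) uv(3) by (meson less_imp_le order_trans)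
    qed (use uv in auto)
    then have "negligible (?S \<inter> {u<..<v})"
      by (rule negligible_subset) auto
    moreover have "openin (top_of_set ?S) (?S \<inter> {u<..<v})" by (simp add: openin_open_Int)
    ultimately show ?thesis using t uv by (intro exI[of _ "?S \<inter> {u<..<v}"]) auto
  qed
  then show ?thesis using locally_negligible_alt[of ?S] by blast
qed

lemma abs_continuous_on_differentiable_ae:
  fixes f :: "real \<Rightarrow> 'a::euclidean_space"
  assumes ac: "abs_continuous_on {a..b} f"
  shows "negligible {t \<in> {a<..<b}. \<not> f differentiable (at t)}"
proof -
  have "negligible {t \<in> {a<..<b}. \<not> (\<lambda>t. f t \<bullet> i) differentiable (at t)}" if i: "i \<in> Basis" for i
  proof (rule abs_continuous_on_differentiable_ae_real, rule abs_continuous_on_dominated[OF ac ac, of _ 1])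
    fix s t
    have "norm (f s \<bullet> i - f t \<bullet> i) \<le> norm (f s - f t)"
      using Basis_le_norm[OF i, of "f s - f t"] by (simp add: inner_diff_left)
    then show "norm (f s \<bullet> i - f t \<bullet> i) \<le> 1 * norm (f s - f t) + 1 * norm (f s - f t)"
      using norm_ge_zero[of "f s - f t"] by linarith
  qed
  then have "negligible (\<Union>i\<in>Basis. {t \<in> {a<..<b}. \<not> (\<lambda>t. f t \<bullet> i) differentiable (at t)})"
    by (intro negligible_Union) auto
  then show ?thesis
  proof (rule negligible_subset, safe)
    fix t assume t: "t \<in> {a<..<b}" "\<not> f differentiable (at t)"
    then obtain i where "i \<in> Basis" "\<not> (\<lambda>t. f t \<bullet> i) differentiable (at t)"
      using differentiable_componentwise_within[of f t UNIV] by blast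
    then show "t \<in> (\<Union>i\<in>Basis. {t \<in> {a<..<b}. \<not> (\<lambda>t. f t \<bullet> i) differentiable (at t)})"
      using t by blast
  qed
qed

text \<open>The supremum \<open>c\<close> of the parameters up to which \<open>H\<close> stays above
  \<open>H a\<close> is reached by \<open>left\<close>, and by \<open>right\<close> it cannot be
  smaller than \<open>b\<close>. The condition \<open>left\<close> only carries lower bounds to the
  limit, so \<open>H\<close> may jump upwards.\<close>

lemma locally_increasing_right:
  fixes H :: "real \<Rightarrow> real"
  assumes "a \<le> b"
    and right: "\<And>c. a \<le> c \<Longrightarrow> c < b \<Longrightarrow> \<exists>d>0. \<forall>s. c < s \<and> s < c + d \<longrightarrow> H c \<le> H s"
    and left: "\<And>c m. a < c \<Longrightarrow> c \<le> b \<Longrightarrow> (\<And>r. a \<le> r \<Longrightarrow> r < c \<Longrightarrow> m \<le> H r) \<Longrightarrow> m \<le> H c"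
  shows "H a \<le> H b"
proof -
  define T where "T = {s \<in> {a..b}. \<forall>r\<in>{a..s}. H a \<le> H r}"
  have aT: "a \<in> T" using \<open>a \<le> b\<close> by (auto simp: T_def)
  have bdd: "bdd_above T" by (rule bdd_aboveI[of _ b]) (auto simp: T_def)
  define c where "c = Sup T"
  have "a \<le> c" unfolding c_def by (rule cSup_upper[OF aT bdd])
  moreover have "c \<le> b" unfolding c_def by (rule cSup_least) (use aT in \<open>auto simp: T_def\<close>)
  ultimately have c: "a \<le> c" "c \<le> b" .
  have below: "H a \<le> H r" if r: "a \<le> r" "r < c" for r
  proof -
    obtain s where "s \<in> T" "r < s" using less_cSupD[of T r] aT r by (auto simp: c_def)
    then show ?thesis using r by (auto simp: T_def)
  qed
  have Hc: "H a \<le> H c"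
  proof (cases "a = c")
    case False
    then show ?thesis using left[of c "H a"] below c by auto
  qed simp
  have "c = b"
  proof (rule ccontr)
    assume "c \<noteq> b"
    then have "c < b" using c by simp
    then obtain d where d: "d > 0" "\<And>s. c < s \<Longrightarrow> s < c + d \<Longrightarrow> H c \<le> H s"
      using right[OF c(1)] by auto
    define s where "s = min b (c + d / 2)"
    have s: "c < s" "s < c + d" "s \<le> b" using d(1) \<open>c < b\<close> by (auto simp: s_def)
    have "s \<in> T"
      unfolding T_def
    proof (intro CollectI conjI ballI)
      fix r assume r: "r \<in> {a..s}"
      show "H a \<le> H r"
      proof (cases r c rule: linorder_cases)
        case less
        then show ?thesis using below[of r] r by auto
      next
        case greater
        then show ?thesis using d(2)[of r] Hc r s by auto
      qed (use Hc in simp)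
    qed (use s c in auto)
    then show False using cSup_upper[OF _ bdd, of s] s by (simp add: c_def)
  qed
  then show ?thesis using Hc by simp
qed

text \<open>A lower Dini derivative condition off a null set \<open>N\<close>: on a small open set around \<open>N\<close> the
  variation of \<open>h\<close> is at most \<open>e\<close>, and adding that variation (and \<open>e t\<close>) to \<open>h\<close> makes it locally
  increasing to the right at every point.\<close>

lemma abs_continuous_on_dini_mono:
  fixes h :: "real \<Rightarrow> real"
  assumes ac: "abs_continuous_on {a..b} h" and N: "negligible N" and "a \<le> b"
    and dini: "\<And>t e. t \<in> {a<..<b} - N \<Longrightarrow> e > 0 \<Longrightarrow> \<exists>d>0. \<forall>s. t < s \<and> s < t + d \<longrightarrow> h t - e * (s - t) \<le> h s"
  shows "h a \<le> h b"
proof -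
  have cont: "continuous_on {a..b} h" by (rule abs_continuous_on_imp_continuous_on[OF ac])
  have inner: "h a' \<le> h b'" if ab': "a < a'" "a' \<le> b'" "b' < b" for a' b'
  proof (rule field_le_epsilon)
    fix e0 :: real assume "e0 > 0"
    \<comment> \<open>The slope term costs \<open>e (b' - a')\<close> and the variation around
      \<open>N\<close> costs \<open>e\<close>; together they amount to \<open>e0\<close>.\<close>
    define e where "e = e0 / (1 + (b' - a'))"
    have e: "e > 0" using \<open>e0 > 0\<close> ab' by (simp add: e_def)
    obtain d where d: "d > 0" "\<And>\<D>. \<D> division_of \<Union>\<D> \<Longrightarrow> \<Union>\<D> \<subseteq> {a..b} \<Longrightarrow> measure lebesgue (\<Union>\<D>) < d \<Longrightarrow>
      (\<Sum>K\<in>\<D>. norm (h (Sup K) - h (Inf K))) < e"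
      by (rule abs_continuous_onE[OF ac e]) (rule that)
    have Ns: "N \<in> sets lebesgue" "measure lebesgue N = 0" "N \<in> lmeasurable"
      using N negligible_imp_sets negligible_imp_measure0 negligible_imp_measurable by auto
    obtain G where G: "open G" "N \<subseteq> G" "G - N \<in> lmeasurable" "emeasure lebesgue (G - N) < ennreal d"
      by (rule sets_lebesgue_outer_open[OF Ns(1) d(1)])
    have Gm: "G \<in> lmeasurable" "measure lebesgue G < d"
    proof -
      have eq: "G = (G - N) \<union> N" using G(2) by blast
      show "G \<in> lmeasurable" using fmeasurable.Un[OF G(3) Ns(3)] eq by simp
      have "measure lebesgue G \<le> measure lebesgue (G - N) + measure lebesgue N"
        using measure_Un_le[of "G - N" lebesgue N] G(3) Ns eq by (simp add: fmeasurableD)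
      moreover have "measure lebesgue (G - N) < d"
        using G(3,4) d(1) by (simp add: emeasure_eq_measure2 ennreal_less_iff)
      ultimately show "measure lebesgue G < d" using Ns by simp
    qed
    define S where "S = G \<inter> {a..b}"
    have bound: "(\<Sum>K\<in>\<D>. norm (h (Sup K) - h (Inf K))) \<le> e" if D: "\<D> division_of \<Union>\<D>" "\<Union>\<D> \<subseteq> S" for \<D>
    proof -
      have "\<Union>\<D> \<in> lmeasurable" using D(1) lmeasurable_division by blast
      then have "measure lebesgue (\<Union>\<D>) \<le> measure lebesgue G"
        using D(2) Gm by (intro measure_mono_fmeasurable) (auto simp: fmeasurableD S_def)
      then show ?thesis using d(2)[OF D(1)] D(2) Gm by (force simp: S_def)
    qed
    define V where "V t = variation h (S \<inter> {..t})" for t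
    have Vmono: "V t \<le> V s" if "t \<le> s" for s t
      unfolding V_def using that by (intro variation_mono[OF bound]) auto
    have V0: "0 \<le> V t" "V t \<le> e" for t
      unfolding V_def by (intro variation_nonneg[OF bound] variation_le[OF bound]; auto)+
    define H where "H t = h t + e * t + V t" for t
    have "H a' \<le> H b'"
    proof (rule locally_increasing_right[OF ab'(2)])
      fix c assume c: "a' \<le> c" "c < b'"
      show "\<exists>d>0. \<forall>s. c < s \<and> s < c + d \<longrightarrow> H c \<le> H s"
      proof (cases "c \<in> N")
        case False
        then obtain d where d: "d > 0" "\<And>s. c < s \<Longrightarrow> s < c + d \<Longrightarrow> h c - e * (s - c) \<le> h s"
          using dini[of c e] e c ab' by auto
        have "H c \<le> H s" if "c < s" "s < c + d" for s
          using d(2)[OF that] Vmono[of c s] that by (simp add: H_def algebra_simps)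
        then show ?thesis using d(1) by blast
      next
        case True
        then obtain r where r: "r > 0" "cball c r \<subseteq> G" using G(1,2) open_contains_cball by blast
        have "H c \<le> H s" if s: "c < s" "s < c + min r (b - c)" for s
        proof -
          have "{c..s} \<subseteq> S"
          proof -
            have "{c..s} \<subseteq> cball c r" using s by (auto simp: cball_eq_atLeastAtMost)
            then show ?thesis using r s c ab' by (auto simp: S_def)
          qed
          then have "V c + norm (h s - h c) \<le> V s"
            unfolding V_def using s by (intro variation_step[OF bound]) auto
          moreover have "e * c \<le> e * s" using e s by simp
          ultimately show ?thesis by (simp add: H_def abs_le_iff)
        qed
        moreover have "min r (b - c) > 0" using r c ab' by simp
        ultimately show ?thesis by blast
      qed
    next
      fix c m assume c: "a' < c" "c \<le> b'" and m: "\<And>r. a' \<le> r \<Longrightarrow> r < c \<Longrightarrow> m \<le> H r"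
      have "isCont h c" using cont c ab' by (intro continuous_on_interior[of "{a..b}"]) auto
      then have "(h \<longlongrightarrow> h c) (at c)" by (simp add: isCont_def)
      then have "(h \<longlongrightarrow> h c) (at_left c)" by (rule tendsto_mono[OF at_le[OF subset_UNIV]])
      then have "((\<lambda>r. h r + e * r + V c) \<longlongrightarrow> h c + e * c + V c) (at_left c)"
        by (intro tendsto_intros)
      \<comment> \<open>Replacing \<open>V r\<close> by the larger \<open>V c\<close> before the
        limit leaves only the continuous part of \<open>H\<close> to pass to the limit.\<close>
      moreover have "\<forall>\<^sub>F r in at_left c. m \<le> h r + e * r + V c"
      proof -
        have "m \<le> h r + e * r + V c" if "a' < r" "r < c" for r
          using m[of r] Vmono[of r c] that by (simp add: H_def)
        then show ?thesis using c by (auto simp: eventually_at_left[of a'])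
      qed
      ultimately show "m \<le> H c"
        unfolding H_def by (intro tendsto_lowerbound) auto
    qed
    then have "h a' \<le> h b' + e * (b' - a') + e"
      using V0[of a'] V0[of b'] by (simp add: H_def algebra_simps)
    also have "h b' + e * (b' - a') + e = h b' + e0"
    proof -
      have "e * (1 + (b' - a')) = e0" using ab' by (simp add: e_def)
      then show ?thesis by (simp add: algebra_simps)
    qed
    finally show "h a' \<le> h b' + e0" by simp
  qed
  show ?thesis
  proof (cases "a = b")
    case False
    then have ab: "a < b" using \<open>a \<le> b\<close> by simp
    define m where "m = (a + b) / 2"
    have m: "a < m" "m < b" using ab by (auto simp: m_def)
    have "(h \<longlongrightarrow> h a) (at a within {a..b})" "(h \<longlongrightarrow> h b) (at b within {a..b})"
      using cont ab by (auto simp: continuous_on_def)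
    then have "(h \<longlongrightarrow> h a) (at_right a)" "(h \<longlongrightarrow> h b) (at_left b)"
      using ab by (auto simp: at_within_Icc_at_right at_within_Icc_at_left)
    moreover have "\<forall>\<^sub>F t in at_right a. h t \<le> h m"
      using inner m by (auto simp: eventually_at_right[OF m(1)] intro!: exI[of _ m])
    moreover have "\<forall>\<^sub>F t in at_left b. h m \<le> h t"
      using inner m by (auto simp: eventually_at_left[OF m(2)] intro!: exI[of _ m])
    ultimately have "h a \<le> h m" "h m \<le> h b"
      by (auto intro: tendsto_upperbound tendsto_lowerbound)
    then show ?thesis by simp
  qed simp
qed

text \<open>Touching from below is symmetric in time, so the Dini criterion applies to
  \<open>h\<close> and to its reflection. One inequality comes from each direction.\<close>

lemma abs_continuous_on_touch_const:
  fixes h :: "real \<Rightarrow> real"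
  assumes ac: "abs_continuous_on {a..b} h" and N: "negligible N" and "a \<le> b"
    and touch: "\<And>t e. t \<in> {a<..<b} - N \<Longrightarrow> e > 0 \<Longrightarrow> \<exists>d>0. \<forall>s. \<bar>s - t\<bar> < d \<longrightarrow> h t - e * \<bar>s - t\<bar> \<le> h s"
  shows "h a = h b"
proof (rule antisym)
  show "h a \<le> h b"
  proof (rule abs_continuous_on_dini_mono[OF ac N \<open>a \<le> b\<close>])
    fix t e :: real assume "t \<in> {a<..<b} - N" "e > 0"
    then obtain d where d: "d > 0" "\<forall>s. \<bar>s - t\<bar> < d \<longrightarrow> h t - e * \<bar>s - t\<bar> \<le> h s" using touch by blast
    have "h t - e * (s - t) \<le> h s" if "t < s" "s < t + d" for s
      using d(2)[rule_format, of s] that by simp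
    then show "\<exists>d>0. \<forall>s. t < s \<and> s < t + d \<longrightarrow> h t - e * (s - t) \<le> h s" using d(1) by blast
  qed
  have "h (- (- b)) \<le> h (- (- a))"
  proof (rule abs_continuous_on_dini_mono[OF abs_continuous_on_reflect[OF ac], of "uminus ` N"])
    show "negligible (uminus ` N)"
      by (rule negligible_differentiable_image_negligible[OF order_refl N])
        (rule linear_imp_differentiable_on[OF linear_uminus])
    fix t e :: real assume t: "t \<in> {- b<..<- a} - uminus ` N" "e > 0"
    then have "- t \<in> {a<..<b} - N" by force
    then obtain d where d: "d > 0" "\<forall>s. \<bar>s - (- t)\<bar> < d \<longrightarrow> h (- t) - e * \<bar>s - (- t)\<bar> \<le> h s"
      using touch \<open>e > 0\<close> by blast
    have "h (- t) - e * (s - t) \<le> h (- s)" if "t < s" "s < t + d" for s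
      using d(2)[rule_format, of "- s"] that by simp
    then show "\<exists>d>0. \<forall>s. t < s \<and> s < t + d \<longrightarrow> h (- t) - e * (s - t) \<le> h (- s)" using d(1) by blast
  qed (use \<open>a \<le> b\<close> in auto)
  then show "h b \<le> h a" by simp
qed

lemma has_real_derivative_zero_touch:
  fixes \<phi> :: "real \<Rightarrow> real"
  assumes "(\<phi> has_real_derivative 0) (at t)" "e > 0"
  shows "\<exists>d>0. \<forall>s. \<bar>s - t\<bar> < d \<longrightarrow> \<phi> t - e * \<bar>s - t\<bar> \<le> \<phi> s"
proof -
  obtain d where d: "d > 0" "\<And>y. norm (y - t) < d \<Longrightarrow> norm (\<phi> y - \<phi> t - 0 * (y - t)) \<le> e * norm (y - t)"
    using assms unfolding has_field_derivative_def has_derivative_at_alt by blast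
  have "\<phi> t - e * \<bar>s - t\<bar> \<le> \<phi> s" if "\<bar>s - t\<bar> < d" for s
    using d(2)[of s] that by (simp add: abs_le_iff)
  then show ?thesis using d(1) by blast
qed

lemma abs_continuous_on_zero_derivative_const:
  fixes h :: "real \<Rightarrow> real"
  assumes "abs_continuous_on {a..b} h" "negligible N" "a \<le> b"
    and "\<And>t. t \<in> {a<..<b} - N \<Longrightarrow> (h has_real_derivative 0) (at t)"
  shows "h a = h b"
  by (rule abs_continuous_on_touch_const[OF assms(1-3)]) (rule has_real_derivative_zero_touch[OF assms(4)])

section \<open>Linear differential equations with measurable coefficients\<close>

lemma measurable_linear_apply:
  fixes B :: "real \<Rightarrow> 'a::euclidean_space \<Rightarrow> 'b::euclidean_space"
  assumes lin: "\<And>\<tau>. \<tau> \<in> S \<Longrightarrow> linear (B \<tau>)"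
    and meas: "\<And>w. (\<lambda>\<tau>. B \<tau> w) \<in> borel_measurable (lebesgue_on S)"
    and w: "w \<in> borel_measurable (lebesgue_on S)"
  shows "(\<lambda>\<tau>. B \<tau> (w \<tau>)) \<in> borel_measurable (lebesgue_on S)"
proof -
  have "(\<lambda>\<tau>. \<Sum>b\<in>Basis. (w \<tau> \<bullet> b) *\<^sub>R B \<tau> b) \<in> borel_measurable (lebesgue_on S)"
    by (intro borel_measurable_sum borel_measurable_scaleR borel_measurable_inner w meas borel_measurable_const)
  moreover have "(\<Sum>b\<in>Basis. (w \<tau> \<bullet> b) *\<^sub>R B \<tau> b) = B \<tau> (w \<tau>)" if "\<tau> \<in> S" for \<tau>
  proof -
    have "B \<tau> (w \<tau>) = B \<tau> (\<Sum>b\<in>Basis. (w \<tau> \<bullet> b) *\<^sub>R b)" by (simp add: euclidean_representation)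
    also have "\<dots> = (\<Sum>b\<in>Basis. (w \<tau> \<bullet> b) *\<^sub>R B \<tau> b)"
      by (simp add: linear_sum[OF lin[OF that]] linear_cmul[OF lin[OF that]])
    finally show ?thesis by simp
  qed
  ultimately show ?thesis by (subst measurable_cong[of _ _ "\<lambda>\<tau>. \<Sum>b\<in>Basis. (w \<tau> \<bullet> b) *\<^sub>R B \<tau> b"]) auto
qed

lemma measurable_continuous_lebesgue_on:
  fixes w :: "real \<Rightarrow> 'b::euclidean_space"
  assumes "continuous_on {s..t} w"
  shows "w \<in> borel_measurable (lebesgue_on {s..t})"
  by (rule continuous_imp_measurable_on_sets_lebesgue[OF assms]) (rule fmeasurableD, rule lmeasurable_interval)

lemma norm_integral_Icc_le:
  fixes g :: "real \<Rightarrow> 'a::euclidean_space"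
  assumes "g integrable_on {u..v}" "u \<le> v" "0 \<le> C" "\<And>x. x \<in> {u..v} \<Longrightarrow> norm (g x) \<le> C"
  shows "norm (integral {u..v} g) \<le> C * (v - u)"
  using has_integral_bound_real[OF assms(3) finite.emptyI integrable_integral[OF assms(1)]] assms(2,4)
  by simp

lemma continuous_on_Icc_bounded:
  fixes w :: "real \<Rightarrow> 'a::real_normed_vector"
  assumes "continuous_on {s..t} w"
  obtains M where "\<And>\<tau>. \<tau> \<in> {s..t} \<Longrightarrow> norm (w \<tau>) \<le> M"
proof -
  have "bounded (w ` {s..t})"
    by (rule compact_imp_bounded[OF compact_continuous_image[OF assms compact_Icc]])
  then obtain M where "\<forall>x\<in>w ` {s..t}. norm x \<le> M" unfolding bounded_iff by blast
  then show ?thesis using that[of M] by blast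
qed

text \<open>Picard iteration as a contraction with factor \<open>K * (t - s) \<le> 1 / 2\<close>.
  The integral from \<open>r\<close> is written as a difference of integrals from \<open>s\<close>,
  so that the prescribed time \<open>r\<close> may be either end: \<open>s\<close> for variations,
  \<open>t\<close> for the adjoint equation.\<close>

lemma linear_ode_integral_solution:
  fixes B :: "real \<Rightarrow> 'a::euclidean_space \<Rightarrow> 'a" and h :: "real \<Rightarrow> 'a"
  assumes "s \<le> t"
    and lin: "\<And>\<tau>. \<tau> \<in> {s..t} \<Longrightarrow> linear (B \<tau>)"
    and bnd: "\<And>\<tau> w. \<tau> \<in> {s..t} \<Longrightarrow> norm (B \<tau> w) \<le> K * norm w"
    and meas: "\<And>w. (\<lambda>\<tau>. B \<tau> w) \<in> borel_measurable (lebesgue_on {s..t})"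
    and h: "h \<in> borel_measurable (lebesgue_on {s..t})" "\<And>\<tau>. \<tau> \<in> {s..t} \<Longrightarrow> norm (h \<tau>) \<le> H"
    and K: "0 \<le> K" "K * (t - s) \<le> 1 / 2" and r: "r \<in> {s..t}"
  shows "\<exists>w. continuous_on {s..t} w \<and> (\<forall>\<tau>\<in>{s..t}. w \<tau> = w0 +
    integral {s..\<tau>} (\<lambda>\<sigma>. B \<sigma> (w \<sigma>) + h \<sigma>) - integral {s..r} (\<lambda>\<sigma>. B \<sigma> (w \<sigma>) + h \<sigma>))"
proof -
  \<comment> \<open>The clamp makes the iterates constant outside \<open>[s, t]\<close>, hence
    bounded continuous functions on the line, which form a complete metric space as a type.\<close>
  define c where "c \<tau> = max s (min \<tau> t)" for \<tau>
  have c: "c \<tau> \<in> {s..t}" for \<tau> using \<open>s \<le> t\<close> by (auto simp: c_def)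
  have cid: "c \<tau> = \<tau>" if "\<tau> \<in> {s..t}" for \<tau> using that by (auto simp: c_def)
  have cc: "continuous_on UNIV c" unfolding c_def by (intro continuous_intros)
  define I where "I w \<tau> = integral {s..\<tau>} (\<lambda>\<sigma>. B \<sigma> (w \<sigma>) + h \<sigma>)" for w :: "real \<Rightarrow> 'a" and \<tau>
  have int: "(\<lambda>\<sigma>. B \<sigma> (w \<sigma>)) integrable_on {s..t}" if w: "continuous_on {s..t} w" for w
  proof -
    obtain M where M: "\<And>\<tau>. \<tau> \<in> {s..t} \<Longrightarrow> norm (w \<tau>) \<le> M"
      by (rule continuous_on_Icc_bounded[OF w]) (rule that)
    show ?thesis
    proof (rule bounded_measurable_imp_integrable_on)
      show "(\<lambda>\<sigma>. B \<sigma> (w \<sigma>)) \<in> borel_measurable (lebesgue_on {s..t})"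
        by (rule measurable_linear_apply[OF lin meas measurable_continuous_lebesgue_on[OF w]])
      show "norm (B \<tau> (w \<tau>)) \<le> K * M" if "\<tau> \<in> {s..t}" for \<tau>
        using bnd[OF that, of "w \<tau>"] mult_left_mono[OF M[OF that] K(1)] by linarith
    qed
  qed
  have inth: "h integrable_on {s..t}" by (rule bounded_measurable_imp_integrable_on[OF h])
  have intBh: "(\<lambda>\<sigma>. B \<sigma> (w \<sigma>) + h \<sigma>) integrable_on {s..t}" if "continuous_on {s..t} w" for w
    by (rule integrable_add[OF int[OF that] inth])
  define T0 where "T0 w \<tau> = w0 + I w (c \<tau>) - I w r" for w and \<tau>
  have T0: "T0 w \<in> bcontfun" if w: "continuous_on {s..t} w" for w
  proof -
    have Ic: "continuous_on {s..t} (I w)" unfolding I_def by (rule indefinite_integral_continuous_1[OF intBh[OF w]])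
    obtain M where M: "\<And>\<tau>. \<tau> \<in> {s..t} \<Longrightarrow> norm (I w \<tau>) \<le> M"
      by (rule continuous_on_Icc_bounded[OF Ic]) (rule that)
    show ?thesis
    proof (rule bcontfun_normI)
      show "continuous_on UNIV (T0 w)"
        unfolding T0_def by (intro continuous_intros continuous_on_compose2[OF Ic cc]) (use c in auto)
      fix \<tau>
      have "norm (T0 w \<tau>) \<le> norm w0 + norm (I w (c \<tau>)) + norm (I w r)"
        unfolding T0_def by (meson norm_triangle_ineq norm_triangle_ineq4 order_trans add_right_mono)
      then show "norm (T0 w \<tau>) \<le> norm w0 + M + M" using M[OF c, of \<tau>] M[OF r] by linarith
    qed
  qed
  define T where "T w = Bcontfun (T0 (apply_bcontfun w))" for w
  have T: "apply_bcontfun (T w) = T0 (apply_bcontfun w)" for w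
    unfolding T_def by (rule Bcontfun_inverse) (rule T0, simp)
  have contr: "dist (T w) (T w') \<le> 1 / 2 * dist w w'" for w w'
  proof (rule dist_bound)
    fix \<tau>
    define W where "W \<sigma> = B \<sigma> (apply_bcontfun w \<sigma>) - B \<sigma> (apply_bcontfun w' \<sigma>)" for \<sigma>
    have intW: "W integrable_on {s..t}" unfolding W_def by (intro integrable_diff int) auto
    have Wb: "norm (W \<sigma>) \<le> K * dist w w'" if "\<sigma> \<in> {s..t}" for \<sigma>
    proof -
      have "W \<sigma> = B \<sigma> (apply_bcontfun w \<sigma> - apply_bcontfun w' \<sigma>)"
        unfolding W_def by (simp add: linear_diff[OF lin[OF that]])
      then have "norm (W \<sigma>) \<le> K * dist (apply_bcontfun w \<sigma>) (apply_bcontfun w' \<sigma>)"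
        using bnd[OF that] by (simp add: dist_norm)
      also have "\<dots> \<le> K * dist w w'" using dist_bounded K by (intro mult_left_mono) auto
      finally show ?thesis .
    qed
    have ID: "I (apply_bcontfun w) \<sigma> - I (apply_bcontfun w') \<sigma> = integral {s..\<sigma>} W" if "\<sigma> \<in> {s..t}" for \<sigma>
    proof -
      have "integral {s..\<sigma>} (\<lambda>\<sigma>. B \<sigma> (apply_bcontfun w \<sigma>) + h \<sigma>) - integral {s..\<sigma>} (\<lambda>\<sigma>. B \<sigma> (apply_bcontfun w' \<sigma>) + h \<sigma>)
         = integral {s..\<sigma>} (\<lambda>\<sigma>. (B \<sigma> (apply_bcontfun w \<sigma>) + h \<sigma>) - (B \<sigma> (apply_bcontfun w' \<sigma>) + h \<sigma>))"
        using that by (intro Henstock_Kurzweil_Integration.integral_diff[symmetric] integrable_on_subinterval[OF intBh]) auto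
      then show ?thesis by (simp add: I_def W_def[abs_def])
    qed
    have seg: "norm (integral {s..u} W - integral {s..v} W) \<le> 1 / 2 * dist w w'" if "u \<in> {s..t}" "v \<in> {s..t}" "u \<le> v" for u v
    proof -
      have "integral {s..u} W + integral {u..v} W = integral {s..v} W"
        using that by (intro Henstock_Kurzweil_Integration.integral_combine integrable_on_subinterval[OF intW]) auto
      then have "norm (integral {s..u} W - integral {s..v} W) = norm (integral {u..v} W)"
        by (metis add_diff_cancel_left' norm_minus_commute)
      also have "\<dots> \<le> K * dist w w' * (v - u)"
        using that K Wb by (intro norm_integral_Icc_le integrable_on_subinterval[OF intW]) auto
      also have "\<dots> \<le> K * dist w w' * (t - s)"
        using that K by (intro mult_left_mono) auto
      also have "\<dots> = K * (t - s) * dist w w'" by simp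
      also have "\<dots> \<le> 1 / 2 * dist w w'" by (rule mult_right_mono[OF K(2)]) simp
      finally show ?thesis .
    qed
    have "dist (apply_bcontfun (T w) \<tau>) (apply_bcontfun (T w') \<tau>) = norm (integral {s..c \<tau>} W - integral {s..r} W)"
      unfolding T T0_def dist_norm ID[OF c, of \<tau>, symmetric] ID[OF r, symmetric] by (simp add: algebra_simps)
    also have "\<dots> \<le> 1 / 2 * dist w w'"
      using seg[OF c r, of \<tau>] seg[OF r c, of \<tau>] by (cases "c \<tau> \<le> r") (auto simp: norm_minus_commute)
    finally show "dist (apply_bcontfun (T w) \<tau>) (apply_bcontfun (T w') \<tau>) \<le> 1 / 2 * dist w w'" .
  qed
  obtain w where w: "T w = w" using banach_fix_type[of "1/2" T] contr by auto
  have "apply_bcontfun w \<tau> = w0 + I (apply_bcontfun w) \<tau> - I (apply_bcontfun w) r" if "\<tau> \<in> {s..t}" for \<tau>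
  proof -
    have "apply_bcontfun w \<tau> = T0 (apply_bcontfun w) \<tau>" using T[of w] w by simp
    then show ?thesis by (simp add: T0_def cid[OF that])
  qed
  then show ?thesis unfolding I_def by (intro exI[of _ "apply_bcontfun w"]) auto
qed

text \<open>The integrand of the integral equation is bounded and measurable. Boundedness makes the
  solution Lipschitz, and Lebesgue differentiation turns the integral equation into a differential
  equation off a null set.\<close>

lemma linear_ode:
  fixes B :: "real \<Rightarrow> 'a::euclidean_space \<Rightarrow> 'a" and h :: "real \<Rightarrow> 'a"
  assumes "s \<le> t"
    and lin: "\<And>\<tau>. \<tau> \<in> {s..t} \<Longrightarrow> linear (B \<tau>)"
    and bnd: "\<And>\<tau> w. \<tau> \<in> {s..t} \<Longrightarrow> norm (B \<tau> w) \<le> K * norm w"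
    and meas: "\<And>w. (\<lambda>\<tau>. B \<tau> w) \<in> borel_measurable (lebesgue_on {s..t})"
    and h: "h \<in> borel_measurable (lebesgue_on {s..t})" "\<And>\<tau>. \<tau> \<in> {s..t} \<Longrightarrow> norm (h \<tau>) \<le> H"
    and K: "0 \<le> K" "K * (t - s) \<le> 1 / 2" and r: "r \<in> {s..t}"
  obtains w L N where "w r = w0" "L-lipschitz_on {s..t} w" "negligible N"
    "\<And>\<tau>. \<tau> \<in> {s<..<t} - N \<Longrightarrow> (w has_vector_derivative B \<tau> (w \<tau>) + h \<tau>) (at \<tau>)"
    "(\<forall>\<tau>\<in>{s..t}. h \<tau> = 0) \<longrightarrow> w0 \<noteq> 0 \<longrightarrow> (\<forall>\<tau>\<in>{s..t}. w \<tau> \<noteq> 0)"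
proof -
  obtain w where wc: "continuous_on {s..t} w" and weq: "\<And>\<tau>. \<tau> \<in> {s..t} \<Longrightarrow> w \<tau> = w0 +
    integral {s..\<tau>} (\<lambda>\<sigma>. B \<sigma> (w \<sigma>) + h \<sigma>) - integral {s..r} (\<lambda>\<sigma>. B \<sigma> (w \<sigma>) + h \<sigma>)"
    using linear_ode_integral_solution[OF assms, of w0] by blast
  define g where "g \<sigma> = B \<sigma> (w \<sigma>) + h \<sigma>" for \<sigma>
  have "compact (w ` {s..t})" by (rule compact_continuous_image[OF wc compact_Icc])
  then have "\<exists>x\<in>w ` {s..t}. \<forall>y\<in>w ` {s..t}. norm y \<le> norm x"
    using \<open>s \<le> t\<close> by (intro continuous_attains_sup continuous_intros) auto
  then obtain m where m: "m \<in> {s..t}" "\<And>\<tau>. \<tau> \<in> {s..t} \<Longrightarrow> norm (w \<tau>) \<le> norm (w m)" by auto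
  define M where "M = norm (w m)"
  have gm: "g \<in> borel_measurable (lebesgue_on {s..t})"
    unfolding g_def using measurable_linear_apply[OF lin meas measurable_continuous_lebesgue_on[OF wc]] h(1)
    by (rule borel_measurable_add)
  have Bb: "norm (B \<tau> (w \<tau>)) \<le> K * M" if "\<tau> \<in> {s..t}" for \<tau>
    using bnd[OF that, of "w \<tau>"] mult_left_mono[OF m(2)[OF that] K(1)] unfolding M_def by linarith
  have gb: "norm (g \<tau>) \<le> K * M + H" if "\<tau> \<in> {s..t}" for \<tau>
    unfolding g_def using norm_triangle_ineq[of "B \<tau> (w \<tau>)" "h \<tau>"] Bb[OF that] h(2)[OF that] by linarith
  have gint: "g integrable_on {s..t}" by (rule bounded_measurable_imp_integrable_on[OF gm gb])
  define G where "G \<tau> = integral {s..\<tau>} g" for \<tau>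
  have wG: "w \<tau> = w0 + G \<tau> - G r" if "\<tau> \<in> {s..t}" for \<tau>
    using weq[OF that] by (simp add: G_def g_def[abs_def])
  have H0: "0 \<le> K * M + H" using gb[OF r] norm_ge_zero[of "g r"] by linarith
  have seg: "norm (w v - w u) \<le> C * (v - u)" if uv: "u \<in> {s..t}" "v \<in> {s..t}" "u \<le> v"
    and C: "\<And>\<sigma>. \<sigma> \<in> {s..t} \<Longrightarrow> norm (g \<sigma>) \<le> C" "0 \<le> C" for u v C
  proof -
    have comb: "integral {s..u} g + integral {u..v} g = integral {s..v} g"
      using uv by (intro Henstock_Kurzweil_Integration.integral_combine integrable_on_subinterval[OF gint]) auto
    have "w v - w u = G v - G u" by (simp add: wG[OF uv(1)] wG[OF uv(2)])
    also have "\<dots> = integral {u..v} g" by (simp add: G_def comb[symmetric])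
    finally have "w v - w u = integral {u..v} g" .
    moreover have "norm (integral {u..v} g) \<le> C * (v - u)"
      using uv C by (intro norm_integral_Icc_le integrable_on_subinterval[OF gint]) auto
    ultimately show ?thesis by simp
  qed
  define N where "N = {\<tau> \<in> {s<..<t}. \<not> (G has_vector_derivative g \<tau>) (at \<tau>)}"
  show ?thesis
  proof (rule that)
    show "w r = w0" using wG[OF r] by simp
    show "(K * M + H)-lipschitz_on {s..t} w"
    proof (rule lipschitz_onI)
      fix u v assume uv: "u \<in> {s..t}" "v \<in> {s..t}"
      show "dist (w u) (w v) \<le> (K * M + H) * dist u v"
        using seg[OF uv _ gb H0] seg[OF uv(2,1) _ gb H0]
        by (cases "u \<le> v") (auto simp: dist_norm norm_minus_commute abs_if)
    qed (rule H0)
    show "negligible N" unfolding N_def G_def by (rule integral_has_vector_derivative_ae[OF gm gb])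
    fix \<tau> assume \<tau>: "\<tau> \<in> {s<..<t} - N"
    then have "(G has_vector_derivative g \<tau>) (at \<tau>)" by (auto simp: N_def)
    then have "((\<lambda>\<tau>. w0 + G \<tau> - G r) has_vector_derivative g \<tau>) (at \<tau>)"
      by (auto intro!: derivative_eq_intros)
    then have "(w has_vector_derivative g \<tau>) (at \<tau>)"
      by (rule has_vector_derivative_transform_within_open[of _ _ _ "{s<..<t}"]) (use \<tau> wG in auto)
    then show "(w has_vector_derivative B \<tau> (w \<tau>) + h \<tau>) (at \<tau>)" by (simp add: g_def)
  next
    \<comment> \<open>In place of Gronwall: if \<open>w\<close> vanished at \<tau>, its maximal norm
      \<open>M\<close> would satisfy \<open>M \<le> K M (t - s) \<le> M / 2\<close>, so
      \<open>w\<close> would vanish identically, contrary to \<open>w r = w0\<close>.\<close>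
    have "w \<tau> \<noteq> 0" if h0: "\<forall>\<tau>\<in>{s..t}. h \<tau> = 0" and "w0 \<noteq> 0" and \<tau>: "\<tau> \<in> {s..t}" for \<tau>
    proof
      assume w\<tau>: "w \<tau> = 0"
      have gb': "norm (g \<sigma>) \<le> K * M" if "\<sigma> \<in> {s..t}" for \<sigma>
        using Bb[OF that] bspec[OF h0 that] by (simp add: g_def)
      have KM: "0 \<le> K * M" using K by (simp add: M_def)
      have "norm (w m - w \<tau>) \<le> K * M * \<bar>m - \<tau>\<bar>"
        using seg[OF m(1) \<tau> _ gb' KM] seg[OF \<tau> m(1) _ gb' KM]
        by (cases "m \<le> \<tau>") (auto simp: norm_minus_commute)
      also have "\<dots> \<le> K * M * (t - s)"
        using m(1) \<tau> KM by (intro mult_left_mono) auto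
      also have "\<dots> = K * (t - s) * M" by simp
      also have "\<dots> \<le> 1 / 2 * M" by (rule mult_right_mono[OF K(2)]) (simp add: M_def)
      finally have "M \<le> 0" using w\<tau> by (simp add: M_def)
      then have "norm (w r) \<le> 0" using m(2)[OF r] by (simp add: M_def)
      then show False using wG[OF r] \<open>w0 \<noteq> 0\<close> by simp
    qed
    then show "(\<forall>\<tau>\<in>{s..t}. h \<tau> = 0) \<longrightarrow> w0 \<noteq> 0 \<longrightarrow> (\<forall>\<tau>\<in>{s..t}. w \<tau> \<noteq> 0)" by blast
  qed
qed

lemma norm_linear_le_basis:
  fixes L :: "'a::euclidean_space \<Rightarrow> 'b::euclidean_space" and C :: real
  assumes "linear L" "\<And>b. b \<in> Basis \<Longrightarrow> norm (L b) \<le> C"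
  shows "norm (L w) \<le> real DIM('a) * C * norm w"
proof -
  have "norm (L w) = norm (\<Sum>b\<in>Basis. (w \<bullet> b) *\<^sub>R L b)"
    by (subst euclidean_representation[of w, symmetric])
      (simp only: linear_sum[OF assms(1)] linear_cmul[OF assms(1)])
  also have "\<dots> \<le> (\<Sum>b\<in>(Basis::'a set). norm w * C)"
  proof (rule sum_norm_le)
    fix b :: 'a assume b: "b \<in> Basis"
    then show "norm ((w \<bullet> b) *\<^sub>R L b) \<le> norm w * C"
      using Basis_le_norm[OF b, of w] assms(2)[OF b] by (auto intro!: mult_mono)
  qed
  finally show ?thesis by (simp add: mult_ac)
qed

text \<open>A derivative is a pointwise limit of difference quotients, which are continuous in time
  and hence measurable; the exceptional points get the value 0.\<close>

lemma velocity_measurable: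
  fixes z y :: "real \<Rightarrow> 'a::euclidean_space"
  assumes z: "continuous_on {s..t} z" and N: "negligible N"
    and d: "\<And>\<tau>. \<tau> \<in> {s<..<t} - N \<Longrightarrow> (z has_vector_derivative y \<tau>) (at \<tau>)"
  shows "(\<lambda>\<tau>. if \<tau> \<in> {s<..<t} - N then y \<tau> else 0) \<in> borel_measurable (lebesgue_on {s..t})"
proof -
  let ?S = "{s<..<t} - N"
  \<comment> \<open>The clamp keeps the shifted argument in \<open>[s, t]\<close>, where
    \<open>z\<close> is known to be continuous; for fixed \<tau> it has no effect once
    \<open>1 / Suc n < t - \<tau>\<close>.\<close>
  define g where "g n \<tau> = (if \<tau> \<in> ?S then real (Suc n) *\<^sub>R (z (min t (max s (\<tau> + 1 / real (Suc n)))) - z \<tau>) else 0)" for n \<tau>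
  have S: "?S \<in> sets (lebesgue_on {s..t})"
    using negligible_imp_sets[OF N] by (auto simp: sets_restrict_space_iff fmeasurableD)
  have "g n \<in> borel_measurable (lebesgue_on {s..t})" for n
    unfolding g_def
  proof (rule measurable_If_set)
    have "continuous_on {s..t} (\<lambda>\<tau>. real (Suc n) *\<^sub>R (z (min t (max s (\<tau> + 1 / real (Suc n)))) - z \<tau>))"
      by (intro continuous_intros z continuous_on_compose2[OF z]) auto
    then show "(\<lambda>\<tau>. real (Suc n) *\<^sub>R (z (min t (max s (\<tau> + 1 / real (Suc n)))) - z \<tau>)) \<in> borel_measurable (lebesgue_on {s..t})"
      by (rule measurable_continuous_lebesgue_on)
    show "?S \<inter> space (lebesgue_on {s..t}) \<in> sets (lebesgue_on {s..t})"
      using sets.Int[OF S sets.top] .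
  qed simp
  moreover have "(\<lambda>n. g n \<tau>) \<longlonglongrightarrow> (if \<tau> \<in> ?S then y \<tau> else 0)" for \<tau>
  proof (cases "\<tau> \<in> ?S")
    case True
    have "((\<lambda>h. (z (\<tau> + h) - z \<tau>) /\<^sub>R h) \<longlongrightarrow> y \<tau>) (at 0)"
      using d[OF True] unfolding has_vector_derivative_def has_derivative_at
    proof -
      have "(z has_derivative (\<lambda>h. h *\<^sub>R y \<tau>)) (at \<tau>)" using d[OF True] by (simp add: has_vector_derivative_def)
      then have "((\<lambda>h. norm (z (\<tau> + h) - z \<tau> - h *\<^sub>R y \<tau>) / norm h) \<longlongrightarrow> 0) (at 0)"
        by (simp add: has_derivative_at)
      then have "((\<lambda>h. norm ((z (\<tau> + h) - z \<tau>) /\<^sub>R h - y \<tau>)) \<longlongrightarrow> 0) (at 0)"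
      proof (rule Lim_transform_eventually)
        show "\<forall>\<^sub>F h in at 0. norm (z (\<tau> + h) - z \<tau> - h *\<^sub>R y \<tau>) / norm h = norm ((z (\<tau> + h) - z \<tau>) /\<^sub>R h - y \<tau>)"
        proof (rule eventually_at_topological[THEN iffD2], intro exI[of _ UNIV] conjI ballI impI)
          fix h :: real assume "h \<noteq> 0"
          then have "(z (\<tau> + h) - z \<tau>) /\<^sub>R h - y \<tau> = (z (\<tau> + h) - z \<tau> - h *\<^sub>R y \<tau>) /\<^sub>R h"
            by (simp add: scaleR_diff_right)
          then show "norm (z (\<tau> + h) - z \<tau> - h *\<^sub>R y \<tau>) / norm h = norm ((z (\<tau> + h) - z \<tau>) /\<^sub>R h - y \<tau>)"
            by (simp add: divide_inverse)
        qed auto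
      qed
      then show ?thesis by (simp add: tendsto_norm_zero_iff LIM_zero_iff)
    qed
    then have "(\<lambda>n. (z (\<tau> + 1 / real (Suc n)) - z \<tau>) /\<^sub>R (1 / real (Suc n))) \<longlonglongrightarrow> y \<tau>"
    proof (rule filterlim_compose)
      show "filterlim (\<lambda>n. 1 / real (Suc n)) (at 0) sequentially"
        unfolding filterlim_at using LIMSEQ_inverse_real_of_nat by (auto simp: inverse_eq_divide)
    qed
    moreover have "\<forall>\<^sub>F n in sequentially. (z (\<tau> + 1 / real (Suc n)) - z \<tau>) /\<^sub>R (1 / real (Suc n)) = g n \<tau>"
    proof -
      have "\<forall>\<^sub>F n in sequentially. 1 / real (Suc n) < t - \<tau>"
        using order_tendstoD(2)[OF LIMSEQ_inverse_real_of_nat, of "t - \<tau>"] True by (simp add: inverse_eq_divide)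
      then show ?thesis
      proof eventually_elim
        case (elim n)
        have "0 < 1 / real (Suc n)" by simp
        then have "s < \<tau> + 1 / real (Suc n)" "\<tau> + 1 / real (Suc n) < t"
          using True elim by (simp_all only: Diff_iff greaterThanLessThan_iff) linarith+
        then have "min t (max s (\<tau> + 1 / real (Suc n))) = \<tau> + 1 / real (Suc n)"
          by (simp only: max_absorb2 min_absorb2 less_imp_le)
        then show ?case using True by (simp add: g_def)
      qed
    qed
    ultimately show ?thesis using True by (auto intro: Lim_transform_eventually)
  next
    case False
    then have "g n \<tau> = 0" for n unfolding g_def by (simp only: if_False)
    then show ?thesis using False by (simp only: if_False tendsto_const)
  qed
  ultimately show ?thesis by (rule borel_measurable_LIMSEQ_metric)
qed

section \<open>Variations of a unit speed curve in one chart\<close>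

text \<open>\<open>N\<close> is the asymmetric norm and \<open>f\<close> the family of unit vector fields in the coordinates of a chart with image \<open>\<Omega>\<close>.\<close>

locale finsler_chart =
  fixes \<Omega> :: "'a::euclidean_space set" and N :: "'a \<Rightarrow> 'a \<Rightarrow> real"
    and U :: "'b::euclidean_space set" and f :: "'a \<Rightarrow> 'b \<Rightarrow> 'a"
  assumes open_dom: "open \<Omega>"
    and N_cont: "continuous_on (\<Omega> \<times> UNIV) (\<lambda>(z, y). N z y)"
    and N_nonneg: "\<And>z y. z \<in> \<Omega> \<Longrightarrow> 0 \<le> N z y"
    and N_zero: "\<And>z. z \<in> \<Omega> \<Longrightarrow> N z 0 = 0"
    and N_scale: "\<And>z y r. z \<in> \<Omega> \<Longrightarrow> 0 < r \<Longrightarrow> N z (r *\<^sub>R y) = r * N z y"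
    and N_triangle: "\<And>z y w. z \<in> \<Omega> \<Longrightarrow> N z (y + w) \<le> N z y + N z w"
    and compact_U: "compact U"
    and f_unit: "\<And>z u. z \<in> \<Omega> \<Longrightarrow> u \<in> U \<Longrightarrow> N z (f z u) = 1"
    and f_surj: "\<And>z y. z \<in> \<Omega> \<Longrightarrow> N z y = 1 \<Longrightarrow> \<exists>u\<in>U. f z u = y"
    and f_inj: "\<And>z. z \<in> \<Omega> \<Longrightarrow> inj_on (f z) U"
    and f_diff: "\<And>z u. z \<in> \<Omega> \<Longrightarrow> u \<in> U \<Longrightarrow> (\<lambda>z. f z u) differentiable (at z)"
    and f_cont: "continuous_on (\<Omega> \<times> U) (\<lambda>(z, u). f z u)"
    and Df_cont: "\<And>e. continuous_on (\<Omega> \<times> U) (\<lambda>(z, u). frechet_derivative (\<lambda>z'. f z' u) (at z) e)"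
begin

abbreviation D :: "'a \<Rightarrow> 'b \<Rightarrow> 'a \<Rightarrow> 'a" where "D z u \<equiv> frechet_derivative (\<lambda>z'. f z' u) (at z)"

lemma D_works: "z \<in> \<Omega> \<Longrightarrow> u \<in> U \<Longrightarrow> ((\<lambda>z'. f z' u) has_derivative D z u) (at z)"
  using f_diff frechet_derivative_works by blast

lemma D_linear: "z \<in> \<Omega> \<Longrightarrow> u \<in> U \<Longrightarrow> linear (D z u)"
  using D_works has_derivative_linear by blast

lemma N_scale0: "z \<in> \<Omega> \<Longrightarrow> 0 \<le> r \<Longrightarrow> N z (r *\<^sub>R y) = r * N z y"
  using N_scale[of z r y] N_zero[of z] by (cases "r = 0") auto

lemma compact_thicken:
  assumes "compact Z" "Z \<subseteq> \<Omega>"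
  obtains r Z' where "r > 0" "compact Z'" "Z' \<subseteq> \<Omega>" "\<And>z y. z \<in> Z \<Longrightarrow> dist z y \<le> r \<Longrightarrow> y \<in> Z'" "Z \<subseteq> Z'"
proof -
  obtain r where r: "r > 0" "(\<Union>x\<in>Z. cball x r) \<subseteq> \<Omega>"
    using compact_subset_open_imp_cball_epsilon_subset[OF assms(1) open_dom assms(2)] by auto
  have eq: "{x + y |x y. x \<in> Z \<and> y \<in> cball 0 r} = (\<Union>x\<in>Z. cball x r)"
  proof (intro equalityI subsetI)
    fix y assume "y \<in> (\<Union>x\<in>Z. cball x r)"
    then obtain x where "x \<in> Z" "dist x y \<le> r" by auto
    then have "y = x + (y - x)" "y - x \<in> cball 0 r" by (auto simp: dist_norm norm_minus_commute)
    then show "y \<in> {x + y |x y. x \<in> Z \<and> y \<in> cball 0 r}" using \<open>x \<in> Z\<close> by blast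
  next
    fix y assume "y \<in> {x + y |x y. x \<in> Z \<and> y \<in> cball 0 r}"
    then obtain x y' where "y = x + y'" "x \<in> Z" "norm y' \<le> r" by auto
    then have "y \<in> cball x r" by (simp add: dist_norm)
    then show "y \<in> (\<Union>x\<in>Z. cball x r)" using \<open>x \<in> Z\<close> by blast
  qed
  have "compact (\<Union>x\<in>Z. cball x r)"
    using compact_sums[OF assms(1) compact_cball[of 0 r]] by (simp only: eq)
  then show ?thesis
    using r by (intro that[of r "\<Union>x\<in>Z. cball x r"]) (auto intro: less_imp_le)
qed

lemma uniform_derivative_bound:
  assumes "compact Z" "Z \<subseteq> \<Omega>"
  obtains K where "0 \<le> K" "\<And>z u w. z \<in> Z \<Longrightarrow> u \<in> U \<Longrightarrow> norm (D z u w) \<le> K * norm w"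
proof -
  have "bounded (\<Union>b\<in>Basis. (\<lambda>(z, u). D z u b) ` (Z \<times> U))"
  proof (rule bounded_UN[OF finite_Basis], rule ballI, rule compact_imp_bounded)
    fix b
    show "compact ((\<lambda>(z, u). D z u b) ` (Z \<times> U))"
      using assms compact_U by (intro compact_continuous_image continuous_on_subset[OF Df_cont] compact_Times) auto
  qed
  then obtain C where C: "\<forall>x\<in>(\<Union>b\<in>Basis. (\<lambda>(z, u). D z u b) ` (Z \<times> U)). norm x \<le> C"
    unfolding bounded_iff by blast
  have b: "norm (D z u b) \<le> C" if "z \<in> Z" "u \<in> U" "b \<in> Basis" for z u b
    using C that by (auto simp: image_def)
  show ?thesis
  proof (rule that)
    show "0 \<le> DIM('a) * \<bar>C\<bar>" by simp
    fix z u w assume zu: "z \<in> Z" "u \<in> U"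
    show "norm (D z u w) \<le> DIM('a) * \<bar>C\<bar> * norm w"
    proof (rule norm_linear_le_basis)
      show "linear (D z u)" using zu assms D_linear by blast
      show "norm (D z u b) \<le> \<bar>C\<bar>" if "b \<in> Basis" for b
        using b[OF zu that] by linarith
    qed
  qed
qed

text \<open>Mean value inequality on \<open>cball z r\<close> for \<open>f y u - D z u y\<close>,
  whose derivative \<open>D y u - D z u\<close> is small by uniform continuity on a compact set. The
  radius is the same for all controls, so nothing about the dependence of \<open>u\<close> on time
  enters.\<close>

lemma uniform_linearization:
  assumes Z: "compact Z" "Z \<subseteq> \<Omega>" and "\<delta> > 0"
  obtains r where "r > 0" "\<And>z y. z \<in> Z \<Longrightarrow> dist z y \<le> r \<Longrightarrow> y \<in> \<Omega>"
    "\<And>z y u. z \<in> Z \<Longrightarrow> dist z y \<le> r \<Longrightarrow> u \<in> U \<Longrightarrow> norm (f y u - f z u - D z u (y - z)) \<le> \<delta> * norm (y - z)"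
proof -
  obtain r0 Z' where r0: "r0 > 0" "compact Z'" "Z' \<subseteq> \<Omega>" "\<And>z y. z \<in> Z \<Longrightarrow> dist z y \<le> r0 \<Longrightarrow> y \<in> Z'" "Z \<subseteq> Z'"
    by (rule compact_thicken[OF Z]) (rule that)
  \<comment> \<open>Uniform continuity is available for each basis direction separately; summing
    over the basis costs the factor \<open>DIM('a)\<close>.\<close>
  define \<delta>' where "\<delta>' = \<delta> / DIM('a)"
  have \<delta>': "\<delta>' > 0" using \<open>\<delta> > 0\<close> by (simp add: \<delta>'_def)
  have "\<forall>b\<in>Basis. \<exists>d>0. \<forall>z\<in>Z'. \<forall>y\<in>Z'. \<forall>u\<in>U. dist z y < d \<longrightarrow> norm (D y u b - D z u b) \<le> \<delta>'"
  proof
    fix b :: 'a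
    have "uniformly_continuous_on (Z' \<times> U) (\<lambda>(z, u). D z u b)"
      using r0 compact_U by (intro compact_uniformly_continuous continuous_on_subset[OF Df_cont] compact_Times) auto
    then obtain d where d: "d > 0" "\<And>p q. p \<in> Z' \<times> U \<Longrightarrow> q \<in> Z' \<times> U \<Longrightarrow> dist q p < d \<Longrightarrow>
        dist ((\<lambda>(z, u). D z u b) q) ((\<lambda>(z, u). D z u b) p) < \<delta>'"
      using \<delta>' unfolding uniformly_continuous_on_def by metis
    have "norm (D y u b - D z u b) \<le> \<delta>'" if "z \<in> Z'" "y \<in> Z'" "u \<in> U" "dist z y < d" for z y u
      using d(2)[of "(z, u)" "(y, u)"] that by (simp add: dist_norm dist_Pair_Pair norm_minus_commute)
    then show "\<exists>d>0. \<forall>z\<in>Z'. \<forall>y\<in>Z'. \<forall>u\<in>U. dist z y < d \<longrightarrow> norm (D y u b - D z u b) \<le> \<delta>'"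
      using d(1) by blast
  qed
  then obtain d where d: "\<And>b. b \<in> Basis \<Longrightarrow> d b > 0"
    "\<And>b z y u. b \<in> Basis \<Longrightarrow> z \<in> Z' \<Longrightarrow> y \<in> Z' \<Longrightarrow> u \<in> U \<Longrightarrow> dist z y < d b \<Longrightarrow> norm (D y u b - D z u b) \<le> \<delta>'"
    by metis
  define r where "r = min r0 (Min (d ` Basis) / 2)"
  have Mpos: "Min (d ` Basis) > 0" using d(1) by (subst Min_gr_iff) auto
  have rd: "r < d b" if "b \<in> Basis" for b
  proof -
    have "Min (d ` Basis) \<le> d b" using that by (intro Min_le) auto
    moreover have "r \<le> Min (d ` Basis) / 2" unfolding r_def by (rule min.cobounded2)
    ultimately show ?thesis using Mpos by linarith
  qed
  show ?thesis
  proof (rule that)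
    show "r > 0" using r0(1) Mpos by (simp add: r_def)
    show "y \<in> \<Omega>" if "z \<in> Z" "dist z y \<le> r" for z y using r0 that by (auto simp: r_def)
    fix z y u assume z: "z \<in> Z" "dist z y \<le> r" and u: "u \<in> U"
    have sub: "y' \<in> Z'" "dist z y' \<le> r" if "y' \<in> cball z r" for y'
      using that r0 z by (auto simp: r_def)
    have "norm ((f y u - D z u y) - (f z u - D z u z)) \<le> \<delta> * norm (y - z)"
    proof (rule differentiable_bound[where S = "cball z r" and f' = "\<lambda>y' w. D y' u w - D z u w"])
      have lz: "linear (D z u)" using D_linear z u Z by blast
      fix y' assume y': "y' \<in> cball z r"
      have y'\<Omega>: "y' \<in> \<Omega>" using sub[OF y'] r0 by blast
      have "((\<lambda>y. f y u) has_derivative D y' u) (at y' within cball z r)"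
        using D_works[OF y'\<Omega> u] by (rule has_derivative_at_withinI)
      then show "((\<lambda>y. f y u - D z u y) has_derivative (\<lambda>w. D y' u w - D z u w)) (at y' within cball z r)"
        by (intro has_derivative_diff linear_imp_has_derivative lz)
      have l: "linear (\<lambda>w. D y' u w - D z u w)"
        by (intro linear_compose_sub D_linear y'\<Omega> u lz)
      have "norm (D y' u w - D z u w) \<le> \<delta> * norm w" for w
      proof -
        have "norm (D y' u w - D z u w) \<le> DIM('a) * \<delta>' * norm w"
        proof (rule norm_linear_le_basis[OF l])
          fix b :: 'a assume b: "b \<in> Basis"
          show "norm (D y' u b - D z u b) \<le> \<delta>'"
            using d(2)[OF b, of z y' u] sub[OF y'] z r0(5) u rd[OF b] by auto
        qed
        then show ?thesis by (simp add: \<delta>'_def)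
      qed
      then show "onorm (\<lambda>w. D y' u w - D z u w) \<le> \<delta>" using \<open>\<delta> > 0\<close> by (intro onorm_bound) auto
    qed (use z \<open>r > 0\<close> in auto)
    moreover have "f y u - D z u y - (f z u - D z u z) = f y u - f z u - D z u (y - z)"
      using linear_diff[OF D_linear, of z u y z] z u Z by (auto simp: subset_iff)
    ultimately show "norm (f y u - f z u - D z u (y - z)) \<le> \<delta> * norm (y - z)" by simp
  qed
qed

text \<open>Positive homogeneity reduces the bound to unit vectors, that is, to the compact set
  \<open>Z \<times> sphere 0 1\<close>.\<close>

lemma N_upper:
  assumes "compact Z" "Z \<subseteq> \<Omega>"
  obtains C where "0 \<le> C" "\<And>z y. z \<in> Z \<Longrightarrow> N z y \<le> C * norm y"
proof -
  have "compact ((\<lambda>(z, y). N z y) ` (Z \<times> sphere 0 1))"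
    using assms by (intro compact_continuous_image continuous_on_subset[OF N_cont] compact_Times) auto
  from compact_imp_bounded[OF this]
  obtain C where C: "\<forall>x\<in>(\<lambda>(z, y). N z y) ` (Z \<times> sphere 0 1). norm x \<le> C"
    unfolding bounded_iff by blast
  show ?thesis
  proof (rule that)
    show "0 \<le> \<bar>C\<bar>" by simp
    fix z y assume z: "z \<in> Z"
    show "N z y \<le> \<bar>C\<bar> * norm y"
    proof (cases "y = 0")
      case True
      then show ?thesis using N_zero z assms by auto
    next
      case False
      then have "N z y = norm y * N z (y /\<^sub>R norm y)"
        using N_scale[of z "norm y" "y /\<^sub>R norm y"] z assms by auto
      moreover have "N z (y /\<^sub>R norm y) \<le> \<bar>C\<bar>"
      proof -
        have "(z, y /\<^sub>R norm y) \<in> Z \<times> sphere 0 1" using z False by simp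
        then have "N z (y /\<^sub>R norm y) \<in> (\<lambda>(z, y). N z y) ` (Z \<times> sphere 0 1)" by force
        then have "norm (N z (y /\<^sub>R norm y)) \<le> C" using C by blast
        then show ?thesis by simp
      qed
      ultimately show ?thesis
        using mult_left_mono[of "N z (y /\<^sub>R norm y)" "\<bar>C\<bar>" "norm y"] by (simp add: mult.commute)
    qed
  qed
qed

lemma N_uniform:
  assumes "compact Z" "Z \<subseteq> \<Omega>" "\<delta> > 0"
  obtains r where "r > 0" "\<And>z z' (y::'a). z \<in> Z \<Longrightarrow> z' \<in> Z \<Longrightarrow> dist z z' < r \<Longrightarrow> norm y \<le> E \<Longrightarrow> N z' y \<le> N z y + \<delta>"
proof -
  have "uniformly_continuous_on (Z \<times> cball 0 E) (\<lambda>(z, y). N z y)"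
    using assms by (intro compact_uniformly_continuous continuous_on_subset[OF N_cont] compact_Times) auto
  then obtain r where r: "r > 0" "\<And>p q. p \<in> Z \<times> cball 0 E \<Longrightarrow> q \<in> Z \<times> cball 0 E \<Longrightarrow> dist q p < r \<Longrightarrow>
        dist ((\<lambda>(z, y). N z y) q) ((\<lambda>(z, y). N z y) p) < \<delta>"
    using \<open>\<delta> > 0\<close> unfolding uniformly_continuous_on_def by metis
  show ?thesis
  proof (rule that[OF r(1)])
    fix z z' and y :: 'a assume "z \<in> Z" "z' \<in> Z" "dist z z' < r" "norm y \<le> E"
    then show "N z' y \<le> N z y + \<delta>"
      using r(2)[of "(z, y)" "(z', y)"] by (simp add: dist_Pair_Pair dist_real_def dist_commute abs_less_iff)
  qed
qed

text \<open>Measurability of \<open>u\<close> is not assumed but follows from that of the velocity \<open>y\<close>: for a closed set \<open>T\<close> the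
  pairs \<open>(z, f z u)\<close> with \<open>z\<close> on the curve and \<open>G (z, u) \<in> T\<close> form a compact set, and \<open>f z\<close> is injective.\<close>

lemma measurable_control:
  fixes z y :: "real \<Rightarrow> 'a" and u :: "real \<Rightarrow> 'b" and G :: "'a \<times> 'b \<Rightarrow> 'c::euclidean_space"
  assumes z: "continuous_on {s..t} z" "z ` {s..t} \<subseteq> \<Omega>"
    and y: "y \<in> borel_measurable (lebesgue_on {s..t})"
    and u: "\<And>\<tau>. \<tau> \<in> {s..t} \<Longrightarrow> u \<tau> \<in> U \<and> f (z \<tau>) (u \<tau>) = y \<tau>"
    and G: "continuous_on (\<Omega> \<times> U) G"
  shows "(\<lambda>\<tau>. G (z \<tau>, u \<tau>)) \<in> borel_measurable (lebesgue_on {s..t})"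
proof (rule borel_measurableI)
  fix S :: "'c set" assume S: "open S"
  define K where "K = z ` {s..t}"
  have K: "compact K" "K \<subseteq> \<Omega>" unfolding K_def using z by (auto intro: compact_continuous_image)
  define W where "W = {p \<in> K \<times> U. G p \<in> - S}"
  have GK: "continuous_on (K \<times> U) G" using K by (intro continuous_on_subset[OF G]) auto
  have "closed W"
  proof -
    have "closed (K \<times> U)" using K compact_U by (intro closed_Times compact_imp_closed)
    then have "closed ((K \<times> U) \<inter> G -` (- S))"
      using S by (intro continuous_closed_preimage[OF GK]) (auto simp: closed_Compl)
    moreover have "(K \<times> U) \<inter> G -` (- S) = W" by (auto simp: W_def)
    ultimately show ?thesis by simp
  qed
  then have "compact ((K \<times> U) \<inter> W)" using K compact_U by (intro compact_Int_closed compact_Times)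
  moreover have "(K \<times> U) \<inter> W = W" by (auto simp: W_def)
  ultimately have "compact W" by simp
  define Th where "Th = (\<lambda>p. (fst p, f (fst p) (snd p)))"
  have "continuous_on W Th"
    unfolding Th_def using K
    by (intro continuous_intros continuous_on_compose2[OF f_cont, unfolded case_prod_unfold])
      (auto simp: W_def)
  then have "closed (Th ` W)" using \<open>compact W\<close> compact_continuous_image compact_imp_closed by blast
  then have cl: "Th ` W \<in> sets borel" by simp
  have "(\<lambda>\<tau>. (z \<tau>, y \<tau>)) \<in> borel_measurable (lebesgue_on {s..t})"
    by (intro borel_measurable_Pair y measurable_continuous_lebesgue_on z)
  from measurable_sets[OF this cl]
  have 1: "(\<lambda>\<tau>. (z \<tau>, y \<tau>)) -` (Th ` W) \<inter> {s..t} \<in> sets (lebesgue_on {s..t})" by simp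
  have "\<tau> \<in> (\<lambda>\<tau>. (z \<tau>, y \<tau>)) -` (Th ` W) \<longleftrightarrow> G (z \<tau>, u \<tau>) \<notin> S" if \<tau>: "\<tau> \<in> {s..t}" for \<tau>
  proof
    assume "\<tau> \<in> (\<lambda>\<tau>. (z \<tau>, y \<tau>)) -` (Th ` W)"
    then obtain p where p: "p \<in> W" "z \<tau> = fst p" "y \<tau> = f (fst p) (snd p)" by (auto simp: Th_def)
    then have "f (z \<tau>) (u \<tau>) = f (z \<tau>) (snd p)" "snd p \<in> U" using u[OF \<tau>] by (auto simp: W_def)
    moreover have "z \<tau> \<in> \<Omega>" using z(2) \<tau> by blast
    ultimately have "u \<tau> = snd p" using f_inj[of "z \<tau>"] u[OF \<tau>] by (auto dest: inj_onD)
    then have "p = (z \<tau>, u \<tau>)" using p by (simp add: prod_eq_iff)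
    then show "G (z \<tau>, u \<tau>) \<notin> S" using p(1) by (auto simp: W_def)
  next
    assume "G (z \<tau>, u \<tau>) \<notin> S"
    then have "(z \<tau>, u \<tau>) \<in> W" using u[OF \<tau>] \<tau> by (auto simp: W_def K_def)
    moreover have "Th (z \<tau>, u \<tau>) = (z \<tau>, y \<tau>)" using u[OF \<tau>] by (simp add: Th_def)
    ultimately have "(z \<tau>, y \<tau>) \<in> Th ` W" by (metis imageI)
    then show "\<tau> \<in> (\<lambda>\<tau>. (z \<tau>, y \<tau>)) -` (Th ` W)" by simp
  qed
  then have "(\<lambda>\<tau>. G (z \<tau>, u \<tau>)) -` S \<inter> space (lebesgue_on {s..t}) = {s..t} - ((\<lambda>\<tau>. (z \<tau>, y \<tau>)) -` (Th ` W) \<inter> {s..t})"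
    by (simp only: set_eq_iff vimage_eq Int_iff Diff_iff space_lebesgue_on) blast
  also have "\<dots> \<in> sets (lebesgue_on {s..t})"
    using sets.Diff[OF sets.top 1] by simp
  finally show "(\<lambda>\<tau>. G (z \<tau>, u \<tau>)) -` S \<inter> space (lebesgue_on {s..t}) \<in> sets (lebesgue_on {s..t})" .
qed

end

text \<open>\<open>Kst\<close> makes the Picard operator of linear equations with coefficients \<open>A\<close> a contraction.\<close>

locale finsler_trajectory = finsler_chart \<Omega> N U f
  for \<Omega> :: "'a::euclidean_space set" and N :: "'a \<Rightarrow> 'a \<Rightarrow> real"
    and U :: "'b::euclidean_space set" and f :: "'a \<Rightarrow> 'b \<Rightarrow> 'a" +
  fixes s t K :: real and z :: "real \<Rightarrow> 'a" and u :: "real \<Rightarrow> 'b" and N0 :: "real set"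
  assumes st: "s < t"
    and z_cont: "continuous_on {s..t} z" and z_in: "\<And>\<tau>. \<tau> \<in> {s..t} \<Longrightarrow> z \<tau> \<in> \<Omega>"
    and u_in: "\<And>\<tau>. \<tau> \<in> {s..t} \<Longrightarrow> u \<tau> \<in> U"
    and N0: "negligible N0"
    and z_deriv: "\<And>\<tau>. \<tau> \<in> {s<..<t} - N0 \<Longrightarrow> (z has_vector_derivative f (z \<tau>) (u \<tau>)) (at \<tau>)"
    and meas: "\<And>G :: 'a \<times> 'b \<Rightarrow> 'a. continuous_on (\<Omega> \<times> U) G \<Longrightarrow>
          (\<lambda>\<tau>. G (z \<tau>, u \<tau>)) \<in> borel_measurable (lebesgue_on {s..t})"
    and K0: "0 \<le> K" and K: "\<And>\<tau> w. \<tau> \<in> {s..t} \<Longrightarrow> norm (D (z \<tau>) (u \<tau>) w) \<le> K * norm w"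
    and Kst: "K * (t - s) \<le> 1 / 2"
begin

section \<open>The linearized equation, its adjoint and their duality\<close>

definition A :: "real \<Rightarrow> 'a \<Rightarrow> 'a" where "A \<tau> = D (z \<tau>) (u \<tau>)"
text \<open>The transpose of \<open>A \<tau>\<close>. Spelled out in the basis, its measurability in
  \<tau> follows from that of \<open>A \<tau> b\<close>.\<close>

definition At :: "real \<Rightarrow> 'a \<Rightarrow> 'a" where "At \<tau> p = (\<Sum>b\<in>Basis. (p \<bullet> A \<tau> b) *\<^sub>R b)"

lemma A_linear: "\<tau> \<in> {s..t} \<Longrightarrow> linear (A \<tau>)"
  unfolding A_def by (rule D_linear[OF z_in u_in])

lemma At_inner: "\<tau> \<in> {s..t} \<Longrightarrow> At \<tau> p \<bullet> w = p \<bullet> A \<tau> w"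
proof -
  assume \<tau>: "\<tau> \<in> {s..t}"
  have "p \<bullet> A \<tau> w = p \<bullet> A \<tau> (\<Sum>b\<in>Basis. (w \<bullet> b) *\<^sub>R b)" by (simp add: euclidean_representation)
  also have "\<dots> = (\<Sum>b\<in>Basis. (w \<bullet> b) * (p \<bullet> A \<tau> b))"
    by (simp add: linear_sum[OF A_linear[OF \<tau>]] linear_cmul[OF A_linear[OF \<tau>]] inner_sum_right)
  also have "\<dots> = At \<tau> p \<bullet> w" unfolding At_def by (simp add: inner_sum_left inner_sum_right mult.commute inner_commute)
  finally show ?thesis by simp
qed

lemma At_linear: "linear (At \<tau>)"
  unfolding At_def by (rule linearI) (simp_all add: inner_add_left scaleR_add_left sum.distrib scaleR_sum_right)

lemma A_meas: "(\<lambda>\<tau>. A \<tau> w) \<in> borel_measurable (lebesgue_on {s..t})"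
  using meas[OF Df_cont[of w]] by (simp add: A_def)

lemma f_meas: "(\<lambda>\<tau>. f (z \<tau>) (u \<tau>)) \<in> borel_measurable (lebesgue_on {s..t})"
  using meas[OF f_cont] by simp

lemma At_meas: "(\<lambda>\<tau>. At \<tau> w) \<in> borel_measurable (lebesgue_on {s..t})"
  unfolding At_def
  by (intro borel_measurable_sum borel_measurable_scaleR borel_measurable_inner A_meas borel_measurable_const)

lemma A_bound: "\<tau> \<in> {s..t} \<Longrightarrow> norm (A \<tau> w) \<le> K * norm w"
  unfolding A_def by (rule K)

lemma At_bound: "\<tau> \<in> {s..t} \<Longrightarrow> norm (At \<tau> p) \<le> K * norm p"
proof -
  assume \<tau>: "\<tau> \<in> {s..t}"
  have "norm (At \<tau> p) * norm (At \<tau> p) = p \<bullet> A \<tau> (At \<tau> p)"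
    using At_inner[OF \<tau>, of p "At \<tau> p"] by (simp add: power2_norm_eq_inner[symmetric] power2_eq_square)
  also have "\<dots> \<le> norm p * norm (A \<tau> (At \<tau> p))" by (rule norm_cauchy_schwarz)
  also have "\<dots> \<le> norm p * (K * norm (At \<tau> p))" by (intro mult_left_mono A_bound \<tau>) auto
  finally have "norm (At \<tau> p) * norm (At \<tau> p) \<le> (K * norm p) * norm (At \<tau> p)" by (simp add: mult_ac)
  then show ?thesis using K0 by (cases "norm (At \<tau> p) = 0") (auto simp: mult_le_cancel_right)
qed

lemma compact_image: "compact (z ` {s..t})" "z ` {s..t} \<subseteq> \<Omega>"
  using z_cont z_in by (auto intro: compact_continuous_image)

lemma f_bounded: obtains C where "\<And>\<tau>. \<tau> \<in> {s..t} \<Longrightarrow> norm (f (z \<tau>) (u \<tau>)) \<le> C"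
proof -
  have "compact ((\<lambda>(z, u). f z u) ` (z ` {s..t} \<times> U))"
    using compact_image(2)
    by (intro compact_continuous_image[OF continuous_on_subset[OF f_cont] compact_Times[OF compact_image(1) compact_U]]) auto
  from compact_imp_bounded[OF this]
  obtain C where C: "\<forall>x\<in>(\<lambda>(z, u). f z u) ` (z ` {s..t} \<times> U). norm x \<le> C" unfolding bounded_iff by blast
  show ?thesis
  proof (rule that)
    fix \<tau> assume "\<tau> \<in> {s..t}"
    then have "f (z \<tau>) (u \<tau>) \<in> (\<lambda>(z, u). f z u) ` (z ` {s..t} \<times> U)" using u_in by force
    then show "norm (f (z \<tau>) (u \<tau>)) \<le> C" using C by blast
  qed
qed

text \<open>The Lipschitz condition belongs to the notion of solution: an equation that holds only
  off a null set does not control the increments of a merely continuous function.\<close>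

definition variation_eq :: "(real \<Rightarrow> 'a) \<Rightarrow> (real \<Rightarrow> 'a) \<Rightarrow> real \<Rightarrow> bool" where
  "variation_eq v \<eta> \<mu> \<longleftrightarrow> (\<exists>L. L-lipschitz_on {s..t} v) \<and> (\<exists>N1. negligible N1 \<and>
     (\<forall>\<tau>\<in>{s<..<t} - N1. (v has_vector_derivative A \<tau> (v \<tau>) + (\<eta> \<tau> - \<mu> *\<^sub>R f (z \<tau>) (u \<tau>))) (at \<tau>)))"

lemma variation_eq_add:
  assumes "variation_eq v \<eta> \<mu>" "variation_eq w \<theta> \<nu>"
  shows "variation_eq (\<lambda>\<tau>. v \<tau> + w \<tau>) (\<lambda>\<tau>. \<eta> \<tau> + \<theta> \<tau>) (\<mu> + \<nu>)"
proof -
  obtain L N1 where 1: "L-lipschitz_on {s..t} v" "negligible N1"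
     "\<And>\<tau>. \<tau>\<in>{s<..<t} - N1 \<Longrightarrow> (v has_vector_derivative A \<tau> (v \<tau>) + (\<eta> \<tau> - \<mu> *\<^sub>R f (z \<tau>) (u \<tau>))) (at \<tau>)"
    using assms(1) unfolding variation_eq_def by blast
  obtain L' N2 where 2: "L'-lipschitz_on {s..t} w" "negligible N2"
     "\<And>\<tau>. \<tau>\<in>{s<..<t} - N2 \<Longrightarrow> (w has_vector_derivative A \<tau> (w \<tau>) + (\<theta> \<tau> - \<nu> *\<^sub>R f (z \<tau>) (u \<tau>))) (at \<tau>)"
    using assms(2) unfolding variation_eq_def by blast
  have "((\<lambda>\<tau>. v \<tau> + w \<tau>) has_vector_derivative A \<tau> (v \<tau> + w \<tau>) + (\<eta> \<tau> + \<theta> \<tau> - (\<mu> + \<nu>) *\<^sub>R f (z \<tau>) (u \<tau>))) (at \<tau>)"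
    if "\<tau> \<in> {s<..<t} - (N1 \<union> N2)" for \<tau>
  proof -
    have "((\<lambda>\<tau>. v \<tau> + w \<tau>) has_vector_derivative (A \<tau> (v \<tau>) + (\<eta> \<tau> - \<mu> *\<^sub>R f (z \<tau>) (u \<tau>))) + (A \<tau> (w \<tau>) + (\<theta> \<tau> - \<nu> *\<^sub>R f (z \<tau>) (u \<tau>)))) (at \<tau>)"
      using that by (intro has_vector_derivative_add 1 2) auto
    moreover have "linear (A \<tau>)" using that by (intro A_linear) auto
    ultimately show ?thesis by (simp add: linear_add algebra_simps)
  qed
  then show ?thesis
    unfolding variation_eq_def using lipschitz_on_add[OF 1(1) 2(1)] negligible_Un[OF 1(2) 2(2)] by blast
qed

lemma variation_eq_scale:
  assumes "variation_eq v \<eta> \<mu>"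
  shows "variation_eq (\<lambda>\<tau>. r *\<^sub>R v \<tau>) (\<lambda>\<tau>. r *\<^sub>R \<eta> \<tau>) (r * \<mu>)"
proof -
  obtain L N1 where 1: "L-lipschitz_on {s..t} v" "negligible N1"
     "\<And>\<tau>. \<tau>\<in>{s<..<t} - N1 \<Longrightarrow> (v has_vector_derivative A \<tau> (v \<tau>) + (\<eta> \<tau> - \<mu> *\<^sub>R f (z \<tau>) (u \<tau>))) (at \<tau>)"
    using assms(1) unfolding variation_eq_def by blast
  have "((\<lambda>\<tau>. r *\<^sub>R v \<tau>) has_vector_derivative A \<tau> (r *\<^sub>R v \<tau>) + (r *\<^sub>R \<eta> \<tau> - (r * \<mu>) *\<^sub>R f (z \<tau>) (u \<tau>))) (at \<tau>)"
    if "\<tau> \<in> {s<..<t} - N1" for \<tau>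
  proof -
    have "((\<lambda>\<tau>. r *\<^sub>R v \<tau>) has_vector_derivative r *\<^sub>R (A \<tau> (v \<tau>) + (\<eta> \<tau> - \<mu> *\<^sub>R f (z \<tau>) (u \<tau>)))) (at \<tau>)"
      using bounded_linear.has_vector_derivative[OF bounded_linear_scaleR_right 1(3)[OF that]] .
    moreover have "linear (A \<tau>)" using that by (intro A_linear) auto
    ultimately show ?thesis by (simp add: linear_cmul algebra_simps)
  qed
  then show ?thesis
    unfolding variation_eq_def using lipschitz_on_cmult[OF 1(1), of r] 1(2) by blast
qed

lemma variation_eq_exists:
  assumes \<eta>: "continuous_on {s..t} \<eta>"
  obtains v where "v s = v0" "variation_eq v \<eta> \<mu>"
proof -
  obtain C where C: "\<And>\<tau>. \<tau> \<in> {s..t} \<Longrightarrow> norm (f (z \<tau>) (u \<tau>)) \<le> C" by (rule f_bounded) (rule that)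
  obtain E where E: "\<And>\<tau>. \<tau> \<in> {s..t} \<Longrightarrow> norm (\<eta> \<tau>) \<le> E" by (rule continuous_on_Icc_bounded[OF \<eta>]) (rule that)
  have hm: "(\<lambda>\<tau>. \<eta> \<tau> - \<mu> *\<^sub>R f (z \<tau>) (u \<tau>)) \<in> borel_measurable (lebesgue_on {s..t})"
    by (intro borel_measurable_diff borel_measurable_scaleR borel_measurable_const f_meas measurable_continuous_lebesgue_on \<eta>)
  have hb: "norm (\<eta> \<tau> - \<mu> *\<^sub>R f (z \<tau>) (u \<tau>)) \<le> E + \<bar>\<mu>\<bar> * C" if "\<tau> \<in> {s..t}" for \<tau>
    using norm_triangle_ineq4[of "\<eta> \<tau>" "\<mu> *\<^sub>R f (z \<tau>) (u \<tau>)"] E[OF that] mult_left_mono[OF C[OF that], of "\<bar>\<mu>\<bar>"] by simp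
  have stle: "s \<le> t" and s: "s \<in> {s..t}" using st by auto
  obtain v L N1 where "v s = v0" "L-lipschitz_on {s..t} v" "negligible N1"
    "\<And>\<tau>. \<tau> \<in> {s<..<t} - N1 \<Longrightarrow> (v has_vector_derivative A \<tau> (v \<tau>) + (\<eta> \<tau> - \<mu> *\<^sub>R f (z \<tau>) (u \<tau>))) (at \<tau>)"
    by (rule linear_ode[OF stle A_linear A_bound A_meas hm hb K0 Kst s, where ?w0.0 = v0]) (assumption | rule that)+
  then show ?thesis by (intro that[of v]) (auto simp: variation_eq_def)
qed

definition adjoint_eq :: "(real \<Rightarrow> 'a) \<Rightarrow> bool" where
  "adjoint_eq p \<longleftrightarrow> (\<exists>L. L-lipschitz_on {s..t} p) \<and> (\<exists>N1. negligible N1 \<and>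
     (\<forall>\<tau>\<in>{s<..<t} - N1. (p has_vector_derivative - At \<tau> (p \<tau>)) (at \<tau>)))"

lemma adjoint_eq_exists:
  obtains p where "p t = p0" "adjoint_eq p" "p0 \<noteq> 0 \<longrightarrow> (\<forall>\<tau>\<in>{s..t}. p \<tau> \<noteq> 0)"
proof -
  have stle: "s \<le> t" and t: "t \<in> {s..t}" using st by auto
  have l: "linear (\<lambda>p. - At \<tau> p)" for \<tau> using linear_compose_neg[OF At_linear] .
  have b: "norm (- At \<tau> p) \<le> K * norm p" if "\<tau> \<in> {s..t}" for \<tau> p using At_bound[OF that] by simp
  have m: "(\<lambda>\<tau>. - At \<tau> p) \<in> borel_measurable (lebesgue_on {s..t})" for p
    by (intro borel_measurable_uminus At_meas)
  have h: "(\<lambda>\<tau>. 0) \<in> borel_measurable (lebesgue_on {s..t})" "\<And>\<tau>. \<tau> \<in> {s..t} \<Longrightarrow> norm (0::'a) \<le> 0" by auto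
  obtain p L N1 where "p t = p0" "L-lipschitz_on {s..t} p" "negligible N1"
    and d: "\<And>\<tau>. \<tau> \<in> {s<..<t} - N1 \<Longrightarrow> (p has_vector_derivative - At \<tau> (p \<tau>) + 0) (at \<tau>)"
    and nz: "(\<forall>\<tau>\<in>{s..t}. (0::'a) = 0) \<longrightarrow> p0 \<noteq> 0 \<longrightarrow> (\<forall>\<tau>\<in>{s..t}. p \<tau> \<noteq> 0)"
    by (rule linear_ode[OF stle l b m h K0 Kst t, where ?w0.0 = p0]) (assumption | rule that)+
  then show ?thesis by (intro that[of p]) (auto simp: adjoint_eq_def)
qed

lemma inner_f_measurable:
  assumes "continuous_on {s..t} p"
  shows "(\<lambda>\<tau>. p \<tau> \<bullet> f (z \<tau>) (u \<tau>)) \<in> borel_measurable (lebesgue_on {s..t})"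
  by (intro borel_measurable_inner f_meas measurable_continuous_lebesgue_on assms)

lemma inner_f_bounded:
  assumes "continuous_on {s..t} p"
  obtains C where "\<And>\<tau>. \<tau> \<in> {s..t} \<Longrightarrow> norm (p \<tau> \<bullet> f (z \<tau>) (u \<tau>)) \<le> C"
proof -
  obtain C where C: "\<And>\<tau>. \<tau> \<in> {s..t} \<Longrightarrow> norm (f (z \<tau>) (u \<tau>)) \<le> C" by (rule f_bounded) (rule that)
  obtain P where P: "\<And>\<tau>. \<tau> \<in> {s..t} \<Longrightarrow> norm (p \<tau>) \<le> P" by (rule continuous_on_Icc_bounded[OF assms]) (rule that)
  show ?thesis
  proof (rule that)
    fix \<tau> assume \<tau>: "\<tau> \<in> {s..t}"
    have "norm (p \<tau> \<bullet> f (z \<tau>) (u \<tau>)) \<le> norm (p \<tau>) * norm (f (z \<tau>) (u \<tau>))" by (simp add: Cauchy_Schwarz_ineq2)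
    also have "\<dots> \<le> P * C" using P[OF \<tau>] C[OF \<tau>] norm_ge_zero order_trans by (intro mult_mono) blast+
    finally show "norm (p \<tau> \<bullet> f (z \<tau>) (u \<tau>)) \<le> P * C" .
  qed
qed

lemma inner_f_integrable:
  assumes "continuous_on {s..t} p"
  shows "(\<lambda>\<tau>. p \<tau> \<bullet> f (z \<tau>) (u \<tau>)) integrable_on {s..t}"
proof -
  obtain C where "\<And>\<tau>. \<tau> \<in> {s..t} \<Longrightarrow> norm (p \<tau> \<bullet> f (z \<tau>) (u \<tau>)) \<le> C" by (rule inner_f_bounded[OF assms]) (rule that)
  then show ?thesis by (rule bounded_measurable_imp_integrable_on[OF inner_f_measurable[OF assms]])
qed

lemma lipschitz_on_inner:
  fixes p v :: "real \<Rightarrow> 'a"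
  assumes "L-lipschitz_on {s..t} p" "L'-lipschitz_on {s..t} v"
  obtains C where "C-lipschitz_on {s..t} (\<lambda>\<tau>. p \<tau> \<bullet> v \<tau>)"
proof -
  obtain P where P: "\<And>\<tau>. \<tau> \<in> {s..t} \<Longrightarrow> norm (p \<tau>) \<le> P"
    by (rule continuous_on_Icc_bounded[OF lipschitz_on_continuous_on[OF assms(1)]]) (rule that)
  obtain V where V: "\<And>\<tau>. \<tau> \<in> {s..t} \<Longrightarrow> norm (v \<tau>) \<le> V"
    by (rule continuous_on_Icc_bounded[OF lipschitz_on_continuous_on[OF assms(2)]]) (rule that)
  have L: "0 \<le> L" "0 \<le> L'" using assms lipschitz_on_nonneg by auto
  show ?thesis
  proof (rule that[OF lipschitz_onI])
    have s: "s \<in> {s..t}" using st by simp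
    show "0 \<le> P * L' + L * V" using L order_trans[OF norm_ge_zero P[OF s]] order_trans[OF norm_ge_zero V[OF s]] by simp
    fix x y assume xy: "x \<in> {s..t}" "y \<in> {s..t}"
    have "p x \<bullet> v x - p y \<bullet> v y = p x \<bullet> (v x - v y) + (p x - p y) \<bullet> v y" by (simp add: algebra_simps)
    then have "\<bar>p x \<bullet> v x - p y \<bullet> v y\<bar> \<le> \<bar>p x \<bullet> (v x - v y)\<bar> + \<bar>(p x - p y) \<bullet> v y\<bar>" by simp
    also have "\<dots> \<le> norm (p x) * norm (v x - v y) + norm (p x - p y) * norm (v y)"
      by (intro add_mono Cauchy_Schwarz_ineq2)
    also have "\<dots> \<le> P * (L' * dist x y) + (L * dist x y) * V"
    proof (intro add_mono mult_mono)
      show "norm (v x - v y) \<le> L' * dist x y" using lipschitz_onD[OF assms(2) xy] by (simp add: dist_norm)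
      show "norm (p x - p y) \<le> L * dist x y" using lipschitz_onD[OF assms(1) xy] by (simp add: dist_norm)
      show "0 \<le> P" using P[OF s] norm_ge_zero order_trans by blast
      show "0 \<le> L * dist x y" using L by simp
    qed (use P V xy in auto)
    finally show "dist (p x \<bullet> v x) (p y \<bullet> v y) \<le> (P * L' + L * V) * dist x y"
      by (simp add: dist_real_def algebra_simps)
  qed
qed

text \<open>In the derivative of \<open>p \<bullet> v\<close> the terms with \<open>A\<close> and
  \<open>At\<close> cancel, and \<open>p \<bullet> (\<eta> - \<mu> z')\<close> remains. After
  subtraction of the integral \<open>G\<close> of this expression, a Lipschitz function with
  derivative 0 off a null set is left.\<close>

lemma duality:
  assumes p: "adjoint_eq p" and v: "variation_eq v \<eta> \<mu>" and \<eta>: "continuous_on {s..t} \<eta>"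
  shows "p t \<bullet> v t - p s \<bullet> v s = integral {s..t} (\<lambda>\<tau>. p \<tau> \<bullet> \<eta> \<tau>) - \<mu> * integral {s..t} (\<lambda>\<tau>. p \<tau> \<bullet> f (z \<tau>) (u \<tau>))"
proof -
  obtain L N1 where 1: "L-lipschitz_on {s..t} v" "negligible N1"
     "\<And>\<tau>. \<tau>\<in>{s<..<t} - N1 \<Longrightarrow> (v has_vector_derivative A \<tau> (v \<tau>) + (\<eta> \<tau> - \<mu> *\<^sub>R f (z \<tau>) (u \<tau>))) (at \<tau>)"
    using v unfolding variation_eq_def by blast
  obtain L' N2 where 2: "L'-lipschitz_on {s..t} p" "negligible N2"
     "\<And>\<tau>. \<tau>\<in>{s<..<t} - N2 \<Longrightarrow> (p has_vector_derivative - At \<tau> (p \<tau>)) (at \<tau>)"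
    using p unfolding adjoint_eq_def by blast
  have pc: "continuous_on {s..t} p" by (rule lipschitz_on_continuous_on[OF 2(1)])
  define g where "g \<tau> = p \<tau> \<bullet> \<eta> \<tau> - \<mu> * (p \<tau> \<bullet> f (z \<tau>) (u \<tau>))" for \<tau>
  have i1: "(\<lambda>\<tau>. p \<tau> \<bullet> \<eta> \<tau>) integrable_on {s..t}"
    by (intro integrable_continuous_real continuous_on_inner pc \<eta>)
  have i2: "(\<lambda>\<tau>. \<mu> * (p \<tau> \<bullet> f (z \<tau>) (u \<tau>))) integrable_on {s..t}"
    by (intro integrable_on_mult_right inner_f_integrable pc)
  have gi: "g integrable_on {s..t}" unfolding g_def by (rule integrable_diff[OF i1 i2])
  obtain C where C: "\<And>\<tau>. \<tau> \<in> {s..t} \<Longrightarrow> norm (p \<tau> \<bullet> f (z \<tau>) (u \<tau>)) \<le> C" by (rule inner_f_bounded[OF pc]) (rule that)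
  obtain E where E: "\<And>\<tau>. \<tau> \<in> {s..t} \<Longrightarrow> norm (p \<tau> \<bullet> \<eta> \<tau>) \<le> E"
    by (rule continuous_on_Icc_bounded[OF continuous_on_inner[OF pc \<eta>]]) (rule that)
  have gm: "g \<in> borel_measurable (lebesgue_on {s..t})"
    unfolding g_def
    by (intro borel_measurable_diff borel_measurable_times borel_measurable_const inner_f_measurable pc
        measurable_continuous_lebesgue_on continuous_on_inner \<eta>)
  have gb: "norm (g \<tau>) \<le> E + \<bar>\<mu>\<bar> * C" if "\<tau> \<in> {s..t}" for \<tau>
    unfolding g_def
    using norm_triangle_ineq4[of "p \<tau> \<bullet> \<eta> \<tau>" "\<mu> * (p \<tau> \<bullet> f (z \<tau>) (u \<tau>))"] E[OF that]
      mult_left_mono[OF C[OF that], of "\<bar>\<mu>\<bar>"] by (simp add: abs_mult)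
  define G where "G \<tau> = integral {s..\<tau>} g" for \<tau>
  define N3 where "N3 = {\<tau> \<in> {s<..<t}. \<not> (G has_real_derivative g \<tau>) (at \<tau>)}"
  have N3: "negligible N3" unfolding N3_def G_def by (rule integral_has_real_derivative_ae[OF gm gb[unfolded real_norm_def]])
  define h where "h \<tau> = p \<tau> \<bullet> v \<tau> - G \<tau>" for \<tau>
  have "h s = h t"
  proof (rule abs_continuous_on_zero_derivative_const[where h = h and a = s and b = t])
    obtain M where M: "M-lipschitz_on {s..t} (\<lambda>\<tau>. p \<tau> \<bullet> v \<tau>)" by (rule lipschitz_on_inner[OF 2(1) 1(1)]) (rule that)
    define C' where "C' = E + \<bar>\<mu>\<bar> * C"
    have "C'-lipschitz_on {s..t} G"
    proof (rule lipschitz_onI)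
      show C': "0 \<le> C'" using gb[of s] st norm_ge_zero[of "g s"] by (simp add: C'_def)
      have *: "norm (G y - G x) \<le> C' * (y - x)" if "x \<in> {s..t}" "y \<in> {s..t}" "x \<le> y" for x y
      proof -
        have comb: "integral {s..x} g + integral {x..y} g = integral {s..y} g"
          using that by (intro Henstock_Kurzweil_Integration.integral_combine integrable_on_subinterval[OF gi]) auto
        have "norm (integral {x..y} g) \<le> C' * (y - x)"
          using that C' gb by (intro norm_integral_Icc_le integrable_on_subinterval[OF gi]) (auto simp: C'_def)
        then show ?thesis by (simp add: G_def comb[symmetric])
      qed
      fix x y assume xy: "x \<in> {s..t}" "y \<in> {s..t}"
      show "dist (G x) (G y) \<le> C' * dist x y"
        using *[OF xy] *[OF xy(2,1)] by (cases "x \<le> y") (auto simp: dist_real_def abs_minus_commute)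
    qed
    from lipschitz_on_diff[OF M this] show "abs_continuous_on {s..t} h"
      unfolding h_def by (rule lipschitz_imp_abs_continuous_on)
    show "negligible (N1 \<union> N2 \<union> N3)" using 1 2 N3 by (intro negligible_Un)
    show "s \<le> t" using st by simp
    fix \<tau> assume \<tau>: "\<tau> \<in> {s<..<t} - (N1 \<union> N2 \<union> N3)"
    then have \<tau>': "\<tau> \<in> {s..t}" by auto
    have "((\<lambda>\<tau>. p \<tau> \<bullet> v \<tau>) has_vector_derivative p \<tau> \<bullet> (A \<tau> (v \<tau>) + (\<eta> \<tau> - \<mu> *\<^sub>R f (z \<tau>) (u \<tau>))) + - At \<tau> (p \<tau>) \<bullet> v \<tau>) (at \<tau>)"
      using \<tau> by (intro bounded_bilinear.has_vector_derivative[OF bounded_bilinear_inner] 1(3) 2(3)) auto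
    moreover have "p \<tau> \<bullet> (A \<tau> (v \<tau>) + (\<eta> \<tau> - \<mu> *\<^sub>R f (z \<tau>) (u \<tau>))) + - At \<tau> (p \<tau>) \<bullet> v \<tau> = g \<tau>"
      using At_inner[OF \<tau>', of "p \<tau>" "v \<tau>"] by (simp add: g_def inner_add_right inner_diff_right)
    ultimately have "((\<lambda>\<tau>. p \<tau> \<bullet> v \<tau>) has_real_derivative g \<tau>) (at \<tau>)"
      by (simp add: has_real_derivative_iff_has_vector_derivative)
    moreover have "(G has_real_derivative g \<tau>) (at \<tau>)" using \<tau> by (auto simp: N3_def)
    ultimately have "((\<lambda>\<tau>. p \<tau> \<bullet> v \<tau> - G \<tau>) has_real_derivative g \<tau> - g \<tau>) (at \<tau>)" by (rule DERIV_diff)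
    then show "(h has_real_derivative 0) (at \<tau>)" by (simp add: h_def[abs_def])
  qed
  then have "p t \<bullet> v t - p s \<bullet> v s = G t" by (simp add: h_def G_def)
  also have "\<dots> = integral {s..t} (\<lambda>\<tau>. p \<tau> \<bullet> \<eta> \<tau>) - \<mu> * integral {s..t} (\<lambda>\<tau>. p \<tau> \<bullet> f (z \<tau>) (u \<tau>))"
    using Henstock_Kurzweil_Integration.integral_diff[OF i1 i2] by (simp add: G_def g_def[abs_def])
  finally show ?thesis .
qed

lemma N_inner_continuous:
  assumes "continuous_on {s..t} \<eta>"
  shows "continuous_on {s..t} (\<lambda>\<tau>. N (z \<tau>) (\<eta> \<tau>))"
proof -
  have "continuous_on {s..t} (\<lambda>\<tau>. (\<lambda>(z, y). N z y) (z \<tau>, \<eta> \<tau>))"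
    using z_in by (intro continuous_on_compose2[OF N_cont] continuous_intros z_cont assms) auto
  then show ?thesis by simp
qed

text \<open>The necessary condition, integrated against all continuous \<open>\<eta>\<close>, gives the pointwise
  maximum principle: test with a bump times a constant vector, and with \<open>\<eta> = 0\<close>.\<close>

lemma maximum_principle:
  assumes p: "continuous_on {s..t} p"
    and var: "\<And>\<eta> \<mu>. continuous_on {s..t} \<eta> \<Longrightarrow> 0 \<le> \<mu> \<Longrightarrow>
       integral {s..t} (\<lambda>\<tau>. p \<tau> \<bullet> \<eta> \<tau>) - \<mu> * integral {s..t} (\<lambda>\<tau>. p \<tau> \<bullet> f (z \<tau>) (u \<tau>))
       \<le> q * (integral {s..t} (\<lambda>\<tau>. N (z \<tau>) (\<eta> \<tau>)) - \<mu> * (t - s))"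
  shows "\<And>\<tau> w. \<tau> \<in> {s..t} \<Longrightarrow> p \<tau> \<bullet> w \<le> q * N (z \<tau>) w"
    and "negligible {\<tau> \<in> {s..t}. p \<tau> \<bullet> f (z \<tau>) (u \<tau>) \<noteq> q}"
proof -
  show max: "p \<tau> \<bullet> w \<le> q * N (z \<tau>) w" if \<tau>: "\<tau> \<in> {s..t}" for \<tau> w
  proof -
    \<comment> \<open>The multiplier is the positive part of the violation itself. Since it is
      nonnegative, homogeneity of \<open>N\<close> turns the tested integrand into \<theta> times
      \<theta>, and the condition says that its integral is at most 0.\<close>
    define \<theta> where "\<theta> \<tau> = max 0 (p \<tau> \<bullet> w - q * N (z \<tau>) w)" for \<tau>
    have \<theta>: "continuous_on {s..t} \<theta>"
      unfolding \<theta>_def by (intro continuous_intros p N_inner_continuous)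
    have \<theta>0: "0 \<le> \<theta> \<tau>" for \<tau> by (simp add: \<theta>_def)
    have \<eta>: "continuous_on {s..t} (\<lambda>\<tau>. \<theta> \<tau> *\<^sub>R w)" by (intro continuous_intros \<theta>)
    have c1: "continuous_on {s..t} (\<lambda>\<tau>. p \<tau> \<bullet> (\<theta> \<tau> *\<^sub>R w))" by (intro continuous_intros p \<theta>)
    have c2: "continuous_on {s..t} (\<lambda>\<tau>. q * N (z \<tau>) (\<theta> \<tau> *\<^sub>R w))" by (intro continuous_intros N_inner_continuous \<theta>)
    have "integral {s..t} (\<lambda>\<tau>. \<theta> \<tau> * \<theta> \<tau>) = integral {s..t} (\<lambda>\<tau>. p \<tau> \<bullet> (\<theta> \<tau> *\<^sub>R w) - q * N (z \<tau>) (\<theta> \<tau> *\<^sub>R w))"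
    proof (rule integral_cong)
      fix \<tau> assume "\<tau> \<in> {s..t}"
      then have "p \<tau> \<bullet> (\<theta> \<tau> *\<^sub>R w) - q * N (z \<tau>) (\<theta> \<tau> *\<^sub>R w) = \<theta> \<tau> * (p \<tau> \<bullet> w - q * N (z \<tau>) w)"
        using N_scale0[OF z_in \<theta>0] by (simp add: algebra_simps)
      also have "\<dots> = \<theta> \<tau> * \<theta> \<tau>" by (simp add: \<theta>_def max_def)
      finally show "\<theta> \<tau> * \<theta> \<tau> = p \<tau> \<bullet> (\<theta> \<tau> *\<^sub>R w) - q * N (z \<tau>) (\<theta> \<tau> *\<^sub>R w)" by simp
    qed
    also have "\<dots> = integral {s..t} (\<lambda>\<tau>. p \<tau> \<bullet> (\<theta> \<tau> *\<^sub>R w)) - integral {s..t} (\<lambda>\<tau>. q * N (z \<tau>) (\<theta> \<tau> *\<^sub>R w))"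
      by (intro Henstock_Kurzweil_Integration.integral_diff integrable_continuous_real c1 c2)
    also have "\<dots> \<le> 0" using var[OF \<eta>, of 0] by simp
    finally have "integral {s..t} (\<lambda>\<tau>. \<theta> \<tau> * \<theta> \<tau>) \<le> 0" .
    moreover have "0 \<le> integral {s..t} (\<lambda>\<tau>. \<theta> \<tau> * \<theta> \<tau>)"
      using \<theta>0 by (intro integral_nonneg integrable_continuous_real continuous_intros \<theta>) auto
    ultimately have "integral {s..t} (\<lambda>\<tau>. \<theta> \<tau> * \<theta> \<tau>) = 0" by simp
    moreover have "continuous_on {s..t} (\<lambda>\<tau>. \<theta> \<tau> * \<theta> \<tau>)" by (intro continuous_intros \<theta>)
    ultimately have "\<forall>\<tau>\<in>{s..t}. \<theta> \<tau> * \<theta> \<tau> = 0"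
      using integral_eq_0_iff[of s t "\<lambda>\<tau>. \<theta> \<tau> * \<theta> \<tau>"] st by simp
    then have "\<theta> \<tau> = 0" using \<tau> by simp
    then show ?thesis by (simp add: \<theta>_def max_def split: if_splits)
  qed
  define g where "g \<tau> = q - p \<tau> \<bullet> f (z \<tau>) (u \<tau>)" for \<tau>
  have g0: "0 \<le> g \<tau>" if "\<tau> \<in> {s..t}" for \<tau>
    using max[OF that, of "f (z \<tau>) (u \<tau>)"] f_unit[OF z_in[OF that] u_in[OF that]] by (simp add: g_def)
  obtain C where C: "\<And>\<tau>. \<tau> \<in> {s..t} \<Longrightarrow> norm (p \<tau> \<bullet> f (z \<tau>) (u \<tau>)) \<le> C" by (rule inner_f_bounded[OF p]) (rule that)
  have gm: "g \<in> borel_measurable (lebesgue_on {s..t})"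
    unfolding g_def by (intro borel_measurable_diff borel_measurable_const inner_f_measurable p)
  have gb: "\<bar>g \<tau>\<bar> \<le> \<bar>q\<bar> + C" if "\<tau> \<in> {s..t}" for \<tau>
    using C[OF that] by (simp add: g_def)
  have gi: "g integrable_on {s..t}" by (rule bounded_measurable_imp_integrable_on[OF gm]) (use gb in simp)
  have "integral {s..t} g = integral {s..t} (\<lambda>\<tau>. q) - integral {s..t} (\<lambda>\<tau>. p \<tau> \<bullet> f (z \<tau>) (u \<tau>))"
    unfolding g_def by (intro Henstock_Kurzweil_Integration.integral_diff inner_f_integrable p) auto
  also have "\<dots> \<le> 0"
  proof -
    have "integral {s..t} (\<lambda>\<tau>. N (z \<tau>) 0) = integral {s..t} (\<lambda>\<tau>. 0)"
      by (rule integral_cong) (simp add: N_zero z_in)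
    then have "- integral {s..t} (\<lambda>\<tau>. p \<tau> \<bullet> f (z \<tau>) (u \<tau>)) \<le> - (q * (t - s))"
      using var[of "\<lambda>_. 0" 1] by (simp add: right_diff_distrib)
    then show ?thesis using st by (simp add: algebra_simps)
  qed
  finally have le: "integral {s..t} g \<le> 0" .
  \<comment> \<open>\<open>g\<close> is nonnegative with integral at most 0, so all its indefinite
    integrals vanish; their derivative is \<open>g\<close> almost everywhere, whence
    \<open>g = 0\<close> almost everywhere.\<close>
  have zero: "integral {s..\<tau>} g = 0" if \<tau>: "\<tau> \<in> {s..t}" for \<tau>
  proof -
    have i1: "g integrable_on {s..\<tau>}" and i2: "g integrable_on {\<tau>..t}"
      using \<tau> by (auto intro: integrable_on_subinterval[OF gi])
    have "0 \<le> integral {s..\<tau>} g" "0 \<le> integral {\<tau>..t} g"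
      using g0 \<tau> by (auto intro!: integral_nonneg i1 i2)
    moreover have "integral {s..\<tau>} g + integral {\<tau>..t} g = integral {s..t} g"
      using \<tau> by (intro Henstock_Kurzweil_Integration.integral_combine gi) auto
    ultimately show ?thesis using le by simp
  qed
  have "{\<tau> \<in> {s..t}. p \<tau> \<bullet> f (z \<tau>) (u \<tau>) \<noteq> q} \<subseteq>
     {\<tau> \<in> {s<..<t}. \<not> ((\<lambda>\<tau>. integral {s..\<tau>} g) has_real_derivative g \<tau>) (at \<tau>)} \<union> {s, t}"
  proof
    fix \<tau> assume \<tau>: "\<tau> \<in> {\<tau> \<in> {s..t}. p \<tau> \<bullet> f (z \<tau>) (u \<tau>) \<noteq> q}"
    show "\<tau> \<in> {\<tau> \<in> {s<..<t}. \<not> ((\<lambda>\<tau>. integral {s..\<tau>} g) has_real_derivative g \<tau>) (at \<tau>)} \<union> {s, t}"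
    proof (rule ccontr)
      assume n: "\<not> ?thesis"
      then have \<tau>': "\<tau> \<in> {s<..<t}" and d: "((\<lambda>\<tau>. integral {s..\<tau>} g) has_real_derivative g \<tau>) (at \<tau>)"
        using \<tau> by auto
      have "((\<lambda>\<tau>. 0) has_real_derivative g \<tau>) (at \<tau>)"
        by (rule has_field_derivative_transform_within_open[OF d, of "{s<..<t}"]) (use \<tau>' zero in auto)
      then have "g \<tau> = 0" using DERIV_const DERIV_unique by blast
      then show False using \<tau> by (simp add: g_def)
    qed
  qed
  moreover have "negligible ({\<tau> \<in> {s<..<t}. \<not> ((\<lambda>\<tau>. integral {s..\<tau>} g) has_real_derivative g \<tau>) (at \<tau>)} \<union> {s, t})"
    by (intro negligible_Un integral_has_real_derivative_ae[OF gm gb]) auto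
  ultimately show "negligible {\<tau> \<in> {s..t}. p \<tau> \<bullet> f (z \<tau>) (u \<tau>) \<noteq> q}"
    using negligible_subset by blast
qed

text \<open>The corrections \<open>e0\<close> and \<open>e1\<close> are interpolated affinely. They
  absorb the higher order difference between the displacements \<epsilon> \<open>v s\<close>,
  \<epsilon> \<open>v t\<close> and the end points that are actually prescribed.\<close>

definition perturb :: "(real \<Rightarrow> 'a) \<Rightarrow> real \<Rightarrow> 'a \<Rightarrow> 'a \<Rightarrow> real \<Rightarrow> 'a" where
  "perturb v \<epsilon> e0 e1 \<tau> = z \<tau> + (\<epsilon> *\<^sub>R v \<tau> + (((t - \<tau>) / (t - s)) *\<^sub>R e0 + ((\<tau> - s) / (t - s)) *\<^sub>R e1))"

lemma perturb_ends: "perturb v \<epsilon> e0 e1 s = z s + \<epsilon> *\<^sub>R v s + e0" "perturb v \<epsilon> e0 e1 t = z t + \<epsilon> *\<^sub>R v t + e1"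
  using st by (simp_all add: perturb_def)

lemma correction_bound:
  assumes "\<tau> \<in> {s..t}" "norm e0 \<le> c" "norm e1 \<le> c"
  shows "norm (((t - \<tau>) / (t - s)) *\<^sub>R e0 + ((\<tau> - s) / (t - s)) *\<^sub>R e1) \<le> c"
proof -
  have "norm (((t - \<tau>) / (t - s)) *\<^sub>R e0 + ((\<tau> - s) / (t - s)) *\<^sub>R e1)
    \<le> (t - \<tau>) / (t - s) * norm e0 + (\<tau> - s) / (t - s) * norm e1"
    using assms(1) st by (intro order_trans[OF norm_triangle_ineq]) simp
  also have "\<dots> \<le> (t - \<tau>) / (t - s) * c + (\<tau> - s) / (t - s) * c"
    using assms st by (intro add_mono mult_left_mono) auto
  also have "\<dots> = ((t - \<tau>) / (t - s) + (\<tau> - s) / (t - s)) * c" by (simp add: distrib_right)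
  also have "(t - \<tau>) / (t - s) + (\<tau> - s) / (t - s) = 1" using st by (simp add: add_divide_distrib[symmetric])
  finally show ?thesis by simp
qed

lemma correction_derivative:
  "((\<lambda>\<tau>. ((t - \<tau>) / (t - s)) *\<^sub>R e0 + ((\<tau> - s) / (t - s)) *\<^sub>R e1) has_vector_derivative (e1 - e0) /\<^sub>R (t - s)) (at \<tau>)"
proof -
  have "((\<lambda>\<tau>. ((t - \<tau>) / (t - s)) *\<^sub>R e0 + ((\<tau> - s) / (t - s)) *\<^sub>R e1) has_vector_derivative
     (((0 - 1) / (t - s)) *\<^sub>R e0 + ((1 - 0) / (t - s)) *\<^sub>R e1)) (at \<tau>)"
    by (intro has_vector_derivative_add bounded_linear.has_vector_derivative[OF bounded_linear_scaleR_left]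
       bounded_linear.has_vector_derivative[OF bounded_linear_divide] has_vector_derivative_diff
       has_vector_derivative_const has_vector_derivative_id)
  then show ?thesis by (simp add: divide_inverse scaleR_diff_right)
qed

text \<open>The velocity of the perturbed curve \<open>y\<close> is
  \<open>(1 - \<epsilon> \<mu>) f y u + \<epsilon> \<eta> + R\<close> with \<open>R\<close> of size
  o(\<epsilon>). Its leading vector is taken at \<open>y\<close>, not at \<open>z\<close>, where it
  has norm exactly 1; the small terms are added by the triangle inequality. Thus \<open>N\<close> is
  compared at different points only on the term that already carries the factor \<epsilon>.\<close>

lemma first_order_estimate:
  assumes v: "variation_eq v \<eta> \<mu>" and \<eta>: "continuous_on {s..t} \<eta>" and \<mu>: "0 \<le> \<mu>" and \<delta>: "\<delta> > 0"
  obtains \<epsilon>0 \<rho> N1 where "\<epsilon>0 > 0" "\<rho> > 0" "negligible N1"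
    "\<And>\<epsilon> e0 e1 \<tau>. 0 < \<epsilon> \<Longrightarrow> \<epsilon> < \<epsilon>0 \<Longrightarrow> norm e0 \<le> \<rho> * \<epsilon> \<Longrightarrow> norm e1 \<le> \<rho> * \<epsilon> \<Longrightarrow> \<tau> \<in> {s..t} \<Longrightarrow>
        perturb v \<epsilon> e0 e1 \<tau> \<in> \<Omega> \<and>
        (\<tau> \<in> {s<..<t} - N1 \<longrightarrow> (\<exists>w. (perturb v \<epsilon> e0 e1 has_vector_derivative w) (at \<tau>) \<and>
           N (perturb v \<epsilon> e0 e1 \<tau>) w \<le> 1 + \<epsilon> * (N (z \<tau>) (\<eta> \<tau>) - \<mu> + \<delta>)))"
proof -
  obtain L N2 where v1: "L-lipschitz_on {s..t} v" "negligible N2"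
     "\<And>\<tau>. \<tau>\<in>{s<..<t} - N2 \<Longrightarrow> (v has_vector_derivative A \<tau> (v \<tau>) + (\<eta> \<tau> - \<mu> *\<^sub>R f (z \<tau>) (u \<tau>))) (at \<tau>)"
    using v unfolding variation_eq_def by blast
  obtain V where V: "\<And>\<tau>. \<tau> \<in> {s..t} \<Longrightarrow> norm (v \<tau>) \<le> V"
    by (rule continuous_on_Icc_bounded[OF lipschitz_on_continuous_on[OF v1(1)]]) (rule that)
  obtain E where E: "\<And>\<tau>. \<tau> \<in> {s..t} \<Longrightarrow> norm (\<eta> \<tau>) \<le> E" by (rule continuous_on_Icc_bounded[OF \<eta>]) (rule that)
  have V0: "0 \<le> V" by (rule order_trans[OF norm_ge_zero V[of s]]) (use st in simp)
  define Z where "Z = z ` {s..t}"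
  have Z: "compact Z" "Z \<subseteq> \<Omega>" using compact_image by (auto simp: Z_def)
  obtain r0 Z' where r0: "r0 > 0" "compact Z'" "Z' \<subseteq> \<Omega>" "\<And>z y. z \<in> Z \<Longrightarrow> dist z y \<le> r0 \<Longrightarrow> y \<in> Z'" "Z \<subseteq> Z'"
    by (rule compact_thicken[OF Z]) (rule that)
  obtain C where C: "0 \<le> C" "\<And>z y. z \<in> Z' \<Longrightarrow> N z y \<le> C * norm y" by (rule N_upper[OF r0(2,3)]) (rule that)
  have \<delta>2: "\<delta> / 2 > 0" using \<delta> by simp
  obtain r1 where r1: "r1 > 0" "\<And>z z' (y::'a). z \<in> Z' \<Longrightarrow> z' \<in> Z' \<Longrightarrow> dist z z' < r1 \<Longrightarrow> norm y \<le> E \<Longrightarrow> N z' y \<le> N z y + \<delta> / 2"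
    by (rule N_uniform[OF r0(2,3) \<delta>2, of E]) (rule that)
  \<comment> \<open>The budget: one half of \<delta> pays for comparing \<open>N\<close> on \<eta>
    at two points, the other half for \<open>N y R\<close>, which needs
    \<open>norm R \<le> \<epsilon> * d\<close>. This \<open>d\<close> is split into thirds: end
    point corrections (\<rho>), linearization error (\<open>\<delta>1\<close>) and the terms of
    second order in \<epsilon> (\<open>M\<close>).\<close>
  define d where "d = \<delta> / (2 * (C + 1))"
  have d: "d > 0" "C * d \<le> \<delta> / 2" using \<delta> C(1) by (auto simp: d_def field_simps)
  define \<rho> where "\<rho> = min 1 (d / (3 * (K + 2 / (t - s))))"
  have K2: "K + 2 / (t - s) > 0" using K0 st by (simp add: add_nonneg_pos)
  have \<rho>: "\<rho> > 0" "\<rho> \<le> 1" "(K + 2 / (t - s)) * \<rho> \<le> d / 3"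
  proof -
    show "\<rho> > 0" "\<rho> \<le> 1" using d K2 by (auto simp: \<rho>_def)
    have "(K + 2 / (t - s)) * \<rho> \<le> (K + 2 / (t - s)) * (d / (3 * (K + 2 / (t - s))))"
      using K2 by (intro mult_left_mono) (auto simp: \<rho>_def)
    also have "x * (d / (3 * x)) = d / 3" if "x > 0" for x :: real using that by (simp add: field_simps)
    from this[OF K2] have "(K + 2 / (t - s)) * (d / (3 * (K + 2 / (t - s)))) = d / 3" .
    finally show "(K + 2 / (t - s)) * \<rho> \<le> d / 3" .
  qed
  define \<delta>1 where "\<delta>1 = d / (3 * (V + 1))"
  have \<delta>1: "\<delta>1 > 0" "\<delta>1 * (V + 1) = d / 3"
  proof -
    show "\<delta>1 > 0" using d V0 by (simp add: \<delta>1_def)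
    have "d / (3 * x) * x = d / 3" if "x > 0" for x :: real using that by (simp add: field_simps)
    from this[of "V + 1"] show "\<delta>1 * (V + 1) = d / 3" using V0 by (simp add: \<delta>1_def)
  qed
  obtain r2 where r2: "r2 > 0" "\<And>z y. z \<in> Z \<Longrightarrow> dist z y \<le> r2 \<Longrightarrow> y \<in> \<Omega>"
    "\<And>z y u. z \<in> Z \<Longrightarrow> dist z y \<le> r2 \<Longrightarrow> u \<in> U \<Longrightarrow> norm (f y u - f z u - D z u (y - z)) \<le> \<delta>1 * norm (y - z)"
    by (rule uniform_linearization[OF Z \<delta>1(1)]) (rule that)
  define r where "r = min r0 (min (r1 / 2) r2)"
  have r: "r > 0" "r \<le> r0" "r < r1" "r \<le> r2" using r0 r1 r2 by (auto simp: r_def min_def)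
  define M where "M = \<mu> * (\<delta>1 + K) * (V + 1)"
  have M: "0 \<le> M" using \<mu> \<delta>1 K0 V0 by (simp add: M_def)
  \<comment> \<open>The three bounds keep the curve within distance \<open>r\<close> of
    \<open>z\<close>, keep the factor \<open>1 - \<epsilon> \<mu>\<close> positive, and make
    \<open>\<epsilon> * M\<close> at most a third of \<open>d\<close>.\<close>
  define \<epsilon>0 where "\<epsilon>0 = min (r / (V + 1)) (min (1 / (\<mu> + 1)) (d / (3 * (M + 1))))"
  have \<epsilon>0: "\<epsilon>0 > 0" using r V0 \<mu> d M by (simp add: \<epsilon>0_def)
  have main: "perturb v \<epsilon> e0 e1 \<tau> \<in> \<Omega> \<and>
        (\<tau> \<in> {s<..<t} - (N0 \<union> N2) \<longrightarrow> (\<exists>w. (perturb v \<epsilon> e0 e1 has_vector_derivative w) (at \<tau>) \<and>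
           N (perturb v \<epsilon> e0 e1 \<tau>) w \<le> 1 + \<epsilon> * (N (z \<tau>) (\<eta> \<tau>) - \<mu> + \<delta>)))"
    if \<epsilon>: "0 < \<epsilon>" "\<epsilon> < \<epsilon>0" and e: "norm e0 \<le> \<rho> * \<epsilon>" "norm e1 \<le> \<rho> * \<epsilon>" and \<tau>: "\<tau> \<in> {s..t}" for \<epsilon> e0 e1 \<tau>
  proof -
    define c where "c = ((t - \<tau>) / (t - s)) *\<^sub>R e0 + ((\<tau> - s) / (t - s)) *\<^sub>R e1"
    define c' where "c' = (e1 - e0) /\<^sub>R (t - s)"
    define y where "y = perturb v \<epsilon> e0 e1 \<tau>"
    have y: "y = z \<tau> + (\<epsilon> *\<^sub>R v \<tau> + c)" by (simp add: y_def perturb_def c_def)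
    have c: "norm c \<le> \<rho> * \<epsilon>" unfolding c_def by (rule correction_bound[OF \<tau> e])
    have c': "norm c' \<le> 2 / (t - s) * \<rho> * \<epsilon>"
    proof -
      have "norm c' = norm (e1 - e0) / (t - s)" using st by (simp add: c'_def divide_inverse mult.commute)
      also have "\<dots> \<le> (2 * (\<rho> * \<epsilon>)) / (t - s)"
        using norm_triangle_ineq4[of e1 e0] e st by (intro divide_right_mono) auto
      finally show ?thesis by simp
    qed
    have \<epsilon>': "\<epsilon> * (V + 1) < r" "\<epsilon> * \<mu> < 1" "\<epsilon> * M \<le> d / 3"
    proof -
      have "\<epsilon> < r / (V + 1)" "\<epsilon> < 1 / (\<mu> + 1)" "\<epsilon> < d / (3 * (M + 1))" using \<epsilon>(2) by (auto simp: \<epsilon>0_def)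
      then have 1: "\<epsilon> * (V + 1) < r" and 2: "\<epsilon> * (\<mu> + 1) < 1" and 3: "\<epsilon> * (3 * (M + 1)) < d"
        using V0 \<mu> M by (simp_all add: pos_less_divide_eq)
      show "\<epsilon> * (V + 1) < r" by (rule 1)
      show "\<epsilon> * \<mu> < 1" using 2 \<epsilon>(1) by (simp add: algebra_simps)
      show "\<epsilon> * M \<le> d / 3" using 3 \<epsilon>(1) by (simp add: algebra_simps)
    qed
    have yz: "norm (y - z \<tau>) \<le> \<epsilon> * (V + 1)"
    proof -
      have "norm (y - z \<tau>) \<le> \<epsilon> * norm (v \<tau>) + norm c"
        unfolding y using norm_triangle_ineq[of "\<epsilon> *\<^sub>R v \<tau>" c] \<epsilon> by simp
      also have "\<dots> \<le> \<epsilon> * V + 1 * \<epsilon>"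
        using V[OF \<tau>] c \<rho> \<epsilon> by (intro add_mono mult_left_mono order_trans[OF c] mult_right_mono) auto
      finally show ?thesis by (simp add: algebra_simps)
    qed
    have dy: "dist (z \<tau>) y < r" using yz \<epsilon>' by (simp add: dist_norm norm_minus_commute)
    have zZ: "z \<tau> \<in> Z" using \<tau> by (simp add: Z_def)
    have yZ': "y \<in> Z'" using r0(4)[OF zZ] dy r by simp
    then have y\<Omega>: "y \<in> \<Omega>" using r0 by blast
    have "\<exists>w. (perturb v \<epsilon> e0 e1 has_vector_derivative w) (at \<tau>) \<and> N y w \<le> 1 + \<epsilon> * (N (z \<tau>) (\<eta> \<tau>) - \<mu> + \<delta>)"
      if \<tau>i: "\<tau> \<in> {s<..<t} - (N0 \<union> N2)"
    proof -
      let ?fz = "f (z \<tau>) (u \<tau>)" and ?fy = "f y (u \<tau>)"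
      define w where "w = ?fz + (\<epsilon> *\<^sub>R (A \<tau> (v \<tau>) + (\<eta> \<tau> - \<mu> *\<^sub>R ?fz)) + c')"
      have "((\<lambda>\<tau>. z \<tau> + (\<epsilon> *\<^sub>R v \<tau> + (((t - \<tau>) / (t - s)) *\<^sub>R e0 + ((\<tau> - s) / (t - s)) *\<^sub>R e1))) has_vector_derivative w) (at \<tau>)"
        unfolding w_def c'_def
        using \<tau>i by (intro has_vector_derivative_add z_deriv correction_derivative
           bounded_linear.has_vector_derivative[OF bounded_linear_scaleR_right] v1(3)) auto
      then have der: "(perturb v \<epsilon> e0 e1 has_vector_derivative w) (at \<tau>)"
        by (simp add: perturb_def[abs_def])
      have u\<tau>: "u \<tau> \<in> U" by (rule u_in[OF \<tau>])
      have linA: "linear (A \<tau>)" by (rule A_linear[OF \<tau>])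
      define Q where "Q = ?fy - ?fz - A \<tau> (y - z \<tau>)"
      have Q: "norm Q \<le> \<delta>1 * norm (y - z \<tau>)"
        unfolding Q_def A_def using r2(3)[OF zZ _ u\<tau>, of y] dy r by simp
      \<comment> \<open>What remains when \<open>f z u\<close> is replaced by
        \<open>f y u - A (y - z) - Q\<close> in the velocity: \<open>A (y - z)\<close> equals
        \<open>\<epsilon> A v + A c\<close>, and its first part cancels the term
        \<open>\<epsilon> A v\<close> of the variation equation.\<close>
      define R where "R = (\<epsilon> * \<mu>) *\<^sub>R (A \<tau> (y - z \<tau>) + Q) - Q - A \<tau> c + c'"
      have weq: "w = (1 - \<epsilon> * \<mu>) *\<^sub>R ?fy + \<epsilon> *\<^sub>R \<eta> \<tau> + R"
      proof -
        have "A \<tau> (y - z \<tau>) = \<epsilon> *\<^sub>R A \<tau> (v \<tau>) + A \<tau> c"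
          unfolding y by (simp add: linear_add[OF linA] linear_cmul[OF linA])
        then show ?thesis unfolding R_def Q_def w_def by (simp add: algebra_simps)
      qed
      have Rb: "norm R \<le> \<epsilon> * d"
      proof -
        have "norm R \<le> norm ((\<epsilon> * \<mu>) *\<^sub>R (A \<tau> (y - z \<tau>) + Q)) + norm Q + norm (A \<tau> c) + norm c'"
          unfolding R_def by (meson norm_triangle_ineq norm_triangle_ineq4 order_trans add_right_mono)
        also have "norm ((\<epsilon> * \<mu>) *\<^sub>R (A \<tau> (y - z \<tau>) + Q)) \<le> (\<epsilon> * \<mu>) * ((\<delta>1 + K) * norm (y - z \<tau>))"
        proof -
          have "norm (A \<tau> (y - z \<tau>) + Q) \<le> (\<delta>1 + K) * norm (y - z \<tau>)"
            using norm_triangle_ineq[of "A \<tau> (y - z \<tau>)" Q] A_bound[OF \<tau>, of "y - z \<tau>"] Q by (simp add: algebra_simps)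
          then show ?thesis using \<epsilon> \<mu> by (simp add: mult_left_mono)
        qed
        also have "(\<epsilon> * \<mu>) * ((\<delta>1 + K) * norm (y - z \<tau>)) \<le> \<epsilon> * (d / 3)"
        proof -
          have "(\<epsilon> * \<mu>) * ((\<delta>1 + K) * norm (y - z \<tau>)) \<le> (\<epsilon> * \<mu>) * ((\<delta>1 + K) * (\<epsilon> * (V + 1)))"
            using \<epsilon> \<mu> \<delta>1 K0 yz by (intro mult_left_mono) auto
          also have "\<dots> = \<epsilon> * (\<epsilon> * M)" by (simp add: M_def)
          also have "\<dots> \<le> \<epsilon> * (d / 3)" using \<epsilon>'(3) \<epsilon> by (intro mult_left_mono) auto
          finally show ?thesis .
        qed
        also have "norm Q \<le> \<epsilon> * (d / 3)"
        proof -
          have "\<delta>1 * norm (y - z \<tau>) \<le> \<delta>1 * (\<epsilon> * (V + 1))" using \<delta>1 yz by (intro mult_left_mono) auto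
          also have "\<dots> = \<epsilon> * (\<delta>1 * (V + 1))" by simp
          finally show ?thesis using Q \<delta>1(2) by simp
        qed
        also have "norm (A \<tau> c) \<le> K * (\<rho> * \<epsilon>)"
          using A_bound[OF \<tau>, of c] mult_left_mono[OF c K0] by linarith
        also have "norm c' \<le> 2 / (t - s) * \<rho> * \<epsilon>" by (rule c')
        finally have "norm R \<le> \<epsilon> * (d / 3) + \<epsilon> * (d / 3) + \<epsilon> * ((K + 2 / (t - s)) * \<rho>)"
          by (simp add: algebra_simps)
        also have "\<dots> \<le> \<epsilon> * (d / 3) + \<epsilon> * (d / 3) + \<epsilon> * (d / 3)"
          using \<rho>(3) \<epsilon> by (intro add_left_mono mult_left_mono) auto
        finally show ?thesis by (simp add: algebra_simps)
      qed
      have "N y w \<le> N y ((1 - \<epsilon> * \<mu>) *\<^sub>R ?fy) + N y (\<epsilon> *\<^sub>R \<eta> \<tau>) + N y R"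
        unfolding weq using N_triangle[OF y\<Omega>] by (meson add_right_mono order_trans)
      also have "N y ((1 - \<epsilon> * \<mu>) *\<^sub>R ?fy) = 1 - \<epsilon> * \<mu>"
        using N_scale0[OF y\<Omega>, of "1 - \<epsilon> * \<mu>"] \<epsilon>'(2) f_unit[OF y\<Omega> u\<tau>] by simp
      also have "N y (\<epsilon> *\<^sub>R \<eta> \<tau>) \<le> \<epsilon> * (N (z \<tau>) (\<eta> \<tau>) + \<delta> / 2)"
      proof -
        have "N y (\<eta> \<tau>) \<le> N (z \<tau>) (\<eta> \<tau>) + \<delta> / 2"
          using r1(2)[of "z \<tau>" y "\<eta> \<tau>"] zZ r0(5) yZ' dy r E[OF \<tau>] by auto
        then show ?thesis using N_scale[OF y\<Omega> \<epsilon>(1)] \<epsilon> by simp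
      qed
      also have "N y R \<le> \<epsilon> * (\<delta> / 2)"
      proof -
        have "N y R \<le> C * norm R" by (rule C(2)[OF yZ'])
        also have "\<dots> \<le> C * (\<epsilon> * d)" using Rb C(1) by (intro mult_left_mono)
        also have "\<dots> = \<epsilon> * (C * d)" by simp
        also have "\<dots> \<le> \<epsilon> * (\<delta> / 2)" using d(2) \<epsilon> by (intro mult_left_mono) auto
        finally show ?thesis .
      qed
      finally have "N y w \<le> 1 + \<epsilon> * (N (z \<tau>) (\<eta> \<tau>) - \<mu> + \<delta>)" by (simp add: algebra_simps)
      then show ?thesis using der by blast
    qed
    then show ?thesis using y\<Omega> unfolding y_def by blast
  qed
  show ?thesis
    by (rule that[OF \<epsilon>0 \<rho>(1) negligible_Un[OF N0 v1(2)]]) (rule main)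
qed

end

section \<open>Curves in atlases with locally Lipschitz, differentiable coordinate changes\<close>

lemma abs_continuous_on_cong:
  assumes "abs_continuous_on {a..b} f" "\<And>t. t \<in> {a..b} \<Longrightarrow> f t = g t"
  shows "abs_continuous_on {a..b} g"
  by (rule abs_continuous_on_dominated[OF assms(1,1), of _ 1]) (simp add: assms(2)[symmetric])

lemma tangent_spaceI:
  assumes "\<And>c. c \<notin> A \<or> p \<notin> fst c \<Longrightarrow> v c = 0"
    and "\<And>c d. c \<in> A \<Longrightarrow> d \<in> A \<Longrightarrow> p \<in> fst c \<Longrightarrow> p \<in> fst d \<Longrightarrow>
      v d = frechet_derivative (transition c d) (at (snd c p)) (v c)"
  shows "v \<in> tangent_space A p"
  using assms unfolding tangent_space_def by blast

lemma tangent_spaceD: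
  assumes "v \<in> tangent_space A p" "c \<in> A" "d \<in> A" "p \<in> fst c" "p \<in> fst d"
  shows "v d = frechet_derivative (transition c d) (at (snd c p)) (v c)"
  using assms unfolding tangent_space_def by blast

lemma tangent_space_outside: "v \<in> tangent_space A p \<Longrightarrow> c \<notin> A \<or> p \<notin> fst c \<Longrightarrow> v c = 0"
  unfolding tangent_space_def by blast

lemma ac_curveE:
  assumes "ac_curve A \<gamma> a b" "t \<in> {a..b}"
  obtains c \<delta> where "c \<in> A" "\<delta> > 0" "\<gamma> ` ({a..b} \<inter> {t - \<delta>..t + \<delta>}) \<subseteq> fst c"
    "abs_continuous_on ({a..b} \<inter> {t - \<delta>..t + \<delta>}) (snd c \<circ> \<gamma>)"
  using assms unfolding ac_curve_def by blast

text \<open>The common properties of a smooth structure and of its cotangent atlas on which the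
  treatment of curves rests: differentiable transitions carry velocities, locally Lipschitz ones
  carry absolute continuity. Both kinds of curves are thereby treated at once.\<close>

definition regular_atlas :: "('p, 'e::euclidean_space) chart set \<Rightarrow> bool" where
  "regular_atlas B \<longleftrightarrow> (\<forall>c\<in>B. inj_on (snd c) (fst c) \<and> (\<forall>d\<in>B. open (snd c ` (fst c \<inter> fst d)) \<and>
     (\<forall>z\<in>snd c ` (fst c \<inter> fst d). transition c d differentiable (at z) \<and>
        (\<exists>r>0. \<exists>L. L-lipschitz_on (ball z r) (transition c d)))))"

locale reg_atlas =
  fixes B :: "('p, 'e::euclidean_space) chart set"
  assumes reg: "regular_atlas B"
begin

lemma inj: "c \<in> B \<Longrightarrow> inj_on (snd c) (fst c)"
  using reg by (simp add: regular_atlas_def)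

lemma open_overlap: "c \<in> B \<Longrightarrow> d \<in> B \<Longrightarrow> open (snd c ` (fst c \<inter> fst d))"
  using reg by (simp add: regular_atlas_def)

lemma transition_lipschitz: "c \<in> B \<Longrightarrow> d \<in> B \<Longrightarrow> p \<in> fst c \<inter> fst d \<Longrightarrow>
   \<exists>r>0. \<exists>L. L-lipschitz_on (ball (snd c p) r) (transition c d)"
  using reg unfolding regular_atlas_def by blast

lemma transition_derivative: "c \<in> B \<Longrightarrow> d \<in> B \<Longrightarrow> p \<in> fst c \<inter> fst d \<Longrightarrow>
   (transition c d has_derivative frechet_derivative (transition c d) (at (snd c p))) (at (snd c p))"
  using reg frechet_derivative_works unfolding regular_atlas_def by blast

lemma transition_linear: "c \<in> B \<Longrightarrow> d \<in> B \<Longrightarrow> p \<in> fst c \<inter> fst d \<Longrightarrow>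
   linear (frechet_derivative (transition c d) (at (snd c p)))"
  using transition_derivative has_derivative_linear by blast

lemma transition_apply: "c \<in> B \<Longrightarrow> p \<in> fst c \<Longrightarrow> transition c d (snd c p) = snd d p"
  using inj by (simp add: transition_def)

lemma transition_cocycle:
  assumes c: "c \<in> B" and d: "d \<in> B" and e: "e \<in> B" and p: "p \<in> fst c" "p \<in> fst d" "p \<in> fst e"
  shows "frechet_derivative (transition d e) (at (snd d p)) (frechet_derivative (transition c d) (at (snd c p)) y)
     = frechet_derivative (transition c e) (at (snd c p)) y"
proof -
  have 1: "(transition c d has_derivative frechet_derivative (transition c d) (at (snd c p))) (at (snd c p))"
    using transition_derivative c d p by blast
  have "(transition d e has_derivative frechet_derivative (transition d e) (at (snd d p))) (at (transition c d (snd c p)))"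
    using transition_derivative[OF d e] p by (simp add: transition_apply[OF c p(1)])
  from diff_chain_at[OF 1 this]
  have 2: "((\<lambda>z. transition d e (transition c d z)) has_derivative
     (\<lambda>y. frechet_derivative (transition d e) (at (snd d p)) (frechet_derivative (transition c d) (at (snd c p)) y))) (at (snd c p))"
    by (simp add: o_def)
  let ?W = "snd c ` (fst c \<inter> fst d) \<inter> snd c ` (fst c \<inter> fst e)"
  have "(transition c e has_derivative
     (\<lambda>y. frechet_derivative (transition d e) (at (snd d p)) (frechet_derivative (transition c d) (at (snd c p)) y))) (at (snd c p))"
  proof (rule has_derivative_transform_within_open[OF 2])
    show "open ?W" using open_overlap c d e by blast
    show "snd c p \<in> ?W" using p by blast
    fix z assume "z \<in> ?W"
    then obtain q q' where q: "z = snd c q" "q \<in> fst c" "q \<in> fst d" "z = snd c q'" "q' \<in> fst c" "q' \<in> fst e" by blast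
    then have "q = q'" using inj[OF c] by (auto dest: inj_onD)
    then show "transition d e (transition c d z) = transition c e z"
      using q by (simp add: transition_apply c d)
  qed
  from frechet_derivative_at[OF this] show ?thesis by metis
qed

lemma transition_self:
  assumes c: "c \<in> B" and p: "p \<in> fst c"
  shows "frechet_derivative (transition c c) (at (snd c p)) y = y"
proof -
  have "(transition c c has_derivative (\<lambda>y. y)) (at (snd c p))"
  proof (rule has_derivative_transform_within_open[OF has_derivative_ident])
    show "open (snd c ` (fst c \<inter> fst c))" using open_overlap c by blast
    show "snd c p \<in> snd c ` (fst c \<inter> fst c)" using p by simp
    fix z assume "z \<in> snd c ` (fst c \<inter> fst c)"
    then obtain q where "z = snd c q" "q \<in> fst c" by blast
    then show "z = transition c c z" using transition_apply[OF c, of q c] by simp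
  qed
  from frechet_derivative_at[OF this] show ?thesis by metis
qed

lemma tangent_of_apply: "c \<in> B \<Longrightarrow> p \<in> fst c \<Longrightarrow> tangent_of B c p y c = y"
  by (simp add: tangent_of_def transition_self)

lemma tangent_of_tangent:
  assumes "c \<in> B" "p \<in> fst c"
  shows "tangent_of B c p y \<in> tangent_space B p"
  unfolding tangent_space_def tangent_of_def using transition_cocycle assms by auto

lemma tangent_space_eq:
  assumes "c \<in> B" "p \<in> fst c" "v \<in> tangent_space B p"
  shows "tangent_of B c p (v c) = v"
proof
  fix d show "tangent_of B c p (v c) d = v d"
    using tangent_spaceD[OF assms(3,1) _ assms(2), of d] tangent_space_outside[OF assms(3), of d]
    by (simp add: tangent_of_def)
qed

lemma tangent_space_cong:
  assumes "c \<in> B" "p \<in> fst c" "v \<in> tangent_space B p" "w \<in> tangent_space B p" "v c = w c"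
  shows "v = w"
  using tangent_space_eq assms by metis

lemma tangent_space_add: "v \<in> tangent_space B p \<Longrightarrow> w \<in> tangent_space B p \<Longrightarrow> (\<lambda>c. v c + w c) \<in> tangent_space B p"
  by (rule tangent_spaceI)
    (simp_all add: tangent_space_outside linear_add[OF transition_linear] tangent_spaceD[symmetric])

lemma tangent_space_scale: "v \<in> tangent_space B p \<Longrightarrow> (\<lambda>c. r *\<^sub>R v c) \<in> tangent_space B p"
  by (rule tangent_spaceI)
    (simp_all add: tangent_space_outside linear_cmul[OF transition_linear] tangent_spaceD[symmetric])

lemma tangent_space_zero: "(\<lambda>c. 0) \<in> tangent_space B p"
  by (rule tangent_spaceI) (simp_all add: linear_0[OF transition_linear])

lemma tangent_of_add: "c \<in> B \<Longrightarrow> p \<in> fst c \<Longrightarrow> tangent_of B c p (y + w) = (\<lambda>d. tangent_of B c p y d + tangent_of B c p w d)"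
  by (rule tangent_space_cong) (auto intro: tangent_of_tangent tangent_space_add simp: tangent_of_apply)

lemma tangent_of_scale: "c \<in> B \<Longrightarrow> p \<in> fst c \<Longrightarrow> tangent_of B c p (r *\<^sub>R y) = (\<lambda>d. r *\<^sub>R tangent_of B c p y d)"
  by (rule tangent_space_cong) (auto intro: tangent_of_tangent tangent_space_scale simp: tangent_of_apply)

lemma tangent_of_zero: "c \<in> B \<Longrightarrow> p \<in> fst c \<Longrightarrow> tangent_of B c p 0 = (\<lambda>d. 0)"
  by (rule tangent_space_cong) (auto intro: tangent_of_tangent tangent_space_zero simp: tangent_of_apply)

lemma eventually_in_chart:
  assumes c: "c \<in> B" and d: "d \<in> B" and t: "\<gamma> t \<in> fst c" "\<gamma> t \<in> fst d"
    and ev: "\<forall>\<^sub>F s in F. \<gamma> s \<in> fst c" and cont: "((\<lambda>s. snd c (\<gamma> s)) \<longlongrightarrow> snd c (\<gamma> t)) F"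
  shows "\<forall>\<^sub>F s in F. \<gamma> s \<in> fst d"
proof -
  have "\<forall>\<^sub>F s in F. snd c (\<gamma> s) \<in> snd c ` (fst c \<inter> fst d)"
    using topological_tendstoD[OF cont open_overlap[OF c d]] t by blast
  with ev show ?thesis
  proof eventually_elim
    case (elim s)
    then obtain q where "snd c (\<gamma> s) = snd c q" "q \<in> fst c" "q \<in> fst d" by blast
    then show ?case using inj[OF c] elim by (auto dest: inj_onD)
  qed
qed

text \<open>The chain rule with the transition map. Chart maps have arbitrary values outside their
  domains, so a derivative in one chart is informative only together with \<open>ev\<close>;
  openness of overlaps then puts the curve into the other chart as well.\<close>

lemma has_velocity_of_chart:
  assumes c: "c \<in> B" and t: "\<gamma> t \<in> fst c" "t \<in> I"
    and ev: "\<forall>\<^sub>F s in at t within I. \<gamma> s \<in> fst c"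
    and der: "((snd c \<circ> \<gamma>) has_vector_derivative w) (at t within I)"
  shows "has_velocity B \<gamma> I t (tangent_of B c (\<gamma> t) w)"
  unfolding has_velocity_def
proof (intro conjI ballI impI)
  show "tangent_of B c (\<gamma> t) w \<in> tangent_space B (\<gamma> t)" by (rule tangent_of_tangent[OF c t(1)])
  fix d assume d: "d \<in> B" "\<gamma> t \<in> fst d"
  let ?D = "frechet_derivative (transition c d) (at (snd c (\<gamma> t)))"
  have "continuous (at t within I) (snd c \<circ> \<gamma>)"
    using der by (rule has_vector_derivative_continuous)
  then have lim: "((\<lambda>s. snd c (\<gamma> s)) \<longlongrightarrow> snd c (\<gamma> t)) (at t within I)" by (simp add: continuous_within o_def)
  have evd: "\<forall>\<^sub>F s in at t within I. \<gamma> s \<in> fst d"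
    by (rule eventually_in_chart[OF c d(1) t(1) d(2) ev lim])
  have "(transition c d has_derivative ?D) (at ((snd c \<circ> \<gamma>) t))"
    using transition_derivative[OF c d(1)] t d by simp
  then have tr: "(transition c d has_derivative ?D) (at ((snd c \<circ> \<gamma>) t) within (snd c \<circ> \<gamma>) ` I)"
    by (rule has_derivative_at_withinI)
  have "((transition c d \<circ> (snd c \<circ> \<gamma>)) has_derivative (?D \<circ> (\<lambda>h. h *\<^sub>R w))) (at t within I)"
    using der tr unfolding has_vector_derivative_def by (rule diff_chain_within)
  moreover have "?D \<circ> (\<lambda>h. h *\<^sub>R w) = (\<lambda>h. h *\<^sub>R ?D w)"
    using transition_linear[OF c d(1), of "\<gamma> t"] t d by (auto simp: linear_cmul)
  ultimately have "((transition c d \<circ> (snd c \<circ> \<gamma>)) has_derivative (\<lambda>h. h *\<^sub>R ?D w)) (at t within I)" by simp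
  then have "((snd d \<circ> \<gamma>) has_derivative (\<lambda>h. h *\<^sub>R ?D w)) (at t within I)"
  proof (rule has_derivative_transform_eventually)
    show "\<forall>\<^sub>F s in at t within I. (transition c d \<circ> (snd c \<circ> \<gamma>)) s = (snd d \<circ> \<gamma>) s"
      using ev evd by eventually_elim (simp add: transition_apply[OF c])
  qed (use t in \<open>simp_all add: transition_apply[OF c]\<close>)
  then show "((snd d \<circ> \<gamma>) has_vector_derivative tangent_of B c (\<gamma> t) w d) (at t within I)"
    using d by (simp add: has_vector_derivative_def tangent_of_def)
qed

text \<open>Close to \<open>t0\<close> the coordinates stay in a ball on which the transition map is
  Lipschitz and inside the overlap of the two charts, and Lipschitz maps preserve absolute
  continuity.\<close>

lemma chart_change_ac:
  assumes c: "c \<in> B" and d: "d \<in> B" and t: "\<gamma> t0 \<in> fst c" "\<gamma> t0 \<in> fst d" "t0 \<in> {a..b}" and \<delta>: "\<delta> > 0"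
    and sub: "\<gamma> ` ({a..b} \<inter> {t0 - \<delta>..t0 + \<delta>}) \<subseteq> fst c"
    and ac: "abs_continuous_on ({a..b} \<inter> {t0 - \<delta>..t0 + \<delta>}) (snd c \<circ> \<gamma>)"
  shows "\<exists>\<delta>'>0. \<gamma> ` ({a..b} \<inter> {t0 - \<delta>'..t0 + \<delta>'}) \<subseteq> fst d \<and>
     abs_continuous_on ({a..b} \<inter> {t0 - \<delta>'..t0 + \<delta>'}) (snd d \<circ> \<gamma>)"
proof -
  obtain r L where r: "r > 0" "L-lipschitz_on (ball (snd c (\<gamma> t0)) r) (transition c d)"
    using transition_lipschitz[OF c d] t by blast
  let ?I = "\<lambda>\<delta>. {a..b} \<inter> {t0 - \<delta>..t0 + \<delta>}"
  have Ieq: "?I \<delta> = {max a (t0 - \<delta>)..min b (t0 + \<delta>)}" for \<delta> by auto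
  let ?W = "ball (snd c (\<gamma> t0)) r \<inter> snd c ` (fst c \<inter> fst d)"
  have W: "open ?W" "snd c (\<gamma> t0) \<in> ?W" using open_overlap[OF c d] r t by auto
  have "continuous_on (?I \<delta>) (snd c \<circ> \<gamma>)"
    using ac unfolding Ieq by (rule abs_continuous_on_imp_continuous_on)
  moreover have "t0 \<in> ?I \<delta>" using t \<delta> by auto
  ultimately have "((snd c \<circ> \<gamma>) \<longlongrightarrow> (snd c \<circ> \<gamma>) t0) (at t0 within ?I \<delta>)"
    unfolding continuous_on_def by blast
  from topological_tendstoD[OF this W(1)] W(2)
  have "\<forall>\<^sub>F s in at t0 within ?I \<delta>. (snd c \<circ> \<gamma>) s \<in> ?W" by (simp only: o_apply)
  then obtain e where e: "e > 0" "\<And>s. s \<in> ?I \<delta> \<Longrightarrow> s \<noteq> t0 \<Longrightarrow> dist s t0 < e \<Longrightarrow> snd c (\<gamma> s) \<in> ?W"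
    unfolding eventually_at by auto
  define \<delta>' where "\<delta>' = min \<delta> (e / 2)"
  have \<delta>': "\<delta>' > 0" "\<delta>' \<le> \<delta>" using \<delta> e by (auto simp: \<delta>'_def)
  have inW: "snd c (\<gamma> s) \<in> ?W" if "s \<in> ?I \<delta>'" for s
  proof (cases "s = t0")
    case False
    have "dist s t0 < e" using that e by (auto simp: dist_real_def \<delta>'_def)
    then show ?thesis using e(2)[of s] that \<delta>' False by auto
  qed (use W in simp)
  have ind: "\<gamma> s \<in> fst c \<and> \<gamma> s \<in> fst d" if s: "s \<in> ?I \<delta>'" for s
  proof -
    have sc: "\<gamma> s \<in> fst c" using sub s \<delta>' by fastforce
    obtain q where "snd c (\<gamma> s) = snd c q" "q \<in> fst c" "q \<in> fst d" using inW[OF s] by blast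
    then show ?thesis using inj[OF c] sc by (auto dest: inj_onD)
  qed
  have "?I \<delta>' \<subseteq> ?I \<delta>" using \<delta>' by auto
  from abs_continuous_on_subset[OF ac this]
  have ac': "abs_continuous_on {max a (t0 - \<delta>')..min b (t0 + \<delta>')} (snd c \<circ> \<gamma>)" unfolding Ieq .
  have mem: "s \<in> ?I \<delta>'" if "s \<in> {max a (t0 - \<delta>')..min b (t0 + \<delta>')}" for s using that by auto
  have "(snd c \<circ> \<gamma>) ` {max a (t0 - \<delta>')..min b (t0 + \<delta>')} \<subseteq> ball (snd c (\<gamma> t0)) r"
    using inW[OF mem] by (intro image_subsetI) simp
  from abs_continuous_on_lipschitz_compose[OF ac' r(2) this]
  have "abs_continuous_on {max a (t0 - \<delta>')..min b (t0 + \<delta>')} (snd d \<circ> \<gamma>)"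
  proof (rule abs_continuous_on_cong)
    fix s assume "s \<in> {max a (t0 - \<delta>')..min b (t0 + \<delta>')}"
    then show "(transition c d \<circ> (snd c \<circ> \<gamma>)) s = (snd d \<circ> \<gamma>) s"
      using ind[OF mem] by (simp add: transition_apply[OF c])
  qed
  then have "abs_continuous_on (?I \<delta>') (snd d \<circ> \<gamma>)" unfolding Ieq .
  moreover have "\<gamma> ` ?I \<delta>' \<subseteq> fst d" using ind by blast
  ultimately show ?thesis using \<delta>'(1) by blast
qed

lemma ac_curve_in_chart:
  assumes ac: "ac_curve B \<gamma> a b" and t: "t0 \<in> {a..b}" and d: "d \<in> B" "\<gamma> t0 \<in> fst d"
  shows "\<exists>\<delta>>0. \<gamma> ` ({a..b} \<inter> {t0 - \<delta>..t0 + \<delta>}) \<subseteq> fst d \<and>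
     abs_continuous_on ({a..b} \<inter> {t0 - \<delta>..t0 + \<delta>}) (snd d \<circ> \<gamma>)"
proof -
  obtain c \<delta> where c: "c \<in> B" "\<delta> > 0" "\<gamma> ` ({a..b} \<inter> {t0 - \<delta>..t0 + \<delta>}) \<subseteq> fst c"
     "abs_continuous_on ({a..b} \<inter> {t0 - \<delta>..t0 + \<delta>}) (snd c \<circ> \<gamma>)"
    using ac t unfolding ac_curve_def by blast
  have "\<gamma> t0 \<in> fst c" using c(2,3) t by auto
  from chart_change_ac[OF c(1) d(1) this d(2) t c(2,3,4)] show ?thesis .
qed

lemma ac_curveI_chart:
  assumes "c \<in> B" "\<gamma> ` {a..b} \<subseteq> fst c" "abs_continuous_on {a..b} (snd c \<circ> \<gamma>)"
  shows "ac_curve B \<gamma> a b"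
  unfolding ac_curve_def
proof (intro ballI bexI[of _ c] exI[of _ 1] conjI)
  fix t
  show "abs_continuous_on ({a..b} \<inter> {t - 1..t + 1}) (snd c \<circ> \<gamma>)"
    using assms(3) by (rule abs_continuous_on_subset) simp
qed (use assms in auto)

lemma ac_curve_cong:
  assumes ac: "ac_curve B \<gamma> a b" and eq: "\<And>t. t \<in> {a..b} \<Longrightarrow> \<gamma> t = \<gamma>' t"
  shows "ac_curve B \<gamma>' a b"
  unfolding ac_curve_def
proof
  fix t assume "t \<in> {a..b}"
  then obtain c \<delta> where c: "c \<in> B" "\<delta> > 0" "\<gamma> ` ({a..b} \<inter> {t - \<delta>..t + \<delta>}) \<subseteq> fst c"
     "abs_continuous_on ({a..b} \<inter> {t - \<delta>..t + \<delta>}) (snd c \<circ> \<gamma>)"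
    using ac unfolding ac_curve_def by blast
  have Ieq: "{a..b} \<inter> {t - \<delta>..t + \<delta>} = {max a (t - \<delta>)..min b (t + \<delta>)}" by auto
  have "abs_continuous_on ({a..b} \<inter> {t - \<delta>..t + \<delta>}) (snd c \<circ> \<gamma>')"
    unfolding Ieq by (rule abs_continuous_on_cong[OF c(4)[unfolded Ieq]]) (simp add: eq)
  moreover have "\<gamma>' ` ({a..b} \<inter> {t - \<delta>..t + \<delta>}) \<subseteq> fst c" using c(3) eq by force
  ultimately show "\<exists>c\<in>B. \<exists>\<delta>>0. \<gamma>' ` ({a..b} \<inter> {t - \<delta>..t + \<delta>}) \<subseteq> fst c \<and>
      abs_continuous_on ({a..b} \<inter> {t - \<delta>..t + \<delta>}) (snd c \<circ> \<gamma>')" using c(1,2) by blast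
qed

text \<open>Only the junction \<open>b\<close> is delicate: the charts given there by the two pieces
  may differ. The right piece is therefore transferred to the chart of the left one before the two
  are joined in coordinates.\<close>

lemma ac_curve_concat:
  assumes ac1: "ac_curve B \<gamma> a b" and ac2: "ac_curve B \<gamma> b c" and abc: "a \<le> b" "b \<le> c"
  shows "ac_curve B \<gamma> a c"
  unfolding ac_curve_def
proof
  fix t assume t: "t \<in> {a..c}"
  show "\<exists>ch\<in>B. \<exists>\<delta>>0. \<gamma> ` ({a..c} \<inter> {t - \<delta>..t + \<delta>}) \<subseteq> fst ch \<and>
      abs_continuous_on ({a..c} \<inter> {t - \<delta>..t + \<delta>}) (snd ch \<circ> \<gamma>)"
  proof (cases t b rule: linorder_cases)
    case less
    then obtain ch \<delta> where ch: "ch \<in> B" "\<delta> > 0" "\<gamma> ` ({a..b} \<inter> {t - \<delta>..t + \<delta>}) \<subseteq> fst ch"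
     "abs_continuous_on ({a..b} \<inter> {t - \<delta>..t + \<delta>}) (snd ch \<circ> \<gamma>)"
      using ac_curveE[OF ac1, of t] t by auto
    define \<delta>' where "\<delta>' = min \<delta> (b - t)"
    have sub: "{a..c} \<inter> {t - \<delta>'..t + \<delta>'} \<subseteq> {a..b} \<inter> {t - \<delta>..t + \<delta>}" by (auto simp: \<delta>'_def)
    have "\<delta>' > 0" using ch(2) less by (simp add: \<delta>'_def)
    then show ?thesis
      using abs_continuous_on_subset[OF ch(4) sub] order_trans[OF image_mono[OF sub] ch(3)] ch(1) by blast
  next
    case greater
    then obtain ch \<delta> where ch: "ch \<in> B" "\<delta> > 0" "\<gamma> ` ({b..c} \<inter> {t - \<delta>..t + \<delta>}) \<subseteq> fst ch"
     "abs_continuous_on ({b..c} \<inter> {t - \<delta>..t + \<delta>}) (snd ch \<circ> \<gamma>)"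
      using ac_curveE[OF ac2, of t] t by auto
    define \<delta>' where "\<delta>' = min \<delta> (t - b)"
    have sub: "{a..c} \<inter> {t - \<delta>'..t + \<delta>'} \<subseteq> {b..c} \<inter> {t - \<delta>..t + \<delta>}" by (auto simp: \<delta>'_def)
    have "\<delta>' > 0" using ch(2) greater by (simp add: \<delta>'_def)
    then show ?thesis
      using abs_continuous_on_subset[OF ch(4) sub] order_trans[OF image_mono[OF sub] ch(3)] ch(1) by blast
  next
    case equal
    obtain ch \<delta> where ch: "ch \<in> B" "\<delta> > 0" "\<gamma> ` ({a..b} \<inter> {b - \<delta>..b + \<delta>}) \<subseteq> fst ch"
     "abs_continuous_on ({a..b} \<inter> {b - \<delta>..b + \<delta>}) (snd ch \<circ> \<gamma>)"
      using ac_curveE[OF ac1, of b] abc by auto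
    have "\<gamma> b \<in> fst ch" using ch(2,3) abc by auto
    then obtain \<delta>2 where d2: "\<delta>2 > 0" "\<gamma> ` ({b..c} \<inter> {b - \<delta>2..b + \<delta>2}) \<subseteq> fst ch"
     "abs_continuous_on ({b..c} \<inter> {b - \<delta>2..b + \<delta>2}) (snd ch \<circ> \<gamma>)"
      using ac_curve_in_chart[OF ac2 _ ch(1), of b] abc by auto
    define \<delta>' where "\<delta>' = min \<delta> \<delta>2"
    have \<delta>': "\<delta>' > 0" "\<delta>' \<le> \<delta>" "\<delta>' \<le> \<delta>2" using ch d2 by (auto simp: \<delta>'_def)
    have "abs_continuous_on {max a (b - \<delta>')..min c (b + \<delta>')} (snd ch \<circ> \<gamma>)"
    proof (rule abs_continuous_on_concat[of _ b])
      show "abs_continuous_on {max a (b - \<delta>')..b} (snd ch \<circ> \<gamma>)"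
        using \<delta>' by (intro abs_continuous_on_subset[OF ch(4)]) auto
      show "abs_continuous_on {b..min c (b + \<delta>')} (snd ch \<circ> \<gamma>)"
        using \<delta>' by (intro abs_continuous_on_subset[OF d2(3)]) auto
    qed (use \<delta>' abc in auto)
    moreover have "{a..c} \<inter> {b - \<delta>'..b + \<delta>'} = {max a (b - \<delta>')..min c (b + \<delta>')}" by auto
    moreover have "\<gamma> s \<in> fst ch" if "s \<in> {a..c} \<inter> {b - \<delta>'..b + \<delta>'}" for s
    proof (cases "s \<le> b")
      case True
      then have "s \<in> {a..b} \<inter> {b - \<delta>..b + \<delta>}" using that \<delta>' by auto
      then show ?thesis using ch(3) by blast
    next
      case False
      then have "s \<in> {b..c} \<inter> {b - \<delta>2..b + \<delta>2}" using that \<delta>' by auto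
      then show ?thesis using d2(2) by blast
    qed
    ultimately show ?thesis using ch(1) \<delta>'(1) equal by (intro bexI[of _ ch] exI[of _ \<delta>']) auto
  qed
qed

lemma ac_curve_velocity_ae:
  assumes ac: "ac_curve B \<gamma> a b"
  shows "negligible {t \<in> {a<..<b}. \<not> (\<exists>v. has_velocity B \<gamma> {a..b} t v)}" (is "negligible ?S")
proof -
  have "\<exists>W. openin (top_of_set ?S) W \<and> t0 \<in> W \<and> negligible W" if t0: "t0 \<in> ?S" for t0
  proof -
    obtain c \<delta> where c: "c \<in> B" "\<delta> > 0" "\<gamma> ` ({a..b} \<inter> {t0 - \<delta>..t0 + \<delta>}) \<subseteq> fst c"
     "abs_continuous_on ({a..b} \<inter> {t0 - \<delta>..t0 + \<delta>}) (snd c \<circ> \<gamma>)"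
      using ac_curveE[OF ac, of t0] t0 by auto
    define u v where "u = max a (t0 - \<delta>)" and "v = min b (t0 + \<delta>)"
    have uv: "u < t0" "t0 < v" "a \<le> u" "v \<le> b" using t0 c(2) by (auto simp: u_def v_def)
    have Ieq: "{a..b} \<inter> {t0 - \<delta>..t0 + \<delta>} = {u..v}" by (auto simp: u_def v_def)
    have n: "negligible {t \<in> {u<..<v}. \<not> (snd c \<circ> \<gamma>) differentiable (at t)}"
      using c(4) unfolding Ieq by (rule abs_continuous_on_differentiable_ae)
    have "?S \<inter> {u<..<v} \<subseteq> {t \<in> {u<..<v}. \<not> (snd c \<circ> \<gamma>) differentiable (at t)}"
    proof (safe, goal_cases)
      case (1 t)
      have "((snd c \<circ> \<gamma>) has_vector_derivative vector_derivative (snd c \<circ> \<gamma>) (at t)) (at t)"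
        using 1 by (simp add: vector_derivative_works)
      then have "((snd c \<circ> \<gamma>) has_vector_derivative vector_derivative (snd c \<circ> \<gamma>) (at t)) (at t within {a..b})"
        by (rule has_vector_derivative_at_within)
      moreover have "\<forall>\<^sub>F s in at t within {a..b}. \<gamma> s \<in> fst c"
      proof -
        have "\<forall>\<^sub>F s in at t within {a..b}. s \<in> {u<..<v}"
          using 1 by (intro eventually_at_in_open'[THEN filter_leD[OF at_le[OF subset_UNIV]]]) auto
        then show ?thesis by eventually_elim (use c(3) Ieq in auto)
      qed
      moreover have "\<gamma> t \<in> fst c" using c(3) Ieq 1 by auto
      ultimately have "has_velocity B \<gamma> {a..b} t (tangent_of B c (\<gamma> t) (vector_derivative (snd c \<circ> \<gamma>) (at t)))"
        using 1 by (intro has_velocity_of_chart[OF c(1)]) auto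
      then show ?case using 1 by blast
    qed
    from negligible_subset[OF n this] have "negligible (?S \<inter> {u<..<v})" .
    moreover have "openin (top_of_set ?S) (?S \<inter> {u<..<v})" by (simp add: openin_open_Int)
    ultimately show ?thesis using t0 uv by (intro exI[of _ "?S \<inter> {u<..<v}"]) auto
  qed
  then show ?thesis using locally_negligible_alt[of ?S] by blast
qed

end

lemma has_velocity_unique:
  assumes "has_velocity B \<gamma> {a..b} t v" "has_velocity B \<gamma> {a..b} t w" "t \<in> {a..b}" "a < b"
  shows "v = w"
proof
  fix c
  show "v c = w c"
  proof (cases "c \<in> B \<and> \<gamma> t \<in> fst c")
    case True
    then have "((snd c \<circ> \<gamma>) has_vector_derivative v c) (at t within {a..b})"
      "((snd c \<circ> \<gamma>) has_vector_derivative w c) (at t within {a..b})"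
      using assms by (auto simp: has_velocity_def)
    then show ?thesis using vector_derivative_unique_within_closed_interval[of a b t] assms by (metis box_real(2))
  next
    case False
    then show ?thesis
      using assms(1,2) tangent_space_outside[of v B "\<gamma> t" c] tangent_space_outside[of w B "\<gamma> t" c]
      by (simp add: has_velocity_def)
  qed
qed

lemma velocity_eq:
  assumes "has_velocity B \<gamma> {a..b} t v" "t \<in> {a..b}" "a < b"
  shows "velocity B \<gamma> {a..b} t = v"
  unfolding velocity_def
  by (rule the_equality[of "has_velocity B \<gamma> {a..b} t", OF assms(1)]) (rule has_velocity_unique[OF _ assms])

section \<open>Smooth structures and the cotangent atlas\<close>

definition locally_lipschitz_at :: "('a::metric_space \<Rightarrow> 'b::metric_space) \<Rightarrow> 'a \<Rightarrow> bool" where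
  "locally_lipschitz_at f z \<longleftrightarrow> (\<exists>r>0. \<exists>L. L-lipschitz_on (ball z r) f)"

lemma locally_lipschitz_atI: "r > 0 \<Longrightarrow> L-lipschitz_on (ball z r) f \<Longrightarrow> locally_lipschitz_at f z"
  unfolding locally_lipschitz_at_def by blast

lemma locally_lipschitz_at_compose:
  assumes f: "locally_lipschitz_at f z" and g: "locally_lipschitz_at g (f z)"
  shows "locally_lipschitz_at (\<lambda>x. g (f x)) z"
proof -
  obtain r L where r: "r > 0" "L-lipschitz_on (ball z r) f" using f unfolding locally_lipschitz_at_def by blast
  obtain q M where q: "q > 0" "M-lipschitz_on (ball (f z) q) g" using g unfolding locally_lipschitz_at_def by blast
  have "continuous_on (ball z r) f" by (rule lipschitz_on_continuous_on[OF r(2)])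
  then have "isCont f z" using r(1) by (simp add: continuous_on_eq_continuous_at)
  then obtain d where d: "d > 0" "\<And>x. dist x z < d \<Longrightarrow> dist (f x) (f z) < q"
    using q(1) unfolding continuous_at_eps_delta by blast
  have "L-lipschitz_on (ball z (min r d)) f" by (rule lipschitz_on_subset[OF r(2)]) auto
  moreover have "M-lipschitz_on (f ` ball z (min r d)) g"
    by (rule lipschitz_on_subset[OF q(2)]) (use d(2) in \<open>auto simp: dist_commute\<close>)
  ultimately have "(M * L)-lipschitz_on (ball z (min r d)) (g \<circ> f)" by (rule lipschitz_on_compose)
  then show ?thesis using r(1) d(1) by (intro locally_lipschitz_atI[of "min r d"]) (auto simp: o_def)
qed

lemma locally_lipschitz_at_Pair:
  assumes f: "locally_lipschitz_at f z" and g: "locally_lipschitz_at g z"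
  shows "locally_lipschitz_at (\<lambda>x. (f x, g x)) z"
proof -
  obtain r L where r: "r > 0" "L-lipschitz_on (ball z r) f" using f unfolding locally_lipschitz_at_def by blast
  obtain q M where q: "q > 0" "M-lipschitz_on (ball z q) g" using g unfolding locally_lipschitz_at_def by blast
  have "L-lipschitz_on (ball z (min r q)) f" "M-lipschitz_on (ball z (min r q)) g"
    by (auto intro: lipschitz_on_subset[OF r(2)] lipschitz_on_subset[OF q(2)])
  from lipschitz_on_Pair[OF this] show ?thesis using r(1) q(1) by (intro locally_lipschitz_atI) auto
qed

lemma locally_lipschitz_at_C1:
  fixes f :: "'a::euclidean_space \<Rightarrow> 'b::euclidean_space"
  assumes S: "open S" "z \<in> S" and d: "\<And>x. x \<in> S \<Longrightarrow> f differentiable (at x)"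
    and c: "\<And>v. continuous_on S (\<lambda>x. frechet_derivative f (at x) v)"
  shows "locally_lipschitz_at f z"
proof -
  obtain r where r: "r > 0" "cball z r \<subseteq> S" using S open_contains_cball by blast
  have "bounded (\<Union>b\<in>Basis. (\<lambda>x. frechet_derivative f (at x) b) ` cball z r)"
    using r by (intro bounded_UN finite_Basis ballI compact_imp_bounded compact_continuous_image
      continuous_on_subset[OF c] compact_cball) auto
  then obtain C where C: "\<forall>y\<in>(\<Union>b\<in>Basis. (\<lambda>x. frechet_derivative f (at x) b) ` cball z r). norm y \<le> C"
    unfolding bounded_iff by blast
  have "(real DIM('a) * \<bar>C\<bar>)-lipschitz_on (ball z r) f"
  proof (rule bounded_derivative_imp_lipschitz)
    fix x assume x: "x \<in> ball z r"
    then have xS: "x \<in> S" using r by auto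
    have D: "(f has_derivative frechet_derivative f (at x)) (at x)"
      using d[OF xS] frechet_derivative_works by blast
    then show "(f has_derivative frechet_derivative f (at x)) (at x within ball z r)"
      by (rule has_derivative_at_withinI)
    have "norm (frechet_derivative f (at x) w) \<le> real DIM('a) * \<bar>C\<bar> * norm w" for w
    proof (rule norm_linear_le_basis)
      show "linear (frechet_derivative f (at x))" using D by (rule has_derivative_linear)
      fix b :: 'a assume "b \<in> Basis"
      then have "frechet_derivative f (at x) b \<in> (\<Union>b\<in>Basis. (\<lambda>x. frechet_derivative f (at x) b) ` cball z r)"
        using x by force
      then show "norm (frechet_derivative f (at x) b) \<le> \<bar>C\<bar>" using C by force
    qed
    then show "onorm (frechet_derivative f (at x)) \<le> real DIM('a) * \<bar>C\<bar>" by (intro onorm_bound) auto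
  qed auto
  then show ?thesis using r by (intro locally_lipschitz_atI)
qed

lemma C_on_continuous_on: "C_on k f S \<Longrightarrow> continuous_on S f"
  by (cases k) (auto intro!: continuous_at_imp_continuous_on differentiable_imp_continuous_within)

lemma C_on_SucD:
  assumes "C_on (Suc k) f S"
  shows "x \<in> S \<Longrightarrow> f differentiable (at x)" "C_on k (\<lambda>x. frechet_derivative f (at x) v) S"
  using assms unfolding C_on.simps by blast+

lemma C_on_locally_lipschitz_at:
  fixes f :: "'a::euclidean_space \<Rightarrow> 'b::euclidean_space"
  assumes "C_on (Suc k) f S" "open S" "z \<in> S"
  shows "locally_lipschitz_at f z"
  by (rule locally_lipschitz_at_C1[OF assms(2,3) C_on_SucD(1)[OF assms(1)] C_on_continuous_on[OF C_on_SucD(2)[OF assms(1)]]])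

lemma smooth_onD: "smooth_on f S \<Longrightarrow> C_on k f S"
  by (simp add: smooth_on_def)

lemma locally_lipschitz_at_bilinear:
  fixes f g :: "'a::euclidean_space \<Rightarrow> 'b::euclidean_space"
  assumes f: "locally_lipschitz_at f z" and g: "locally_lipschitz_at g z"
  shows "locally_lipschitz_at (\<lambda>x. f x \<bullet> g x) z"
proof -
  have "locally_lipschitz_at (\<lambda>p::'b \<times> 'b. fst p \<bullet> snd p) (f z, g z)"
  proof (rule locally_lipschitz_at_C1[of UNIV])
    have der: "((\<lambda>p::'b \<times> 'b. fst p \<bullet> snd p) has_derivative (\<lambda>h. fst p \<bullet> snd h + fst h \<bullet> snd p)) (at p)" for p
      by (auto intro!: derivative_eq_intros)
    show "(\<lambda>p::'b \<times> 'b. fst p \<bullet> snd p) differentiable (at p)" for p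
      using der unfolding differentiable_def by blast
    show "continuous_on UNIV (\<lambda>x. frechet_derivative (\<lambda>p::'b \<times> 'b. fst p \<bullet> snd p) (at x) v)" for v
      unfolding frechet_derivative_at[OF der, symmetric] by (intro continuous_intros)
  qed auto
  from locally_lipschitz_at_compose[OF locally_lipschitz_at_Pair[OF f g] this] show ?thesis by simp
qed

lemma locally_lipschitz_at_lipschitz: "L-lipschitz_on UNIV f \<Longrightarrow> locally_lipschitz_at f z"
  by (rule locally_lipschitz_atI[of 1 L]) (auto intro: lipschitz_on_subset)

lemma locally_lipschitz_at_fst: "locally_lipschitz_at fst z"
  by (rule locally_lipschitz_at_lipschitz[of 1]) (auto intro!: lipschitz_onI simp: dist_Pair_Pair real_le_rsqrt)

lemma locally_lipschitz_at_snd: "locally_lipschitz_at snd z"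
  by (rule locally_lipschitz_at_lipschitz[of 1]) (auto intro!: lipschitz_onI simp: dist_Pair_Pair real_le_rsqrt)

lemma locally_lipschitz_at_vec:
  fixes f :: "'i::finite \<Rightarrow> 'a::metric_space \<Rightarrow> real"
  assumes "\<And>i. locally_lipschitz_at (f i) z"
  shows "locally_lipschitz_at (\<lambda>x. \<chi> i. f i x) z"
proof -
  have "\<forall>i. \<exists>r L. r > 0 \<and> L-lipschitz_on (ball z r) (f i)"
    using assms unfolding locally_lipschitz_at_def by blast
  then obtain r L where r: "\<And>i. r i > 0" "\<And>i. (L i)-lipschitz_on (ball z (r i)) (f i)" by metis
  define q where "q = Min (range r)"
  have q: "q > 0" "\<And>i. q \<le> r i" using r(1) by (auto simp: q_def Min_gr_iff)
  have "(\<Sum>i\<in>UNIV. L i)-lipschitz_on (ball z q) (\<lambda>x. \<chi> i. f i x)"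
  proof (rule lipschitz_onI)
    fix x y assume xy: "x \<in> ball z q" "y \<in> ball z q"
    have "dist (\<chi> i. f i x) (\<chi> i. f i y) \<le> (\<Sum>i\<in>UNIV. \<bar>((\<chi> i. f i x) - (\<chi> i. f i y)) $ i\<bar>)"
      unfolding dist_norm by (rule norm_le_l1_cart)
    also have "\<dots> \<le> (\<Sum>i\<in>UNIV. L i * dist x y)"
    proof (rule sum_mono)
      fix i
      have "dist (f i x) (f i y) \<le> L i * dist x y"
        by (rule lipschitz_onD[OF r(2)]) (use xy q(2)[of i] in auto)
      then show "\<bar>((\<chi> i. f i x) - (\<chi> i. f i y)) $ i\<bar> \<le> L i * dist x y" by (simp add: dist_real_def)
    qed
    finally show "dist (\<chi> i. f i x) (\<chi> i. f i y) \<le> (\<Sum>i\<in>UNIV. L i) * dist x y" by (simp add: sum_distrib_right)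
  qed (use lipschitz_on_nonneg[OF r(2)] in \<open>auto intro: sum_nonneg\<close>)
  then show ?thesis using q(1) by (rule locally_lipschitz_atI[rotated])
qed

lemma smooth_structure_chart:
  assumes "smooth_structure A" "c \<in> A"
  shows "open (fst c)" "open (snd c ` fst c)" "inj_on (snd c) (fst c)" "continuous_on (fst c) (snd c)"
    "continuous_on (snd c ` fst c) (inv_into (fst c) (snd c))"
proof -
  have "is_chart c" using assms by (auto simp: smooth_structure_def)
  then have c: "open (fst c)" "open (snd c ` fst c)"
     and h: "homeomorphism (fst c) (snd c ` fst c) (snd c) (inv_into (fst c) (snd c))"
    by (auto simp: is_chart_def)
  show "open (fst c)" "open (snd c ` fst c)" by fact+
  show "inj_on (snd c) (fst c)" by (rule inj_on_inverseI) (use h in \<open>auto simp: homeomorphism_def\<close>)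
  show "continuous_on (fst c) (snd c)" "continuous_on (snd c ` fst c) (inv_into (fst c) (snd c))"
    using h by (auto simp: homeomorphism_def)
qed

lemma smooth_structure_overlap_open:
  assumes A: "smooth_structure A" "c \<in> A" and W: "open W"
  shows "open (snd c ` (fst c \<inter> W))"
proof -
  note c = smooth_structure_chart[OF A]
  have "open ((inv_into (fst c) (snd c)) -` (fst c \<inter> W) \<inter> (snd c ` fst c))"
    using continuous_on_open_vimage[OF c(2)] c(1,5) W by blast
  moreover have "(inv_into (fst c) (snd c)) -` (fst c \<inter> W) \<inter> (snd c ` fst c) = snd c ` (fst c \<inter> W)"
    using c(3) by auto
  ultimately show ?thesis by simp
qed

lemma smooth_structure_transition:
  assumes "smooth_structure A" "c \<in> A" "d \<in> A"
  shows "C_on k (transition c d) (snd c ` (fst c \<inter> fst d))"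
proof -
  have "compatible_charts c d" using assms by (simp add: smooth_structure_def)
  then show ?thesis by (simp add: compatible_charts_def smooth_onD)
qed

lemma smooth_structure_regular:
  assumes "smooth_structure A"
  shows "regular_atlas A"
  unfolding regular_atlas_def
proof (intro ballI conjI)
  fix c assume c: "c \<in> A"
  show "inj_on (snd c) (fst c)" by (rule smooth_structure_chart[OF assms c])
  fix d assume d: "d \<in> A"
  show op: "open (snd c ` (fst c \<inter> fst d))"
    by (rule smooth_structure_overlap_open[OF assms c]) (rule smooth_structure_chart[OF assms d])
  have C: "C_on (Suc 0) (transition c d) (snd c ` (fst c \<inter> fst d))"
    by (rule smooth_structure_transition[OF assms c d])
  fix z assume z: "z \<in> snd c ` (fst c \<inter> fst d)"
  then show "transition c d differentiable (at z)" by (rule C_on_SucD(1)[OF C])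
  show "\<exists>r>0. \<exists>L. L-lipschitz_on (ball z r) (transition c d)"
    using C_on_locally_lipschitz_at[OF C op z] by (simp add: locally_lipschitz_at_def)
qed

locale manifold =
  fixes A :: "('m::{t2_space, second_countable_topology}, real^'n) chart set"
  assumes smooth: "smooth_structure A"

sublocale manifold \<subseteq> reg_atlas A
  by unfold_locales (rule smooth_structure_regular[OF smooth])

context manifold
begin

section \<open>Coordinates of covectors and regularity of the cotangent atlas\<close>

definition covec :: "('m, real^'n) chart \<Rightarrow> 'm \<Rightarrow> real^'n \<Rightarrow> ('m, real^'n) cvec" where
  "covec c p \<xi> = (\<lambda>v. if v \<in> tangent_space A p then \<xi> \<bullet> v c else 0)"

definition cocoord :: "('m, real^'n) chart \<Rightarrow> 'm \<Rightarrow> ('m, real^'n) cvec \<Rightarrow> real^'n" where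
  "cocoord c p \<alpha> = (\<chi> i. \<alpha> (tangent_of A c p (axis i 1)))"

lemma cotangent_chart_eq: "cotangent_chart A c = ({(p, \<alpha>). p \<in> fst c \<and> \<alpha> \<in> cotangent_space A p}, \<lambda>(p, \<alpha>). (snd c p, cocoord c p \<alpha>))"
  by (simp add: cotangent_chart_def cocoord_def)

lemma covec_cotangent: "covec c p \<xi> \<in> cotangent_space A p"
  unfolding cotangent_space_def covec_def
  by (simp add: tangent_space_add tangent_space_scale inner_add_right)

lemma cocoord_covec: "c \<in> A \<Longrightarrow> p \<in> fst c \<Longrightarrow> cocoord c p (covec c p \<xi>) = \<xi>"
  by (simp add: cocoord_def covec_def tangent_of_tangent tangent_of_apply inner_axis vec_eq_iff)

lemma cotangent_apply:
  assumes c: "c \<in> A" "p \<in> fst c" and \<alpha>: "\<alpha> \<in> cotangent_space A p" and v: "v \<in> tangent_space A p"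
  shows "\<alpha> v = cocoord c p \<alpha> \<bullet> v c"
proof -
  define g where "g y = \<alpha> (tangent_of A c p y)" for y
  have add: "\<alpha> (\<lambda>c. v c + w c) = \<alpha> v + \<alpha> w" if "v \<in> tangent_space A p" "w \<in> tangent_space A p" for v w
    using \<alpha> that by (simp add: cotangent_space_def)
  have scale: "\<alpha> (\<lambda>c. r *\<^sub>R v c) = r * \<alpha> v" if "v \<in> tangent_space A p" for r v
    using \<alpha> that by (simp add: cotangent_space_def)
  have lin: "linear g"
    by (rule linearI) (simp_all add: g_def tangent_of_add[OF c] tangent_of_scale[OF c] add scale tangent_of_tangent c)
  have "g (v c) = g (\<Sum>i\<in>UNIV. (v c $ i) *\<^sub>R axis i 1)"
    using basis_expansion[of "v c"] by (simp add: scalar_mult_eq_scaleR)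
  also have "\<dots> = (\<Sum>i\<in>UNIV. v c $ i * g (axis i 1))"
    by (simp add: linear_sum[OF lin] linear_cmul[OF lin])
  also have "\<dots> = cocoord c p \<alpha> \<bullet> v c" by (simp add: inner_vec_def cocoord_def g_def mult.commute)
  finally show ?thesis by (simp add: g_def tangent_space_eq[OF c v])
qed

lemma cotangent_eq:
  assumes c: "c \<in> A" "p \<in> fst c" and \<alpha>: "\<alpha> \<in> cotangent_space A p"
  shows "covec c p (cocoord c p \<alpha>) = \<alpha>"
proof
  fix v show "covec c p (cocoord c p \<alpha>) v = \<alpha> v"
  proof (cases "v \<in> tangent_space A p")
    case True
    then show ?thesis using cotangent_apply[OF c \<alpha>] by (simp add: covec_def)
  next
    case False
    then show ?thesis using \<alpha> by (simp add: covec_def cotangent_space_def)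
  qed
qed

lemma cotangent_chart_inj: "c \<in> A \<Longrightarrow> inj_on (snd (cotangent_chart A c)) (fst (cotangent_chart A c))"
proof (rule inj_onI)
  fix q q' assume c: "c \<in> A" and q: "q \<in> fst (cotangent_chart A c)" "q' \<in> fst (cotangent_chart A c)"
    and eq: "snd (cotangent_chart A c) q = snd (cotangent_chart A c) q'"
  obtain p \<alpha> p' \<alpha>' where p: "q = (p, \<alpha>)" "q' = (p', \<alpha>')" by fastforce
  have "snd c p = snd c p'" and \<alpha>: "cocoord c p \<alpha> = cocoord c p' \<alpha>'" and in_c: "p \<in> fst c" "p' \<in> fst c"
    and cot: "\<alpha> \<in> cotangent_space A p" "\<alpha>' \<in> cotangent_space A p'"
    using q eq by (auto simp: p cotangent_chart_eq)
  then have "p = p'" using inj[OF c] by (auto dest: inj_onD)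
  moreover have "\<alpha> = \<alpha>'"
  proof -
    have "\<alpha> = covec c p (cocoord c p \<alpha>)" by (rule cotangent_eq[OF c in_c(1) cot(1), symmetric])
    also have "\<dots> = covec c p (cocoord c p' \<alpha>')" by (rule arg_cong[OF \<alpha>])
    also have "\<dots> = covec c p' (cocoord c p' \<alpha>')" by (simp only: \<open>p = p'\<close>)
    also have "\<dots> = \<alpha>'" by (rule cotangent_eq[OF c in_c(2) cot(2)])
    finally show ?thesis .
  qed
  ultimately show "q = q'" by (simp add: p)
qed

text \<open>The coordinate change of the cotangent bundle: covectors are pulled back by the
  derivative of the inverse transition, taken at the new point. As an explicit formula it avoids the
  inverse of the bundle chart.\<close>

definition cotransition :: "('m, real^'n) chart \<Rightarrow> ('m, real^'n) chart \<Rightarrow> (real^'n) \<times> (real^'n) \<Rightarrow> (real^'n) \<times> (real^'n)" where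
  "cotransition c d = (\<lambda>w. (transition c d (fst w),
     \<chi> i. snd w \<bullet> frechet_derivative (transition d c) (at (transition c d (fst w))) (axis i 1)))"

lemma cotangent_overlap:
  assumes c: "c \<in> A" and d: "d \<in> A"
  shows "snd (cotangent_chart A c) ` (fst (cotangent_chart A c) \<inter> fst (cotangent_chart A d)) = snd c ` (fst c \<inter> fst d) \<times> UNIV"
proof (intro equalityI subsetI)
  fix w assume "w \<in> snd (cotangent_chart A c) ` (fst (cotangent_chart A c) \<inter> fst (cotangent_chart A d))"
  then show "w \<in> snd c ` (fst c \<inter> fst d) \<times> UNIV" by (auto simp: cotangent_chart_eq)
next
  fix w :: "(real^'n) \<times> (real^'n)" assume "w \<in> snd c ` (fst c \<inter> fst d) \<times> UNIV"
  then obtain p \<xi> where p: "p \<in> fst c" "p \<in> fst d" "w = (snd c p, \<xi>)" by (cases w) auto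
  have "(p, covec c p \<xi>) \<in> fst (cotangent_chart A c) \<inter> fst (cotangent_chart A d)"
    using p covec_cotangent by (auto simp: cotangent_chart_eq)
  moreover have "snd (cotangent_chart A c) (p, covec c p \<xi>) = w"
    using p cocoord_covec[OF c p(1)] by (simp add: cotangent_chart_eq)
  ultimately show "w \<in> snd (cotangent_chart A c) ` (fst (cotangent_chart A c) \<inter> fst (cotangent_chart A d))"
    by (metis imageI)
qed

lemma cotransition_eq:
  assumes c: "c \<in> A" and d: "d \<in> A" and w: "w \<in> snd c ` (fst c \<inter> fst d) \<times> UNIV"
  shows "transition (cotangent_chart A c) (cotangent_chart A d) w = cotransition c d w"
proof -
  obtain p \<xi> where p: "p \<in> fst c" "p \<in> fst d" "w = (snd c p, \<xi>)" using w by (cases w) auto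
  let ?q = "(p, covec c p \<xi>)"
  have q: "?q \<in> fst (cotangent_chart A c)" using p covec_cotangent by (auto simp: cotangent_chart_eq)
  have wq: "snd (cotangent_chart A c) ?q = w"
    using p cocoord_covec[OF c p(1)] by (simp add: cotangent_chart_eq)
  have "inv_into (fst (cotangent_chart A c)) (snd (cotangent_chart A c)) w = ?q"
    using inv_into_f_f[OF cotangent_chart_inj[OF c] q] by (simp only: wq)
  then have "transition (cotangent_chart A c) (cotangent_chart A d) w = (snd d p, cocoord d p (covec c p \<xi>))"
    by (simp add: transition_def cotangent_chart_eq)
  also have "cocoord d p (covec c p \<xi>) = (\<chi> i. \<xi> \<bullet> frechet_derivative (transition d c) (at (snd d p)) (axis i 1))"
    using tangent_of_tangent[OF d p(2)] p c by (simp add: cocoord_def covec_def tangent_of_def)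
  finally show ?thesis using p transition_apply[OF c p(1)] by (simp add: cotransition_def)
qed

text \<open>The fibre component contains first derivatives of \<open>transition d c\<close>, so that
  second order smoothness of the transition is what makes it differentiable and locally
  Lipschitz.\<close>

lemma cotransition_regular:
  assumes c: "c \<in> A" and d: "d \<in> A" and w: "w \<in> snd c ` (fst c \<inter> fst d) \<times> UNIV"
  shows "cotransition c d differentiable (at w)" "locally_lipschitz_at (cotransition c d) w"
proof -
  obtain p \<xi> where p: "p \<in> fst c" "p \<in> fst d" "w = (snd c p, \<xi>)" using w by (cases w) auto
  let ?G = "\<lambda>i y. frechet_derivative (transition d c) (at y) (axis i 1)"
  have pc: "snd c p \<in> snd c ` (fst c \<inter> fst d)" and pd: "transition c d (fst w) \<in> snd d ` (fst d \<inter> fst c)"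
    using p transition_apply[OF c p(1)] by auto
  have C: "C_on (Suc 0) (transition c d) (snd c ` (fst c \<inter> fst d))"
    and C2: "C_on (Suc (Suc 0)) (transition d c) (snd d ` (fst d \<inter> fst c))"
    using smooth_structure_transition[OF smooth] c d by blast+
  have CG: "C_on (Suc 0) (?G i) (snd d ` (fst d \<inter> fst c))" for i by (rule C_on_SucD(2)[OF C2])
  have "transition c d differentiable (at (snd c p))" by (rule C_on_SucD(1)[OF C pc])
  then have 1: "(\<lambda>w. transition c d (fst w)) differentiable (at w)"
    using differentiable_chain_at[of fst w "transition c d"] p(3) by (simp add: o_def bounded_linear_fst bounded_linear_imp_differentiable)
  have "?G i differentiable (at (transition c d (fst w)))" for i by (rule C_on_SucD(1)[OF CG pd])
  then have 2: "(\<lambda>w. ?G i (transition c d (fst w))) differentiable (at w)" for i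
    using differentiable_chain_at[OF 1, of "?G i"] by (simp add: o_def)
  have 3: "(\<lambda>w. \<chi> i. snd w \<bullet> ?G i (transition c d (fst w))) differentiable (at w)"
  proof -
    have "(\<lambda>w. \<Sum>i\<in>UNIV. (snd w \<bullet> ?G i (transition c d (fst w))) *\<^sub>R (axis i 1 :: real^'n)) differentiable (at w)"
    proof (rule differentiable_sum)
      have sd: "snd differentiable (at w)" by (rule bounded_linear_imp_differentiable[OF bounded_linear_snd])
      show "\<forall>i\<in>UNIV. (\<lambda>w. (snd w \<bullet> ?G i (transition c d (fst w))) *\<^sub>R (axis i 1 :: real^'n)) differentiable (at w)"
        using differentiable_scaleR[OF differentiable_inner[OF sd 2] differentiable_const] by blast
    qed simp
    moreover have "(\<Sum>i\<in>UNIV. g i *\<^sub>R (axis i 1 :: real^'n)) = (\<chi> i. g i)" for g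
      using basis_expansion[of "\<chi> i. g i"] by (simp add: scalar_mult_eq_scaleR)
    ultimately show ?thesis by simp
  qed
  obtain D1 D2 where "((\<lambda>w. transition c d (fst w)) has_derivative D1) (at w)"
     "((\<lambda>w. \<chi> i. snd w \<bullet> ?G i (transition c d (fst w))) has_derivative D2) (at w)"
    using 1 3 unfolding differentiable_def by blast
  from has_derivative_Pair[OF this] show "cotransition c d differentiable (at w)"
    unfolding cotransition_def differentiable_def by blast
  have l1: "locally_lipschitz_at (\<lambda>w. transition c d (fst w)) w"
  proof (rule locally_lipschitz_at_compose[OF locally_lipschitz_at_fst])
    show "locally_lipschitz_at (transition c d) (fst w)"
      using C_on_locally_lipschitz_at[OF C open_overlap[OF c d]] pc p by simp
  qed
  have "locally_lipschitz_at (\<lambda>w. ?G i (transition c d (fst w))) w" for i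
    by (rule locally_lipschitz_at_compose[OF l1 C_on_locally_lipschitz_at[OF CG open_overlap[OF d c] pd]])
  then show "locally_lipschitz_at (cotransition c d) w"
    unfolding cotransition_def
    by (intro locally_lipschitz_at_Pair l1 locally_lipschitz_at_vec locally_lipschitz_at_bilinear locally_lipschitz_at_snd)
qed

lemma cotangent_regular: "regular_atlas (cotangent_atlas A)"
  unfolding regular_atlas_def
proof (intro ballI conjI)
  fix c' d' assume "c' \<in> cotangent_atlas A"
  then obtain c where c: "c \<in> A" "c' = cotangent_chart A c" by (auto simp: cotangent_atlas_def)
  show "inj_on (snd c') (fst c')" unfolding c(2) by (rule cotangent_chart_inj[OF c(1)])
  assume "d' \<in> cotangent_atlas A"
  then obtain d where d: "d \<in> A" "d' = cotangent_chart A d" by (auto simp: cotangent_atlas_def)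
  let ?W = "snd c ` (fst c \<inter> fst d) \<times> (UNIV :: (real^'n) set)"
  have W: "snd c' ` (fst c' \<inter> fst d') = ?W" unfolding c d by (rule cotangent_overlap[OF c(1) d(1)])
  have opW: "open ?W" by (rule open_Times[OF open_overlap[OF c(1) d(1)] open_UNIV])
  show "open (snd c' ` (fst c' \<inter> fst d'))" unfolding W by (rule opW)
  fix w assume "w \<in> snd c' ` (fst c' \<inter> fst d')"
  then have w: "w \<in> ?W" unfolding W .
  have eq: "transition c' d' x = cotransition c d x" if "x \<in> ?W" for x
    unfolding c d by (rule cotransition_eq[OF c(1) d(1) that])
  obtain D where "(cotransition c d has_derivative D) (at w)"
    using cotransition_regular(1)[OF c(1) d(1) w] unfolding differentiable_def by blast
  from has_derivative_transform_within_open[OF this opW w] eq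
  show "transition c' d' differentiable (at w)" unfolding differentiable_def by metis
  obtain r L where r: "r > 0" "L-lipschitz_on (ball w r) (cotransition c d)"
    using cotransition_regular(2)[OF c(1) d(1) w] unfolding locally_lipschitz_at_def by blast
  obtain e where e: "e > 0" "ball w e \<subseteq> ?W" using opW w open_contains_ball by blast
  have "L-lipschitz_on (ball w (min r e)) (cotransition c d)"
    by (rule lipschitz_on_subset[OF r(2)]) auto
  then have "L-lipschitz_on (ball w (min r e)) (transition c' d')"
    by (rule lipschitz_on_transform) (use e(2) eq in \<open>auto simp: subset_iff\<close>)
  then show "\<exists>r>0. \<exists>L. L-lipschitz_on (ball w r) (transition c' d')"
    using r(1) e(1) by (intro exI[of _ "min r e"]) auto
qed

end

section \<open>Charts of a Pontryagin type structure\<close>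

lemma AE_lebesgue_negligible:
  "(AE t in lebesgue. P t) \<longleftrightarrow> (\<exists>N. negligible N \<and> (\<forall>t. t \<notin> N \<longrightarrow> P t))"
  unfolding eventually_ae_filter negligible_iff_null_sets by auto

locale finsler_manifold = manifold A for A :: "('m::{t2_space, second_countable_topology}, real^'n) chart set" +
  fixes F :: "'m \<times> ('m, real^'n) tvec \<Rightarrow> real"
  assumes finsler: "C0_Finsler A F"
begin

text \<open>\<open>F\<close> in the natural coordinates of the tangent bundle.\<close>

definition norm_in :: "('m, real^'n) chart \<Rightarrow> real^'n \<Rightarrow> real^'n \<Rightarrow> real" where
  "norm_in c z y = F (inv_into (fst c) (snd c) z, tangent_of A c (inv_into (fst c) (snd c) z) y)"

lemma norm_in_eq: "c \<in> A \<Longrightarrow> p \<in> fst c \<Longrightarrow> norm_in c (snd c p) y = F (p, tangent_of A c p y)"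
  using inj by (simp add: norm_in_def)

lemma norm_in_tangent: "c \<in> A \<Longrightarrow> p \<in> fst c \<Longrightarrow> v \<in> tangent_space A p \<Longrightarrow> norm_in c (snd c p) (v c) = F (p, v)"
  by (simp add: norm_in_eq tangent_space_eq)

lemma F_norm:
  shows F_nonneg: "v \<in> tangent_space A p \<Longrightarrow> 0 \<le> F (p, v)"
    and F_zero: "v \<in> tangent_space A p \<Longrightarrow> F (p, v) = 0 \<longleftrightarrow> v = (\<lambda>_. 0)"
    and F_scale: "v \<in> tangent_space A p \<Longrightarrow> r > 0 \<Longrightarrow> F (p, \<lambda>c. r *\<^sub>R v c) = r * F (p, v)"
    and F_add: "v \<in> tangent_space A p \<Longrightarrow> w \<in> tangent_space A p \<Longrightarrow> F (p, \<lambda>c. v c + w c) \<le> F (p, v) + F (p, w)"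
proof -
  have "asymmetric_norm (tangent_space A p) (\<lambda>v. F (p, v))" using finsler by (simp add: C0_Finsler_def)
  then show "v \<in> tangent_space A p \<Longrightarrow> 0 \<le> F (p, v)"
    "v \<in> tangent_space A p \<Longrightarrow> F (p, v) = 0 \<longleftrightarrow> v = (\<lambda>_. 0)"
    "v \<in> tangent_space A p \<Longrightarrow> r > 0 \<Longrightarrow> F (p, \<lambda>c. r *\<^sub>R v c) = r * F (p, v)"
    "v \<in> tangent_space A p \<Longrightarrow> w \<in> tangent_space A p \<Longrightarrow> F (p, \<lambda>c. v c + w c) \<le> F (p, v) + F (p, w)"
    unfolding asymmetric_norm_def by blast+
qed

text \<open>A set is open in the atlas topology if its preimage in every chart is relatively open.
  Continuity of \<open>F\<close>, read in the single chart \<open>tangent_chart A c\<close>, is the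
  claim, since the inverse of this chart is \<open>tangent_of\<close>.\<close>

lemma norm_in_continuous:
  assumes c: "c \<in> A"
  shows "continuous_on (snd c ` fst c \<times> UNIV) (\<lambda>(z, y). norm_in c z y)"
proof -
  let ?X = "atlas_topology (tangent_atlas A)" and ?T = "tangent_chart A c"
  have T: "?T \<in> tangent_atlas A" using c by (simp add: tangent_atlas_def)
  have inT: "inv_into (fst ?T) (snd ?T) (snd c p, y) = (p, tangent_of A c p y)
      \<and> (snd c p, y) \<in> snd ?T ` fst ?T \<and> (p, tangent_of A c p y) \<in> fst ?T" if p: "p \<in> fst c" for p y
  proof -
    have m: "(p, tangent_of A c p y) \<in> fst ?T" using p tangent_of_tangent[OF c p] by (simp add: tangent_chart_def)
    have e: "snd ?T (p, tangent_of A c p y) = (snd c p, y)" using tangent_of_apply[OF c p] by (simp add: tangent_chart_def)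
    have "inj_on (snd ?T) (fst ?T)"
    proof (rule inj_onI)
      fix q q' assume q: "q \<in> fst ?T" "q' \<in> fst ?T" "snd ?T q = snd ?T q'"
      obtain p v p' v' where pv: "q = (p, v)" "q' = (p', v')" by fastforce
      have *: "p \<in> fst c" "p' \<in> fst c" "v \<in> tangent_space A p" "v' \<in> tangent_space A p'" "snd c p = snd c p'" "v c = v' c"
        using q by (auto simp: pv tangent_chart_def)
      then have "p = p'" using inj[OF c] by (auto dest: inj_onD)
      have "v' \<in> tangent_space A p" using *(4) \<open>p = p'\<close> by simp
      then have "v = v'" using tangent_space_cong[OF c *(1) *(3)] *(6) by blast
      with \<open>p = p'\<close> show "q = q'" by (simp add: pv)
    qed
    from inv_into_f_f[OF this m] m e show ?thesis by (metis imageI)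
  qed
  have im: "snd ?T ` fst ?T = snd c ` fst c \<times> UNIV"
  proof (intro equalityI subsetI)
    fix w assume "w \<in> snd ?T ` fst ?T" then show "w \<in> snd c ` fst c \<times> UNIV" by (auto simp: tangent_chart_def)
  next
    fix w :: "(real^'n) \<times> (real^'n)" assume "w \<in> snd c ` fst c \<times> UNIV"
    then obtain p y where "w = (snd c p, y)" "p \<in> fst c" by (cases w) auto
    then show "w \<in> snd ?T ` fst ?T" using inT by blast
  qed
  show ?thesis
    unfolding continuous_openin_preimage_eq
  proof (intro allI impI)
    fix V :: "real set" assume V: "open V"
    have "openin ?X {x \<in> topspace ?X. F x \<in> V}"
      using finsler V by (auto simp: C0_Finsler_def continuous_map_def)
    then have o: "openin (top_of_set (snd ?T ` fst ?T)) {w \<in> snd ?T ` fst ?T. inv_into (fst ?T) (snd ?T) w \<in> {x \<in> topspace ?X. F x \<in> V}}"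
      using T unfolding openin_atlas_topology by blast
    \<comment> \<open>\<open>continuous_map\<close> speaks of points of \<open>topspace\<close>
      only, so the chart domain has to be located in it.\<close>
    have top: "fst ?T \<subseteq> topspace ?X"
    proof -
      have "openin ?X (topspace ?X)" by simp
      have "openin ?X (\<Union>c\<in>tangent_atlas A. fst c)"
        unfolding openin_atlas_topology
      proof (intro conjI ballI)
        fix d assume "d \<in> tangent_atlas A"
        then have "inv_into (fst d) (snd d) z \<in> (\<Union>c\<in>tangent_atlas A. fst c)" if "z \<in> snd d ` fst d" for z
          using inv_into_into[OF that] by blast
        then have "{z \<in> snd d ` fst d. inv_into (fst d) (snd d) z \<in> (\<Union>c\<in>tangent_atlas A. fst c)} = snd d ` fst d"
          by blast
        then show "openin (top_of_set (snd d ` fst d)) {z \<in> snd d ` fst d. inv_into (fst d) (snd d) z \<in> (\<Union>c\<in>tangent_atlas A. fst c)}"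
          by (simp only: openin_subtopology_self)
      qed simp
      then show ?thesis using T openin_subset by blast
    qed
    have "{w \<in> snd ?T ` fst ?T. inv_into (fst ?T) (snd ?T) w \<in> {x \<in> topspace ?X. F x \<in> V}} =
      (snd c ` fst c \<times> UNIV) \<inter> (\<lambda>(z, y). norm_in c z y) -` V"
    proof (rule set_eqI)
      fix w :: "(real^'n) \<times> (real^'n)"
      show "w \<in> {w \<in> snd ?T ` fst ?T. inv_into (fst ?T) (snd ?T) w \<in> {x \<in> topspace ?X. F x \<in> V}} \<longleftrightarrow>
         w \<in> (snd c ` fst c \<times> UNIV) \<inter> (\<lambda>(z, y). norm_in c z y) -` V"
      proof (cases "w \<in> snd c ` fst c \<times> UNIV")
        case True
        then obtain p y where w: "w = (snd c p, y)" "p \<in> fst c" by (cases w) auto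
        have "(p, tangent_of A c p y) \<in> topspace ?X" using inT[OF w(2)] top by blast
        then show ?thesis using inT[OF w(2), of y] norm_in_eq[OF c w(2), of y] True by (simp add: w)
      qed (simp add: im)
    qed
    then show "openin (top_of_set (snd c ` fst c \<times> UNIV)) ((snd c ` fst c \<times> UNIV) \<inter> (\<lambda>(z, y). norm_in c z y) -` V)"
      using o by (simp only: im)
  qed
qed

lemma family_finsler_chart:
  assumes fam: "pontryagin_family A F c f"
  shows "finsler_chart (snd c ` fst c) (norm_in c) (sphere 0 1) f"
proof -
  have c: "c \<in> A" using fam by (simp add: pontryagin_family_def)
  have C1: "C_on (Suc 0) (\<lambda>z. f z u) (snd c ` fst c)" if "u \<in> sphere 0 1" for u
    using fam that unfolding pontryagin_family_def by (metis One_nat_def)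
  have hom: "\<exists>g. homeomorphism (sphere 0 1) ((\<lambda>v. v c) ` unit_sphere A F p) (f (snd c p)) g" if "p \<in> fst c" for p
    using fam that by (simp add: pontryagin_family_def)
  have fc: "continuous_on ((snd c ` fst c) \<times> sphere 0 1) (\<lambda>(z, u). f z u)"
    using fam by (simp add: pontryagin_family_def)
  have Dfc: "continuous_on ((snd c ` fst c) \<times> sphere 0 1) (\<lambda>(z, u). frechet_derivative (\<lambda>z'. f z' u) (at z) (axis i 1))" for i
    using fam by (simp add: pontryagin_family_def)
  have im: "f (snd c p) ` sphere 0 1 = (\<lambda>v. v c) ` unit_sphere A F p" and inj_f: "inj_on (f (snd c p)) (sphere 0 1)" if pc: "p \<in> fst c" for p
  proof -
    obtain g where g: "homeomorphism (sphere 0 1) ((\<lambda>v. v c) ` unit_sphere A F p) (f (snd c p)) g"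
      using hom[OF pc] by blast
    show "f (snd c p) ` sphere 0 1 = (\<lambda>v. v c) ` unit_sphere A F p" using g by (simp add: homeomorphism_def)
    show "inj_on (f (snd c p)) (sphere 0 1)"
      by (rule inj_on_inverseI[of _ g]) (use g in \<open>auto simp: homeomorphism_def\<close>)
  qed
  show ?thesis
  proof
    show "open (snd c ` fst c)" by (rule smooth_structure_chart[OF smooth c])
    show "continuous_on ((snd c ` fst c) \<times> UNIV) (\<lambda>(z, y). norm_in c z y)" by (rule norm_in_continuous[OF c])
    show "compact (sphere 0 1 :: (real^'n) set)" by simp
    show "continuous_on ((snd c ` fst c) \<times> sphere 0 1) (\<lambda>(z, u). f z u)" by (rule fc)
  next
    fix z y assume "z \<in> snd c ` fst c"
    then obtain p where p: "z = snd c p" "p \<in> fst c" by blast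
    show "0 \<le> norm_in c z y" unfolding p(1) norm_in_eq[OF c p(2)] by (rule F_nonneg[OF tangent_of_tangent[OF c p(2)]])
  next
    fix z assume "z \<in> snd c ` fst c"
    then obtain p where p: "z = snd c p" "p \<in> fst c" by blast
    show "norm_in c z 0 = 0" unfolding p(1) norm_in_eq[OF c p(2)] tangent_of_zero[OF c p(2)]
      using F_zero[OF tangent_space_zero] by blast
  next
    fix z y and r :: real assume "z \<in> snd c ` fst c" and r: "0 < r"
    then obtain p where p: "z = snd c p" "p \<in> fst c" by blast
    show "norm_in c z (r *\<^sub>R y) = r * norm_in c z y"
      unfolding p(1) norm_in_eq[OF c p(2)] tangent_of_scale[OF c p(2)] by (rule F_scale[OF tangent_of_tangent[OF c p(2)] r])
  next
    fix z y w assume "z \<in> snd c ` fst c"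
    then obtain p where p: "z = snd c p" "p \<in> fst c" by blast
    show "norm_in c z (y + w) \<le> norm_in c z y + norm_in c z w"
      unfolding p(1) norm_in_eq[OF c p(2)] tangent_of_add[OF c p(2)]
      by (rule F_add[OF tangent_of_tangent[OF c p(2)] tangent_of_tangent[OF c p(2)]])
  next
    fix z and u :: "real^'n" assume z: "z \<in> snd c ` fst c" and u: "u \<in> sphere 0 1"
    then obtain p where p: "z = snd c p" "p \<in> fst c" by blast
    have "f (snd c p) u \<in> (\<lambda>v. v c) ` unit_sphere A F p" using im[OF p(2)] u by blast
    then obtain v where v: "f (snd c p) u = v c" "v \<in> tangent_space A p" "F (p, v) = 1" by (auto simp: unit_sphere_def)
    show "norm_in c z (f z u) = 1" unfolding p(1) v(1) norm_in_tangent[OF c p(2) v(2)] by (rule v(3))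
    show "(\<lambda>z. f z u) differentiable (at z)" by (rule C_on_SucD(1)[OF C1[OF u] z])
  next
    fix z y assume "z \<in> snd c ` fst c" and n: "norm_in c z y = 1"
    then obtain p where p: "z = snd c p" "p \<in> fst c" by blast
    have "tangent_of A c p y \<in> unit_sphere A F p"
      using n tangent_of_tangent[OF c p(2)] unfolding p(1) norm_in_eq[OF c p(2)] by (simp add: unit_sphere_def)
    then have "y \<in> (\<lambda>v. v c) ` unit_sphere A F p" by (rule image_eqI[rotated]) (simp add: tangent_of_apply[OF c p(2)])
    then show "\<exists>u\<in>sphere 0 1. f z u = y" unfolding im[OF p(2), symmetric] p(1) by blast
  next
    fix z assume "z \<in> snd c ` fst c"
    then obtain p where p: "z = snd c p" "p \<in> fst c" by blast
    show "inj_on (f z) (sphere 0 1)" unfolding p(1) by (rule inj_f[OF p(2)])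
  next
    fix e :: "real^'n"
    \<comment> \<open>The family provides continuity of the partial derivatives; a derivative in
      direction \<open>e\<close> is their linear combination with the coordinates of
      \<open>e\<close>.\<close>
    have "continuous_on ((snd c ` fst c) \<times> sphere 0 1)
        (\<lambda>w. \<Sum>i\<in>UNIV. (e $ i) *\<^sub>R (\<lambda>(z, u). frechet_derivative (\<lambda>z'. f z' u) (at z) (axis i 1)) w)"
      by (intro continuous_intros Dfc)
    then show "continuous_on ((snd c ` fst c) \<times> sphere 0 1) (\<lambda>(z, u). frechet_derivative (\<lambda>z'. f z' u) (at z) e)"
    proof (rule continuous_on_eq)
      fix w :: "(real^'n) \<times> (real^'n)" assume "w \<in> (snd c ` fst c) \<times> sphere 0 1"
      then obtain z u where w: "w = (z, u)" "z \<in> snd c ` fst c" "u \<in> sphere 0 1" by blast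
      have lin: "linear (frechet_derivative (\<lambda>z'. f z' u) (at z))"
        using C_on_SucD(1)[OF C1[OF w(3)] w(2)] frechet_derivative_works has_derivative_linear by blast
      have "frechet_derivative (\<lambda>z'. f z' u) (at z) e = frechet_derivative (\<lambda>z'. f z' u) (at z) (\<Sum>i\<in>UNIV. (e $ i) *\<^sub>R axis i 1)"
        using basis_expansion[of e] by (simp add: scalar_mult_eq_scaleR)
      then show "(\<Sum>i\<in>UNIV. (e $ i) *\<^sub>R (\<lambda>(z, u). frechet_derivative (\<lambda>z'. f z' u) (at z) (axis i 1)) w) =
         (\<lambda>(z, u). frechet_derivative (\<lambda>z'. f z' u) (at z) e) w"
        by (simp add: w(1) linear_sum[OF lin] linear_cmul[OF lin])
    qed
  qed
qed

end

section \<open>Cutting a unit speed curve into pieces that lie in one chart\<close>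

locale unit_speed = finsler_manifold A F
  for A :: "('m::{t2_space, second_countable_topology}, real^'n) chart set" and F +
  fixes x :: "real \<Rightarrow> 'm" and a b :: real
  assumes pont: "pontryagin_type A F" and ab: "a < b"
    and ac: "ac_curve A x a b" and arc: "arclength_parameterized A F x a b"
begin

lemma velocity_exists:
  "\<exists>N. negligible N \<and> (\<forall>t\<in>{a..b} - N. \<exists>v. has_velocity A x {a..b} t v \<and> F (x t, v) = 1)"
  using arc unfolding arclength_parameterized_def AE_lebesgue_negligible by blast

definition chart_piece :: "('m, real^'n) chart \<Rightarrow> (real^'n \<Rightarrow> real^'n \<Rightarrow> real^'n) \<Rightarrow> real \<Rightarrow> real \<Rightarrow>
    real \<Rightarrow> (real \<Rightarrow> real^'n) \<Rightarrow> real set \<Rightarrow> bool" where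
  "chart_piece c f s t K u N0 \<longleftrightarrow> pontryagin_family A F c f \<and> a \<le> s \<and> t \<le> b \<and> x ` {s..t} \<subseteq> fst c \<and>
     abs_continuous_on {s..t} (snd c \<circ> x) \<and>
     finsler_trajectory (snd c ` fst c) (norm_in c) (sphere 0 1) f s t K (snd c \<circ> x) u N0"

text \<open>Around \<open>t0\<close> the curve stays in a chart with a Pontryagin family, and
  surjectivity of \<open>f z\<close> onto the unit sphere converts velocities into controls. The
  claim covers all subintervals close to \<open>t0\<close>, as required by the later bisection of
  \<open>[a, b]\<close>.\<close>

lemma chart_piece_exists:
  assumes t0: "t0 \<in> {a..b}"
  shows "\<exists>\<delta>>0. \<forall>s t. a \<le> s \<and> s < t \<and> t \<le> b \<and> t0 - \<delta> \<le> s \<and> t \<le> t0 + \<delta> \<longrightarrow>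
     (\<exists>c f K u N0. chart_piece c f s t K u N0)"
proof -
  obtain c f where cf: "x t0 \<in> fst c" "pontryagin_family A F c f"
    using pont unfolding pontryagin_type_def by blast
  have c: "c \<in> A" using cf(2) by (simp add: pontryagin_family_def)
  interpret fc: finsler_chart "snd c ` fst c" "norm_in c" "sphere 0 1" f by (rule family_finsler_chart[OF cf(2)])
  obtain \<delta>0 where \<delta>0: "\<delta>0 > 0" "x ` ({a..b} \<inter> {t0 - \<delta>0..t0 + \<delta>0}) \<subseteq> fst c"
     "abs_continuous_on ({a..b} \<inter> {t0 - \<delta>0..t0 + \<delta>0}) (snd c \<circ> x)"
    using ac_curve_in_chart[OF ac t0 c cf(1)] by blast
  define lo hi where "lo = max a (t0 - \<delta>0)" and "hi = min b (t0 + \<delta>0)"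
  have Ieq: "{a..b} \<inter> {t0 - \<delta>0..t0 + \<delta>0} = {lo..hi}" by (auto simp: lo_def hi_def)
  define z where "z = snd c \<circ> x"
  have acz: "abs_continuous_on {lo..hi} z" using \<delta>0(3) unfolding Ieq z_def .
  have zc: "continuous_on {lo..hi} z" by (rule abs_continuous_on_imp_continuous_on[OF acz])
  have xin: "x \<tau> \<in> fst c" if "\<tau> \<in> {lo..hi}" for \<tau> using \<delta>0(2) that unfolding Ieq by blast
  have Z: "compact (z ` {lo..hi})" "z ` {lo..hi} \<subseteq> snd c ` fst c"
    using zc xin by (auto simp: z_def intro: compact_continuous_image)
  obtain K where K: "0 \<le> K" "\<And>\<zeta> u w. \<zeta> \<in> z ` {lo..hi} \<Longrightarrow> u \<in> sphere 0 1 \<Longrightarrow> norm (fc.D \<zeta> u w) \<le> K * norm w"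
    by (rule fc.uniform_derivative_bound[OF Z]) (rule that)
  \<comment> \<open>Admissible pieces have length at most twice \<delta>, so
    \<open>K * (t - s) \<le> 1 / 2\<close> holds on them.\<close>
  define \<delta> where "\<delta> = min \<delta>0 (1 / (4 * (K + 1)))"
  have \<delta>: "\<delta> > 0" "\<delta> \<le> \<delta>0" "K * (2 * \<delta>) \<le> 1 / 2"
  proof -
    show "\<delta> > 0" "\<delta> \<le> \<delta>0" using \<delta>0 K by (auto simp: \<delta>_def)
    have "(K + 1) * \<delta> \<le> (K + 1) * (1 / (4 * (K + 1)))" using K(1) by (intro mult_left_mono) (auto simp: \<delta>_def)
    also have "\<dots> = 1 / 4" using K(1) by simp
    finally show "K * (2 * \<delta>) \<le> 1 / 2" using \<open>\<delta> > 0\<close> by (simp add: algebra_simps)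
  qed
  obtain N V where N: "negligible N" and V: "\<And>t. t \<in> {a..b} - N \<Longrightarrow> has_velocity A x {a..b} t (V t) \<and> F (x t, V t) = 1"
    using velocity_exists by metis
  have main: "\<exists>u N0. chart_piece c f s t K u N0" if st: "a \<le> s" "s < t" "t \<le> b" "t0 - \<delta> \<le> s" "t \<le> t0 + \<delta>" for s t
  proof -
    have sub: "{s..t} \<subseteq> {lo..hi}" using st \<delta> by (auto simp: lo_def hi_def)
    let ?S = "{s<..<t} - N"
    have zc': "continuous_on {s..t} z" by (rule continuous_on_subset[OF zc sub])
    have zin: "z \<tau> \<in> snd c ` fst c" if "\<tau> \<in> {s..t}" for \<tau> using Z(2) sub that by blast
    have zd: "(z has_vector_derivative V \<tau> c) (at \<tau>)" if \<tau>: "\<tau> \<in> ?S" for \<tau>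
    proof -
      have "\<tau> \<in> {a..b} - N" and int: "\<tau> \<in> interior {a..b}" and xc: "x \<tau> \<in> fst c"
        using \<tau> st sub xin[of \<tau>] by auto
      then have "(z has_vector_derivative V \<tau> c) (at \<tau> within {a..b})"
        using V c by (simp add: has_velocity_def z_def)
      then show ?thesis using int by (simp only: at_within_interior)
    qed
    define y where "y \<tau> = (if \<tau> \<in> ?S then V \<tau> c else 0)" for \<tau>
    have ym: "y \<in> borel_measurable (lebesgue_on {s..t})"
      unfolding y_def by (rule velocity_measurable[OF zc' N zd])
    \<comment> \<open>An arbitrary control for the times without a known velocity, including both
      end points. The control is then defined everywhere, and the vectors \<open>y'\<close> it
      produces are still measurable.\<close>
    obtain u0 :: "real^'n" where u0: "u0 \<in> sphere 0 1" by (rule that[of "axis undefined 1"]) simp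
    define y' where "y' \<tau> = (if \<tau> \<in> ?S then y \<tau> else f (z \<tau>) u0)" for \<tau>
    have y'm: "y' \<in> borel_measurable (lebesgue_on {s..t})"
      unfolding y'_def
    proof (rule measurable_If_set[OF ym])
      have "continuous_on {s..t} (\<lambda>\<tau>. (\<lambda>(z, u). f z u) (z \<tau>, u0))"
        by (rule continuous_on_compose2[OF fc.f_cont]) (use zin u0 zc' in \<open>auto intro!: continuous_intros\<close>)
      then show "(\<lambda>\<tau>. f (z \<tau>) u0) \<in> borel_measurable (lebesgue_on {s..t})"
        by (intro measurable_continuous_lebesgue_on) simp
      have "?S \<in> sets (lebesgue_on {s..t})"
        using negligible_imp_sets[OF N] by (auto simp: sets_restrict_space_iff fmeasurableD)
      then show "?S \<inter> space (lebesgue_on {s..t}) \<in> sets (lebesgue_on {s..t})" by (rule sets.Int) simp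
    qed
    have "\<exists>u. u \<in> sphere 0 1 \<and> f (z \<tau>) u = y' \<tau>" if \<tau>: "\<tau> \<in> {s..t}" for \<tau>
    proof (cases "\<tau> \<in> ?S")
      case True
      then have \<tau>N: "\<tau> \<in> {a..b} - N" using st by auto
      have xc: "x \<tau> \<in> fst c" using xin \<tau> sub by blast
      have "norm_in c (z \<tau>) (V \<tau> c) = 1"
        using norm_in_tangent[OF c xc, of "V \<tau>"] V[OF \<tau>N] by (simp add: z_def has_velocity_def)
      from fc.f_surj[OF zin[OF \<tau>] this] obtain u where "u \<in> sphere 0 1" "f (z \<tau>) u = V \<tau> c" by blast
      then show ?thesis using True by (intro exI[of _ u]) (simp add: y'_def y_def)
    qed (use u0 in \<open>auto simp: y'_def\<close>)
    then obtain u where u: "\<And>\<tau>. \<tau> \<in> {s..t} \<Longrightarrow> u \<tau> \<in> sphere 0 1 \<and> f (z \<tau>) (u \<tau>) = y' \<tau>" by metis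
    have "finsler_trajectory (snd c ` fst c) (norm_in c) (sphere 0 1) f s t K z u N"
    proof (unfold_locales)
      show "s < t" "continuous_on {s..t} z" "negligible N" "0 \<le> K" by fact+
      show "z \<tau> \<in> snd c ` fst c" if "\<tau> \<in> {s..t}" for \<tau> by (rule zin[OF that])
      show "u \<tau> \<in> sphere 0 1" if "\<tau> \<in> {s..t}" for \<tau> using u[OF that] by blast
      show "(z has_vector_derivative f (z \<tau>) (u \<tau>)) (at \<tau>)" if "\<tau> \<in> ?S" for \<tau>
        using zd[OF that] u[of \<tau>] that by (simp add: y'_def y_def)
      show "(\<lambda>\<tau>. G (z \<tau>, u \<tau>)) \<in> borel_measurable (lebesgue_on {s..t})"
        if "continuous_on (snd c ` fst c \<times> sphere 0 1) G" for G :: "(real^'n) \<times> (real^'n) \<Rightarrow> real^'n"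
        by (rule fc.measurable_control[OF zc' _ y'm u that]) (use zin in auto)
      show "norm (fc.D (z \<tau>) (u \<tau>) w) \<le> K * norm w" if "\<tau> \<in> {s..t}" for \<tau> w
        by (rule K(2)) (use that sub u[OF that] in auto)
      have "K * (t - s) \<le> K * (2 * \<delta>)" using st K(1) by (intro mult_left_mono) auto
      then show "K * (t - s) \<le> 1 / 2" using \<delta>(3) by linarith
    qed
    moreover have "abs_continuous_on {s..t} z" by (rule abs_continuous_on_subset[OF acz sub])
    moreover have "x ` {s..t} \<subseteq> fst c" using xin sub by blast
    ultimately show ?thesis using cf(2) st unfolding chart_piece_def z_def by blast
  qed
  show ?thesis
  proof (intro exI[of _ \<delta>] conjI allI impI)
    show "\<delta> > 0" by (rule \<delta>(1))
    fix s t assume "a \<le> s \<and> s < t \<and> t \<le> b \<and> t0 - \<delta> \<le> s \<and> t \<le> t0 + \<delta>"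
    then obtain u N0 where "chart_piece c f s t K u N0" using main[of s t] by blast
    then show "\<exists>c f K u N0. chart_piece c f s t K u N0" by (intro exI)
  qed
qed

end

section \<open>First order variations of a unit speed curve\<close>

lemma has_velocity_interior:
  assumes "\<tau> \<in> {s<..<t}"
  shows "has_velocity B \<gamma> {s..t} \<tau> v \<longleftrightarrow> has_velocity B \<gamma> UNIV \<tau> v"
proof -
  have "at \<tau> within {s..t} = at \<tau>" using assms by (intro at_within_interior) auto
  then show ?thesis by (simp add: has_velocity_def)
qed

lemma has_velocity_local:
  assumes v: "has_velocity B \<gamma> UNIV \<tau> v" and S: "open S" "\<tau> \<in> S" and eq: "\<And>\<sigma>. \<sigma> \<in> S \<Longrightarrow> \<gamma> \<sigma> = \<gamma>' \<sigma>"
  shows "has_velocity B \<gamma>' UNIV \<tau> v"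
  unfolding has_velocity_def
proof (intro conjI ballI impI)
  have \<tau>: "\<gamma>' \<tau> = \<gamma> \<tau>" using eq[OF S(2)] by simp
  show "v \<in> tangent_space B (\<gamma>' \<tau>)" using v \<tau> by (simp add: has_velocity_def)
  fix c assume "c \<in> B" "\<gamma>' \<tau> \<in> fst c"
  then have "((snd c \<circ> \<gamma>) has_vector_derivative v c) (at \<tau>)" using v \<tau> by (simp add: has_velocity_def)
  then show "((snd c \<circ> \<gamma>') has_vector_derivative v c) (at \<tau>)"
    by (rule has_vector_derivative_transform_within_open[OF _ S]) (simp add: eq)
qed

context finsler_manifold
begin

text \<open>A majorant of the speed avoids the question whether the speed itself is measurable.\<close>

definition cost_bounded :: "(real \<Rightarrow> 'm) \<Rightarrow> real \<Rightarrow> real \<Rightarrow> real \<Rightarrow> bool" where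
  "cost_bounded y s t C \<longleftrightarrow> (\<exists>\<beta> N. negligible N \<and> \<beta> integrable_on {s..t} \<and> integral {s..t} \<beta> \<le> C \<and>
     (\<forall>\<tau>\<in>{s<..<t} - N. \<exists>v. has_velocity A y UNIV \<tau> v \<and> F (y \<tau>, v) \<le> \<beta> \<tau>))"

lemma cost_bounded_concat:
  assumes "cost_bounded y s t C" "cost_bounded y' t r C'" "s \<le> t" "t \<le> r"
  shows "cost_bounded (\<lambda>\<tau>. if \<tau> \<le> t then y \<tau> else y' \<tau>) s r (C + C')"
proof -
  let ?y = "\<lambda>\<tau>. if \<tau> \<le> t then y \<tau> else y' \<tau>"
  obtain \<beta> N where 1: "negligible N" "\<beta> integrable_on {s..t}" "integral {s..t} \<beta> \<le> C"
     "\<And>\<tau>. \<tau> \<in> {s<..<t} - N \<Longrightarrow> \<exists>v. has_velocity A y UNIV \<tau> v \<and> F (y \<tau>, v) \<le> \<beta> \<tau>"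
    using assms(1) unfolding cost_bounded_def by blast
  obtain \<beta>' N' where 2: "negligible N'" "\<beta>' integrable_on {t..r}" "integral {t..r} \<beta>' \<le> C'"
     "\<And>\<tau>. \<tau> \<in> {t<..<r} - N' \<Longrightarrow> \<exists>v. has_velocity A y' UNIV \<tau> v \<and> F (y' \<tau>, v) \<le> \<beta>' \<tau>"
    using assms(2) unfolding cost_bounded_def by blast
  define g where "g \<tau> = (if \<tau> \<le> t then \<beta> \<tau> else \<beta>' \<tau>)" for \<tau>
  have g1: "(g has_integral integral {s..t} \<beta>) {s..t}"
    using integrable_integral[OF 1(2)] by (rule has_integral_eq[rotated]) (simp add: g_def)
  have g2: "(g has_integral integral {t..r} \<beta>') {t..r}"
    using integrable_integral[OF 2(2)]
    by (rule has_integral_spike_finite[of "{t}", rotated 2]) (auto simp: g_def)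
  have g: "(g has_integral integral {s..t} \<beta> + integral {t..r} \<beta>') {s..r}"
    by (rule has_integral_combine[OF assms(3,4) g1 g2])
  have "\<exists>v. has_velocity A ?y UNIV \<tau> v \<and> F (?y \<tau>, v) \<le> g \<tau>" if \<tau>: "\<tau> \<in> {s<..<r} - (N \<union> N' \<union> {t})" for \<tau>
  proof (cases "\<tau> < t")
    case True
    then obtain v where v: "has_velocity A y UNIV \<tau> v" "F (y \<tau>, v) \<le> \<beta> \<tau>" using 1(4)[of \<tau>] \<tau> by auto
    have "has_velocity A ?y UNIV \<tau> v"
      by (rule has_velocity_local[OF v(1), of "{..<t}"]) (use True in auto)
    then show ?thesis using v(2) True by (auto simp: g_def)
  next
    case False
    then have gt: "t < \<tau>" using \<tau> by auto
    then obtain v where v: "has_velocity A y' UNIV \<tau> v" "F (y' \<tau>, v) \<le> \<beta>' \<tau>" using 2(4)[of \<tau>] \<tau> by auto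
    have "has_velocity A ?y UNIV \<tau> v"
      by (rule has_velocity_local[OF v(1), of "{t<..}"]) (use gt in auto)
    then show ?thesis using v(2) gt by (auto simp: g_def)
  qed
  moreover have "negligible (N \<union> N' \<union> {t})" using 1 2 by auto
  moreover have "integral {s..r} g \<le> C + C'" using integral_unique[OF g] 1(3) 2(3) by simp
  ultimately show ?thesis using g unfolding cost_bounded_def by blast
qed

text \<open>Where the velocity exists, the speed lies between 0 and the majorant. If the speed is
  integrable, integrals are compared; if not, the integral is 0 by convention, and the majorant has
  a nonnegative integral.\<close>

lemma curve_length_le:
  assumes "cost_bounded y s t C" "s < t"
  shows "curve_length A F y s t \<le> C"
proof -
  obtain \<beta> N where 1: "negligible N" "\<beta> integrable_on {s..t}" "integral {s..t} \<beta> \<le> C"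
     "\<And>\<tau>. \<tau> \<in> {s<..<t} - N \<Longrightarrow> \<exists>v. has_velocity A y UNIV \<tau> v \<and> F (y \<tau>, v) \<le> \<beta> \<tau>"
    using assms(1) unfolding cost_bounded_def by blast
  let ?g = "\<lambda>\<tau>. F (y \<tau>, velocity A y {s..t} \<tau>)"
  have g: "0 \<le> ?g \<tau> \<and> ?g \<tau> \<le> \<beta> \<tau>" if \<tau>: "\<tau> \<in> {s..t} - (N \<union> {s, t})" for \<tau>
  proof -
    have i: "\<tau> \<in> {s<..<t}" using \<tau> by auto
    then obtain v where v: "has_velocity A y UNIV \<tau> v" "F (y \<tau>, v) \<le> \<beta> \<tau>" using 1(4)[of \<tau>] \<tau> by auto
    then have "velocity A y {s..t} \<tau> = v"
      using has_velocity_interior[OF i] i by (intro velocity_eq \<open>s < t\<close>) auto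
    then show ?thesis using v F_nonneg[of v "y \<tau>"] by (simp add: has_velocity_def)
  qed
  define \<beta>' where "\<beta>' \<tau> = (if \<tau> \<in> N \<union> {s, t} then 0 else \<beta> \<tau>)" for \<tau>
  define g' where "g' \<tau> = (if \<tau> \<in> N \<union> {s, t} then 0 else ?g \<tau>)" for \<tau>
  have neg: "negligible (N \<union> {s, t})" using 1(1) by auto
  have b: "(\<beta>' has_integral integral {s..t} \<beta>) {s..t}"
    by (rule has_integral_spike[OF neg _ integrable_integral[OF 1(2)]]) (simp add: \<beta>'_def)
  show ?thesis
  proof (cases "?g integrable_on {s..t}")
    case True
    have "(g' has_integral integral {s..t} ?g) {s..t}"
      by (rule has_integral_spike[OF neg _ integrable_integral[OF True]]) (simp add: g'_def)
    then have "integral {s..t} ?g \<le> integral {s..t} \<beta>"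
      by (rule has_integral_le[OF _ b]) (use g in \<open>auto simp: g'_def \<beta>'_def\<close>)
    then show ?thesis using 1(3) by (simp add: curve_length_def)
  next
    case False
    have "0 \<le> integral {s..t} \<beta>"
    proof (rule has_integral_nonneg[OF b])
      fix \<tau> assume "\<tau> \<in> {s..t}"
      then show "0 \<le> \<beta>' \<tau>" using g[of \<tau>] by (cases "\<tau> \<in> N \<union> {s, t}") (auto simp: \<beta>'_def)
    qed
    then show ?thesis using 1(3) not_integrable_integral[OF False] by (simp add: curve_length_def)
  qed
qed

text \<open>Makes the set of lengths in \<open>minimizing\<close> bounded below; the real
  \<open>Inf\<close> of an unbounded set would give no comparison.\<close>

lemma curve_length_nonneg:
  assumes "ac_curve A y s t" "s < t"
  shows "0 \<le> curve_length A F y s t"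
proof -
  let ?N = "{\<tau> \<in> {s<..<t}. \<not> (\<exists>v. has_velocity A y {s..t} \<tau> v)} \<union> {s, t}"
  let ?g = "\<lambda>\<tau>. F (y \<tau>, velocity A y {s..t} \<tau>)"
  have N: "negligible ?N" using ac_curve_velocity_ae[OF assms(1)] by (intro negligible_Un) auto
  have g: "0 \<le> ?g \<tau>" if \<tau>: "\<tau> \<in> {s..t} - ?N" for \<tau>
  proof -
    obtain v where v: "has_velocity A y {s..t} \<tau> v" using \<tau> by force
    then have "velocity A y {s..t} \<tau> = v" using \<tau> by (intro velocity_eq \<open>s < t\<close>) auto
    then show ?thesis using v F_nonneg[of v "y \<tau>"] by (simp add: has_velocity_def)
  qed
  show ?thesis
  proof (cases "?g integrable_on {s..t}")
    case True
    have "((\<lambda>\<tau>. if \<tau> \<in> ?N then 0 else ?g \<tau>) has_integral integral {s..t} ?g) {s..t}"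
      by (rule has_integral_spike[OF N _ integrable_integral[OF True]]) (simp only: Diff_iff if_False)
    then have "0 \<le> integral {s..t} ?g"
    proof (rule has_integral_nonneg)
      fix \<tau> assume "\<tau> \<in> {s..t}"
      then show "0 \<le> (if \<tau> \<in> ?N then 0 else ?g \<tau>)" using g[of \<tau>] by (cases "\<tau> \<in> ?N") simp_all
    qed
    then show ?thesis by (simp add: curve_length_def)
  qed (simp add: curve_length_def not_integrable_integral)
qed

text \<open>A family of points that starts at \<open>p\<close> with one-sided velocity
  \<open>V\<close>. Remaining in a chart for small \<epsilon> is demanded separately, because a
  derivative of coordinates says nothing about points outside the chart domain.\<close>

definition first_order :: "(real \<Rightarrow> 'm) \<Rightarrow> 'm \<Rightarrow> ('m, real^'n) tvec \<Rightarrow> bool" where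
  "first_order q p V \<longleftrightarrow> q 0 = p \<and> (\<exists>c\<in>A. p \<in> fst c \<and> (\<forall>\<^sub>F \<epsilon> in at_right 0. q \<epsilon> \<in> fst c)) \<and>
     has_velocity A q {0..} 0 V"

lemma at_within_atLeast: "at (0::real) within {0..} = at_right 0"
proof -
  have "{0..} - {0} = {0::real<..} - {0}" by auto
  then show ?thesis by (simp add: at_within_def)
qed

lemma first_order_chart:
  assumes q: "first_order q p V" and c: "c \<in> A" "p \<in> fst c"
  shows "\<forall>\<^sub>F \<epsilon> in at_right 0. q \<epsilon> \<in> fst c"
proof -
  obtain d where d: "d \<in> A" "p \<in> fst d" "\<forall>\<^sub>F \<epsilon> in at_right 0. q \<epsilon> \<in> fst d" and q0: "q 0 = p" and v: "has_velocity A q {0..} 0 V"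
    using q unfolding first_order_def by blast
  have "((snd d \<circ> q) has_vector_derivative V d) (at 0 within {0..})" using v d q0 by (simp add: has_velocity_def)
  then have "continuous (at 0 within {0..}) (snd d \<circ> q)" by (rule has_vector_derivative_continuous)
  then have "((\<lambda>\<epsilon>. snd d (q \<epsilon>)) \<longlongrightarrow> snd d (q 0)) (at_right 0)"
    by (simp add: continuous_within at_within_atLeast o_def)
  from eventually_in_chart[OF d(1) c(1) _ _ d(3) this] show ?thesis using d c q0 by simp
qed

text \<open>The bound has the form that \<open>first_order_estimate\<close> demands of the end point
  corrections, with the same arbitrary factor \<rho>.\<close>

lemma first_order_remainder:
  assumes q: "first_order q p V" and c: "c \<in> A" "p \<in> fst c" and \<rho>: "\<rho> > 0"
  shows "\<forall>\<^sub>F \<epsilon> in at_right 0. norm (snd c (q \<epsilon>) - snd c p - \<epsilon> *\<^sub>R V c) \<le> \<rho> * \<epsilon>"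
proof -
  have "((snd c \<circ> q) has_vector_derivative V c) (at 0 within {0..})" and q0: "q 0 = p"
    using q c by (auto simp: has_velocity_def first_order_def)
  then have "\<exists>d>0. \<forall>y\<in>{0..}. norm (y - 0) < d \<longrightarrow> norm ((snd c \<circ> q) y - (snd c \<circ> q) 0 - (y - 0) *\<^sub>R V c) \<le> \<rho> * norm (y - 0)"
    using \<rho> unfolding has_vector_derivative_def has_derivative_within_alt by blast
  then obtain d where d: "d > 0" "\<And>y. 0 \<le> y \<Longrightarrow> \<bar>y\<bar> < d \<Longrightarrow> norm (snd c (q y) - snd c p - y *\<^sub>R V c) \<le> \<rho> * \<bar>y\<bar>"
    using q0 by auto
  show ?thesis
    unfolding eventually_at_right_field using d by (intro exI[of _ d]) (auto dest: spec)
qed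

text \<open>A straight segment in one chart. Such a family serves as the common intermediate end
  point when two pieces are joined.\<close>

lemma first_order_exists:
  assumes V: "V \<in> tangent_space A p"
  shows "\<exists>q. first_order q p V"
proof -
  have "p \<in> (\<Union>c\<in>A. fst c)" using smooth by (simp add: smooth_structure_def)
  then obtain c where c: "c \<in> A" "p \<in> fst c" by blast
  let ?i = "inv_into (fst c) (snd c)" and ?w = "\<lambda>\<epsilon>. snd c p + \<epsilon> *\<^sub>R V c"
  define q where "q \<epsilon> = ?i (?w \<epsilon>)" for \<epsilon> :: real
  have q0: "q 0 = p" using inj[OF c(1)] c(2) by (simp add: q_def)
  have op: "open (snd c ` fst c)" by (rule smooth_structure_chart[OF smooth c(1)])
  have "(?w \<longlongrightarrow> snd c p + 0 *\<^sub>R V c) (at 0)" by (intro tendsto_intros)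
  then have ev: "\<forall>\<^sub>F \<epsilon> in at 0. ?w \<epsilon> \<in> snd c ` fst c"
    using topological_tendstoD[of ?w _ "at 0", OF _ op] c(2) by simp
  have evq: "\<forall>\<^sub>F \<epsilon> in at 0. q \<epsilon> \<in> fst c \<and> snd c (q \<epsilon>) = ?w \<epsilon>"
    using ev by eventually_elim (simp add: q_def inv_into_into f_inv_into_f)
  have le: "at (0::real) within S \<le> at 0" for S by (rule at_le) simp
  have "(?w has_derivative (\<lambda>h. h *\<^sub>R V c)) (at 0 within {0..})"
    by (auto intro!: derivative_eq_intros)
  then have "((snd c \<circ> q) has_derivative (\<lambda>h. h *\<^sub>R V c)) (at 0 within {0..})"
  proof (rule has_derivative_transform_eventually)
    show "\<forall>\<^sub>F \<epsilon> in at 0 within {0..}. ?w \<epsilon> = (snd c \<circ> q) \<epsilon>"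
      using filter_leD[OF le evq] by eventually_elim simp
  qed (use q0 in auto)
  then have "((snd c \<circ> q) has_vector_derivative V c) (at 0 within {0..})" by (simp add: has_vector_derivative_def)
  moreover have "\<forall>\<^sub>F \<epsilon> in at 0 within {0..}. q \<epsilon> \<in> fst c"
    using filter_leD[OF le evq] by eventually_elim simp
  ultimately have "has_velocity A q {0..} 0 (tangent_of A c (q 0) (V c))"
    using c q0 by (intro has_velocity_of_chart) auto
  then have "has_velocity A q {0..} 0 V" using q0 tangent_space_eq[OF c V] by simp
  moreover have "\<forall>\<^sub>F \<epsilon> in at_right 0. q \<epsilon> \<in> fst c"
    using filter_leD[OF le evq] by eventually_elim simp
  ultimately show ?thesis using q0 c unfolding first_order_def by blast
qed

lemma first_order_const: "first_order (\<lambda>_. p) p (\<lambda>_. 0)"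
proof -
  have "p \<in> (\<Union>c\<in>A. fst c)" using smooth by (simp add: smooth_structure_def)
  then obtain c where c: "c \<in> A" "p \<in> fst c" by blast
  have "has_velocity A (\<lambda>_. p) {0::real..} 0 (\<lambda>_. 0)"
    unfolding has_velocity_def using tangent_space_zero by (auto simp: o_def)
  then show ?thesis using c unfolding first_order_def by auto
qed

end

context unit_speed
begin

text \<open>Up to order \<open>o(\<epsilon>)\<close>, the length grows by at most \<open>\<epsilon> k\<close> when the end points are displaced by
  \<open>\<epsilon> V\<close> and \<open>\<epsilon> W\<close>. Quantifying over all families of end points with these velocities makes the
  relation transitive.\<close>

definition reach :: "real \<Rightarrow> real \<Rightarrow> ('m, real^'n) tvec \<Rightarrow> ('m, real^'n) tvec \<Rightarrow> real \<Rightarrow> bool" where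
  "reach s t V W k \<longleftrightarrow> (\<forall>q r \<delta>. first_order q (x s) V \<and> first_order r (x t) W \<and> \<delta> > 0 \<longrightarrow>
     (\<forall>\<^sub>F \<epsilon> in at_right 0. \<exists>y. ac_curve A y s t \<and> y s = q \<epsilon> \<and> y t = r \<epsilon> \<and> cost_bounded y s t ((t - s) + \<epsilon> * (k + \<delta>))))"

text \<open>One family \<open>m\<close> of intermediate points with velocity \<open>W\<close> is
  fixed and used as final points on the left and as initial points on the right. Since
  \<open>reach\<close> admits all families, the curves fit together exactly; each piece gets half of
  \<delta>.\<close>

lemma reach_trans:
  assumes 1: "reach s t V W k" and 2: "reach t r W X k'" and W: "W \<in> tangent_space A (x t)" and str: "s \<le> t" "t \<le> r"
  shows "reach s r V X (k + k')"
  unfolding reach_def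
proof (intro allI impI, elim conjE)
  fix q q' and \<delta> :: real assume q: "first_order q (x s) V" and q': "first_order q' (x r) X" and \<delta>: "\<delta> > 0"
  obtain m where m: "first_order m (x t) W" using first_order_exists[OF W] by blast
  have d2: "\<delta> / 2 > 0" using \<delta> by simp
  have e1: "\<forall>\<^sub>F \<epsilon> in at_right 0. \<exists>y. ac_curve A y s t \<and> y s = q \<epsilon> \<and> y t = m \<epsilon> \<and> cost_bounded y s t ((t - s) + \<epsilon> * (k + \<delta> / 2))"
    using 1 q m d2 unfolding reach_def by blast
  have e2: "\<forall>\<^sub>F \<epsilon> in at_right 0. \<exists>y. ac_curve A y t r \<and> y t = m \<epsilon> \<and> y r = q' \<epsilon> \<and> cost_bounded y t r ((r - t) + \<epsilon> * (k' + \<delta> / 2))"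
    using 2 q' m d2 unfolding reach_def by blast
  show "\<forall>\<^sub>F \<epsilon> in at_right 0. \<exists>y. ac_curve A y s r \<and> y s = q \<epsilon> \<and> y r = q' \<epsilon> \<and> cost_bounded y s r ((r - s) + \<epsilon> * (k + k' + \<delta>))"
    using e1 e2
  proof eventually_elim
    case (elim \<epsilon>)
    obtain y where y: "ac_curve A y s t" "y s = q \<epsilon>" "y t = m \<epsilon>" "cost_bounded y s t ((t - s) + \<epsilon> * (k + \<delta> / 2))"
      using elim by blast
    obtain y' where y': "ac_curve A y' t r" "y' t = m \<epsilon>" "y' r = q' \<epsilon>" "cost_bounded y' t r ((r - t) + \<epsilon> * (k' + \<delta> / 2))"
      using elim by blast
    let ?y = "\<lambda>\<tau>. if \<tau> \<le> t then y \<tau> else y' \<tau>"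
    have "ac_curve A ?y s r"
    proof (rule ac_curve_concat[OF _ _ str])
      show "ac_curve A ?y s t" by (rule ac_curve_cong[OF y(1)]) simp
      show "ac_curve A ?y t r" by (rule ac_curve_cong[OF y'(1)]) (use y(3) y'(2) in auto)
    qed
    moreover have "cost_bounded ?y s r ((t - s) + \<epsilon> * (k + \<delta> / 2) + ((r - t) + \<epsilon> * (k' + \<delta> / 2)))"
      by (rule cost_bounded_concat[OF y(4) y'(4) str])
    moreover have "(t - s) + \<epsilon> * (k + \<delta> / 2) + ((r - t) + \<epsilon> * (k' + \<delta> / 2)) = (r - s) + \<epsilon> * (k + k' + \<delta>)"
      by (simp add: algebra_simps)
    moreover have "?y s = q \<epsilon>" using y(2) str by simp
    moreover have "?y r = q' \<epsilon>"
    proof (cases "r = t")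
      case True
      then show ?thesis using y(3) y'(2,3) by simp
    next
      case False
      then show ?thesis using y'(3) str by simp
    qed
    ultimately show ?case by (intro exI[of _ ?y]) simp
  qed
qed

text \<open>The prescribed end points differ from the displacements \<epsilon> \<open>v s\<close>
  and \<epsilon> \<open>v t\<close> by o(\<epsilon>), so they are reached by the corrections
  \<open>e0\<close> and \<open>e1\<close>. The perturbed curve is pulled back by the chart, and the
  pointwise speed bound is integrated.\<close>

lemma reach_chart_piece:
  assumes piece: "chart_piece c f s t K u N0"
    and v: "finsler_trajectory.variation_eq f s t (snd c \<circ> x) u v \<eta> \<mu>" and \<eta>: "continuous_on {s..t} \<eta>" and \<mu>: "0 \<le> \<mu>"
    and V: "v s = V c" and W: "v t = W c"
    and k: "integral {s..t} (\<lambda>\<tau>. norm_in c (snd c (x \<tau>)) (\<eta> \<tau>)) - \<mu> * (t - s) \<le> k"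
  shows "reach s t V W k"
  unfolding reach_def
proof (intro allI impI, elim conjE)
  fix q r and \<delta> :: real assume q: "first_order q (x s) V" and r: "first_order r (x t) W" and \<delta>: "\<delta> > 0"
  interpret ft: finsler_trajectory "snd c ` fst c" "norm_in c" "sphere 0 1" f s t K "snd c \<circ> x" u N0
    using piece by (simp add: chart_piece_def)
  have c: "c \<in> A" using piece by (simp add: chart_piece_def pontryagin_family_def)
  have acz: "abs_continuous_on {s..t} (snd c \<circ> x)" using piece by (simp add: chart_piece_def)
  have xin: "x \<tau> \<in> fst c" if "\<tau> \<in> {s..t}" for \<tau> using piece that by (auto simp: chart_piece_def)
  have st: "s < t" by (rule ft.st)
  \<comment> \<open>A pointwise excess that integrates to \<delta> over
    \<open>[s, t]\<close>.\<close>
  define \<delta>' where "\<delta>' = \<delta> / (t - s)"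
  have \<delta>': "\<delta>' > 0" "\<delta>' * (t - s) = \<delta>" using \<delta> st by (auto simp: \<delta>'_def)
  obtain \<epsilon>0 \<rho> N1 where e: "\<epsilon>0 > 0" "\<rho> > 0" "negligible N1"
    "\<And>\<epsilon> e0 e1 \<tau>. 0 < \<epsilon> \<Longrightarrow> \<epsilon> < \<epsilon>0 \<Longrightarrow> norm e0 \<le> \<rho> * \<epsilon> \<Longrightarrow> norm e1 \<le> \<rho> * \<epsilon> \<Longrightarrow> \<tau> \<in> {s..t} \<Longrightarrow>
        ft.perturb v \<epsilon> e0 e1 \<tau> \<in> snd c ` fst c \<and>
        (\<tau> \<in> {s<..<t} - N1 \<longrightarrow> (\<exists>w. (ft.perturb v \<epsilon> e0 e1 has_vector_derivative w) (at \<tau>) \<and>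
           norm_in c (ft.perturb v \<epsilon> e0 e1 \<tau>) w \<le> 1 + \<epsilon> * (norm_in c ((snd c \<circ> x) \<tau>) (\<eta> \<tau>) - \<mu> + \<delta>')))"
    by (rule ft.first_order_estimate[OF v \<eta> \<mu> \<delta>'(1)]) (rule that)
  have s: "s \<in> {s..t}" and t: "t \<in> {s..t}" using st by auto
  have ev0: "\<forall>\<^sub>F \<epsilon> in at_right (0::real). 0 < \<epsilon> \<and> \<epsilon> < \<epsilon>0"
    using e(1) unfolding eventually_at_right_field by blast
  show "\<forall>\<^sub>F \<epsilon> in at_right 0. \<exists>y. ac_curve A y s t \<and> y s = q \<epsilon> \<and> y t = r \<epsilon> \<and> cost_bounded y s t ((t - s) + \<epsilon> * (k + \<delta>))"
    using ev0 first_order_chart[OF q c xin[OF s]] first_order_chart[OF r c xin[OF t]]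
      first_order_remainder[OF q c xin[OF s] e(2)] first_order_remainder[OF r c xin[OF t] e(2)]
  proof eventually_elim
    case (elim \<epsilon>)
    define e0 e1 where "e0 = snd c (q \<epsilon>) - snd c (x s) - \<epsilon> *\<^sub>R V c" and "e1 = snd c (r \<epsilon>) - snd c (x t) - \<epsilon> *\<^sub>R W c"
    define w where "w = ft.perturb v \<epsilon> e0 e1"
    have est: "w \<tau> \<in> snd c ` fst c \<and> (\<tau> \<in> {s<..<t} - N1 \<longrightarrow> (\<exists>w'. (w has_vector_derivative w') (at \<tau>) \<and>
           norm_in c (w \<tau>) w' \<le> 1 + \<epsilon> * (norm_in c ((snd c \<circ> x) \<tau>) (\<eta> \<tau>) - \<mu> + \<delta>')))" if "\<tau> \<in> {s..t}" for \<tau>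
      unfolding w_def by (rule e(4)) (use elim that in \<open>auto simp: e0_def e1_def\<close>)
    define y where "y \<tau> = inv_into (fst c) (snd c) (w \<tau>)" for \<tau>
    have yin: "y \<tau> \<in> fst c" and yw: "snd c (y \<tau>) = w \<tau>" if "\<tau> \<in> {s..t}" for \<tau>
      using est[OF that] by (auto simp: y_def inv_into_into f_inv_into_f)
    have ys: "y s = q \<epsilon>"
    proof -
      have "w s = snd c (q \<epsilon>)" unfolding w_def ft.perturb_ends(1) by (simp add: e0_def V)
      then show ?thesis using inj[OF c] elim by (simp add: y_def)
    qed
    have yt: "y t = r \<epsilon>"
    proof -
      have "w t = snd c (r \<epsilon>)" unfolding w_def ft.perturb_ends(2) by (simp add: e1_def W)
      then show ?thesis using inj[OF c] elim by (simp add: y_def)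
    qed
    obtain L where L: "L-lipschitz_on {s..t} v" using v unfolding ft.variation_eq_def by blast
    have "abs_continuous_on {s..t} w"
    proof -
      have a1: "abs_continuous_on {s..t} (\<lambda>\<tau>. \<epsilon> *\<^sub>R v \<tau>)"
        by (rule lipschitz_imp_abs_continuous_on[OF lipschitz_on_cmult[OF L]])
      have a2: "abs_continuous_on {s..t} (\<lambda>\<tau>. ((t - \<tau>) / (t - s)) *\<^sub>R e0 + ((\<tau> - s) / (t - s)) *\<^sub>R e1)"
      proof (rule abs_continuous_on_dominated[OF abs_continuous_on_id abs_continuous_on_id, of _ _ _ "norm (e1 - e0) / (t - s)"])
        fix \<sigma> \<tau> :: real
        have "((t - \<sigma>) / (t - s)) *\<^sub>R e0 + ((\<sigma> - s) / (t - s)) *\<^sub>R e1 - (((t - \<tau>) / (t - s)) *\<^sub>R e0 + ((\<tau> - s) / (t - s)) *\<^sub>R e1)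
          = ((\<sigma> - \<tau>) / (t - s)) *\<^sub>R (e1 - e0)"
          by (simp add: diff_divide_distrib algebra_simps)
        then have "norm (((t - \<sigma>) / (t - s)) *\<^sub>R e0 + ((\<sigma> - s) / (t - s)) *\<^sub>R e1 - (((t - \<tau>) / (t - s)) *\<^sub>R e0 + ((\<tau> - s) / (t - s)) *\<^sub>R e1))
          = norm (e1 - e0) / (t - s) * norm (\<sigma> - \<tau>)" using st by (simp add: mult.commute)
        moreover have "0 \<le> norm (e1 - e0) / (t - s) * norm (\<sigma> - \<tau>)" using st by simp
        ultimately show "norm (((t - \<sigma>) / (t - s)) *\<^sub>R e0 + ((\<sigma> - s) / (t - s)) *\<^sub>R e1 - (((t - \<tau>) / (t - s)) *\<^sub>R e0 + ((\<tau> - s) / (t - s)) *\<^sub>R e1))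
          \<le> norm (e1 - e0) / (t - s) * norm (\<sigma> - \<tau>) + norm (e1 - e0) / (t - s) * norm (\<sigma> - \<tau>)" by linarith
      qed
      show ?thesis
        unfolding w_def ft.perturb_def[abs_def] by (intro abs_continuous_on_add acz a1 a2)
    qed
    then have "abs_continuous_on {s..t} (snd c \<circ> y)"
      by (rule abs_continuous_on_cong) (simp add: yw)
    then have "ac_curve A y s t" using yin by (intro ac_curveI_chart[OF c]) auto
    moreover have "cost_bounded y s t ((t - s) + \<epsilon> * (k + \<delta>))"
    proof -
      let ?n = "\<lambda>\<tau>. norm_in c (snd c (x \<tau>)) (\<eta> \<tau>)"
      let ?\<beta> = "\<lambda>\<tau>. 1 + \<epsilon> * (?n \<tau> - \<mu> + \<delta>')"
      have ni: "?n integrable_on {s..t}"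
        using ft.N_inner_continuous[OF \<eta>] by (intro integrable_continuous_real) simp
      have i: "(?\<beta> has_integral ((t - s) + \<epsilon> * (integral {s..t} ?n - (t - s) * \<mu> + (t - s) * \<delta>'))) {s..t}"
      proof (rule has_integral_add)
        show "((\<lambda>\<tau>. 1) has_integral (t - s)) {s..t}" using has_integral_const_real[of "1::real" s t] st by simp
        show "((\<lambda>\<tau>. \<epsilon> * (?n \<tau> - \<mu> + \<delta>')) has_integral \<epsilon> * (integral {s..t} ?n - (t - s) * \<mu> + (t - s) * \<delta>')) {s..t}"
          using has_integral_const_real[of \<mu> s t] has_integral_const_real[of \<delta>' s t] st
          by (intro has_integral_mult_right has_integral_add has_integral_diff integrable_integral[OF ni]) auto
      qed
      then have b1: "?\<beta> integrable_on {s..t}" by blast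
      have "\<epsilon> * (integral {s..t} ?n - (t - s) * \<mu> + (t - s) * \<delta>') \<le> \<epsilon> * (k + \<delta>)"
        using k \<delta>'(2) elim by (intro mult_left_mono) (auto simp: mult.commute)
      then have b2: "integral {s..t} ?\<beta> \<le> (t - s) + \<epsilon> * (k + \<delta>)" using integral_unique[OF i] by simp
      have "\<exists>v. has_velocity A y UNIV \<tau> v \<and> F (y \<tau>, v) \<le> ?\<beta> \<tau>" if \<tau>: "\<tau> \<in> {s<..<t} - N1" for \<tau>
      proof -
      from \<tau> have \<tau>': "\<tau> \<in> {s..t}" by auto
      obtain w' where w': "(w has_vector_derivative w') (at \<tau>)" "norm_in c (w \<tau>) w' \<le> ?\<beta> \<tau>"
        using est[OF \<tau>'] \<tau> by auto
      have "((snd c \<circ> y) has_vector_derivative w') (at \<tau>)"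
        by (rule has_vector_derivative_transform_within_open[OF w'(1), of "{s<..<t}"]) (use \<tau> yw in auto)
      moreover have "\<forall>\<^sub>F \<sigma> in at \<tau>. y \<sigma> \<in> fst c"
        using \<tau> yin by (intro eventually_at_topological[THEN iffD2] exI[of _ "{s<..<t}"]) auto
      ultimately have "has_velocity A y UNIV \<tau> (tangent_of A c (y \<tau>) w')"
        by (intro has_velocity_of_chart[where \<gamma> = y and t = \<tau>, OF c yin[OF \<tau>']]) auto
      moreover have "F (y \<tau>, tangent_of A c (y \<tau>) w') \<le> ?\<beta> \<tau>"
        using w'(2) norm_in_eq[OF c yin[OF \<tau>'], of w'] yw[OF \<tau>'] by simp
      ultimately show "\<exists>v. has_velocity A y UNIV \<tau> v \<and> F (y \<tau>, v) \<le> ?\<beta> \<tau>" by blast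
      qed
      then show ?thesis unfolding cost_bounded_def using e(3) b1 b2 by blast
    qed
    ultimately show ?case using ys yt by blast
  qed
qed

sublocale cot: reg_atlas "cotangent_atlas A"
  by unfold_locales (rule cotangent_regular)

section \<open>Propagation of variation cones and existence of an extremal\<close>

text \<open>In a pair \<open>(k, V)\<close>, \<open>k\<close> is a first order change of length and \<open>V\<close> a displacement of the end point.\<close>

definition tangent_cone :: "'m \<Rightarrow> (real \<times> ('m, real^'n) tvec) set \<Rightarrow> bool" where
  "tangent_cone p S \<longleftrightarrow> (\<forall>k V. (k, V) \<in> S \<longrightarrow> V \<in> tangent_space A p) \<and> (0, \<lambda>_. 0) \<in> S \<and>
     (\<forall>k V k' V'. (k, V) \<in> S \<longrightarrow> (k', V') \<in> S \<longrightarrow> (k + k', \<lambda>c. V c + V' c) \<in> S) \<and>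
     (\<forall>k V r. (k, V) \<in> S \<longrightarrow> r \<ge> 0 \<longrightarrow> (r * k, \<lambda>c. r *\<^sub>R V c) \<in> S)"

definition lift :: "(real \<Rightarrow> ('m, real^'n) cvec) \<Rightarrow> real \<Rightarrow> 'm \<times> ('m, real^'n) cvec" where
  "lift \<alpha> \<tau> = (x \<tau>, \<alpha> \<tau>)"

text \<open>Velocities are taken at interior times with respect to \<open>UNIV\<close>, not within
  \<open>{s..t}\<close>; they depend only on the curve close to that time and survive
  concatenation.\<close>

definition extremal_on :: "(real \<Rightarrow> ('m, real^'n) cvec) \<Rightarrow> real \<Rightarrow> real \<Rightarrow> bool" where
  "extremal_on \<alpha> s t \<longleftrightarrow> (\<forall>\<tau>\<in>{s..t}. \<alpha> \<tau> \<in> cotangent_space A (x \<tau>)) \<and> ac_curve (cotangent_atlas A) (lift \<alpha>) s t \<and>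
     (\<exists>N. negligible N \<and> (\<forall>\<tau>\<in>{s<..<t} - N. \<exists>V\<in>extended_geodesic_field A F (lift \<alpha> \<tau>).
         has_velocity (cotangent_atlas A) (lift \<alpha>) UNIV \<tau> V))"

lemma extremal_on_concat:
  assumes 1: "extremal_on \<alpha> s t" and 2: "extremal_on \<beta> t r" and eq: "\<alpha> t = \<beta> t" and str: "s \<le> t" "t \<le> r"
  shows "extremal_on (\<lambda>\<tau>. if \<tau> \<le> t then \<alpha> \<tau> else \<beta> \<tau>) s r"
proof -
  let ?\<gamma> = "\<lambda>\<tau>. if \<tau> \<le> t then \<alpha> \<tau> else \<beta> \<tau>"
  obtain N where N: "negligible N" "\<And>\<tau>. \<tau>\<in>{s<..<t} - N \<Longrightarrow> \<exists>V\<in>extended_geodesic_field A F (lift \<alpha> \<tau>).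
         has_velocity (cotangent_atlas A) (lift \<alpha>) UNIV \<tau> V" using 1 unfolding extremal_on_def by blast
  obtain M where M: "negligible M" "\<And>\<tau>. \<tau>\<in>{t<..<r} - M \<Longrightarrow> \<exists>V\<in>extended_geodesic_field A F (lift \<beta> \<tau>).
         has_velocity (cotangent_atlas A) (lift \<beta>) UNIV \<tau> V" using 2 unfolding extremal_on_def by blast
  have "\<exists>V\<in>extended_geodesic_field A F (lift ?\<gamma> \<tau>). has_velocity (cotangent_atlas A) (lift ?\<gamma>) UNIV \<tau> V"
    if \<tau>: "\<tau> \<in> {s<..<r} - (N \<union> M \<union> {t})" for \<tau>
  proof (cases "\<tau> < t")
    case True
    then obtain V where V: "V \<in> extended_geodesic_field A F (lift \<alpha> \<tau>)" "has_velocity (cotangent_atlas A) (lift \<alpha>) UNIV \<tau> V"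
      using N(2)[of \<tau>] \<tau> by auto
    have "has_velocity (cotangent_atlas A) (lift ?\<gamma>) UNIV \<tau> V"
      by (rule has_velocity_local[OF V(2), of "{..<t}"]) (use True in \<open>auto simp: lift_def\<close>)
    moreover have "lift ?\<gamma> \<tau> = lift \<alpha> \<tau>" using True by (simp add: lift_def)
    ultimately show ?thesis using V(1) by auto
  next
    case False
    then have gt: "t < \<tau>" using \<tau> by auto
    then obtain V where V: "V \<in> extended_geodesic_field A F (lift \<beta> \<tau>)" "has_velocity (cotangent_atlas A) (lift \<beta>) UNIV \<tau> V"
      using M(2)[of \<tau>] \<tau> by auto
    have "has_velocity (cotangent_atlas A) (lift ?\<gamma>) UNIV \<tau> V"
      by (rule has_velocity_local[OF V(2), of "{t<..}"]) (use gt in \<open>auto simp: lift_def\<close>)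
    moreover have "lift ?\<gamma> \<tau> = lift \<beta> \<tau>" using gt by (simp add: lift_def)
    ultimately show ?thesis using V(1) by auto
  qed
  moreover have "negligible (N \<union> M \<union> {t})" using N M by auto
  moreover have "ac_curve (cotangent_atlas A) (lift ?\<gamma>) s r"
  proof (rule cot.ac_curve_concat[OF _ _ str])
    have c1: "ac_curve (cotangent_atlas A) (lift \<alpha>) s t" and c2: "ac_curve (cotangent_atlas A) (lift \<beta>) t r"
      using 1 2 unfolding extremal_on_def by blast+
    show "ac_curve (cotangent_atlas A) (lift ?\<gamma>) s t" by (rule cot.ac_curve_cong[OF c1]) (simp add: lift_def)
    show "ac_curve (cotangent_atlas A) (lift ?\<gamma>) t r"
      by (rule cot.ac_curve_cong[OF c2]) (use eq in \<open>auto simp: lift_def\<close>)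
  qed
  moreover have "?\<gamma> \<tau> \<in> cotangent_space A (x \<tau>)" if "\<tau> \<in> {s..r}" for \<tau>
    using 1 2 that unfolding extremal_on_def by (cases "\<tau> \<le> t") auto
  ultimately show ?thesis unfolding extremal_on_def by blast
qed

text \<open>All vectors \<open>f z v\<close> have norm 1, so \<open>max\<close> bounds every
  Hamiltonian by \<open>q\<close>, and by \<open>eq\<close> the actual control attains this value.
  The adjoint equation, written in coordinates, is the fibre part of the Hamiltonian field.\<close>

lemma chart_piece_extremal:
  assumes piece: "chart_piece c f s t K u N0"
    and p: "finsler_trajectory.adjoint_eq f s t (snd c \<circ> x) u p"
    and max: "\<And>\<tau> w. \<tau> \<in> {s..t} \<Longrightarrow> p \<tau> \<bullet> w \<le> q * norm_in c (snd c (x \<tau>)) w"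
    and eq: "negligible {\<tau> \<in> {s..t}. p \<tau> \<bullet> f (snd c (x \<tau>)) (u \<tau>) \<noteq> q}"
  shows "extremal_on (\<lambda>\<tau>. covec c (x \<tau>) (p \<tau>)) s t"
proof -
  interpret ft: finsler_trajectory "snd c ` fst c" "norm_in c" "sphere 0 1" f s t K "snd c \<circ> x" u N0
    using piece by (simp add: chart_piece_def)
  have fam: "pontryagin_family A F c f" using piece by (simp add: chart_piece_def)
  then have c: "c \<in> A" by (simp add: pontryagin_family_def)
  have acz: "abs_continuous_on {s..t} (snd c \<circ> x)" using piece by (simp add: chart_piece_def)
  have xin: "x \<tau> \<in> fst c" if "\<tau> \<in> {s..t}" for \<tau> using piece that by (auto simp: chart_piece_def)
  let ?\<alpha> = "\<lambda>\<tau>. covec c (x \<tau>) (p \<tau>)" and ?cc = "cotangent_chart A c"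
  have cc: "?cc \<in> cotangent_atlas A" using c by (simp add: cotangent_atlas_def)
  obtain L N1 where p1: "L-lipschitz_on {s..t} p" "negligible N1"
     "\<And>\<tau>. \<tau> \<in> {s<..<t} - N1 \<Longrightarrow> (p has_vector_derivative - ft.At \<tau> (p \<tau>)) (at \<tau>)"
    using p unfolding ft.adjoint_eq_def by blast
  have lin: "lift ?\<alpha> \<tau> \<in> fst ?cc" and lco: "snd ?cc (lift ?\<alpha> \<tau>) = (snd c (x \<tau>), p \<tau>)" if "\<tau> \<in> {s..t}" for \<tau>
    using xin[OF that] covec_cotangent cocoord_covec[OF c xin[OF that]] by (auto simp: lift_def cotangent_chart_eq)
  have acp: "abs_continuous_on {s..t} p" by (rule lipschitz_imp_abs_continuous_on[OF p1(1)])
  have "abs_continuous_on {s..t} (snd ?cc \<circ> lift ?\<alpha>)"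
    by (rule abs_continuous_on_cong[OF abs_continuous_on_Pair[OF acz acp]]) (simp add: lco)
  then have "ac_curve (cotangent_atlas A) (lift ?\<alpha>) s t"
    using lin by (intro cot.ac_curveI_chart[OF cc]) auto
  moreover have "\<exists>V\<in>extended_geodesic_field A F (lift ?\<alpha> \<tau>). has_velocity (cotangent_atlas A) (lift ?\<alpha>) UNIV \<tau> V"
    if \<tau>: "\<tau> \<in> {s<..<t} - (N0 \<union> N1 \<union> {\<tau> \<in> {s..t}. p \<tau> \<bullet> f (snd c (x \<tau>)) (u \<tau>) \<noteq> q})" for \<tau>
  proof -
    have \<tau>': "\<tau> \<in> {s..t}" using \<tau> by auto
    let ?z = "snd c (x \<tau>)"
    define w where "w = (f ?z (u \<tau>), - ft.At \<tau> (p \<tau>))"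
    have "((\<lambda>\<tau>. ((snd c \<circ> x) \<tau>, p \<tau>)) has_vector_derivative w) (at \<tau>)"
    proof -
      have "((snd c \<circ> x) has_vector_derivative f ((snd c \<circ> x) \<tau>) (u \<tau>)) (at \<tau>)"
        by (rule ft.z_deriv) (use \<tau> in blast)
      moreover have "(p has_vector_derivative - ft.At \<tau> (p \<tau>)) (at \<tau>)" by (rule p1(3)) (use \<tau> in blast)
      ultimately show ?thesis unfolding w_def by (simp add: has_vector_derivative_Pair o_def)
    qed
    then have der: "((snd ?cc \<circ> lift ?\<alpha>) has_vector_derivative w) (at \<tau>)"
      by (rule has_vector_derivative_transform_within_open[of _ _ _ "{s<..<t}"]) (use \<tau> lco in auto)
    let ?V = "tangent_of (cotangent_atlas A) ?cc (lift ?\<alpha> \<tau>) w"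
    have "has_velocity (cotangent_atlas A) (lift ?\<alpha>) UNIV \<tau> ?V"
    proof (rule cot.has_velocity_of_chart[OF cc lin[OF \<tau>'] _ _ der])
      show "\<forall>\<^sub>F \<sigma> in at \<tau>. lift ?\<alpha> \<sigma> \<in> fst ?cc"
        using \<tau> lin by (intro eventually_at_topological[THEN iffD2] exI[of _ "{s<..<t}"]) auto
    qed simp
    moreover have "?V \<in> extended_geodesic_field A F (lift ?\<alpha> \<tau>)"
      unfolding extended_geodesic_field_def
    proof (intro CollectI conjI exI bexI)
      show "?V \<in> tangent_space (cotangent_atlas A) (lift ?\<alpha> \<tau>)" by (rule cot.tangent_of_tangent[OF cc lin[OF \<tau>']])
      show "pontryagin_family A F c f" by (rule fam)
      show "fst (lift ?\<alpha> \<tau>) \<in> fst c" using xin[OF \<tau>'] by (simp add: lift_def)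
      have At: "ft.At \<tau> (p \<tau>) $ i = (\<Sum>j\<in>UNIV. p \<tau> $ j * frechet_derivative (\<lambda>z'. f z' (u \<tau>)) (at ?z) (axis i 1) $ j)" for i
      proof -
        have "ft.At \<tau> (p \<tau>) $ i = ft.At \<tau> (p \<tau>) \<bullet> axis i 1" by (simp add: inner_axis)
        also have "\<dots> = p \<tau> \<bullet> ft.A \<tau> (axis i 1)" by (rule ft.At_inner[OF \<tau>'])
        finally show ?thesis by (simp add: ft.A_def inner_vec_def)
      qed
      show "?V ?cc = hamiltonian_field f (u \<tau>) (snd ?cc (lift ?\<alpha> \<tau>))"
        unfolding cot.tangent_of_apply[OF cc lin[OF \<tau>']] lco[OF \<tau>'] hamiltonian_field_def w_def
        by (simp add: vec_eq_iff At)
      have ham: "hamiltonian A c f v (lift ?\<alpha> \<tau>) = p \<tau> \<bullet> f ?z v" for v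
        using tangent_of_tangent[OF c xin[OF \<tau>']] tangent_of_apply[OF c xin[OF \<tau>']]
        by (simp add: hamiltonian_def lift_def control_field_def covec_def)
      have us: "u \<tau> \<in> sphere 0 1" by (rule ft.u_in[OF \<tau>'])
      have "p \<tau> \<bullet> f ?z v \<le> p \<tau> \<bullet> f ?z (u \<tau>)" if "v \<in> sphere 0 1" for v
      proof -
        have "p \<tau> \<bullet> f ?z v \<le> q * norm_in c ?z (f ?z v)" by (rule max[OF \<tau>'])
        also have "norm_in c ?z (f ?z v) = 1" using ft.f_unit[OF _ that] xin[OF \<tau>'] by blast
        finally show ?thesis using \<tau> \<tau>' by simp
      qed
      then show "u \<tau> \<in> maximizing_controls A c f (lift ?\<alpha> \<tau>)"
        using us unfolding maximizing_controls_def ham by blast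
    qed
    ultimately show ?thesis by blast
  qed
  moreover have "negligible (N0 \<union> N1 \<union> {\<tau> \<in> {s..t}. p \<tau> \<bullet> f (snd c (x \<tau>)) (u \<tau>) \<noteq> q})"
    using ft.N0 p1(2) eq by (intro negligible_Un)
  ultimately show ?thesis unfolding extremal_on_def using covec_cotangent by blast
qed

text \<open>Variations with a cone \<open>S\<close> at time \<open>s\<close> extend to variations with a cone \<open>T\<close> at time \<open>t\<close>, and
  functionals that are nonpositive on \<open>T\<close> extend backwards to extremals that are nonpositive on \<open>S\<close>.
  This holds on short intervals and is transitive.\<close>

definition propagates :: "real \<Rightarrow> real \<Rightarrow> bool" where
  "propagates s t \<longleftrightarrow> (\<forall>S. tangent_cone (x s) S \<longrightarrow> (\<exists>T. tangent_cone (x t) T \<and>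
     (\<forall>k' W. (k', W) \<in> T \<longrightarrow> (\<exists>k V. (k, V) \<in> S \<and> reach s t V W (k' - k))) \<and>
     (\<exists>k' W. (k', W) \<in> T \<and> k' < 0) \<and>
     (\<forall>q \<psi>. \<psi> \<in> cotangent_space A (x t) \<longrightarrow> (\<forall>k' W. (k', W) \<in> T \<longrightarrow> \<psi> W \<le> q * k') \<longrightarrow>
        (\<exists>\<alpha>. extremal_on \<alpha> s t \<and> \<alpha> t = \<psi> \<and> (\<psi> \<noteq> (\<lambda>_. 0) \<longrightarrow> (\<forall>\<tau>\<in>{s..t}. \<alpha> \<tau> \<noteq> (\<lambda>_. 0))) \<and>
           (\<forall>k V. (k, V) \<in> S \<longrightarrow> \<alpha> s V \<le> q * k)))))"

lemma propagates_trans: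
  assumes 1: "propagates s t" and 2: "propagates t r" and str: "s \<le> t" "t \<le> r"
  shows "propagates s r"
  unfolding propagates_def
proof (intro allI impI)
  fix S assume S: "tangent_cone (x s) S"
  obtain T where T: "tangent_cone (x t) T" "\<And>k' W. (k', W) \<in> T \<Longrightarrow> \<exists>k V. (k, V) \<in> S \<and> reach s t V W (k' - k)"
     "\<And>q \<psi>. \<psi> \<in> cotangent_space A (x t) \<Longrightarrow> (\<forall>k' W. (k', W) \<in> T \<longrightarrow> \<psi> W \<le> q * k') \<Longrightarrow>
        (\<exists>\<alpha>. extremal_on \<alpha> s t \<and> \<alpha> t = \<psi> \<and> (\<psi> \<noteq> (\<lambda>_. 0) \<longrightarrow> (\<forall>\<tau>\<in>{s..t}. \<alpha> \<tau> \<noteq> (\<lambda>_. 0))) \<and>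
           (\<forall>k V. (k, V) \<in> S \<longrightarrow> \<alpha> s V \<le> q * k))"
    using 1[unfolded propagates_def, rule_format, OF S] by blast
  obtain R where R: "tangent_cone (x r) R" "\<And>k' W. (k', W) \<in> R \<Longrightarrow> \<exists>k V. (k, V) \<in> T \<and> reach t r V W (k' - k)"
     "\<exists>k' W. (k', W) \<in> R \<and> k' < 0"
     "\<And>q \<psi>. \<psi> \<in> cotangent_space A (x r) \<Longrightarrow> (\<forall>k' W. (k', W) \<in> R \<longrightarrow> \<psi> W \<le> q * k') \<Longrightarrow>
        (\<exists>\<alpha>. extremal_on \<alpha> t r \<and> \<alpha> r = \<psi> \<and> (\<psi> \<noteq> (\<lambda>_. 0) \<longrightarrow> (\<forall>\<tau>\<in>{t..r}. \<alpha> \<tau> \<noteq> (\<lambda>_. 0))) \<and>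
           (\<forall>k V. (k, V) \<in> T \<longrightarrow> \<alpha> t V \<le> q * k))"
    using 2[unfolded propagates_def, rule_format, OF T(1)] by blast
  show "\<exists>T. tangent_cone (x r) T \<and>
     (\<forall>k' W. (k', W) \<in> T \<longrightarrow> (\<exists>k V. (k, V) \<in> S \<and> reach s r V W (k' - k))) \<and>
     (\<exists>k' W. (k', W) \<in> T \<and> k' < 0) \<and>
     (\<forall>q \<psi>. \<psi> \<in> cotangent_space A (x r) \<longrightarrow> (\<forall>k' W. (k', W) \<in> T \<longrightarrow> \<psi> W \<le> q * k') \<longrightarrow>
        (\<exists>\<alpha>. extremal_on \<alpha> s r \<and> \<alpha> r = \<psi> \<and> (\<psi> \<noteq> (\<lambda>_. 0) \<longrightarrow> (\<forall>\<tau>\<in>{s..r}. \<alpha> \<tau> \<noteq> (\<lambda>_. 0))) \<and>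
           (\<forall>k V. (k, V) \<in> S \<longrightarrow> \<alpha> s V \<le> q * k)))"
  proof (rule exI[of _ R], rule conjI[OF R(1)], rule conjI[OF _ conjI[OF R(3)]]; intro allI impI)
    fix k' W assume "(k', W) \<in> R"
    then obtain k1 V1 where 3: "(k1, V1) \<in> T" "reach t r V1 W (k' - k1)" using R(2) by blast
    then obtain k V where 4: "(k, V) \<in> S" "reach s t V V1 (k1 - k)" using T(2) by blast
    have "V1 \<in> tangent_space A (x t)" using T(1) 3(1) unfolding tangent_cone_def by blast
    from reach_trans[OF 4(2) 3(2) this str] have "reach s r V W (k' - k)" by simp
    then show "\<exists>k V. (k, V) \<in> S \<and> reach s r V W (k' - k)" using 4(1) by blast
  next
    fix q \<psi> assume \<psi>: "\<psi> \<in> cotangent_space A (x r)" "\<forall>k' W. (k', W) \<in> R \<longrightarrow> \<psi> W \<le> q * k'"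
    \<comment> \<open>Cones move forwards but functionals backwards: the right piece is treated
      first, and its value at \<open>t\<close> is the final datum of the left piece, with the same
      \<open>q\<close>.\<close>
    obtain \<beta> where \<beta>: "extremal_on \<beta> t r" "\<beta> r = \<psi>" "\<psi> \<noteq> (\<lambda>_. 0) \<longrightarrow> (\<forall>\<tau>\<in>{t..r}. \<beta> \<tau> \<noteq> (\<lambda>_. 0))"
       "\<forall>k V. (k, V) \<in> T \<longrightarrow> \<beta> t V \<le> q * k" using R(4)[OF \<psi>] by blast
    have "\<beta> t \<in> cotangent_space A (x t)" using \<beta>(1) str unfolding extremal_on_def by auto
    from T(3)[OF this \<beta>(4)]
    obtain \<alpha> where \<alpha>: "extremal_on \<alpha> s t" "\<alpha> t = \<beta> t" "\<beta> t \<noteq> (\<lambda>_. 0) \<longrightarrow> (\<forall>\<tau>\<in>{s..t}. \<alpha> \<tau> \<noteq> (\<lambda>_. 0))"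
       "\<forall>k V. (k, V) \<in> S \<longrightarrow> \<alpha> s V \<le> q * k" by blast
    let ?\<gamma> = "\<lambda>\<tau>. if \<tau> \<le> t then \<alpha> \<tau> else \<beta> \<tau>"
    have "extremal_on ?\<gamma> s r" by (rule extremal_on_concat[OF \<alpha>(1) \<beta>(1) \<alpha>(2) str])
    moreover have "?\<gamma> r = \<psi>"
    proof (cases "r = t")
      case True
      then show ?thesis using \<alpha>(2) \<beta>(2) by simp
    next
      case False
      then show ?thesis using \<beta>(2) str by simp
    qed
    moreover have "\<psi> \<noteq> (\<lambda>_. 0) \<longrightarrow> (\<forall>\<tau>\<in>{s..r}. ?\<gamma> \<tau> \<noteq> (\<lambda>_. 0))"
      using \<alpha>(3) \<beta>(3) str by auto
    moreover have "\<forall>k V. (k, V) \<in> S \<longrightarrow> ?\<gamma> s V \<le> q * k" using \<alpha>(4) str by simp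
    ultimately show "\<exists>\<alpha>. extremal_on \<alpha> s r \<and> \<alpha> r = \<psi> \<and> (\<psi> \<noteq> (\<lambda>_. 0) \<longrightarrow> (\<forall>\<tau>\<in>{s..r}. \<alpha> \<tau> \<noteq> (\<lambda>_. 0))) \<and>
           (\<forall>k V. (k, V) \<in> S \<longrightarrow> \<alpha> s V \<le> q * k)" by blast
  qed
qed

lemma chart_piece_propagates:
  assumes piece: "chart_piece c f s t K u N0"
  shows "propagates s t"
  unfolding propagates_def
proof (intro allI impI)
  fix S assume S: "tangent_cone (x s) S"
  interpret ft: finsler_trajectory "snd c ` fst c" "norm_in c" "sphere 0 1" f s t K "snd c \<circ> x" u N0
    using piece by (simp add: chart_piece_def)
  have c: "c \<in> A" using piece by (simp add: chart_piece_def pontryagin_family_def)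
  have st: "s < t" by (rule ft.st)
  have xin: "x \<tau> \<in> fst c" if "\<tau> \<in> {s..t}" for \<tau> using piece that by (auto simp: chart_piece_def)
  have xs: "x s \<in> fst c" and xt: "x t \<in> fst c" using xin st by auto
  have S0: "(0, \<lambda>_. 0) \<in> S" and Ssub: "\<And>k V. (k, V) \<in> S \<Longrightarrow> V \<in> tangent_space A (x s)"
    and Sadd: "\<And>k V k' V'. (k, V) \<in> S \<Longrightarrow> (k', V') \<in> S \<Longrightarrow> (k + k', \<lambda>c. V c + V' c) \<in> S"
    and Sscale: "\<And>k V r. (k, V) \<in> S \<Longrightarrow> r \<ge> 0 \<Longrightarrow> (r * k, \<lambda>c. r *\<^sub>R V c) \<in> S"
    using S unfolding tangent_cone_def by blast+
  let ?n = "\<lambda>\<eta>. integral {s..t} (\<lambda>\<tau>. norm_in c (snd c (x \<tau>)) (\<eta> \<tau>))"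
  have ni: "(\<lambda>\<tau>. norm_in c (snd c (x \<tau>)) (\<eta> \<tau>)) integrable_on {s..t}" if "continuous_on {s..t} \<eta>" for \<eta>
    using ft.N_inner_continuous[OF that] by (intro integrable_continuous_real) simp
  have zin: "snd c (x \<tau>) \<in> snd c ` fst c" if "\<tau> \<in> {s..t}" for \<tau> using xin[OF that] by blast
  \<comment> \<open>The inequality in \<open>\<le> k'\<close> makes \<open>T\<close> upward closed
    in the cost. With equality \<open>T\<close> would not be closed under addition, since the cost
    of a sum of two \<eta> is only subadditive.\<close>
  define gen where "gen k' W \<longleftrightarrow> (\<exists>k V \<eta> \<mu> v. (k, V) \<in> S \<and> continuous_on {s..t} \<eta> \<and> 0 \<le> \<mu> \<and> ft.variation_eq v \<eta> \<mu> \<and>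
     v s = V c \<and> W = tangent_of A c (x t) (v t) \<and> k + (?n \<eta> - \<mu> * (t - s)) \<le> k')" for k' W
  define T where "T = {(k', W). gen k' W}"
  have genI: "gen k' (tangent_of A c (x t) (v t))"
    if "(k, V) \<in> S" "continuous_on {s..t} \<eta>" "0 \<le> \<mu>" "ft.variation_eq v \<eta> \<mu>" "v s = V c" "k + (?n \<eta> - \<mu> * (t - s)) \<le> k'"
    for k V \<eta> \<mu> v k'
    using that unfolding gen_def by blast
  have n0: "?n (\<lambda>_. 0) = 0"
  proof -
    have "?n (\<lambda>_. 0) = integral {s..t} (\<lambda>_. 0)"
      by (rule integral_cong) (simp add: ft.N_zero[OF zin])
    then show ?thesis by simp
  qed
  show "\<exists>T. tangent_cone (x t) T \<and>
     (\<forall>k' W. (k', W) \<in> T \<longrightarrow> (\<exists>k V. (k, V) \<in> S \<and> reach s t V W (k' - k))) \<and>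
     (\<exists>k' W. (k', W) \<in> T \<and> k' < 0) \<and>
     (\<forall>q \<psi>. \<psi> \<in> cotangent_space A (x t) \<longrightarrow> (\<forall>k' W. (k', W) \<in> T \<longrightarrow> \<psi> W \<le> q * k') \<longrightarrow>
        (\<exists>\<alpha>. extremal_on \<alpha> s t \<and> \<alpha> t = \<psi> \<and> (\<psi> \<noteq> (\<lambda>_. 0) \<longrightarrow> (\<forall>\<tau>\<in>{s..t}. \<alpha> \<tau> \<noteq> (\<lambda>_. 0))) \<and>
           (\<forall>k V. (k, V) \<in> S \<longrightarrow> \<alpha> s V \<le> q * k)))"
  proof (intro exI[of _ T] conjI)
    show "tangent_cone (x t) T"
      unfolding tangent_cone_def
    proof (intro conjI allI impI)
      fix k' W assume "(k', W) \<in> T"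
      then show "W \<in> tangent_space A (x t)" using tangent_of_tangent[OF c xt] by (auto simp: T_def gen_def)
    next
      have "ft.variation_eq (\<lambda>_. 0) (\<lambda>_. 0) 0"
        unfolding ft.variation_eq_def
      proof (intro conjI exI ballI)
        show "0-lipschitz_on {s..t} (\<lambda>_. 0)" by (rule lipschitz_on_constant)
        show "negligible {}" by simp
        fix \<tau> assume "\<tau> \<in> {s<..<t} - {}"
        then have "linear (ft.A \<tau>)" by (intro ft.A_linear) auto
        then show "((\<lambda>_. 0) has_vector_derivative ft.A \<tau> 0 + (0 - 0 *\<^sub>R f ((snd c \<circ> x) \<tau>) (u \<tau>))) (at \<tau>)"
          by (simp add: linear_0)
      qed
      from genI[OF S0 _ _ this, of 0] show "(0, \<lambda>_. 0) \<in> T"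
        using n0 by (simp add: T_def tangent_of_zero[OF c xt])
    next
      fix k1 W1 k2 W2 assume 1: "(k1, W1) \<in> T" and 2: "(k2, W2) \<in> T"
      obtain k V \<eta> \<mu> v where a: "(k, V) \<in> S" "continuous_on {s..t} \<eta>" "0 \<le> \<mu>" "ft.variation_eq v \<eta> \<mu>"
        "v s = V c" "W1 = tangent_of A c (x t) (v t)" "k + (?n \<eta> - \<mu> * (t - s)) \<le> k1"
        using 1 unfolding T_def gen_def by blast
      obtain k' V' \<eta>' \<mu>' v' where b: "(k', V') \<in> S" "continuous_on {s..t} \<eta>'" "0 \<le> \<mu>'" "ft.variation_eq v' \<eta>' \<mu>'"
        "v' s = V' c" "W2 = tangent_of A c (x t) (v' t)" "k' + (?n \<eta>' - \<mu>' * (t - s)) \<le> k2"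
        using 2 unfolding T_def gen_def by blast
      have "?n (\<lambda>\<tau>. \<eta> \<tau> + \<eta>' \<tau>) \<le> integral {s..t} (\<lambda>\<tau>. norm_in c (snd c (x \<tau>)) (\<eta> \<tau>) + norm_in c (snd c (x \<tau>)) (\<eta>' \<tau>))"
        by (intro integral_le ni integrable_add continuous_on_add a b ft.N_triangle zin)
      also have "\<dots> = ?n \<eta> + ?n \<eta>'" by (intro Henstock_Kurzweil_Integration.integral_add ni a b)
      finally have n: "?n (\<lambda>\<tau>. \<eta> \<tau> + \<eta>' \<tau>) \<le> ?n \<eta> + ?n \<eta>'" .
      have "gen (k1 + k2) (tangent_of A c (x t) (v t + v' t))"
      proof (rule genI[OF Sadd[OF a(1) b(1)] _ _ ft.variation_eq_add[OF a(4) b(4)]])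
        show "continuous_on {s..t} (\<lambda>\<tau>. \<eta> \<tau> + \<eta>' \<tau>)" by (intro continuous_on_add a b)
        show "0 \<le> \<mu> + \<mu>'" using a b by simp
        show "v s + v' s = V c + V' c" using a b by simp
        show "k + k' + (?n (\<lambda>\<tau>. \<eta> \<tau> + \<eta>' \<tau>) - (\<mu> + \<mu>') * (t - s)) \<le> k1 + k2"
          using n a(7) b(7) by (simp add: distrib_right)
      qed
      then show "(k1 + k2, \<lambda>d. W1 d + W2 d) \<in> T" by (simp add: T_def a(6) b(6) tangent_of_add[OF c xt])
    next
      fix k1 W1 and r :: real assume 1: "(k1, W1) \<in> T" and r: "r \<ge> 0"
      obtain k V \<eta> \<mu> v where a: "(k, V) \<in> S" "continuous_on {s..t} \<eta>" "0 \<le> \<mu>" "ft.variation_eq v \<eta> \<mu>"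
        "v s = V c" "W1 = tangent_of A c (x t) (v t)" "k + (?n \<eta> - \<mu> * (t - s)) \<le> k1"
        using 1 unfolding T_def gen_def by blast
      have "?n (\<lambda>\<tau>. r *\<^sub>R \<eta> \<tau>) = integral {s..t} (\<lambda>\<tau>. r * norm_in c (snd c (x \<tau>)) (\<eta> \<tau>))"
        by (rule integral_cong) (simp add: ft.N_scale0[OF zin r])
      then have n: "?n (\<lambda>\<tau>. r *\<^sub>R \<eta> \<tau>) = r * ?n \<eta>" by simp
      have "gen (r * k1) (tangent_of A c (x t) (r *\<^sub>R v t))"
      proof (rule genI[OF Sscale[OF a(1) r] _ _ ft.variation_eq_scale[OF a(4)]])
        show "continuous_on {s..t} (\<lambda>\<tau>. r *\<^sub>R \<eta> \<tau>)" by (intro continuous_intros a)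
        show "0 \<le> r * \<mu>" using a r by simp
        show "r *\<^sub>R v s = r *\<^sub>R V c" using a by simp
        show "r * k + (?n (\<lambda>\<tau>. r *\<^sub>R \<eta> \<tau>) - r * \<mu> * (t - s)) \<le> r * k1"
          using mult_left_mono[OF a(7) r] by (simp add: n algebra_simps)
      qed
      then show "(r * k1, \<lambda>d. r *\<^sub>R W1 d) \<in> T" by (simp add: T_def a(6) tangent_of_scale[OF c xt])
    qed
    show "\<forall>k' W. (k', W) \<in> T \<longrightarrow> (\<exists>k V. (k, V) \<in> S \<and> reach s t V W (k' - k))"
    proof (intro allI impI)
      fix k' W assume "(k', W) \<in> T"
      then obtain k V \<eta> \<mu> v where a: "(k, V) \<in> S" "continuous_on {s..t} \<eta>" "0 \<le> \<mu>" "ft.variation_eq v \<eta> \<mu>"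
        "v s = V c" "W = tangent_of A c (x t) (v t)" "k + (?n \<eta> - \<mu> * (t - s)) \<le> k'"
        unfolding T_def gen_def by blast
      have "reach s t V W (k' - k)"
        by (rule reach_chart_piece[where V = V and W = W and k = "k' - k", OF piece a(4,2,3,5)]) (use a(6,7) tangent_of_apply[OF c xt] in auto)
      then show "\<exists>k V. (k, V) \<in> S \<and> reach s t V W (k' - k)" using a(1) by blast
    qed
    have c0: "continuous_on {s..t} (\<lambda>_. 0 :: real^'n)" by (rule continuous_on_const)
    \<comment> \<open>Pure slowing down, with \<eta> zero and \<mu> equal to 1, from the vertex of
      \<open>S\<close>: the length drops by \<open>t - s\<close> while the end point is displaced by
      \<open>v t\<close>, whatever that is.\<close>
    show "\<exists>k' W. (k', W) \<in> T \<and> k' < 0"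
    proof -
      obtain v where v: "v s = 0" "ft.variation_eq v (\<lambda>_. 0) 1" by (rule ft.variation_eq_exists[OF c0]) (rule that)
      have "gen (- (t - s)) (tangent_of A c (x t) (v t))"
        by (rule genI[OF S0 c0 _ v(2)]) (use v n0 in auto)
      then show ?thesis using st unfolding T_def by (intro exI[of _ "- (t - s)"]) auto
    qed
    show "\<forall>q \<psi>. \<psi> \<in> cotangent_space A (x t) \<longrightarrow> (\<forall>k' W. (k', W) \<in> T \<longrightarrow> \<psi> W \<le> q * k') \<longrightarrow>
        (\<exists>\<alpha>. extremal_on \<alpha> s t \<and> \<alpha> t = \<psi> \<and> (\<psi> \<noteq> (\<lambda>_. 0) \<longrightarrow> (\<forall>\<tau>\<in>{s..t}. \<alpha> \<tau> \<noteq> (\<lambda>_. 0))) \<and>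
           (\<forall>k V. (k, V) \<in> S \<longrightarrow> \<alpha> s V \<le> q * k))"
    proof (intro allI impI)
      fix q \<psi> assume \<psi>: "\<psi> \<in> cotangent_space A (x t)" and le: "\<forall>k' W. (k', W) \<in> T \<longrightarrow> \<psi> W \<le> q * k'"
      define p1 where "p1 = cocoord c (x t) \<psi>"
      obtain p where p: "p t = p1" "ft.adjoint_eq p" "p1 \<noteq> 0 \<longrightarrow> (\<forall>\<tau>\<in>{s..t}. p \<tau> \<noteq> 0)"
        by (rule ft.adjoint_eq_exists[of p1]) (rule that)
      have pc: "continuous_on {s..t} p"
        using p(2) lipschitz_on_continuous_on unfolding ft.adjoint_eq_def by blast
      let ?\<alpha> = "\<lambda>\<tau>. covec c (x \<tau>) (p \<tau>)"
      have at: "?\<alpha> t = \<psi>" using cotangent_eq[OF c xt \<psi>] p(1) by (simp add: p1_def)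
      have gen_le: "p t \<bullet> v t \<le> q * k'"
        if "(k, V) \<in> S" "continuous_on {s..t} \<eta>" "0 \<le> \<mu>" "ft.variation_eq v \<eta> \<mu>" "v s = V c" "k + (?n \<eta> - \<mu> * (t - s)) \<le> k'"
        for k V \<eta> \<mu> v k'
      proof -
        have "\<psi> (tangent_of A c (x t) (v t)) \<le> q * k'" using genI[OF that] le by (simp add: T_def)
        moreover have "\<psi> (tangent_of A c (x t) (v t)) = p t \<bullet> v t"
          using cotangent_apply[OF c xt \<psi> tangent_of_tangent[OF c xt]] tangent_of_apply[OF c xt] p(1) by (simp add: p1_def)
        ultimately show ?thesis by simp
      qed
      have var: "integral {s..t} (\<lambda>\<tau>. p \<tau> \<bullet> \<eta> \<tau>) - \<mu> * integral {s..t} (\<lambda>\<tau>. p \<tau> \<bullet> f ((snd c \<circ> x) \<tau>) (u \<tau>))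
         \<le> q * (integral {s..t} (\<lambda>\<tau>. norm_in c ((snd c \<circ> x) \<tau>) (\<eta> \<tau>)) - \<mu> * (t - s))"
        if \<eta>: "continuous_on {s..t} \<eta>" and \<mu>: "0 \<le> \<mu>" for \<eta> \<mu>
      proof -
        \<comment> \<open>Variations starting at the vertex \<open>(0, 0)\<close> of
          \<open>S\<close> isolate the contribution of the piece itself; duality then removes the
          end point value \<open>p t \<bullet> v t\<close>.\<close>
        obtain v where v: "v s = 0" "ft.variation_eq v \<eta> \<mu>" by (rule ft.variation_eq_exists[OF \<eta>]) (rule that)
        have "p t \<bullet> v t \<le> q * (?n \<eta> - \<mu> * (t - s))"
          by (rule gen_le[OF S0 \<eta> \<mu> v(2)]) (use v in auto)
        then show ?thesis using ft.duality[OF p(2) v(2) \<eta>] v(1) by simp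
      qed
      note mp = ft.maximum_principle[OF pc var]
      have "extremal_on ?\<alpha> s t"
        by (rule chart_piece_extremal[OF piece p(2)]) (use mp in simp_all)
      moreover have "\<psi> \<noteq> (\<lambda>_. 0) \<longrightarrow> (\<forall>\<tau>\<in>{s..t}. ?\<alpha> \<tau> \<noteq> (\<lambda>_. 0))"
      proof (intro impI ballI notI)
        fix \<tau> assume "\<psi> \<noteq> (\<lambda>_. 0)" and \<tau>: "\<tau> \<in> {s..t}" and z: "?\<alpha> \<tau> = (\<lambda>_. 0)"
        have "p1 \<noteq> 0"
        proof
          assume "p1 = 0"
          then have "\<psi> = covec c (x t) 0" using at p(1) by simp
          then show False using \<open>\<psi> \<noteq> (\<lambda>_. 0)\<close> by (auto simp: covec_def)
        qed
        then have "p \<tau> \<noteq> 0" using p(3) \<tau> by blast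
        moreover have "p \<tau> = cocoord c (x \<tau>) (\<lambda>_. 0)" using cocoord_covec[OF c xin[OF \<tau>], of "p \<tau>"] z by simp
        ultimately show False by (simp add: cocoord_def vec_eq_iff)
      qed
      \<comment> \<open>A displacement \<open>V\<close> carried along without forcing or slowing
        costs nothing more, and \<open>p \<bullet> v\<close> is constant along it, so the inequality
        at \<open>t\<close> is the one at \<open>s\<close>.\<close>
      moreover have "?\<alpha> s V \<le> q * k" if kV: "(k, V) \<in> S" for k V
      proof -
        obtain v where v: "v s = V c" "ft.variation_eq v (\<lambda>_. 0) 0" by (rule ft.variation_eq_exists[OF c0]) (rule that)
        have "p t \<bullet> v t \<le> q * k" by (rule gen_le[OF kV c0 _ v(2,1)]) (use n0 in auto)
        moreover have "p t \<bullet> v t - p s \<bullet> v s = 0" using ft.duality[OF p(2) v(2) c0] by simp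
        moreover have "?\<alpha> s V = p s \<bullet> V c" using Ssub[OF kV] by (simp add: covec_def)
        ultimately show ?thesis using v(1) by simp
      qed
      ultimately show "\<exists>\<alpha>. extremal_on \<alpha> s t \<and> \<alpha> t = \<psi> \<and> (\<psi> \<noteq> (\<lambda>_. 0) \<longrightarrow> (\<forall>\<tau>\<in>{s..t}. \<alpha> \<tau> \<noteq> (\<lambda>_. 0))) \<and>
           (\<forall>k V. (k, V) \<in> S \<longrightarrow> \<alpha> s V \<le> q * k)" using at by (intro exI[of _ ?\<alpha>]) blast
    qed
  qed
qed

text \<open>Compactness of \<open>[a, b]\<close> in the form of bisection: the property holds on all
  short intervals around each point and is transitive.\<close>

lemma propagates_all: "propagates a b"
proof -
  have "a \<le> s \<and> s < t \<and> t \<le> b \<longrightarrow> propagates s t" if "a \<le> b" "s = a" "t = b" for s t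
    unfolding that
  proof (rule Bolzano[where P = "\<lambda>s t. a \<le> s \<and> s < t \<and> t \<le> b \<longrightarrow> propagates s t", OF \<open>a \<le> b\<close>])
    fix s t r assume 1: "a \<le> s \<and> s < t \<and> t \<le> b \<longrightarrow> propagates s t" and 2: "a \<le> t \<and> t < r \<and> r \<le> b \<longrightarrow> propagates t r"
      and le: "s \<le> t" "t \<le> r"
    show "a \<le> s \<and> s < r \<and> r \<le> b \<longrightarrow> propagates s r"
    proof
      assume h: "a \<le> s \<and> s < r \<and> r \<le> b"
      show "propagates s r"
      proof (cases "s = t \<or> t = r")
        case True
        then show ?thesis using 1 2 h by auto
      next
        \<comment> \<open>Bisection may yield empty pieces, for which the implication with
          \<open>s < t\<close> holds vacuously; only here are both pieces proper.\<close>
        case False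
        then show ?thesis using propagates_trans[of s t r] 1 2 h le by auto
      qed
    qed
  next
    fix t0 assume "a \<le> t0" "t0 \<le> b"
    then obtain \<delta> where \<delta>: "\<delta> > 0" "\<And>s t. a \<le> s \<and> s < t \<and> t \<le> b \<and> t0 - \<delta> \<le> s \<and> t \<le> t0 + \<delta> \<Longrightarrow>
       (\<exists>c f K u N0. chart_piece c f s t K u N0)"
      using chart_piece_exists[of t0] by auto
    have "propagates s t" if "s \<le> t0" "t0 \<le> t" "t - s < \<delta>" "a \<le> s \<and> s < t \<and> t \<le> b" for s t
      using \<delta>(2)[of s t] that chart_piece_propagates by auto
    then show "\<exists>d>0. \<forall>s t. s \<le> t0 \<and> t0 \<le> t \<and> t - s < d \<longrightarrow> a \<le> s \<and> s < t \<and> t \<le> b \<longrightarrow> propagates s t"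
      using \<delta>(1) by blast
  qed
  then show ?thesis using ab by auto
qed

section \<open>From minimality to a separating functional and an extremal\<close>

lemma curve_length_unit_speed: "curve_length A F x a b = b - a"
proof -
  obtain N where N: "negligible N" "\<forall>t\<in>{a..b} - N. \<exists>v. has_velocity A x {a..b} t v \<and> F (x t, v) = 1"
    using velocity_exists by blast
  have "((\<lambda>t. F (x t, velocity A x {a..b} t)) has_integral (b - a)) {a..b}"
  proof (rule has_integral_spike[OF N(1)])
    show "((\<lambda>t. 1) has_integral (b - a)) {a..b}" using has_integral_const_real[of "1::real" a b] ab by simp
    fix t assume t: "t \<in> {a..b} - N"
    then obtain v where v: "has_velocity A x {a..b} t v" "F (x t, v) = 1" using N(2) by blast
    then show "F (x t, velocity A x {a..b} t) = 1" using velocity_eq[OF v(1)] t ab by simp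
  qed
  then show ?thesis by (simp add: curve_length_def integral_unique)
qed

text \<open>A negative \<open>k\<close> would, for small \<delta> and \<epsilon>, give a curve with
  the same end points and length below \<open>b - a\<close>, the length of \<open>x\<close>.\<close>

lemma minimizing_reach_nonneg:
  assumes min: "minimizing A F x a b" and r: "reach a b (\<lambda>_. 0) (\<lambda>_. 0) k"
  shows "0 \<le> k"
proof (rule field_le_epsilon)
  fix \<delta> :: real assume \<delta>: "\<delta> > 0"
  let ?L = "{curve_length A F y c d | y c d. c < d \<and> ac_curve A y c d \<and> y c = x a \<and> y d = x b}"
  have "\<forall>\<^sub>F \<epsilon> in at_right (0::real). \<exists>y. ac_curve A y a b \<and> y a = x a \<and> y b = x b \<and> cost_bounded y a b ((b - a) + \<epsilon> * (k + \<delta>))"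
    using r[unfolded reach_def, rule_format, of "\<lambda>_. x a" "\<lambda>_. x b" \<delta>]
      first_order_const[of "x a"] first_order_const[of "x b"] \<delta> by simp
  moreover have "\<forall>\<^sub>F \<epsilon> in at_right (0::real). 0 < \<epsilon>" by (simp add: eventually_at_right_less)
  ultimately have "\<forall>\<^sub>F \<epsilon> in at_right (0::real). 0 < \<epsilon> \<and> (\<exists>y. ac_curve A y a b \<and> y a = x a \<and> y b = x b \<and> cost_bounded y a b ((b - a) + \<epsilon> * (k + \<delta>)))"
    by eventually_elim simp
  then obtain \<epsilon> y where \<epsilon>: "0 < \<epsilon>" and y: "ac_curve A y a b" "y a = x a" "y b = x b" "cost_bounded y a b ((b - a) + \<epsilon> * (k + \<delta>))"
    using eventually_happens'[OF trivial_limit_at_right_real[of 0]] by blast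
  have "bdd_below ?L" by (rule bdd_belowI[of _ 0]) (use curve_length_nonneg in blast)
  moreover have "curve_length A F y a b \<in> ?L" using y ab by blast
  ultimately have "Inf ?L \<le> curve_length A F y a b" by (rule cInf_lower[rotated])
  moreover have "b - a = Inf ?L" using min curve_length_unit_speed by (simp add: minimizing_def)
  moreover have "curve_length A F y a b \<le> (b - a) + \<epsilon> * (k + \<delta>)" by (rule curve_length_le[OF y(4) ab])
  ultimately have "0 \<le> \<epsilon> * (k + \<delta>)" by linarith
  then show "0 \<le> k + \<delta>" using \<epsilon> by (simp add: zero_le_mult_iff)
qed

lemma extremal_exists:
  assumes min: "minimizing A F x a b"
  shows "\<exists>\<alpha>. extremal_on \<alpha> a b \<and> (\<forall>\<tau>\<in>{a..b}. \<alpha> \<tau> \<noteq> (\<lambda>_. 0))"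
proof -
  \<comment> \<open>The initial point is fixed, so propagation starts from the trivial cone, and all
    elements of \<open>T\<close> come from variations with initial displacement 0.\<close>
  have cone0: "tangent_cone (x a) {(0, \<lambda>_. 0)}"
    unfolding tangent_cone_def using tangent_space_zero by auto
  from propagates_all[unfolded propagates_def, THEN spec, THEN mp, OF cone0]
  obtain T where T1: "tangent_cone (x b) T"
     and T2: "\<forall>k' W. (k', W) \<in> T \<longrightarrow> (\<exists>k V. (k, V) \<in> {(0, \<lambda>_. 0)} \<and> reach a b V W (k' - k))"
     and T3: "\<exists>k' W. (k', W) \<in> T \<and> k' < 0"
     and T4: "\<forall>q \<psi>. \<psi> \<in> cotangent_space A (x b) \<longrightarrow> (\<forall>k' W. (k', W) \<in> T \<longrightarrow> \<psi> W \<le> q * k') \<longrightarrow>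
        (\<exists>\<alpha>. extremal_on \<alpha> a b \<and> \<alpha> b = \<psi> \<and> (\<psi> \<noteq> (\<lambda>_. 0) \<longrightarrow> (\<forall>\<tau>\<in>{a..b}. \<alpha> \<tau> \<noteq> (\<lambda>_. 0))) \<and>
           (\<forall>k V. (k, V) \<in> {(0, \<lambda>_. 0)} \<longrightarrow> \<alpha> a V \<le> q * k))"
    by (rule exE) ((erule conjE)+, rule that)
  have T2': "reach a b (\<lambda>_. 0) W k'" if "(k', W) \<in> T" for k' W
    using T2[rule_format, OF that] by simp
  have "x b \<in> (\<Union>c\<in>A. fst c)" using smooth by (simp add: smooth_structure_def)
  then obtain c where c: "c \<in> A" "x b \<in> fst c" by blast
  \<comment> \<open>Separation takes place in a Euclidean space, hence the coordinates in
    \<open>c\<close>. The set \<open>?R\<close> consists of the forbidden directions: a length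
    decrease with fixed end point.\<close>
  define S where "S = (\<lambda>(k, W). (k :: real, W c)) ` T"
  let ?R = "{(k, 0::real^'n) |k. k < (0::real)}"
  have S0: "(0, 0) \<in> S" using T1 unfolding S_def tangent_cone_def by force
  have Sscale: "r *\<^sub>R p \<in> S" if "p \<in> S" "r \<ge> 0" for p r
  proof -
    obtain k W where kW: "(k, W) \<in> T" "p = (k, W c)" using \<open>p \<in> S\<close> by (auto simp: S_def)
    have "(r * k, \<lambda>d. r *\<^sub>R W d) \<in> T" using T1 kW(1) \<open>r \<ge> 0\<close> unfolding tangent_cone_def by blast
    then show ?thesis using kW(2) by (force simp: S_def)
  qed
  have Sadd: "p + p' \<in> S" if pS: "p \<in> S" "p' \<in> S" for p p'
  proof -
    obtain k W k' W' where kW: "(k, W) \<in> T" "p = (k, W c)" "(k', W') \<in> T" "p' = (k', W' c)" using pS by (auto simp: S_def)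
    have "(k + k', \<lambda>d. W d + W' d) \<in> T" using T1 kW(1,3) unfolding tangent_cone_def by blast
    then show ?thesis using kW(2,4) by (force simp: S_def)
  qed
  have "convex S" unfolding convex_def using Sscale Sadd by blast
  moreover have "convex ?R"
  proof (rule convexI)
    fix p q and u v :: real assume "p \<in> ?R" "q \<in> ?R" and uv: "0 \<le> u" "0 \<le> v" "u + v = 1"
    then obtain k l where kl: "p = (k, 0)" "q = (l, 0)" "k < 0" "l < 0" by blast
    have "u * k + v * l < 0"
    proof (cases "u = 0")
      case True
      then show ?thesis using uv kl by simp
    next
      case False
      then have "u * k < 0" using uv kl by (simp add: mult_pos_neg)
      moreover have "v * l \<le> 0" using uv kl by (simp add: mult_nonneg_nonpos)
      ultimately show ?thesis by simp
    qed
    then show "u *\<^sub>R p + v *\<^sub>R q \<in> ?R" using kl by simp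
  qed
  moreover have "S \<noteq> {}" using S0 by blast
  moreover have Rm: "(- 1, 0) \<in> ?R" by simp
  moreover have "S \<inter> ?R = {}"
  proof (rule ccontr)
    assume "S \<inter> ?R \<noteq> {}"
    then obtain k W where kW: "(k, W) \<in> T" "W c = 0" "k < 0" by (auto simp: S_def)
    have "W \<in> tangent_space A (x b)" using T1 kW(1) unfolding tangent_cone_def by blast
    then have "W = (\<lambda>_. 0)" using tangent_space_eq[OF c] kW(2) tangent_of_zero[OF c] by metis
    then have "reach a b (\<lambda>_. 0) (\<lambda>_. 0) k" using T2'[OF kW(1)] by simp
    then show False using minimizing_reach_nonneg[OF min] kW(3) by force
  qed
  ultimately obtain A0 \<beta> where sep: "A0 \<noteq> 0" "\<And>p. p \<in> S \<Longrightarrow> A0 \<bullet> p \<le> \<beta>" "\<And>p. p \<in> ?R \<Longrightarrow> \<beta> \<le> A0 \<bullet> p"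
    using separating_hyperplane_sets[of S ?R] by blast
  obtain m \<xi> where A0: "A0 = (m, \<xi>)" by fastforce
  have \<beta>0: "0 \<le> \<beta>" using sep(2)[OF S0] by (simp add: A0)
  have m: "m \<le> 0" using sep(3)[OF Rm] \<beta>0 by (simp add: A0)
  \<comment> \<open>A functional bounded above on a cone is nonpositive there: otherwise the
    multiple \<open>r *\<^sub>R p\<close> has the value \<beta> + 1.\<close>
  have Sle: "A0 \<bullet> p \<le> 0" if "p \<in> S" for p
  proof (rule ccontr)
    assume n: "\<not> A0 \<bullet> p \<le> 0"
    define r where "r = (\<beta> + 1) / (A0 \<bullet> p)"
    have "r \<ge> 0" using n \<beta>0 by (simp add: r_def)
    then have "A0 \<bullet> (r *\<^sub>R p) \<le> \<beta>" using sep(2) Sscale that by blast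
    moreover have "A0 \<bullet> (r *\<^sub>R p) = \<beta> + 1" using n by (simp add: r_def)
    ultimately show False by simp
  qed
  define \<psi> where "\<psi> = covec c (x b) \<xi>"
  have \<psi>T: "\<psi> W \<le> (- m) * k'" if "(k', W) \<in> T" for k' W
  proof -
    have "W \<in> tangent_space A (x b)" using T1 that unfolding tangent_cone_def by blast
    then have "\<psi> W = \<xi> \<bullet> W c" by (simp add: \<psi>_def covec_def)
    moreover have "(k', W c) \<in> S" using that by (force simp: S_def)
    then have "m * k' + \<xi> \<bullet> W c \<le> 0" using Sle[of "(k', W c)"] by (simp add: A0)
    ultimately show ?thesis by simp
  qed
  have "\<xi> \<noteq> 0"
  proof
    assume "\<xi> = 0"
    then have "m \<noteq> 0" using sep(1) by (simp add: A0 zero_prod_def)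
    then have "m < 0" using m by simp
    obtain k' W where kW: "(k', W) \<in> T" "k' < 0" using T3 by blast
    have "\<psi> W = 0" using \<open>\<xi> = 0\<close> by (simp add: \<psi>_def covec_def)
    then have "0 \<le> (- m) * k'" using \<psi>T[OF kW(1)] by simp
    then show False using \<open>m < 0\<close> kW(2) by (simp add: mult_le_0_iff)
  qed
  have "\<psi> \<noteq> (\<lambda>_. 0)"
  proof
    assume "\<psi> = (\<lambda>_. 0)"
    then have "\<xi> = cocoord c (x b) (\<lambda>_. 0)" using cocoord_covec[OF c, of \<xi>] by (simp add: \<psi>_def)
    then show False using \<open>\<xi> \<noteq> 0\<close> by (simp add: cocoord_def vec_eq_iff)
  qed
  moreover have "\<psi> \<in> cotangent_space A (x b)" unfolding \<psi>_def by (rule covec_cotangent)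
  ultimately show ?thesis using T4[rule_format, of \<psi> "- m"] \<psi>T by blast
qed

lemma pontryagin_extremal_exists:
  assumes min: "minimizing A F x a b"
  shows "\<exists>\<gamma>. pontryagin_extremal A F \<gamma> a b \<and> (\<forall>t\<in>{a..b}. fst (\<gamma> t) = x t)"
proof -
  obtain \<alpha> where \<alpha>: "extremal_on \<alpha> a b" "\<forall>\<tau>\<in>{a..b}. \<alpha> \<tau> \<noteq> (\<lambda>_. 0)" using extremal_exists[OF min] by blast
  obtain N where N: "negligible N" "\<forall>\<tau>\<in>{a<..<b} - N. \<exists>V\<in>extended_geodesic_field A F (lift \<alpha> \<tau>).
         has_velocity (cotangent_atlas A) (lift \<alpha>) UNIV \<tau> V" using \<alpha>(1) unfolding extremal_on_def by blast
  have "pontryagin_extremal A F (lift \<alpha>) a b"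
    unfolding pontryagin_extremal_def
  proof (intro conjI ballI)
    fix t assume "t \<in> {a..b}"
    then show "snd (lift \<alpha> t) \<in> cotangent_space A (fst (lift \<alpha> t))" "snd (lift \<alpha> t) \<noteq> (\<lambda>_. 0)"
      using \<alpha> by (auto simp: lift_def extremal_on_def)
  next
    show "ac_curve (cotangent_atlas A) (lift \<alpha>) a b" using \<alpha>(1) by (simp add: extremal_on_def)
    show "AE t in lebesgue. t \<in> {a..b} \<longrightarrow> (\<exists>V\<in>extended_geodesic_field A F (lift \<alpha> t). has_velocity (cotangent_atlas A) (lift \<alpha>) {a..b} t V)"
      unfolding AE_lebesgue_negligible
    proof (intro exI[of _ "N \<union> {a, b}"] conjI allI impI)
      show "negligible (N \<union> {a, b})" using N(1) by auto
      fix t assume "t \<notin> N \<union> {a, b}" "t \<in> {a..b}"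
      then have t: "t \<in> {a<..<b} - N" by auto
      then obtain V where V: "V\<in>extended_geodesic_field A F (lift \<alpha> t)" "has_velocity (cotangent_atlas A) (lift \<alpha>) UNIV t V"
        using N(2) by blast
      have "t \<in> {a<..<b}" using t by simp
      from has_velocity_interior[OF this] V
      show "\<exists>V\<in>extended_geodesic_field A F (lift \<alpha> t). has_velocity (cotangent_atlas A) (lift \<alpha>) {a..b} t V" by blast
    qed
  qed
  then show ?thesis by (intro exI[of _ "lift \<alpha>"]) (simp add: lift_def)
qed

end

context finsler_manifold
begin

section \<open>Constancy of the maximized Hamiltonian\<close>

lemma family_image:
  assumes fam: "pontryagin_family A F c f" and p: "p \<in> fst c"
  shows "f (snd c p) ` sphere 0 1 = (\<lambda>v. v c) ` unit_sphere A F p"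
proof -
  obtain g where "homeomorphism (sphere 0 1) ((\<lambda>v. v c) ` unit_sphere A F p) (f (snd c p)) g"
    using fam p unfolding pontryagin_family_def by blast
  then show ?thesis by (simp add: homeomorphism_def)
qed

text \<open>The asymmetric norm dual to \<open>F\<close>. It refers to no chart and no family of
  controls, so its values can be compared along a curve that passes through several charts.\<close>

definition max_hamiltonian :: "'m \<times> ('m, real^'n) cvec \<Rightarrow> real" where
  "max_hamiltonian q = Sup (snd q ` unit_sphere A F (fst q))"

lemma hamiltonian_eq:
  assumes fam: "pontryagin_family A F c f" and p: "fst q \<in> fst c" and \<alpha>: "snd q \<in> cotangent_space A (fst q)"
  shows "hamiltonian A c f u q = cocoord c (fst q) (snd q) \<bullet> f (snd c (fst q)) u"
proof -
  have c: "c \<in> A" using fam by (simp add: pontryagin_family_def)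
  show ?thesis
    using cotangent_apply[OF c p \<alpha> tangent_of_tangent[OF c p]] tangent_of_apply[OF c p]
    by (simp add: hamiltonian_def control_field_def case_prod_unfold)
qed

text \<open>The controls parameterize the unit sphere, so both suprema agree, and compactness of the
  sphere of controls gives a maximizer.\<close>

lemma max_hamiltonian_eq:
  assumes fam: "pontryagin_family A F c f" and p: "fst q \<in> fst c" and \<alpha>: "snd q \<in> cotangent_space A (fst q)"
  shows "\<And>u. u \<in> sphere 0 1 \<Longrightarrow> hamiltonian A c f u q \<le> max_hamiltonian q"
    and "u \<in> maximizing_controls A c f q \<Longrightarrow> hamiltonian A c f u q = max_hamiltonian q"
    and "\<exists>u. u \<in> maximizing_controls A c f q"
proof -
  have c: "c \<in> A" using fam by (simp add: pontryagin_family_def)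
  interpret fc: finsler_chart "snd c ` fst c" "norm_in c" "sphere 0 1" f by (rule family_finsler_chart[OF fam])
  let ?\<xi> = "cocoord c (fst q) (snd q)" and ?z = "snd c (fst q)"
  have "snd q ` unit_sphere A F (fst q) = (\<lambda>w. ?\<xi> \<bullet> w) ` ((\<lambda>v. v c) ` unit_sphere A F (fst q))"
    unfolding image_image by (rule image_cong[OF refl]) (simp add: cotangent_apply[OF c p \<alpha>] unit_sphere_def)
  also have "\<dots> = (\<lambda>u. hamiltonian A c f u q) ` sphere 0 1"
    unfolding family_image[OF fam p, symmetric] image_image hamiltonian_eq[OF assms] ..
  finally have eq: "max_hamiltonian q = Sup ((\<lambda>u. hamiltonian A c f u q) ` sphere 0 1)"
    by (simp add: max_hamiltonian_def)
  have "continuous_on (sphere 0 1) (\<lambda>u. ?\<xi> \<bullet> (\<lambda>(z, u). f z u) (?z, u))"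
    using p by (intro continuous_intros continuous_on_compose2[OF fc.f_cont]) auto
  then have cont: "continuous_on (sphere 0 1) (\<lambda>u. hamiltonian A c f u q)"
    by (simp add: hamiltonian_eq[OF assms])
  have ne: "sphere (0::real^'n) 1 \<noteq> {}" by simp
  obtain u0 where u0: "u0 \<in> sphere 0 1" "\<And>v. v \<in> sphere 0 1 \<Longrightarrow> hamiltonian A c f v q \<le> hamiltonian A c f u0 q"
    using continuous_attains_sup[OF compact_sphere ne cont] by blast
  have bdd: "bdd_above ((\<lambda>u. hamiltonian A c f u q) ` sphere 0 1)"
    by (rule bdd_aboveI2[OF u0(2)])
  show le: "hamiltonian A c f u q \<le> max_hamiltonian q" if "u \<in> sphere 0 1" for u
    unfolding eq by (rule cSUP_upper[OF that bdd])
  show "\<exists>u. u \<in> maximizing_controls A c f q"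
    using u0 unfolding maximizing_controls_def by blast
  show "hamiltonian A c f u q = max_hamiltonian q" if u: "u \<in> maximizing_controls A c f q"
  proof (rule antisym)
    show "hamiltonian A c f u q \<le> max_hamiltonian q" using le u by (simp add: maximizing_controls_def)
    show "max_hamiltonian q \<le> hamiltonian A c f u q"
      unfolding eq by (rule cSUP_least[OF ne]) (use u in \<open>simp add: maximizing_controls_def\<close>)
  qed
qed

text \<open>In coordinates it is a maximum over \<open>u\<close> of the functions
  \<open>\<xi> \<bullet> f z u\<close>, which on bounded sets are Lipschitz with a constant
  independent of \<open>u\<close>. A maximum of such functions is Lipschitz, and the coordinates are
  absolutely continuous.\<close>

lemma max_hamiltonian_abs_continuous:
  assumes cot: "\<And>t. t \<in> {a..b} \<Longrightarrow> snd (\<gamma> t) \<in> cotangent_space A (fst (\<gamma> t))"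
    and ac: "ac_curve (cotangent_atlas A) \<gamma> a b" and t0: "t0 \<in> {a..b}" and pont: "pontryagin_type A F"
  shows "\<exists>\<delta>>0. abs_continuous_on ({a..b} \<inter> {t0 - \<delta>..t0 + \<delta>}) (\<lambda>t. max_hamiltonian (\<gamma> t))"
proof -
  interpret cot: reg_atlas "cotangent_atlas A" by unfold_locales (rule cotangent_regular)
  obtain c f where p0: "fst (\<gamma> t0) \<in> fst c" and fam: "pontryagin_family A F c f"
    using pont unfolding pontryagin_type_def by blast
  have c: "c \<in> A" using fam by (simp add: pontryagin_family_def)
  interpret fc: finsler_chart "snd c ` fst c" "norm_in c" "sphere 0 1" f by (rule family_finsler_chart[OF fam])
  let ?cc = "cotangent_chart A c"
  have cc: "?cc \<in> cotangent_atlas A" using c by (simp add: cotangent_atlas_def)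
  have incc: "q \<in> fst ?cc \<longleftrightarrow> fst q \<in> fst c \<and> snd q \<in> cotangent_space A (fst q)"
    and cceq: "snd ?cc q = (snd c (fst q), cocoord c (fst q) (snd q))" for q
    by (auto simp: cotangent_chart_eq case_prod_unfold)
  have "\<gamma> t0 \<in> fst ?cc" using p0 cot[OF t0] by (simp add: incc)
  then obtain \<delta>0 where \<delta>0: "\<delta>0 > 0" "\<gamma> ` ({a..b} \<inter> {t0 - \<delta>0..t0 + \<delta>0}) \<subseteq> fst ?cc"
     "abs_continuous_on ({a..b} \<inter> {t0 - \<delta>0..t0 + \<delta>0}) (snd ?cc \<circ> \<gamma>)"
    using cot.ac_curve_in_chart[OF ac t0 cc] by blast
  define z \<xi> where "z t = snd c (fst (\<gamma> t))" and "\<xi> t = cocoord c (fst (\<gamma> t)) (snd (\<gamma> t))" for t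
  have Ieq: "{a..b} \<inter> {t0 - \<delta>..t0 + \<delta>} = {max a (t0 - \<delta>)..min b (t0 + \<delta>)}" for \<delta> by auto
  let ?J = "{max a (t0 - \<delta>0)..min b (t0 + \<delta>0)}"
  have zxi: "snd ?cc \<circ> \<gamma> = (\<lambda>t. (z t, \<xi> t))" by (auto simp: cceq z_def \<xi>_def)
  have acp: "abs_continuous_on ?J (\<lambda>t. (z t, \<xi> t))" using \<delta>0(3) unfolding Ieq zxi .
  have cont: "continuous_on ?J (\<lambda>t. (z t, \<xi> t))" by (rule abs_continuous_on_imp_continuous_on[OF acp])
  have zc: "continuous_on ?J z" and xc: "continuous_on ?J \<xi>"
    using continuous_on_fst[OF cont] continuous_on_snd[OF cont] by simp_all
  have z0: "z t0 \<in> snd c ` fst c" using p0 by (simp add: z_def)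
  obtain r where r: "r > 0" "cball (z t0) r \<subseteq> snd c ` fst c" using fc.open_dom z0 open_contains_cball by blast
  have t0I: "t0 \<in> ?J" using t0 \<delta>0 by auto
  obtain d where d: "d > 0" "\<And>t. t \<in> ?J \<Longrightarrow> dist t t0 < d \<Longrightarrow> dist (z t) (z t0) < r"
    using bspec[OF zc[unfolded continuous_on_iff] t0I] r(1) by blast
  define \<delta> where "\<delta> = min \<delta>0 (d / 2)"
  have \<delta>: "\<delta> > 0" "\<delta> \<le> \<delta>0" using \<delta>0 d by (auto simp: \<delta>_def)
  let ?I = "{max a (t0 - \<delta>)..min b (t0 + \<delta>)}"
  have sub: "?I \<subseteq> ?J" using \<delta> by auto
  have zball: "z t \<in> cball (z t0) r" if "t \<in> ?I" for t
  proof -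
    have "dist t t0 < d" using that d(1) by (auto simp: dist_real_def \<delta>_def)
    moreover have "t \<in> ?J" using sub that by (rule subsetD)
    ultimately have "dist (z t) (z t0) < r" using d(2)[of t] by simp
    then show ?thesis by (simp add: dist_commute)
  qed
  have gin: "fst (\<gamma> t) \<in> fst c \<and> snd (\<gamma> t) \<in> cotangent_space A (fst (\<gamma> t))" if "t \<in> ?I" for t
  proof -
    have "t \<in> {a..b} \<inter> {t0 - \<delta>0..t0 + \<delta>0}" using that \<delta> by auto
    then have "\<gamma> t \<in> fst ?cc" using \<delta>0(2) by blast
    then show ?thesis by (simp add: incc)
  qed
  obtain K where K: "0 \<le> K" "\<And>\<zeta> u w. \<zeta> \<in> cball (z t0) r \<Longrightarrow> u \<in> sphere 0 1 \<Longrightarrow> norm (fc.D \<zeta> u w) \<le> K * norm w"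
    by (rule fc.uniform_derivative_bound[OF compact_cball r(2)]) (rule that)
  have lip: "norm (f \<zeta> u - f \<zeta>' u) \<le> K * norm (\<zeta> - \<zeta>')"
    if \<zeta>: "\<zeta> \<in> cball (z t0) r" "\<zeta>' \<in> cball (z t0) r" and u: "u \<in> sphere 0 1" for \<zeta> \<zeta>' u
  proof (rule differentiable_bound[where S = "cball (z t0) r" and f = "\<lambda>\<zeta>. f \<zeta> u" and f' = "\<lambda>\<zeta>. fc.D \<zeta> u"
        and B = K and x = \<zeta> and y = \<zeta>'])
    fix w assume w: "w \<in> cball (z t0) r"
    show "((\<lambda>\<zeta>. f \<zeta> u) has_derivative fc.D w u) (at w within cball (z t0) r)"
      by (rule has_derivative_at_withinI[OF fc.D_works[OF subsetD[OF r(2) w] u]])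
    show "onorm (fc.D w u) \<le> K" by (rule onorm_bound[OF K(1) K(2)[OF w u]])
  qed (rule convex_cball \<zeta>)+
  have "compact ((\<lambda>(z, u). f z u) ` (cball (z t0) r \<times> sphere 0 1))"
    using r(2) by (intro compact_continuous_image[OF continuous_on_subset[OF fc.f_cont] compact_Times]) auto
  from compact_imp_bounded[OF this]
  obtain C1 where C1': "\<forall>x\<in>(\<lambda>(z, u). f z u) ` (cball (z t0) r \<times> sphere 0 1). norm x \<le> C1" unfolding bounded_iff by blast
  have C1: "norm (f \<zeta> u) \<le> C1" if "\<zeta> \<in> cball (z t0) r" "u \<in> sphere 0 1" for \<zeta> u
  proof -
    have "(\<lambda>(z, u). f z u) (\<zeta>, u) \<in> (\<lambda>(z, u). f z u) ` (cball (z t0) r \<times> sphere 0 1)"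
      by (intro imageI SigmaI that)
    from bspec[OF C1' this] show ?thesis by simp
  qed
  obtain C2 where C2: "\<And>t. t \<in> ?J \<Longrightarrow> norm (\<xi> t) \<le> C2" by (rule continuous_on_Icc_bounded[OF xc]) (rule that)
  have C20: "0 \<le> C2" by (rule order_trans[OF norm_ge_zero C2[OF t0I]])
  \<comment> \<open>The control that is maximal at \<open>s\<close> is a competitor at
    \<open>t\<close>; the other sign follows by exchanging \<open>s\<close> and
    \<open>t\<close>.\<close>
  have one: "max_hamiltonian (\<gamma> s) - max_hamiltonian (\<gamma> t) \<le> C2 * (K * norm (z s - z t)) + C1 * norm (\<xi> s - \<xi> t)"
    if s: "s \<in> ?I" and t: "t \<in> ?I" for s t
  proof -
    obtain u where u: "u \<in> maximizing_controls A c f (\<gamma> s)" using max_hamiltonian_eq(3)[OF fam] gin[OF s] by blast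
    then have us: "u \<in> sphere 0 1" by (simp add: maximizing_controls_def)
    have "max_hamiltonian (\<gamma> s) = \<xi> s \<bullet> f (z s) u"
      using max_hamiltonian_eq(2)[OF fam _ _ u] hamiltonian_eq[OF fam, of "\<gamma> s"] gin[OF s] by (simp add: \<xi>_def z_def)
    moreover have "\<xi> t \<bullet> f (z t) u \<le> max_hamiltonian (\<gamma> t)"
      using max_hamiltonian_eq(1)[OF fam _ _ us, of "\<gamma> t"] hamiltonian_eq[OF fam, of "\<gamma> t"] gin[OF t] by (simp add: \<xi>_def z_def)
    moreover have "\<xi> s \<bullet> f (z s) u - \<xi> t \<bullet> f (z t) u = \<xi> t \<bullet> (f (z s) u - f (z t) u) + (\<xi> s - \<xi> t) \<bullet> f (z s) u"
      by (simp add: algebra_simps)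
    moreover have "\<xi> t \<bullet> (f (z s) u - f (z t) u) \<le> C2 * (K * norm (z s - z t))"
    proof -
      have "\<xi> t \<bullet> (f (z s) u - f (z t) u) \<le> norm (\<xi> t) * norm (f (z s) u - f (z t) u)" by (rule norm_cauchy_schwarz)
      also have "\<dots> \<le> C2 * (K * norm (z s - z t))"
        by (intro mult_mono C2[OF subsetD[OF sub t]] lip[OF zball[OF s] zball[OF t] us] C20 norm_ge_zero)
      finally show ?thesis .
    qed
    moreover have "(\<xi> s - \<xi> t) \<bullet> f (z s) u \<le> C1 * norm (\<xi> s - \<xi> t)"
    proof -
      have "(\<xi> s - \<xi> t) \<bullet> f (z s) u \<le> norm (\<xi> s - \<xi> t) * norm (f (z s) u)" by (rule norm_cauchy_schwarz)
      also have "\<dots> \<le> norm (\<xi> s - \<xi> t) * C1" using C1[OF zball[OF s] us] by (intro mult_left_mono) auto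
      finally show ?thesis by (simp add: mult.commute)
    qed
    ultimately show ?thesis by linarith
  qed
  have "abs_continuous_on ?I (\<lambda>t. max_hamiltonian (\<gamma> t))"
  proof (rule abs_continuous_on_dominated)
    show ac': "abs_continuous_on ?I (\<lambda>t. (z t, \<xi> t))" by (rule abs_continuous_on_subset[OF acp sub])
    show "abs_continuous_on ?I (\<lambda>t. (z t, \<xi> t))" by (rule ac')
    fix s t assume s: "s \<in> ?I" and t: "t \<in> ?I"
    let ?n = "norm ((z s, \<xi> s) - (z t, \<xi> t))"
    have C10: "0 \<le> C1"
    proof -
      have "axis undefined 1 \<in> sphere (0::real^'n) 1" by simp
      then show ?thesis by (rule order_trans[OF norm_ge_zero C1[OF zball[OF s]]])
    qed
    have n: "norm (z s - z t) \<le> ?n" "norm (\<xi> s - \<xi> t) \<le> ?n"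
      using norm_fst_le[of "z s - z t" "\<xi> s - \<xi> t"] norm_snd_le[of "\<xi> s - \<xi> t" "z s - z t"] by simp_all
    have "C2 * (K * norm (z s - z t)) + C1 * norm (\<xi> s - \<xi> t) \<le> C2 * (K * ?n) + C1 * ?n"
      using n C20 C10 K(1) by (intro add_mono mult_left_mono) auto
    also have "\<dots> = (C2 * K + C1) * ?n" by (simp add: algebra_simps)
    finally have b: "C2 * (K * norm (z s - z t)) + C1 * norm (\<xi> s - \<xi> t) \<le> (C2 * K + C1) * ?n" .
    have "\<bar>max_hamiltonian (\<gamma> s) - max_hamiltonian (\<gamma> t)\<bar> \<le> (C2 * K + C1) * ?n"
      using one[OF s t] one[OF t s] b by (simp add: abs_le_iff norm_minus_commute)
    moreover have "0 \<le> (C2 * K + C1) * ?n" using C20 C10 K(1) by simp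
    ultimately show "norm (max_hamiltonian (\<gamma> s) - max_hamiltonian (\<gamma> t)) \<le> (C2 * K + C1) * ?n + (C2 * K + C1) * ?n"
      unfolding real_norm_def by linarith
  qed
  then show ?thesis using \<delta>(1) unfolding Ieq[symmetric] by blast
qed

text \<open>With \<open>h = f z u\<close> this is the cancellation by which a Hamiltonian is
  stationary along its own Hamiltonian field.\<close>

lemma hamiltonian_field_orthogonal:
  assumes "linear (frechet_derivative (\<lambda>z'. f z' u) (at z))"
  shows "snd (hamiltonian_field f u (z, \<xi>)) \<bullet> h = - (\<xi> \<bullet> frechet_derivative (\<lambda>z'. f z' u) (at z) h)"
proof -
  let ?D = "frechet_derivative (\<lambda>z'. f z' u) (at z)"
  have "\<xi> \<bullet> ?D h = \<xi> \<bullet> ?D (\<Sum>i\<in>UNIV. (h $ i) *\<^sub>R axis i 1)"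
    using basis_expansion[of h] by (simp add: scalar_mult_eq_scaleR)
  also have "\<dots> = (\<Sum>i\<in>UNIV. h $ i * (\<xi> \<bullet> ?D (axis i 1)))"
    by (simp add: linear_sum[OF assms] linear_cmul[OF assms] inner_sum_right)
  finally show ?thesis
    by (simp add: hamiltonian_field_def inner_vec_def sum_negf mult.commute)
qed

text \<open>Freezing the control \<open>u\<close> of time \<open>t\<close> gives a lower bound \<open>H\<^sub>u \<circ> \<gamma>\<close> with equality at \<open>t\<close> and with derivative \<open>0\<close> there.\<close>

lemma extremal_max_hamiltonian_touch:
  assumes cot: "\<And>t. t \<in> {a..b} \<Longrightarrow> snd (\<gamma> t) \<in> cotangent_space A (fst (\<gamma> t))"
    and ac: "ac_curve (cotangent_atlas A) \<gamma> a b"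
    and t: "t \<in> {a<..<b}" and V: "V \<in> extended_geodesic_field A F (\<gamma> t)"
    and vel: "has_velocity (cotangent_atlas A) \<gamma> {a..b} t V"
    and e: "e > 0"
  shows "\<exists>d>0. \<forall>s. \<bar>s - t\<bar> < d \<longrightarrow> max_hamiltonian (\<gamma> t) - e * \<bar>s - t\<bar> \<le> max_hamiltonian (\<gamma> s)"
proof -
  obtain c f u where fam: "pontryagin_family A F c f" and p: "fst (\<gamma> t) \<in> fst c"
    and u: "u \<in> maximizing_controls A c f (\<gamma> t)"
    and Vc: "V (cotangent_chart A c) = hamiltonian_field f u (snd (cotangent_chart A c) (\<gamma> t))"
    using V unfolding extended_geodesic_field_def by blast
  have c: "c \<in> A" using fam by (simp add: pontryagin_family_def)
  interpret fc: finsler_chart "snd c ` fst c" "norm_in c" "sphere 0 1" f by (rule family_finsler_chart[OF fam])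
  have us: "u \<in> sphere 0 1" using u by (simp add: maximizing_controls_def)
  let ?cc = "cotangent_chart A c"
  have cc: "?cc \<in> cotangent_atlas A" using c by (simp add: cotangent_atlas_def)
  have tab: "t \<in> {a..b}" using t by auto
  define z \<xi> where "z s = snd c (fst (\<gamma> s))" and "\<xi> s = cocoord c (fst (\<gamma> s)) (snd (\<gamma> s))" for s
  have zxi: "snd ?cc (\<gamma> s) = (z s, \<xi> s)" for s by (simp add: cotangent_chart_eq case_prod_unfold z_def \<xi>_def)
  have in_cc: "\<gamma> t \<in> fst ?cc" using p cot[OF tab] by (simp add: cotangent_chart_eq case_prod_unfold)
  have "((snd ?cc \<circ> \<gamma>) has_vector_derivative V ?cc) (at t within {a..b})"
    using vel cc in_cc by (simp add: has_velocity_def)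
  moreover have "at t within {a..b} = at t" using t by (intro at_within_interior) auto
  ultimately have der: "((\<lambda>s. (z s, \<xi> s)) has_vector_derivative hamiltonian_field f u (z t, \<xi> t)) (at t)"
    by (simp add: Vc zxi o_def)
  let ?w = "hamiltonian_field f u (z t, \<xi> t)"
  have dz: "(z has_vector_derivative f (z t) u) (at t)"
    using bounded_linear.has_vector_derivative[OF bounded_linear_fst der] by (simp add: hamiltonian_field_def)
  have dx: "(\<xi> has_vector_derivative snd ?w) (at t)"
    using bounded_linear.has_vector_derivative[OF bounded_linear_snd der] by simp
  have zt: "z t \<in> snd c ` fst c" using p by (simp add: z_def)
  have D: "((\<lambda>z'. f z' u) has_derivative fc.D (z t) u) (at (z t))" by (rule fc.D_works[OF zt us])
  have "((\<lambda>z'. f z' u) \<circ> z has_derivative fc.D (z t) u \<circ> (\<lambda>h. h *\<^sub>R f (z t) u)) (at t)"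
    using dz D unfolding has_vector_derivative_def by (rule diff_chain_at)
  moreover have "fc.D (z t) u \<circ> (\<lambda>h. h *\<^sub>R f (z t) u) = (\<lambda>h. h *\<^sub>R fc.D (z t) u (f (z t) u))"
    by (auto simp: linear_cmul[OF fc.D_linear[OF zt us]])
  ultimately have df: "((\<lambda>s. f (z s) u) has_vector_derivative fc.D (z t) u (f (z t) u)) (at t)"
    by (simp add: has_vector_derivative_def o_def)
  define \<phi> where "\<phi> s = \<xi> s \<bullet> f (z s) u" for s
  have "(\<phi> has_vector_derivative \<xi> t \<bullet> fc.D (z t) u (f (z t) u) + snd ?w \<bullet> f (z t) u) (at t)"
    unfolding \<phi>_def by (rule bounded_bilinear.has_vector_derivative[OF bounded_bilinear_inner dx df])
  moreover have "snd ?w \<bullet> f (z t) u = - (\<xi> t \<bullet> fc.D (z t) u (f (z t) u))"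
    by (rule hamiltonian_field_orthogonal) (rule fc.D_linear[OF zt us])
  ultimately have "(\<phi> has_real_derivative 0) (at t)"
    by (simp add: has_real_derivative_iff_has_vector_derivative)
  from has_real_derivative_zero_touch[OF this e]
  obtain d where d: "d > 0" "\<And>s. \<bar>s - t\<bar> < d \<Longrightarrow> \<phi> t - e * \<bar>s - t\<bar> \<le> \<phi> s" by blast
  have "\<phi> t = max_hamiltonian (\<gamma> t)"
    using max_hamiltonian_eq(2)[OF fam p cot[OF tab] u] hamiltonian_eq[OF fam p cot[OF tab], of u] by (simp add: \<phi>_def z_def \<xi>_def)
  moreover have "\<exists>d'>0. \<forall>s. \<bar>s - t\<bar> < d' \<longrightarrow> \<phi> s \<le> max_hamiltonian (\<gamma> s)"
  proof -
    interpret cot: reg_atlas "cotangent_atlas A" by unfold_locales (rule cotangent_regular)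
    obtain \<delta> where \<delta>: "\<delta> > 0" "\<gamma> ` ({a..b} \<inter> {t - \<delta>..t + \<delta>}) \<subseteq> fst ?cc"
      using cot.ac_curve_in_chart[OF ac tab cc in_cc] by blast
    have "\<phi> s \<le> max_hamiltonian (\<gamma> s)" if s: "\<bar>s - t\<bar> < min \<delta> (min (t - a) (b - t))" for s
    proof -
      have "s \<in> {a..b} \<inter> {t - \<delta>..t + \<delta>}" using s by (auto simp: abs_less_iff)
      then have "\<gamma> s \<in> fst ?cc" using \<delta>(2) by blast
      then have ps: "fst (\<gamma> s) \<in> fst c" "snd (\<gamma> s) \<in> cotangent_space A (fst (\<gamma> s))"
        by (auto simp: cotangent_chart_eq case_prod_unfold)
      show ?thesis
        using max_hamiltonian_eq(1)[OF fam ps us] hamiltonian_eq[OF fam ps, of u] by (simp add: \<phi>_def z_def \<xi>_def)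
    qed
    moreover have "min \<delta> (min (t - a) (b - t)) > 0" using \<delta>(1) t by simp
    ultimately show ?thesis by blast
  qed
  then obtain d' where d': "d' > 0" "\<And>s. \<bar>s - t\<bar> < d' \<Longrightarrow> \<phi> s \<le> max_hamiltonian (\<gamma> s)" by blast
  have "max_hamiltonian (\<gamma> t) - e * \<bar>s - t\<bar> \<le> max_hamiltonian (\<gamma> s)" if "\<bar>s - t\<bar> < min d d'" for s
    using d(2)[of s] d'(2)[of s] that calculation by simp
  moreover have "min d d' > 0" using d(1) d'(1) by simp
  ultimately show ?thesis by blast
qed

text \<open>Absolute continuity is known only near each parameter, so the touching criterion is
  applied on short intervals and bisection extends the equality to \<open>{a..s}\<close>.\<close>

lemma extremal_max_hamiltonian_constant:
  assumes pont: "pontryagin_type A F" and ab: "a < b" and ext: "pontryagin_extremal A F \<gamma> a b"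
    and s: "s \<in> {a..b}"
  shows "max_hamiltonian (\<gamma> s) = max_hamiltonian (\<gamma> a)"
proof -
  have cot: "\<And>t. t \<in> {a..b} \<Longrightarrow> snd (\<gamma> t) \<in> cotangent_space A (fst (\<gamma> t))"
    and ac: "ac_curve (cotangent_atlas A) \<gamma> a b"
    using ext unfolding pontryagin_extremal_def by blast+
  have "\<exists>N. negligible N \<and> (\<forall>t. t \<notin> N \<longrightarrow> t \<in> {a..b} \<longrightarrow> (\<exists>V \<in> extended_geodesic_field A F (\<gamma> t). has_velocity (cotangent_atlas A) \<gamma> {a..b} t V))"
    using ext unfolding pontryagin_extremal_def AE_lebesgue_negligible by blast
  then obtain N where N: "negligible N"
     "\<And>t. t \<in> {a..b} - N \<Longrightarrow> \<exists>V \<in> extended_geodesic_field A F (\<gamma> t). has_velocity (cotangent_atlas A) \<gamma> {a..b} t V"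
    by blast
  let ?M = "\<lambda>t. max_hamiltonian (\<gamma> t)"
  let ?P = "\<lambda>s t. a \<le> s \<and> s \<le> t \<and> t \<le> b \<longrightarrow> ?M s = ?M t"
  have "?P a s"
  proof (rule Bolzano[of a s ?P])
    show "a \<le> s" using s by simp
    show "?P p r" if "?P p q" "?P q r" "p \<le> q" "q \<le> r" for p q r using that by auto
    fix t0 assume "a \<le> t0" "t0 \<le> s"
    then have "t0 \<in> {a..b}" using s by simp
    from max_hamiltonian_abs_continuous[OF cot ac this pont]
    obtain \<delta> where \<delta>: "\<delta> > 0" "abs_continuous_on ({a..b} \<inter> {t0 - \<delta>..t0 + \<delta>}) ?M" by blast
    have "?P p q" if pq: "p \<le> t0" "t0 \<le> q" "q - p < \<delta>" for p q
    proof
      assume "a \<le> p \<and> p \<le> q \<and> q \<le> b"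
      then have pq': "a \<le> p" "p \<le> q" "q \<le> b" by auto
      have "abs_continuous_on {p..q} ?M"
        by (rule abs_continuous_on_subset[OF \<delta>(2)]) (use pq pq' in auto)
      then show "?M p = ?M q"
      proof (rule abs_continuous_on_touch_const[OF _ N(1) \<open>p \<le> q\<close>])
        fix t e :: real assume t: "t \<in> {p<..<q} - N" and e: "e > 0"
        have tab: "t \<in> {a<..<b}" and "t \<in> {a..b} - N" using t pq' by auto
        from N(2)[OF this(2)] obtain V where
          V: "V \<in> extended_geodesic_field A F (\<gamma> t)" "has_velocity (cotangent_atlas A) \<gamma> {a..b} t V" by blast
        show "\<exists>d>0. \<forall>s. \<bar>s - t\<bar> < d \<longrightarrow> ?M t - e * \<bar>s - t\<bar> \<le> ?M s"
          by (rule extremal_max_hamiltonian_touch[OF cot ac tab V e])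
      qed
    qed
    then show "\<exists>d>0. \<forall>p q. p \<le> t0 \<and> t0 \<le> q \<and> q - p < d \<longrightarrow> ?P p q" using \<delta>(1) by blast
  qed
  then show ?thesis using s by simp
qed

text \<open>The vector \<open>V\<close> may come from another family \<open>c'\<close>,
  \<open>f'\<close> with maximizing control \<open>u'\<close>. Its base component and the given
  velocity are derivatives of the same curve, so \<open>X_u\<close> and the field of
  \<open>u'\<close> agree at this point; a covector takes the same value on both, and that value is
  the maximum.\<close>

lemma extremal_hamiltonian_velocity:
  assumes ab: "a < b" and t: "t \<in> {a..b}" and cot: "snd (\<gamma> t) \<in> cotangent_space A (fst (\<gamma> t))"
    and V: "V \<in> extended_geodesic_field A F (\<gamma> t)" and vel: "has_velocity (cotangent_atlas A) \<gamma> {a..b} t V"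
    and fam: "pontryagin_family A F c f" and p: "fst (\<gamma> t) \<in> fst c"
    and v: "has_velocity A (fst \<circ> \<gamma>) {a..b} t (control_field A c f u (fst (\<gamma> t)))"
  shows "hamiltonian A c f u (\<gamma> t) = max_hamiltonian (\<gamma> t)"
proof -
  obtain c' f' u' where fam': "pontryagin_family A F c' f'" and p': "fst (\<gamma> t) \<in> fst c'"
    and u': "u' \<in> maximizing_controls A c' f' (\<gamma> t)"
    and Vc: "V (cotangent_chart A c') = hamiltonian_field f' u' (snd (cotangent_chart A c') (\<gamma> t))"
    using V unfolding extended_geodesic_field_def by blast
  have c': "c' \<in> A" using fam' by (simp add: pontryagin_family_def)
  let ?cc = "cotangent_chart A c'"
  have cc: "?cc \<in> cotangent_atlas A" using c' by (simp add: cotangent_atlas_def)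
  have in_cc: "\<gamma> t \<in> fst ?cc" using p' cot by (simp add: cotangent_chart_eq case_prod_unfold)
  let ?v = "control_field A c f u (fst (\<gamma> t))"
  have vt: "?v \<in> tangent_space A (fst (\<gamma> t))" and
    vd: "((snd c' \<circ> (fst \<circ> \<gamma>)) has_vector_derivative ?v c') (at t within {a..b})"
    using v c' p' by (simp_all add: has_velocity_def)
  have "((snd ?cc \<circ> \<gamma>) has_vector_derivative V ?cc) (at t within {a..b})"
    using vel cc in_cc by (simp add: has_velocity_def)
  from bounded_linear.has_vector_derivative[OF bounded_linear_fst this[unfolded Vc]]
  have "((snd c' \<circ> (fst \<circ> \<gamma>)) has_vector_derivative f' (snd c' (fst (\<gamma> t))) u') (at t within {a..b})"
    by (simp add: hamiltonian_field_def cotangent_chart_eq case_prod_unfold o_def)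
  then have veq: "?v c' = f' (snd c' (fst (\<gamma> t))) u'"
    using vector_derivative_unique_within_closed_interval[of a b t] ab t vd unfolding box_real by blast
  have "hamiltonian A c f u (\<gamma> t) = snd (\<gamma> t) ?v" by (simp add: hamiltonian_def case_prod_unfold)
  also have "\<dots> = cocoord c' (fst (\<gamma> t)) (snd (\<gamma> t)) \<bullet> f' (snd c' (fst (\<gamma> t))) u'"
    by (simp add: cotangent_apply[OF c' p' cot vt] veq)
  also have "\<dots> = max_hamiltonian (\<gamma> t)"
    using hamiltonian_eq[OF fam' p' cot, of u'] max_hamiltonian_eq(2)[OF fam' p' cot u'] by simp
  finally show ?thesis .
qed

lemma extremal_hamiltonian_constant_along:
  assumes pont: "pontryagin_type A F" and ab: "a < b" and ext: "pontryagin_extremal A F \<gamma> a b"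
  shows "hamiltonian_constant_along A F \<gamma> a b"
proof -
  have cot: "\<And>t. t \<in> {a..b} \<Longrightarrow> snd (\<gamma> t) \<in> cotangent_space A (fst (\<gamma> t))"
    and ae: "AE t in lebesgue. t \<in> {a..b} \<longrightarrow>
        (\<exists>V \<in> extended_geodesic_field A F (\<gamma> t). has_velocity (cotangent_atlas A) \<gamma> {a..b} t V)"
    using ext unfolding pontryagin_extremal_def by blast+
  show ?thesis
    unfolding hamiltonian_constant_along_def
  proof (intro exI)
    show "AE t in lebesgue. t \<in> {a..b} \<longrightarrow>
        (\<forall>c f u. pontryagin_family A F c f \<and> fst (\<gamma> t) \<in> fst c \<and> u \<in> sphere 0 1 \<and>
           has_velocity A (fst \<circ> \<gamma>) {a..b} t (control_field A c f u (fst (\<gamma> t))) \<longrightarrow>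
           hamiltonian A c f u (\<gamma> t) = max_hamiltonian (\<gamma> a))"
      using ae
    proof eventually_elim
      case (elim t)
      show ?case
      proof (intro impI allI, elim conjE)
        fix c f u
        assume t: "t \<in> {a..b}" and fam: "pontryagin_family A F c f" and p: "fst (\<gamma> t) \<in> fst c"
          and v: "has_velocity A (fst \<circ> \<gamma>) {a..b} t (control_field A c f u (fst (\<gamma> t)))"
        obtain V where V: "V \<in> extended_geodesic_field A F (\<gamma> t)" "has_velocity (cotangent_atlas A) \<gamma> {a..b} t V"
          using elim t by blast
        show "hamiltonian A c f u (\<gamma> t) = max_hamiltonian (\<gamma> a)"
          using extremal_hamiltonian_velocity[OF ab t cot[OF t] V fam p v]
            extremal_max_hamiltonian_constant[OF pont ab ext t] by simp
      qed
    qed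
  qed
qed

end

theorem theorem4p4:
  fixes A :: "('m::{t2_space, second_countable_topology}, real^'n) chart set"
    and F :: "'m \<times> ('m, real^'n) tvec \<Rightarrow> real"
    and x :: "real \<Rightarrow> 'm" and a b :: real
  assumes "smooth_structure A"
    and "C0_Finsler A F"
    and "pontryagin_type A F"
    and "a < b"
    and "minimizing A F x a b"
    and "arclength_parameterized A F x a b"
  shows "(\<exists>\<gamma>. pontryagin_extremal A F \<gamma> a b \<and> (\<forall>t\<in>{a..b}. fst (\<gamma> t) = x t)) \<and>
    (\<forall>\<gamma>. pontryagin_extremal A F \<gamma> a b \<and> (\<forall>t\<in>{a..b}. fst (\<gamma> t) = x t) \<longrightarrow>
       hamiltonian_constant_along A F \<gamma> a b)"
proof -
  interpret unit_speed A F x a b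
    by unfold_locales (use assms in \<open>auto simp: minimizing_def\<close>)
  show ?thesis
    using pontryagin_extremal_exists extremal_hamiltonian_constant_along assms by blast
qed

end
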